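(* With the notation of the context: (i) For $k\in\{1,\dots,m\}$ and $\lambda\in\mathbb C\setminus\sigma_D$, the two numbers $\Delta_{k,\pm}(\lambda)=\frac12(\tau_{k,\pm}+\tau_{k,\pm}^{-1})$, where $\tau_{k,\pm}$ are the eigenvalues of $\mathcal M_k(\lambda)$, are given by $\Delta_{k,\pm}=\xi_k\pm\sqrt{\rho_k}$. (ii) For every $k\in\mathbb Z_N$, $$\sigma(H_k)=\sigma_{pp}(H_k)\cup\sigma_{ac}(H_k),\qquad \sigma_{pp}(H_k)=\sigma_D,\qquad \sigma_{ac}(H_k)=\{\lambda\in\mathbb R:\Delta_k(\lambda)\in[-1,1]\},$$ where $\Delta_k(\lambda)\in[-1,1]$ means that at least one of the values $\xi_k(\lambda)\pm\sqrt{\rho_k(\lambda)}$ lies in $[-1,1]$. (iii) If $k\in\{0,\dots,m\}$, $\lambda\in\mathbb R$ is not a branch point of $\Delta_k$ (i.e. $\rho_k(\lambda)\ne0$ when $k\ne0$), and a branch of $\Delta_k$ takes a value in $(-1,1)$ at $\lambda$, then the derivative of that (locally analytic) branch at $\lambda$ is nonzero.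
   Context: Fix an integer $m\ge0$, $N=2m+1$, $s=e^{2\pi i/N}$, $c_k=\cos\frac{\pi k}N$, $s_k=\sin\frac{\pi k}N$, and a real-valued $q\in L^2(0,1)$. Let $\vartheta,\varphi$ solve $-y''+qy=\lambda y$ on $[0,1]$ with $\vartheta(0)=\varphi'(0)=1$, $\vartheta'(0)=\varphi(0)=0$, $\Delta=\frac12(\varphi'(1,\cdot)+\vartheta(1,\cdot))$, $\sigma_D=\{\lambda:\varphi(1,\lambda)=0\}$. Define the entire functions $\Delta_0=2\Delta^2+\frac14\vartheta'(1,\cdot)\varphi(1,\cdot)-1$, $\xi_k=\Delta_0+s_k^2$, $\rho_k=\frac{s_k^2}{c_k^2}(c_k^2-\xi_k^2)$, and the two-valued function $\Delta_k=\xi_k+\sqrt{\rho_k}$ on the two-sheeted Riemann surface of $\sqrt{\rho_k}$ (for $k=0$, $\rho_0=0$ and $\Delta_k=\Delta_0$). Graph $\Gamma^1$: edges $\Gamma_{n,j}$, $(n,j)\in\mathbb Z\times\{0,1,2\}$, each a copy of $[0,1]$. For $k\in\mathbb Z_N$, $H_k$ is the self-adjoint operator in $L^2(\Gamma^1)=\bigoplus L^2(0,1)$, $(H_kf)_\alpha=-f_\alpha''+qf_\alpha$, with domain $f\in L^2$, $f_\alpha\in W^{2,2}(0,1)$, $(f_\alpha'')\in L^2$, satisfying for all $n$: (K0) $f_{n,0}(1)=f_{n,1}(0)=s^kf_{n,2}(1)$, $f_{n+1,0}(0)=f_{n,1}(1)=f_{n,2}(0)$; (K1) $-f'_{n,0}(1)+f'_{n,1}(0)-s^kf'_{n,2}(1)=0$,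 $f'_{n+1,0}(0)-f'_{n,1}(1)+f'_{n,2}(0)=0$. For $\lambda\notin\sigma_D$ there are unique $\Theta_k,\Phi_k$ solving $-f_\alpha''+qf_\alpha=\lambda f_\alpha$ on each edge, satisfying (K0),(K1), and $\Theta_{k,(0,0)}(0)=\Phi'_{k,(0,0)}(0)=1$, $\Theta'_{k,(0,0)}(0)=\Phi_{k,(0,0)}(0)=0$; the monodromy matrix is $\mathcal M_k(\lambda)=\begin{pmatrix}\Theta_{k,(1,0)}(0,\lambda)&\Phi_{k,(1,0)}(0,\lambda)\\ \Theta'_{k,(1,0)}(0,\lambda)&\Phi'_{k,(1,0)}(0,\lambda)\end{pmatrix}$. *)

theory Defs
  imports "HOL-Analysis.Analysis"
begin

text \<open>Edges Gamma_{n,j}, (n,j) in Z x {0,1,2}; a function on the graph is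
  f :: int * nat => real => complex, only edges in Edges and points of [0,1] matter.\<close>

definition Edges :: "(int \<times> nat) set" where
  "Edges = UNIV \<times> {0,1,2}"

definition edge_L2 :: "(real \<Rightarrow> complex) \<Rightarrow> bool" where
  "edge_L2 u \<longleftrightarrow> u \<in> borel_measurable (lebesgue_on {0..1})
                 \<and> (\<lambda>t. (cmod (u t))^2) integrable_on {0..1}"

definition gL2 :: "(int \<times> nat \<Rightarrow> real \<Rightarrow> complex) \<Rightarrow> bool" where
  "gL2 f \<longleftrightarrow> (\<forall>\<alpha>\<in>Edges. edge_L2 (f \<alpha>))
             \<and> (\<lambda>\<alpha>. integral {0..1} (\<lambda>t. (cmod (f \<alpha> t))^2)) summable_on Edges"

definition gnorm :: "(int \<times> nat \<Rightarrow> real \<Rightarrow> complex) \<Rightarrow> real" where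
  "gnorm f = sqrt (\<Sum>\<^sub>\<infinity>\<alpha>\<in>Edges. integral {0..1} (\<lambda>t. (cmod (f \<alpha> t))^2))"

definition ginner :: "(int \<times> nat \<Rightarrow> real \<Rightarrow> complex) \<Rightarrow> (int \<times> nat \<Rightarrow> real \<Rightarrow> complex) \<Rightarrow> complex" where
  "ginner u f = (\<Sum>\<^sub>\<infinity>\<alpha>\<in>Edges. integral {0..1} (\<lambda>t. u \<alpha> t * cnj (f \<alpha> t)))"

definition ae_eq :: "(int \<times> nat \<Rightarrow> real \<Rightarrow> complex) \<Rightarrow> (int \<times> nat \<Rightarrow> real \<Rightarrow> complex) \<Rightarrow> bool" where
  "ae_eq u v \<longleftrightarrow> (\<forall>\<alpha>\<in>Edges. AE t in lborel. t \<in> {0..1} \<longrightarrow> u \<alpha> t = v \<alpha> t)"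

definition sN :: "nat \<Rightarrow> complex" where
  "sN m = exp (2 * of_real pi * \<i> / of_nat (2 * m + 1))"

definition K0 :: "nat \<Rightarrow> nat \<Rightarrow> (int \<times> nat \<Rightarrow> real \<Rightarrow> complex) \<Rightarrow> bool" where
  "K0 m k f \<longleftrightarrow> (\<forall>n::int.
      f (n,0) 1 = f (n,1) 0 \<and> f (n,1) 0 = sN m ^ k * f (n,2) 1 \<and>
      f (n+1,0) 0 = f (n,1) 1 \<and> f (n,1) 1 = f (n,2) 0)"

definition K1 :: "nat \<Rightarrow> nat \<Rightarrow> (int \<times> nat \<Rightarrow> real \<Rightarrow> complex) \<Rightarrow> bool" where
  "K1 m k f' \<longleftrightarrow> (\<forall>n::int.
      - f' (n,0) 1 + f' (n,1) 0 - sN m ^ k * f' (n,2) 1 = 0 \<and>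
      f' (n+1,0) 0 - f' (n,1) 1 + f' (n,2) 0 = 0)"

text \<open>u in W^{2,2}(0,1) with derivative u' and second derivative u'' (absolutely continuous
  u, u', and u'' in L^2(0,1)).\<close>
definition W22 :: "(real \<Rightarrow> complex) \<Rightarrow> (real \<Rightarrow> complex) \<Rightarrow> (real \<Rightarrow> complex) \<Rightarrow> bool" where
  "W22 u u' u'' \<longleftrightarrow> edge_L2 u'' \<and>
     (\<forall>x\<in>{0..1}. u x = u 0 + integral {0..x} u' \<and> u' x = u' 0 + integral {0..x} u'')"

definition Hdom :: "nat \<Rightarrow> nat \<Rightarrow> (int \<times> nat \<Rightarrow> real \<Rightarrow> complex) \<Rightarrow>
    (int \<times> nat \<Rightarrow> real \<Rightarrow> complex) \<Rightarrow> (int \<times> nat \<Rightarrow> real \<Rightarrow> complex) \<Rightarrow> bool" where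
  "Hdom m k f f' f'' \<longleftrightarrow> gL2 f \<and> gL2 f'' \<and> (\<forall>\<alpha>\<in>Edges. W22 (f \<alpha>) (f' \<alpha>) (f'' \<alpha>))
      \<and> K0 m k f \<and> K1 m k f'"

definition Hminus :: "(real \<Rightarrow> real) \<Rightarrow> (int \<times> nat \<Rightarrow> real \<Rightarrow> complex) \<Rightarrow>
    (int \<times> nat \<Rightarrow> real \<Rightarrow> complex) \<Rightarrow> complex \<Rightarrow> (int \<times> nat \<Rightarrow> real \<Rightarrow> complex)" where
  "Hminus q f f'' z = (\<lambda>\<alpha> t. - f'' \<alpha> t + (of_real (q t) - z) * f \<alpha> t)"

definition Hspec :: "(real \<Rightarrow> real) \<Rightarrow> nat \<Rightarrow> nat \<Rightarrow> complex set" where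
  "Hspec q m k = {z. \<not> ((\<exists>C. \<forall>f f' f''. Hdom m k f f' f'' \<longrightarrow>
                             gnorm f \<le> C * gnorm (Hminus q f f'' z))
                       \<and> (\<forall>g. gL2 g \<longrightarrow> (\<exists>f f' f''. Hdom m k f f' f'' \<and> ae_eq (Hminus q f f'' z) g)))}"

definition Heigen :: "(real \<Rightarrow> real) \<Rightarrow> nat \<Rightarrow> nat \<Rightarrow> complex set" where
  "Heigen q m k = {z. \<exists>f f' f''. Hdom m k f f' f'' \<and> gnorm f \<noteq> 0
                                   \<and> ae_eq (Hminus q f f'' z) (\<lambda>_ _. 0)}"

definition Hpp :: "(real \<Rightarrow> real) \<Rightarrow> nat \<Rightarrow> nat \<Rightarrow> complex set" where
  "Hpp q m k = closure (Heigen q m k)"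

text \<open>mu is the spectral measure of f w.r.t. H_k:
   <(H_k - z)^{-1} f, f> = integral of 1/(t - z) dmu(t) for all non-real z.\<close>
definition spec_meas :: "(real \<Rightarrow> real) \<Rightarrow> nat \<Rightarrow> nat \<Rightarrow> (int \<times> nat \<Rightarrow> real \<Rightarrow> complex) \<Rightarrow>
    real measure \<Rightarrow> bool" where
  "spec_meas q m k f \<mu> \<longleftrightarrow> sets \<mu> = sets borel \<and> finite_measure \<mu> \<and>
     (\<forall>z. Im z \<noteq> 0 \<longrightarrow> (\<forall>u u' u''. Hdom m k u u' u'' \<and> ae_eq (Hminus q u u'' z) f \<longrightarrow>
          ginner u f = integral\<^sup>L \<mu> (\<lambda>t. 1 / (of_real t - z))))"

text \<open>absolutely continuous spectrum: spectrum of H_k restricted to the absolutely continuous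
  subspace, i.e. the closure of the union of supports of the (absolutely continuous)
  spectral measures of vectors in H_ac.\<close>
definition Hac :: "(real \<Rightarrow> real) \<Rightarrow> nat \<Rightarrow> nat \<Rightarrow> complex set" where
  "Hac q m k = {complex_of_real x | x. \<forall>\<epsilon>>0. \<exists>f \<mu>. gL2 f \<and> spec_meas q m k f \<mu>
                    \<and> absolutely_continuous lborel \<mu> \<and> emeasure \<mu> (ball x \<epsilon>) > 0}"

definition sol :: "(real \<Rightarrow> real) \<Rightarrow> complex \<Rightarrow> (real \<Rightarrow> complex) \<Rightarrow> (real \<Rightarrow> complex) \<Rightarrow> bool" where
  "sol q z y y' \<longleftrightarrow> (\<lambda>t. (of_real (q t) - z) * y t) integrable_on {0..1} \<and>
     (\<forall>x\<in>{0..1}. y x = y 0 + integral {0..x} y' \<and>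
                 y' x = y' 0 + integral {0..x} (\<lambda>t. (of_real (q t) - z) * y t))"

definition fund :: "(real \<Rightarrow> real) \<Rightarrow> complex \<Rightarrow> complex \<Rightarrow> complex \<Rightarrow>
    (real \<Rightarrow> complex) \<times> (real \<Rightarrow> complex)" where
  "fund q z a b = (THE p. sol q z (fst p) (snd p) \<and> fst p 0 = a \<and> snd p 0 = b
                     \<and> (\<forall>x. x \<notin> {0..1} \<longrightarrow> fst p x = 0 \<and> snd p x = 0))"

definition theta1 :: "(real \<Rightarrow> real) \<Rightarrow> complex \<Rightarrow> complex" where
  "theta1 q z = fst (fund q z 1 0) 1"
definition theta1' :: "(real \<Rightarrow> real) \<Rightarrow> complex \<Rightarrow> complex" where
  "theta1' q z = snd (fund q z 1 0) 1"
definition phi1 :: "(real \<Rightarrow> real) \<Rightarrow> complex \<Rightarrow> complex" where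
  "phi1 q z = fst (fund q z 0 1) 1"
definition phi1' :: "(real \<Rightarrow> real) \<Rightarrow> complex \<Rightarrow> complex" where
  "phi1' q z = snd (fund q z 0 1) 1"

definition sigmaD :: "(real \<Rightarrow> real) \<Rightarrow> complex set" where
  "sigmaD q = {z. phi1 q z = 0}"

definition DeltaL :: "(real \<Rightarrow> real) \<Rightarrow> complex \<Rightarrow> complex" where
  "DeltaL q z = (phi1' q z + theta1 q z) / 2"

definition Delta0 :: "(real \<Rightarrow> real) \<Rightarrow> complex \<Rightarrow> complex" where
  "Delta0 q z = 2 * (DeltaL q z)^2 + theta1' q z * phi1 q z / 4 - 1"

definition cN :: "nat \<Rightarrow> nat \<Rightarrow> real" where
  "cN m k = cos (pi * real k / real (2 * m + 1))"
definition sNk :: "nat \<Rightarrow> nat \<Rightarrow> real" where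
  "sNk m k = sin (pi * real k / real (2 * m + 1))"

definition xi :: "(real \<Rightarrow> real) \<Rightarrow> nat \<Rightarrow> nat \<Rightarrow> complex \<Rightarrow> complex" where
  "xi q m k z = Delta0 q z + of_real ((sNk m k)^2)"

definition rho :: "(real \<Rightarrow> real) \<Rightarrow> nat \<Rightarrow> nat \<Rightarrow> complex \<Rightarrow> complex" where
  "rho q m k z = of_real ((sNk m k)^2 / (cN m k)^2) * (of_real ((cN m k)^2) - (xi q m k z)^2)"

definition gsol :: "(real \<Rightarrow> real) \<Rightarrow> nat \<Rightarrow> nat \<Rightarrow> complex \<Rightarrow>
    (int \<times> nat \<Rightarrow> real \<Rightarrow> complex) \<Rightarrow> (int \<times> nat \<Rightarrow> real \<Rightarrow> complex) \<Rightarrow> bool" where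
  "gsol q m k z f f' \<longleftrightarrow> (\<forall>\<alpha>\<in>Edges. sol q z (f \<alpha>) (f' \<alpha>)) \<and> K0 m k f \<and> K1 m k f'"

text \<open>monodromy matrix ((a,b),(c,d)) encoded as (a,b,c,d)\<close>
definition monodromy :: "(real \<Rightarrow> real) \<Rightarrow> nat \<Rightarrow> nat \<Rightarrow> complex \<Rightarrow>
    complex \<times> complex \<times> complex \<times> complex" where
  "monodromy q m k z = (THE M. \<exists>f f' g g'.
      gsol q m k z f f' \<and> f (0,0) 0 = 1 \<and> f' (0,0) 0 = 0 \<and>
      gsol q m k z g g' \<and> g (0,0) 0 = 0 \<and> g' (0,0) 0 = 1 \<and>
      M = (f (1,0) 0, g (1,0) 0, f' (1,0) 0, g' (1,0) 0))"

end

theory Submission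
  imports Defs "HOL-Complex_Analysis.Complex_Analysis" "HOL-Probability.Distribution_Functions"
begin

text \<open>Solving the equation on each edge in terms of its end values reduces \<open>H\<^sub>k\<close> to a two-component
  recurrence for the vertex values, whose elimination is, after a gauge transformation,
  \<open>v (n + 1) + v (n - 1) = 2 F v n\<close> with \<open>F = \<xi>\<^sub>k / c\<^sub>k\<close>. At Dirichlet eigenvalues there are compactly supported eigenfunctions.
  Away from them the resolvent is a convolution with decaying powers of a root of \<open>w + 1/w = 2 F\<close>,
  unless \<open>F\<close> lies in \<open>[-1,1]\<close>; this yields the spectrum, and the resolvent bound shows that a point with
  \<open>|F| > 1\<close> carries no absolutely continuous spectral measure. Self-adjointness forces \<open>F\<close> to avoid
  \<open>[-1,1]\<close> off the real line, so \<open>F\<close> and the Lyapunov branches have nonzero derivative inside the bands.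
  There the quasimomentum \<open>P\<close> with \<open>F = cos P\<close> is a coordinate, and superpositions of Bloch waves
  in \<open>P\<close> have, by Parseval's identity, explicit absolutely continuous spectral measures.\<close>

subsection \<open>Linear initial value problems with square integrable coefficients\<close>

text \<open>Why \<open>F\<close> and not the two-valued Lyapunov function: with
  \<open>F = cos P\<close> one has \<open>xi = cos al * cos P\<close> and
  \<open>rho = (sin al * sin P)^2\<close>, so the two branches are cos (P - al) and cos (P + al).
  The twist \<open>s = cis (2 * al)\<close> merely shifts the quasimomentum; \<open>F\<close>
  removes the shift and is entire, so complex analysis applies without branch points, and a branch
  takes a value in [-1,1] only where \<open>F\<close> does. The main obstacle is that edges are
  parametrised by their end values through division by \<open>phi1\<close>, which fails on the
  Dirichlet spectrum, and Dirichlet eigenvalues may lie inside bands as well as gaps. Identities are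
  therefore kept multiplied by \<open>phi1\<close> as long as possible, and limiting arguments work
  at nearby points: Dirichlet eigenvalues are isolated, and a measure without atoms does not see one
  of them. Spectral measures enter only through their Cauchy transforms, so no spectral theorem is
  invoked. Symmetry of the operator enters only as conservation of the current Im (cnj f f') at
  vertices. Since \<open>q\<close> is merely square integrable, every differential equation is
  handled as a pair of integral equations.\<close>

lemma edge_L2_measurable: "edge_L2 u \<Longrightarrow> u \<in> borel_measurable (lebesgue_on {0..1})"
  by (simp add: edge_L2_def)

lemma edge_L2_integrable_sq: "edge_L2 u \<Longrightarrow> (\<lambda>t. (cmod (u t))^2) integrable_on {0..1}"
  unfolding edge_L2_def by auto

lemma mult_le_sum_squares: "(a::real) * b \<le> a^2 + b^2"
proof -
  have "0 \<le> (a - b)^2 + a^2 + b^2" by simp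
  then show ?thesis by (simp add: power2_eq_square algebra_simps)
qed

lemma edge_L2_mult_integrable:
  assumes "edge_L2 u" "edge_L2 v"
  shows "(\<lambda>t. u t * v t) absolutely_integrable_on {0..1}"
proof (rule measurable_bounded_by_integrable_imp_absolutely_integrable)
  show "(\<lambda>t. u t * v t) \<in> borel_measurable (lebesgue_on {0..1})"
    using assms by (intro borel_measurable_times edge_L2_measurable)
  show "(\<lambda>t. (cmod (u t))^2 + (cmod (v t))^2) integrable_on {0..1}"
    using assms by (intro integrable_add edge_L2_integrable_sq)
qed (auto simp: norm_mult mult_le_sum_squares)

lemma edge_L2_dominated:
  assumes "u \<in> borel_measurable (lebesgue_on {0..1})" "g integrable_on {0..1}"
    "\<And>t. t \<in> {0..1} \<Longrightarrow> (cmod (u t))^2 \<le> g t"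
  shows "edge_L2 u"
proof -
  have "(\<lambda>t. (cmod (u t))^2) absolutely_integrable_on {0..1}"
    by (rule measurable_bounded_by_integrable_imp_absolutely_integrable[where g=g])
      (use assms in auto)
  then show ?thesis using assms by (auto simp: edge_L2_def absolutely_integrable_on_def)
qed

lemma borel_measurable_continuous_Icc:
  fixes u :: "real \<Rightarrow> complex"
  shows "continuous_on {0..1} u \<Longrightarrow> u \<in> borel_measurable (lebesgue_on {0..1})"
  by (rule continuous_imp_measurable_on_sets_lebesgue) auto

lemma edge_L2_continuous: "continuous_on {0..1} u \<Longrightarrow> edge_L2 u"
  unfolding edge_L2_def
  by (intro conjI borel_measurable_continuous_Icc integrable_continuous_real continuous_intros)

lemma edge_L2_const [simp]: "edge_L2 (\<lambda>_. c)"
  by (intro edge_L2_continuous continuous_intros)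

lemma sq_norm_add_le: "(cmod (a + b))^2 \<le> 2 * (cmod a)^2 + 2 * (cmod b)^2"
proof -
  have "(cmod (a + b))^2 \<le> (cmod a + cmod b)^2"
    by (intro power_mono norm_triangle_ineq) auto
  also have "\<dots> \<le> 2 * (cmod a)^2 + 2 * (cmod b)^2"
    using zero_le_power2[of "cmod a - cmod b"] by (simp add: power2_eq_square algebra_simps)
  finally show ?thesis .
qed

lemma edge_L2_add:
  assumes "edge_L2 u" "edge_L2 v" shows "edge_L2 (\<lambda>t. u t + v t)"
proof (rule edge_L2_dominated)
  show "(\<lambda>t. u t + v t) \<in> borel_measurable (lebesgue_on {0..1})"
    using assms by (intro borel_measurable_add edge_L2_measurable)
  show "(\<lambda>t. 2 * (cmod (u t))^2 + 2 * (cmod (v t))^2) integrable_on {0..1}"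
    using assms by (intro integrable_add integrable_on_mult_right edge_L2_integrable_sq)
qed (rule sq_norm_add_le)

lemma edge_L2_mult_continuous:
  assumes "edge_L2 u" "continuous_on {0..1} c" shows "edge_L2 (\<lambda>t. c t * u t)"
proof -
  have "bounded (c ` {0..1})"
    using assms by (intro compact_imp_bounded compact_continuous_image) auto
  then obtain B where B: "\<And>t. t \<in> {0..1} \<Longrightarrow> cmod (c t) \<le> B"
    unfolding bounded_iff by blast
  show ?thesis
  proof (rule edge_L2_dominated)
    show "(\<lambda>t. c t * u t) \<in> borel_measurable (lebesgue_on {0..1})"
      using assms by (intro borel_measurable_times edge_L2_measurable borel_measurable_continuous_Icc)
    show "(\<lambda>t. B^2 * (cmod (u t))^2) integrable_on {0..1}"
      using assms by (intro integrable_on_mult_right edge_L2_integrable_sq)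
    fix t :: real assume "t \<in> {0..1}"
    with B show "(cmod (c t * u t))^2 \<le> B^2 * (cmod (u t))^2"
      by (auto simp: norm_mult power_mult_distrib intro!: mult_right_mono power_mono)
  qed
qed

lemma edge_L2_cmult: "edge_L2 u \<Longrightarrow> edge_L2 (\<lambda>t. c * u t)"
  by (intro edge_L2_mult_continuous continuous_intros)

lemma edge_L2_uminus: "edge_L2 u \<Longrightarrow> edge_L2 (\<lambda>t. - u t)"
  using edge_L2_cmult[of u "-1"] by simp

lemma edge_L2_diff: "edge_L2 u \<Longrightarrow> edge_L2 v \<Longrightarrow> edge_L2 (\<lambda>t. u t - v t)"
  using edge_L2_add[of u "\<lambda>t. - v t"] edge_L2_uminus[of v] by simp

lemma edge_L2_cnj: "edge_L2 u \<Longrightarrow> edge_L2 (\<lambda>t. cnj (u t))"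
  unfolding edge_L2_def complex_mod_cnj
  by (auto intro: borel_measurable_continuous_on[where f=cnj, OF continuous_on_cnj[OF continuous_on_id]])

lemma edge_L2_absolutely_integrable:
  "edge_L2 u \<Longrightarrow> u absolutely_integrable_on {0..1}"
  using edge_L2_mult_integrable[of u "\<lambda>_. 1"] by simp

lemma edge_L2_integrable: "edge_L2 u \<Longrightarrow> u integrable_on {0..1}"
  using edge_L2_absolutely_integrable absolutely_integrable_on_def by blast

lemma absolutely_integrable_Icc_subset:
  fixes f :: "real \<Rightarrow> complex"
  assumes "f absolutely_integrable_on {0..1}" "x \<in> {0..1}"
  shows "f absolutely_integrable_on {0..x}"
  using absolutely_integrable_on_subinterval[OF assms(1), of 0 x] assms(2) by auto

lemma integrable_Icc_subset:
  fixes f :: "real \<Rightarrow> 'a::banach"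
  assumes "f integrable_on {0..1}" "x \<in> {0..1}"
  shows "f integrable_on {0..x}"
  using integrable_on_subinterval[OF assms(1), of 0 x] assms(2) by auto

lemma norm_integral_le_L1:
  fixes f :: "real \<Rightarrow> complex"
  assumes "f absolutely_integrable_on {0..1}" "x \<in> {0..1}"
  shows "cmod (integral {0..x} f) \<le> integral {0..1} (\<lambda>t. cmod (f t))"
proof -
  have "cmod (integral {0..x} f) \<le> integral {0..x} (\<lambda>t. cmod (f t))"
    using absolutely_integrable_Icc_subset[OF assms]
    by (intro integral_norm_bound_integral) (auto simp: absolutely_integrable_on_def)
  also have "\<dots> \<le> integral {0..1} (\<lambda>t. cmod (f t))"
    using assms absolutely_integrable_Icc_subset[OF assms]
    by (intro integral_subset_le) (auto simp: absolutely_integrable_on_def)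
  finally show ?thesis .
qed

text \<open>The variance of \<open>cmod (u t)\<close> about its mean \<open>?m\<close> is
  nonnegative; expanding the square under the integral gives the bound, the interval having length
  1.\<close>

lemma L1_le_L2:
  assumes "edge_L2 u"
  shows "(integral {0..1} (\<lambda>t. cmod (u t)))^2 \<le> integral {0..1} (\<lambda>t. (cmod (u t))^2)"
proof -
  let ?m = "integral {0..1} (\<lambda>t. cmod (u t))"
  have i1: "(\<lambda>t. cmod (u t)) integrable_on {0..1}"
    using edge_L2_absolutely_integrable[OF assms] by (auto simp: absolutely_integrable_on_def)
  have i2: "(\<lambda>t. (cmod (u t))^2) integrable_on {0..1}"
    using assms by (rule edge_L2_integrable_sq)
  have "((\<lambda>t. (cmod (u t))^2 - 2 * ?m * cmod (u t) + ?m^2) has_integral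
      integral {0..1} (\<lambda>t. (cmod (u t))^2) - 2 * ?m * ?m + ?m^2) {0..1}"
    using i1 i2 has_integral_const_real[of "?m^2" 0 1]
    by (intro has_integral_add has_integral_diff has_integral_mult_right integrable_integral) auto
  moreover have "0 \<le> (cmod (u t))^2 - 2 * ?m * cmod (u t) + ?m^2" for t
    using zero_le_power2[of "cmod (u t) - ?m"] by (simp add: power2_eq_square algebra_simps)
  ultimately have "0 \<le> integral {0..1} (\<lambda>t. (cmod (u t))^2) - 2 * ?m * ?m + ?m^2"
    by (rule has_integral_nonneg)
  then show ?thesis by (simp add: power2_eq_square)
qed

lemma mult_le_weighted_squares:
  fixes a b c :: real
  assumes "0 < c"
  shows "a * b \<le> (c * a^2 + b^2 / c) / 2"
proof -
  have "0 \<le> (c * a - b)^2 / c" using assms by (intro divide_nonneg_pos) auto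
  also have "\<dots> = c * a^2 - 2 * (a * b) + b^2 / c"
    using assms by (simp add: power2_eq_square field_simps)
  finally show ?thesis by simp
qed

text \<open>The exponential weight makes the Volterra operator with kernel bound \<open>k\<close> a contraction by
  the factor 1/2; only the L2 norm of \<open>k\<close> enters.\<close>

lemma weighted_integral_bound:
  fixes f :: "real \<Rightarrow> 'a::euclidean_space"
  assumes k: "(\<lambda>t. (k t)^2) integrable_on {0..1}" "integral {0..1} (\<lambda>t. (k t)^2) \<le> K" "0 < K"
    and x: "x \<in> {0..1}" and f: "f integrable_on {0..x}" and "0 \<le> S"
    and le: "\<And>t. t \<in> {0..x} \<Longrightarrow> norm (f t) \<le> k t * (S * exp (2 * K * t))"
  shows "norm (integral {0..x} f) \<le> S * exp (2 * K * x) / 2"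
proof -
  \<comment> \<open>Weight in a b \<le> (c a^2 + b^2 / c) / 2. With this value each of the two
    terms, once integrated, is at most \<open>exp (2 * K * x) / 2\<close>, which produces the factor
    one half.\<close>
  let ?c = "exp (2 * K * x) / (2 * K)"
  have c: "?c > 0" using assms by auto
  have kx: "(\<lambda>t. (k t)^2) integrable_on {0..x}" by (rule integrable_Icc_subset[OF k(1) x])
  have kle: "integral {0..x} (\<lambda>t. (k t)^2) \<le> K"
    using k(2) integral_subset_le[of "{0..x}" "{0..1}" "\<lambda>t. (k t)^2"] k kx x by auto
  have "((\<lambda>t. exp (4 * K * t)) has_integral (exp (4 * K * x) / (4 * K) - exp (4 * K * 0) / (4 * K))) {0..x}"
    using x \<open>K > 0\<close>
    by (intro fundamental_theorem_of_calculus)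
      (auto intro!: derivative_eq_intros simp: has_real_derivative_iff_has_vector_derivative[symmetric])
  then have E: "((\<lambda>t. exp (4 * K * t)) has_integral (exp (4 * K * x) - 1) / (4 * K)) {0..x}"
    by (simp add: diff_divide_distrib)
  have I: "((\<lambda>t. S * ((?c * (k t)^2 + exp (4 * K * t) / ?c) / 2)) has_integral
      S * ((?c * integral {0..x} (\<lambda>t. (k t)^2) + (exp (4 * K * x) - 1) / (4 * K) / ?c) / 2)) {0..x}"
    by (intro has_integral_mult_right has_integral_divide has_integral_add integrable_integral kx E)
  have pw: "norm (f t) \<le> S * ((?c * (k t)^2 + exp (4 * K * t) / ?c) / 2)" if "t \<in> {0..x}" for t
  proof -
    let ?e = "exp (2 * K * t)"
    have "k t * ?e \<le> (?c * (k t)^2 + ?e^2 / ?c) / 2" by (rule mult_le_weighted_squares[OF c])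
    moreover have "?e^2 = exp (4 * K * t)" by (simp add: exp_double[symmetric])
    ultimately have "S * (k t * ?e) \<le> S * ((?c * (k t)^2 + exp (4 * K * t) / ?c) / 2)"
      using \<open>0 \<le> S\<close> by (intro mult_left_mono) auto
    with le[OF that] show ?thesis by (simp add: algebra_simps)
  qed
  have "norm (integral {0..x} f) \<le>
      S * ((?c * integral {0..x} (\<lambda>t. (k t)^2) + (exp (4 * K * x) - 1) / (4 * K) / ?c) / 2)"
    using integral_norm_bound_integral[OF f has_integral_integrable[OF I] pw] unfolding integral_unique[OF I] .
  also have "\<dots> \<le> S * ((?c * K + exp (4 * K * x) / (4 * K) / ?c) / 2)"
    using c \<open>K > 0\<close> kle \<open>0 \<le> S\<close>
    by (intro mult_left_mono divide_right_mono add_mono) auto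
  also have "exp (4 * K * x) / (4 * K) / ?c = exp (2 * K * x) / 2"
    using \<open>K > 0\<close> by (simp add: field_simps flip: exp_add)
  also have "?c * K = exp (2 * K * x) / 2" using \<open>K > 0\<close> by simp
  finally show ?thesis by simp
qed

text \<open>Caratheodory form of y'' = v y + h: \<open>y'\<close> is a separate function tied to
  \<open>y\<close> by an integral equation, because y'' exists only almost everywhere. Integrability
  of the right-hand side is demanded since \<open>integral\<close> defaults to 0 on nonintegrable
  functions.\<close>

definition ivp :: "(real \<Rightarrow> complex) \<Rightarrow> (real \<Rightarrow> complex) \<Rightarrow> (real \<Rightarrow> complex) \<Rightarrow> (real \<Rightarrow> complex) \<Rightarrow> bool" where
  "ivp v h y y' \<longleftrightarrow> (\<lambda>t. v t * y t + h t) integrable_on {0..1} \<and>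
     (\<forall>x\<in>{0..1}. y x = y 0 + integral {0..x} y' \<and>
                 y' x = y' 0 + integral {0..x} (\<lambda>t. v t * y t + h t))"

lemma ivpD:
  assumes "ivp v h y y'"
  shows "(\<lambda>t. v t * y t + h t) integrable_on {0..1}"
    "x \<in> {0..1} \<Longrightarrow> y x = y 0 + integral {0..x} y'"
    "x \<in> {0..1} \<Longrightarrow> y' x = y' 0 + integral {0..x} (\<lambda>t. v t * y t + h t)"
  using assms unfolding ivp_def by blast+

lemma sol_ivp: "sol q z y y' \<longleftrightarrow> ivp (\<lambda>t. of_real (q t) - z) (\<lambda>_. 0) y y'"
  unfolding sol_def ivp_def by simp

lemma continuous_on_Icc_cong_integral:
  fixes y :: "real \<Rightarrow> complex"
  assumes "f integrable_on {0..1}" "\<And>x. x \<in> {0..1} \<Longrightarrow> y x = c + integral {0..x} f"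
  shows "continuous_on {0..1} y"
  using continuous_on_add[OF continuous_on_const[of _ c] indefinite_integral_continuous_1[OF assms(1)]]
  by (rule continuous_on_eq) (simp add: assms(2))

lemma ivp_continuous:
  assumes "ivp v h y y'"
  shows "continuous_on {0..1} y'" "continuous_on {0..1} y"
proof -
  show c: "continuous_on {0..1} y'"
    by (rule continuous_on_Icc_cong_integral[OF ivpD(1)[OF assms] ivpD(3)[OF assms]])
  show "continuous_on {0..1} y"
    by (rule continuous_on_Icc_cong_integral[OF integrable_continuous_real[OF c] ivpD(2)[OF assms]])
qed

lemma ivp_lincomb:
  assumes "ivp v h y y'" "ivp v g w w'"
  shows "ivp v (\<lambda>t. c * h t + d * g t) (\<lambda>t. c * y t + d * w t) (\<lambda>t. c * y' t + d * w' t)"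
proof -
  have cont: "continuous_on {0..1} y'" "continuous_on {0..1} w'"
    using assms ivp_continuous by blast+
  have eq: "(\<lambda>t. v t * (c * y t + d * w t) + (c * h t + d * g t)) =
      (\<lambda>t. c * (v t * y t + h t) + d * (v t * w t + g t))"
    by (auto simp: algebra_simps)
  have i: "(\<lambda>t. v t * y t + h t) integrable_on {0..1}" "(\<lambda>t. v t * w t + g t) integrable_on {0..1}"
    using assms by (auto simp: ivp_def)
  show ?thesis unfolding ivp_def eq
  proof (intro conjI ballI)
    show "(\<lambda>t. c * (v t * y t + h t) + d * (v t * w t + g t)) integrable_on {0..1}"
      by (intro integrable_add[OF integrable_on_mult_right[OF i(1)] integrable_on_mult_right[OF i(2)]])
    fix x :: real assume x: "x \<in> {0..1}"
    have "integral {0..x} (\<lambda>t. c * y' t + d * w' t) = c * integral {0..x} y' + d * integral {0..x} w'"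
      using integrable_Icc_subset[OF integrable_continuous_real[OF cont(1)] x]
        integrable_Icc_subset[OF integrable_continuous_real[OF cont(2)] x]
      by (subst integral_add) (auto intro: integrable_on_mult_right)
    then show "c * y x + d * w x = c * y 0 + d * w 0 + integral {0..x} (\<lambda>t. c * y' t + d * w' t)"
      using ivpD(2)[OF assms(1) x] ivpD(2)[OF assms(2) x] by (simp only: algebra_simps)
    have "integral {0..x} (\<lambda>t. c * (v t * y t + h t) + d * (v t * w t + g t)) =
        c * integral {0..x} (\<lambda>t. v t * y t + h t) + d * integral {0..x} (\<lambda>t. v t * w t + g t)"
      using integrable_Icc_subset[OF i(1) x] integrable_Icc_subset[OF i(2) x]
      by (subst integral_add) (auto intro: integrable_on_mult_right)
    then show "c * y' x + d * w' x = c * y' 0 + d * w' 0 +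
        integral {0..x} (\<lambda>t. c * (v t * y t + h t) + d * (v t * w t + g t))"
      using ivpD(3)[OF assms(1) x] ivpD(3)[OF assms(2) x] by (simp only: algebra_simps)
  qed
qed

text \<open>A multiple of the solution may be moved between source and potential. This lets a
  solution for one spectral parameter be read as a solution of an inhomogeneous problem for
  another.\<close>

lemma ivp_cong_h:
  assumes "ivp v h y y'" "\<And>t. t \<in> {0..1} \<Longrightarrow> h t = g t + u t * y t" "\<And>t. t \<in> {0..1} \<Longrightarrow> w t = v t + u t"
  shows "ivp w g y y'"
proof -
  have eq: "w t * y t + g t = v t * y t + h t" if "t \<in> {0..1}" for t
    using assms(2,3)[OF that] by (simp add: algebra_simps)
  have "((\<lambda>t. w t * y t + g t) integrable_on {0..1}) = ((\<lambda>t. v t * y t + h t) integrable_on {0..1})"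
    by (rule integrable_cong) (rule eq)
  with ivpD(1)[OF assms(1)] have "(\<lambda>t. w t * y t + g t) integrable_on {0..1}" by simp
  moreover have "integral {0..x} (\<lambda>t. w t * y t + g t) = integral {0..x} (\<lambda>t. v t * y t + h t)" if "x \<in> {0..1}" for x
    by (rule integral_cong) (use that eq in auto)
  ultimately show ?thesis
    unfolding ivp_def using ivpD(2,3)[OF assms(1)] by metis
qed

text \<open>The exponent is twice the squared L2 norm of 1 + |v|, the value of the exponential
  weight at the right end; the factor 2 comes from absorbing half of the weighted maximum in
  \<open>ivp_bound\<close>.\<close>

definition ivp_const :: "(real \<Rightarrow> complex) \<Rightarrow> real" where
  "ivp_const v = 2 * exp (2 * integral {0..1} (\<lambda>t. (1 + cmod (v t))^2))"

lemma integrable_weight: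
  assumes "edge_L2 v"
  shows "(\<lambda>t. (1 + cmod (v t))^2) integrable_on {0..1}"
proof -
  have "(\<lambda>t. (1 + cmod (v t))^2) = (\<lambda>t. 1 + 2 * cmod (v t) + (cmod (v t))^2)"
    by (auto simp: power2_eq_square algebra_simps)
  moreover have "(\<lambda>t. 1 + 2 * cmod (v t) + (cmod (v t))^2) integrable_on {0..1}"
    using edge_L2_integrable_sq[OF assms] edge_L2_absolutely_integrable[OF assms]
    by (intro integrable_add integrable_on_mult_right) (auto simp: absolutely_integrable_on_def)
  ultimately show ?thesis by simp
qed

lemma integral_weight_ge_1:
  assumes "edge_L2 v"
  shows "1 \<le> integral {0..1} (\<lambda>t. (1 + cmod (v t))^2)"
proof -
  have "integral {0..1::real} (\<lambda>t. 1::real) \<le> integral {0..1} (\<lambda>t. (1 + cmod (v t))^2)"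
    using integrable_weight[OF assms] by (intro integral_le) (auto simp: one_le_power)
  then show ?thesis by simp
qed

text \<open>A weighted maximum replaces Gronwall's inequality: at the point \<open>s\<close> where
  \<open>exp (- (2 * K * t)) * Y t\<close> attains its maximum \<open>S\<close>, the contraction
  estimate gives S \<le> M + S / 2, hence S \<le> 2 M.\<close>

lemma ivp_bound:
  assumes v: "edge_L2 v" and h: "h absolutely_integrable_on {0..1}" and y: "ivp v h y y'"
    and x: "x \<in> {0..1}"
  shows "cmod (y x) + cmod (y' x) \<le>
    ivp_const v * (cmod (y 0) + cmod (y' 0) + integral {0..1} (\<lambda>t. cmod (h t)))"
proof -
  define K where "K = integral {0..1} (\<lambda>t. (1 + cmod (v t))^2)"
  define M where "M = cmod (y 0) + cmod (y' 0) + integral {0..1} (\<lambda>t. cmod (h t))"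
  define Y where "Y t = cmod (y t) + cmod (y' t)" for t
  have K: "1 \<le> K" using integral_weight_ge_1[OF v] by (simp add: K_def)
  note c = ivp_continuous[OF y]
  have cy: "continuous_on {0..1} Y" unfolding Y_def by (intro continuous_intros c)
  then have "continuous_on {0..1} (\<lambda>t. exp (- (2 * K * t)) * Y t)" by (intro continuous_intros)
  then obtain s where s: "s \<in> {0..1}"
    and sup: "\<And>t. t \<in> {0..1} \<Longrightarrow> exp (- (2 * K * t)) * Y t \<le> exp (- (2 * K * s)) * Y s"
    using continuous_attains_sup[of "{0..1::real}" "\<lambda>t. exp (- (2 * K * t)) * Y t"] by auto
  define S where "S = exp (- (2 * K * s)) * Y s"
  have S0: "0 \<le> S" by (simp add: S_def Y_def)
  have YS: "Y t \<le> S * exp (2 * K * t)" if "t \<in> {0..1}" for t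
    using sup[OF that] unfolding S_def[symmetric] by (simp add: exp_minus field_simps)
  have vy: "(\<lambda>t. v t * y t) absolutely_integrable_on {0..1}"
    by (intro edge_L2_mult_integrable v edge_L2_continuous c)
  have i1: "(\<lambda>t. cmod (y' t)) integrable_on {0..s}"
    using s by (intro integrable_Icc_subset[OF _ s] integrable_continuous_real continuous_intros c)
  have i2: "(\<lambda>t. cmod (v t * y t)) integrable_on {0..s}"
    using absolutely_integrable_Icc_subset[OF vy s] by (auto simp: absolutely_integrable_on_def)
  have "norm (integral {0..s} (\<lambda>t. cmod (y' t) + cmod (v t * y t))) \<le> S * exp (2 * K * s) / 2"
  proof (rule weighted_integral_bound[where k = "\<lambda>t. 1 + cmod (v t)"])
    show "(\<lambda>t. cmod (y' t) + cmod (v t * y t)) integrable_on {0..s}"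
      by (intro integrable_add i1 i2)
    fix t assume t: "t \<in> {0..s}"
    then have t1: "t \<in> {0..1}" using s by auto
    have "norm (cmod (y' t) + cmod (v t * y t)) \<le> (1 + cmod (v t)) * Y t"
      by (simp add: Y_def norm_mult algebra_simps)
    also have "\<dots> \<le> (1 + cmod (v t)) * (S * exp (2 * K * t))"
      by (intro mult_left_mono YS[OF t1]) auto
    finally show "norm (cmod (y' t) + cmod (v t * y t)) \<le> \<dots>" .
  qed (use K integrable_weight[OF v] s S0 in \<open>auto simp: K_def\<close>)
  then have T: "integral {0..s} (\<lambda>t. cmod (y' t)) + integral {0..s} (\<lambda>t. cmod (v t * y t)) \<le> S * exp (2 * K * s) / 2"
    unfolding integral_add[OF i1 i2] real_norm_def by linarith
  have "cmod (y s) \<le> cmod (y 0) + integral {0..s} (\<lambda>t. cmod (y' t))"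
  proof -
    have "cmod (y s) \<le> cmod (y 0) + cmod (integral {0..s} y')"
      by (subst ivpD(2)[OF y s]) (rule norm_triangle_ineq)
    also have "cmod (integral {0..s} y') \<le> integral {0..s} (\<lambda>t. cmod (y' t))"
      by (rule integral_norm_bound_integral)
        (use i1 integrable_Icc_subset[OF integrable_continuous_real[OF c(1)] s] in auto)
    finally show ?thesis by simp
  qed
  moreover have "cmod (y' s) \<le> cmod (y' 0) + integral {0..s} (\<lambda>t. cmod (v t * y t)) + integral {0..1} (\<lambda>t. cmod (h t))"
  proof -
    have i3: "(\<lambda>t. v t * y t) integrable_on {0..s}" "h integrable_on {0..s}"
      using absolutely_integrable_Icc_subset[OF vy s] absolutely_integrable_Icc_subset[OF h s]
      by (auto simp: absolutely_integrable_on_def)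
    have "y' s = y' 0 + (integral {0..s} (\<lambda>t. v t * y t) + integral {0..s} h)"
      by (subst ivpD(3)[OF y s], subst integral_add[OF i3]) simp
    then have "cmod (y' s) \<le> cmod (y' 0) + (cmod (integral {0..s} (\<lambda>t. v t * y t)) + cmod (integral {0..s} h))"
      by (metis norm_triangle_ineq norm_triangle_mono order_refl)
    moreover have "cmod (integral {0..s} (\<lambda>t. v t * y t)) \<le> integral {0..s} (\<lambda>t. cmod (v t * y t))"
      by (rule integral_norm_bound_integral) (use i2 i3 in auto)
    moreover have "cmod (integral {0..s} h) \<le> integral {0..1} (\<lambda>t. cmod (h t))"
      by (rule norm_integral_le_L1[OF h s])
    ultimately show ?thesis by linarith
  qed
  ultimately have "Y s \<le> M + S * exp (2 * K * s) / 2"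
    using T by (simp add: Y_def M_def)
  then have "exp (- (2 * K * s)) * Y s \<le> exp (- (2 * K * s)) * (M + S * exp (2 * K * s) / 2)"
    by (intro mult_left_mono) auto
  also have "\<dots> = exp (- (2 * K * s)) * M + S / 2 * (exp (- (2 * K * s)) * exp (2 * K * s))"
    by (simp add: distrib_left)
  also have "exp (- (2 * K * s)) * exp (2 * K * s) = 1" by (simp flip: exp_add)
  finally have SM: "S \<le> exp (- (2 * K * s)) * M + S / 2" unfolding S_def[symmetric] by simp
  have M0: "0 \<le> M"
  proof -
    have "0 \<le> integral {0..1} (\<lambda>t. cmod (h t))" using h by (intro integral_nonneg) (auto simp: absolutely_integrable_on_def)
    then show ?thesis by (simp add: M_def)
  qed
  have "exp (- (2 * K * s)) * M \<le> 1 * M"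
    using M0 K s by (intro mult_right_mono) auto
  with SM have "S \<le> 2 * M" by linarith
  have "Y x \<le> S * exp (2 * K * x)" by (rule YS[OF x])
  also have "\<dots> \<le> (2 * M) * exp (2 * K * 1)"
    using \<open>S \<le> 2 * M\<close> K x M0 by (intro mult_mono) auto
  also have "\<dots> = 2 * exp (2 * K) * M" by simp
  finally show ?thesis unfolding Y_def M_def ivp_const_def K_def .
qed

text \<open>Picard iteration of the pair (function, derivative), started at zero. In the weighted
  norm each increment is at most half the previous one, so the iterates converge pointwise with a
  uniform bound; dominated convergence carries the integral equations to the limit.\<close>

lemma ivp_exists:
  assumes v: "edge_L2 v" and h: "h absolutely_integrable_on {0..1}"
  obtains y y' where "ivp v h y y'" "y 0 = a" "y' 0 = b"
proof -
  define K where "K = integral {0..1} (\<lambda>t. (1 + cmod (v t))^2)"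
  define M where "M = cmod a + cmod b + integral {0..1} (\<lambda>t. cmod (h t))"
  define P where "P = rec_nat ((\<lambda>_. 0), (\<lambda>_. 0))
    (\<lambda>_ Y. ((\<lambda>x. a + integral {0..x} (snd Y)), (\<lambda>x. b + integral {0..x} (\<lambda>t. v t * fst Y t + h t))))"
  define p r where "p n = fst (P n)" and "r n = snd (P n)" for n
  have p0: "p 0 = (\<lambda>_. 0)" "r 0 = (\<lambda>_. 0)" by (simp_all add: p_def r_def P_def)
  have pS: "p (Suc n) x = a + integral {0..x} (r n)"
    and rS: "r (Suc n) x = b + integral {0..x} (\<lambda>t. v t * p n t + h t)" for n x
    by (simp_all add: p_def r_def P_def)
  have K: "1 \<le> K" using integral_weight_ge_1[OF v] by (simp add: K_def)
  have hi: "h integrable_on {0..1}" using h by (simp add: absolutely_integrable_on_def)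
  have h0: "0 \<le> integral {0..1} (\<lambda>t. cmod (h t))"
    using h by (intro integral_nonneg) (auto simp: absolutely_integrable_on_def)
  have M0: "0 \<le> M" using h0 by (simp add: M_def)
  have cont: "continuous_on {0..1} (p n)" "continuous_on {0..1} (r n)" for n
  proof (induction n)
    case 0 show "continuous_on {0..1} (p 0)" "continuous_on {0..1} (r 0)" by (simp_all add: p0)
  next
    case (Suc n)
    show "continuous_on {0..1} (p (Suc n))"
      by (rule continuous_on_Icc_cong_integral[OF integrable_continuous_real[OF Suc(2)] pS])
    have "(\<lambda>t. v t * p n t) absolutely_integrable_on {0..1}"
      by (intro edge_L2_mult_integrable v edge_L2_continuous Suc)
    then show "continuous_on {0..1} (r (Suc n))"
      by (intro continuous_on_Icc_cong_integral[OF _ rS] integrable_add hi)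
        (simp add: absolutely_integrable_on_def)
  qed
  have vp: "(\<lambda>t. v t * f t) absolutely_integrable_on {0..1}" if "continuous_on {0..1} f" for f
    by (intro edge_L2_mult_integrable v edge_L2_continuous that)
  have vp': "(\<lambda>t. v t * f t) integrable_on {0..x}" if "continuous_on {0..1} f" "x \<in> {0..1}" for f x
    using vp[OF that(1)] that(2) by (auto simp: absolutely_integrable_on_def intro: integrable_Icc_subset)
  have ri: "r n integrable_on {0..x}" if "x \<in> {0..1}" for n x
    using integrable_Icc_subset[OF integrable_continuous_real[OF cont(2)] that] .
  have D: "cmod (p (Suc n) x - p n x) + cmod (r (Suc n) x - r n x) \<le> M * (1/2)^n * exp (2 * K * x)"
    if x: "x \<in> {0..1}" for n x
    using x
  proof (induction n arbitrary: x)
    case (0 x)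
    have "cmod (b + integral {0..x} h) \<le> cmod b + cmod (integral {0..x} h)" by (rule norm_triangle_ineq)
    with norm_integral_le_L1[OF h 0] have "cmod (p (Suc 0) x - p 0 x) + cmod (r (Suc 0) x - r 0 x) \<le> M * 1"
      by (simp add: p0 pS rS M_def)
    also have "\<dots> \<le> M * exp (2 * K * x)" using M0 K 0 by (intro mult_left_mono) auto
    finally show ?case by simp
  next
    case (Suc n x)
    let ?f = "\<lambda>t. r (Suc n) t - r n t" and ?g = "\<lambda>t. v t * (p (Suc n) t - p n t)"
    have fi: "?f integrable_on {0..x}" "(\<lambda>t. cmod (?f t)) integrable_on {0..x}"
      by (intro integrable_Icc_subset[OF _ Suc.prems] integrable_continuous_real continuous_intros cont)+
    have "?g absolutely_integrable_on {0..x}"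
      by (rule absolutely_integrable_Icc_subset[OF vp Suc.prems]) (intro continuous_intros cont)
    then have gi: "?g integrable_on {0..x}" "(\<lambda>t. cmod (?g t)) integrable_on {0..x}"
      by (auto simp: absolutely_integrable_on_def)
    have 1: "p (Suc (Suc n)) x - p (Suc n) x = integral {0..x} ?f"
      by (subst integral_diff[OF ri[OF Suc.prems] ri[OF Suc.prems]]) (simp add: pS)
    have 2: "r (Suc (Suc n)) x - r (Suc n) x = integral {0..x} ?g"
    proof -
      have "r (Suc (Suc n)) x - r (Suc n) x =
        integral {0..x} (\<lambda>t. v t * p (Suc n) t + h t) - integral {0..x} (\<lambda>t. v t * p n t + h t)"
        by (simp add: rS)
      also have "\<dots> = integral {0..x} (\<lambda>t. (v t * p (Suc n) t + h t) - (v t * p n t + h t))"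
        by (rule integral_diff[symmetric])
          (intro integrable_add vp' cont Suc.prems integrable_Icc_subset[OF hi])+
      also have "\<dots> = integral {0..x} ?g" by (simp add: algebra_simps)
      finally show ?thesis .
    qed
    have "norm (integral {0..x} (\<lambda>t. cmod (?f t) + cmod (?g t))) \<le> (M * (1/2)^n) * exp (2 * K * x) / 2"
    proof (rule weighted_integral_bound[where k = "\<lambda>t. 1 + cmod (v t)"])
      show "(\<lambda>t. cmod (?f t) + cmod (?g t)) integrable_on {0..x}"
        by (intro integrable_add fi gi)
      fix t assume t: "t \<in> {0..x}"
      then have t1: "t \<in> {0..1}" using Suc.prems by auto
      have "norm (cmod (?f t) + cmod (?g t)) \<le> (1 + cmod (v t)) * (cmod (p (Suc n) t - p n t) + cmod (?f t))"
        by (simp add: norm_mult distrib_left distrib_right)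
      also have "\<dots> \<le> (1 + cmod (v t)) * (M * (1/2)^n * exp (2 * K * t))"
        by (intro mult_left_mono Suc.IH t1) auto
      finally show "norm (cmod (?f t) + cmod (?g t)) \<le> \<dots>" .
    qed (use K M0 integrable_weight[OF v] Suc.prems in \<open>auto simp: K_def\<close>)
    then have "integral {0..x} (\<lambda>t. cmod (?f t)) + integral {0..x} (\<lambda>t. cmod (?g t)) \<le> (M * (1/2)^n) * exp (2 * K * x) / 2"
      unfolding integral_add[OF fi(2) gi(2)] real_norm_def by linarith
    moreover have "cmod (integral {0..x} ?f) \<le> integral {0..x} (\<lambda>t. cmod (?f t))"
      by (rule integral_norm_bound_integral) (use fi in auto)
    moreover have "cmod (integral {0..x} ?g) \<le> integral {0..x} (\<lambda>t. cmod (?g t))"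
      by (rule integral_norm_bound_integral) (use gi in auto)
    ultimately show ?case unfolding 1 2 by simp
  qed
  define C where "C = M * exp (2 * K)"
  have DC: "cmod (p (Suc n) x - p n x) \<le> C * (1/2)^n" "cmod (r (Suc n) x - r n x) \<le> C * (1/2)^n"
    if x: "x \<in> {0..1}" for n x
  proof -
    have "M * (1/2)^n * exp (2 * K * x) \<le> M * (1/2)^n * exp (2 * K)"
      using M0 K x by (intro mult_left_mono) auto
    also have "\<dots> = C * (1/2)^n" by (simp add: C_def)
    finally have "M * (1/2)^n * exp (2 * K * x) \<le> C * (1/2)^n" .
    with D[OF x, of n] show "cmod (p (Suc n) x - p n x) \<le> C * (1/2)^n" "cmod (r (Suc n) x - r n x) \<le> C * (1/2)^n"
      using norm_ge_zero[of "p (Suc n) x - p n x"] norm_ge_zero[of "r (Suc n) x - r n x"]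
      by linarith+
  qed
  have lim: "convergent u" "cmod (u n) \<le> 2 * C"
    if u: "u 0 = 0" "\<And>n. cmod (u (Suc n) - u n) \<le> C * (1/2)^n" for u :: "nat \<Rightarrow> complex" and n
  proof -
    have gs: "(\<lambda>n. C * (1/2::real)^n) sums (C * 2)"
      using sums_mult[OF geometric_sums[of "1/2::real"], of C] by simp
    have s: "summable (\<lambda>n. u (Suc n) - u n)"
      by (rule summable_comparison_test[OF _ sums_summable[OF gs]]) (use u in auto)
    have t: "(\<Sum>i<n. u (Suc i) - u i) = u n" for n using u(1) by (simp add: sum_lessThan_telescope)
    show "convergent u"
      using s by (simp add: summable_iff_convergent t)
    have "cmod (\<Sum>i<n. u (Suc i) - u i) \<le> (\<Sum>i<n. C * (1/2)^i)"
      by (rule sum_norm_le) (use u in auto)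
    also have "\<dots> \<le> C * 2"
      unfolding sums_unique[OF gs] by (rule sum_le_suminf[OF sums_summable[OF gs]]) (use M0 in \<open>auto simp: C_def\<close>)
    finally show "cmod (u n) \<le> 2 * C" by (simp add: t)
  qed
  define y y' where "y x = lim (\<lambda>n. p n x)" and "y' x = lim (\<lambda>n. r n x)" for x
  have py: "(\<lambda>n. p n x) \<longlonglongrightarrow> y x" "(\<lambda>n. r n x) \<longlonglongrightarrow> y' x" if "x \<in> {0..1}" for x
    using lim(1)[OF _ DC(1)[OF that]] lim(1)[OF _ DC(2)[OF that]] p0
    by (auto simp: y_def y'_def convergent_LIMSEQ_iff)
  have bnd: "cmod (p n x) \<le> 2 * C" "cmod (r n x) \<le> 2 * C" if "x \<in> {0..1}" for n x
    using lim(2)[OF _ DC(1)[OF that], of n] lim(2)[OF _ DC(2)[OF that], of n] p0 by auto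
  have bi: "(\<lambda>t. cmod (v t) * (2 * C) + cmod (h t)) integrable_on {0..1}"
    using edge_L2_absolutely_integrable[OF v] h
    by (intro integrable_add integrable_on_mult_left) (auto simp: absolutely_integrable_on_def)
  have dc1: "(\<lambda>k. integral {0..x} (r k)) \<longlonglongrightarrow> integral {0..x} y'" if x: "x \<in> {0..1}" for x
    by (rule dominated_convergence(2)[where h="\<lambda>_. 2 * C"]) (use x ri bnd py in auto)
  have dc2: "(\<lambda>k. integral {0..x} (\<lambda>t. v t * p k t + h t)) \<longlonglongrightarrow> integral {0..x} (\<lambda>t. v t * y t + h t)"
      "(\<lambda>t. v t * y t + h t) integrable_on {0..x}" if x: "x \<in> {0..1}" for x
  proof -
    have i: "(\<lambda>t. v t * p k t + h t) integrable_on {0..x}" for k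
      by (intro integrable_add vp' cont x integrable_Icc_subset[OF hi x])
    have b: "norm (v t * p k t + h t) \<le> cmod (v t) * (2 * C) + cmod (h t)" if "t \<in> {0..x}" for t k
      using norm_triangle_ineq[of "v t * p k t" "h t"] bnd(1)[of t k] x that
        mult_left_mono[of "cmod (p k t)" "2 * C" "cmod (v t)"]
      by (auto simp: norm_mult)
    have l: "(\<lambda>k. v t * p k t + h t) \<longlonglongrightarrow> v t * y t + h t" if "t \<in> {0..x}" for t
      using that x by (intro tendsto_intros py) auto
    show "(\<lambda>k. integral {0..x} (\<lambda>t. v t * p k t + h t)) \<longlonglongrightarrow> integral {0..x} (\<lambda>t. v t * y t + h t)"
      "(\<lambda>t. v t * y t + h t) integrable_on {0..x}"
      using dominated_convergence[OF i integrable_Icc_subset[OF bi x] b l] by auto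
  qed
  have e1: "y x = a + integral {0..x} y'" if x: "x \<in> {0..1}" for x
    using LIMSEQ_unique[OF LIMSEQ_Suc[OF py(1)[OF x]]] tendsto_add[OF tendsto_const[of a] dc1[OF x]]
    by (simp add: pS)
  have e2: "y' x = b + integral {0..x} (\<lambda>t. v t * y t + h t)" if x: "x \<in> {0..1}" for x
    using LIMSEQ_unique[OF LIMSEQ_Suc[OF py(2)[OF x]]] tendsto_add[OF tendsto_const[of b] dc2(1)[OF x]]
    by (simp add: rS)
  have e0: "y 0 = a" "y' 0 = b" using e1[of 0] e2[of 0] by simp_all
  have "ivp v h y y'" unfolding ivp_def e0 using e1 e2 dc2(2)[of 1] by auto
  then show ?thesis using e0 by (rule that)
qed

lemma ivp_unique:
  assumes v: "edge_L2 v" and y: "ivp v h y y'" and w: "ivp v h w w'" and "y 0 = w 0" "y' 0 = w' 0"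
    and x: "x \<in> {0..1}"
  shows "y x = w x" "y' x = w' x"
proof -
  have "ivp v (\<lambda>t. 1 * h t + (-1) * h t) (\<lambda>t. 1 * y t + (-1) * w t) (\<lambda>t. 1 * y' t + (-1) * w' t)"
    by (rule ivp_lincomb[OF y w])
  then have "ivp v (\<lambda>t. 0) (\<lambda>t. y t - w t) (\<lambda>t. y' t - w' t)" by simp
  from ivp_bound[OF v _ this x] assms have "cmod (y x - w x) + cmod (y' x - w' x) \<le> 0" by simp
  then have "cmod (y x - w x) = 0" "cmod (y' x - w' x) = 0"
    using norm_ge_zero[of "y x - w x"] norm_ge_zero[of "y' x - w' x"] by linarith+
  then show "y x = w x" "y' x = w' x" by auto
qed

subsection \<open>Integration by parts and the Sobolev space\<close>

lemma integral_diff_Icc: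
  fixes f :: "real \<Rightarrow> complex"
  assumes "f integrable_on {0..1}" "0 \<le> x" "x \<le> y" "y \<le> 1"
  shows "integral {0..y} f - integral {0..x} f = integral {x..y} f" "f integrable_on {x..y}"
proof -
  have "f integrable_on {0..y}" using assms by (auto intro: integrable_Icc_subset[OF assms(1)])
  then show "integral {0..y} f - integral {0..x} f = integral {x..y} f"
    using Henstock_Kurzweil_Integration.integral_combine[of 0 x y f] assms by (simp add: algebra_simps)
  show "f integrable_on {x..y}"
    using integrable_on_subinterval[OF assms(1), of x y] assms by auto
qed

text \<open>The second factor is only absolutely continuous, so the fundamental theorem of calculus does
  not apply. Instead, the defect has derivative zero everywhere, because its increment over an
  interval of length \<open>d\<close> is at most \<open>2 L d\<close> times the integral of \<open>norm w\<close> over that interval.\<close>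

lemma integral_by_parts_AC:
  fixes v :: "real \<Rightarrow> complex"
  assumes v': "continuous_on {0..1} v'" and v: "\<And>x. x \<in> {0..1} \<Longrightarrow> v x = v 0 + integral {0..x} v'"
    and w: "w absolutely_integrable_on {0..1}" and W: "\<And>x. x \<in> {0..1} \<Longrightarrow> W x = W 0 + integral {0..x} w"
    and z: "z \<in> {0..1}"
  shows "((\<lambda>t. v t * w t + v' t * W t) has_integral v z * W z - v 0 * W 0) {0..z}"
proof -
  have v'i: "v' integrable_on {0..1}" by (rule integrable_continuous_real[OF v'])
  have wi: "w integrable_on {0..1}" and wni: "(\<lambda>t. cmod (w t)) integrable_on {0..1}"
    using w by (auto simp: absolutely_integrable_on_def)
  have cv: "continuous_on {0..1} v" by (rule continuous_on_Icc_cong_integral[OF v'i v])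
  have cW: "continuous_on {0..1} W" by (rule continuous_on_Icc_cong_integral[OF wi W])
  have vw: "(\<lambda>t. v t * w t) absolutely_integrable_on {0..1}"
  proof -
    have "bounded (v ` {0..1})" by (intro compact_imp_bounded compact_continuous_image cv) auto
    then obtain B where B: "\<And>t. t \<in> {0..1} \<Longrightarrow> cmod (v t) \<le> B" unfolding bounded_iff by blast
    show ?thesis
    proof (rule measurable_bounded_by_integrable_imp_absolutely_integrable)
      show "(\<lambda>t. v t * w t) \<in> borel_measurable (lebesgue_on {0..1})"
        using absolutely_integrable_imp_borel_measurable[OF w]
        by (auto intro!: borel_measurable_times borel_measurable_continuous_Icc[OF cv])
      show "(\<lambda>t. B * cmod (w t)) integrable_on {0..1}" by (intro integrable_on_mult_right wni)
    qed (auto simp: norm_mult intro!: mult_right_mono B)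
  qed
  then have vwi: "(\<lambda>t. v t * w t) integrable_on {0..1}" by (simp add: absolutely_integrable_on_def)
  have vWi: "(\<lambda>t. v' t * W t) integrable_on {0..1}"
    by (intro integrable_continuous_real continuous_intros v' cW)
  have fi: "(\<lambda>t. v t * w t + v' t * W t) integrable_on {0..1}" by (intro integrable_add vwi vWi)
  have "bounded (v' ` {0..1})" by (intro compact_imp_bounded compact_continuous_image v') auto
  then obtain L where L: "\<And>t. t \<in> {0..1} \<Longrightarrow> cmod (v' t) \<le> L" unfolding bounded_iff by blast
  have L0: "0 \<le> L" using order_trans[OF norm_ge_zero L[of 0]] by simp
  define G where "G x = integral {0..x} (\<lambda>t. cmod (w t))" for x
  have cG: "continuous_on {0..1} G" unfolding G_def by (rule indefinite_integral_continuous_1[OF wni])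
  define D where "D x = v x * W x - integral {0..x} (\<lambda>t. v t * w t + v' t * W t)" for x
  have key: "cmod (D y - D x) \<le> (y - x) * (2 * L * (G y - G x))" if xy: "0 \<le> x" "x \<le> y" "y \<le> 1" for x y
  proof -
    have vd: "cmod (v b - v a) \<le> L * (b - a)" if "0 \<le> a" "a \<le> b" "b \<le> 1" for a b
    proof -
      have "v b - v a = integral {a..b} v'"
        using v[of a] v[of b] integral_diff_Icc(1)[OF v'i that] that by simp
      also have "cmod \<dots> \<le> L * (b - a)"
        using that L integral_diff_Icc(2)[OF v'i that] by (intro integral_bound) (auto intro: continuous_on_subset[OF v'])
      finally show ?thesis .
    qed
    have Gd: "G b - G a = integral {a..b} (\<lambda>t. cmod (w t))" "(\<lambda>t. cmod (w t)) integrable_on {a..b}"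
      if "0 \<le> a" "a \<le> b" "b \<le> 1" for a b
      using Henstock_Kurzweil_Integration.integral_combine[of 0 a b "\<lambda>t. cmod (w t)"] that
        integrable_Icc_subset[OF wni, of b] integrable_on_subinterval[OF wni, of a b]
      by (auto simp: G_def)
    have Wd: "cmod (W x - W s) \<le> G y - G x" if "x \<le> s" "s \<le> y" for s
    proof -
      have s: "0 \<le> x" "x \<le> s" "s \<le> 1" using that xy by auto
      have "cmod (W x - W s) = cmod (integral {x..s} w)"
        using W[of x] W[of s] integral_diff_Icc(1)[OF wi s] s by (simp add: norm_minus_commute)
      also have "\<dots> \<le> G s - G x"
        unfolding Gd(1)[OF s] using integral_diff_Icc(2)[OF wi s] Gd(2)[OF s]
        by (intro integral_norm_bound_integral) auto
      also have "\<dots> \<le> G y - G x"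
        using Gd(1)[of s y] integral_nonneg[OF Gd(2)[of s y]] s that xy by auto
      finally show ?thesis .
    qed
    have E1: "integral {x..y} (\<lambda>t. v y * w t) = v y * (W y - W x)"
      using W[of x] W[of y] integral_diff_Icc(1)[OF wi xy] xy by simp
    have E2: "integral {x..y} (\<lambda>t. W x * v' t) = W x * (v y - v x)"
      using v[of x] v[of y] integral_diff_Icc(1)[OF v'i xy] xy by simp
    \<comment> \<open>The increment of the product is v(y) (W(y) - W(x)) + W(x) (v(y) - v(x)).
      Writing both differences as integrals and subtracting the integrand leaves only products of an
      increment with a derivative, which are small.\<close>
    have "D y - D x = integral {x..y} (\<lambda>t. v y * w t) + integral {x..y} (\<lambda>t. W x * v' t)
        - integral {x..y} (\<lambda>t. v t * w t + v' t * W t)"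
      unfolding E1 E2 integral_diff_Icc(1)[OF fi xy, symmetric] D_def by (simp add: right_diff_distrib)
    also have "\<dots> = integral {x..y} (\<lambda>t. v y * w t + W x * v' t - (v t * w t + v' t * W t))"
      using integral_diff_Icc(2)[OF wi xy] integral_diff_Icc(2)[OF v'i xy] integral_diff_Icc(2)[OF fi xy]
      by (intro integral_unique[symmetric] has_integral_diff has_integral_add integrable_integral integrable_on_mult_right)
    finally have eq: "D y - D x = integral {x..y} (\<lambda>t. v y * w t + W x * v' t - (v t * w t + v' t * W t))" .
    have "cmod (D y - D x) \<le> integral {x..y} (\<lambda>t. L * (y - x) * cmod (w t) + L * (G y - G x))"
      unfolding eq
    proof (rule integral_norm_bound_integral)
      show "(\<lambda>t. v y * w t + W x * v' t - (v t * w t + v' t * W t)) integrable_on {x..y}"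
        by (intro integrable_diff[OF _ integral_diff_Icc(2)[OF fi xy]] integrable_add integrable_on_mult_right
            integral_diff_Icc(2)[OF wi xy] integral_diff_Icc(2)[OF v'i xy])
      show "(\<lambda>t. L * (y - x) * cmod (w t) + L * (G y - G x)) integrable_on {x..y}"
        by (intro integrable_add integrable_on_mult_right Gd(2) xy) auto
      fix s assume s: "s \<in> {x..y}"
      have "v y * w s + W x * v' s - (v s * w s + v' s * W s) = (v y - v s) * w s + v' s * (W x - W s)"
        by (simp add: algebra_simps)
      also have "cmod \<dots> \<le> cmod (v y - v s) * cmod (w s) + cmod (v' s) * cmod (W x - W s)"
        by (metis norm_mult norm_triangle_ineq)
      also have "\<dots> \<le> (L * (y - x)) * cmod (w s) + L * (G y - G x)"
      proof (intro add_mono mult_mono L Wd)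
        have "cmod (v y - v s) \<le> L * (y - s)" using s xy by (intro vd) auto
        also have "\<dots> \<le> L * (y - x)" using s L0 by (intro mult_left_mono) auto
        finally show "cmod (v y - v s) \<le> L * (y - x)" .
      qed (use s xy L0 in auto)
      finally show "cmod (v y * w s + W x * v' s - (v s * w s + v' s * W s)) \<le> L * (y - x) * cmod (w s) + L * (G y - G x)" .
    qed
    also have "\<dots> = L * (y - x) * (G y - G x) + L * (G y - G x) * (y - x)"
      unfolding Gd(1)[OF xy] using Gd(2)[OF xy] xy
      by (subst integral_add) (auto intro: integrable_on_mult_right)
    finally show ?thesis by (simp add: algebra_simps)
  qed
  have "D z = D 0"
  proof (rule has_derivative_zero_unique_strong_interval[of "{}" 0 1])
    show "continuous_on {0..1} D" unfolding D_def
      by (intro continuous_intros cv cW indefinite_integral_continuous_1 fi)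
    fix x :: real assume "x \<in> {0..1} - {}" then have x: "x \<in> {0..1}" by simp
    have "((\<lambda>y. (1 / norm (y - x)) *\<^sub>R (D y - (D x + 0))) \<longlongrightarrow> 0) (at x within {0..1})"
    proof (rule Lim_null_comparison)
      show "\<forall>\<^sub>F y in at x within {0..1}. norm ((1 / norm (y - x)) *\<^sub>R (D y - (D x + 0))) \<le> 2 * L * \<bar>G y - G x\<bar>"
        unfolding eventually_at_filter
      proof (intro always_eventually allI impI)
        fix y assume y: "y \<noteq> x" "y \<in> {0..1}"
        have "cmod (D y - D x) \<le> \<bar>y - x\<bar> * (2 * L * \<bar>G y - G x\<bar>)"
        proof (cases "x \<le> y")
          case True
          have "cmod (D y - D x) \<le> (y - x) * (2 * L * (G y - G x))" using key[of x y] True x y by auto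
          also have "\<dots> \<le> \<bar>y - x\<bar> * (2 * L * \<bar>G y - G x\<bar>)" using True L0 by (auto intro!: mult_left_mono)
          finally show ?thesis .
        next
          case False
          have "cmod (D y - D x) \<le> (x - y) * (2 * L * (G x - G y))" using key[of y x] False x y by (auto simp: norm_minus_commute)
          also have "\<dots> \<le> \<bar>y - x\<bar> * (2 * L * \<bar>G y - G x\<bar>)" using False L0 by (auto intro!: mult_left_mono)
          finally show ?thesis .
        qed
        then show "norm ((1 / norm (y - x)) *\<^sub>R (D y - (D x + 0))) \<le> 2 * L * \<bar>G y - G x\<bar>"
          using y by (simp add: divide_simps mult_ac)
      qed
      have "(G \<longlongrightarrow> G x) (at x within {0..1})" using cG x by (simp add: continuous_on_def)
      then show "((\<lambda>y. 2 * L * \<bar>G y - G x\<bar>) \<longlongrightarrow> 0) (at x within {0..1})"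
        by (auto intro!: tendsto_eq_intros)
    qed
    then show "(D has_derivative (\<lambda>h. 0)) (at x within {0..1})"
      by (simp add: has_derivative_within)
  qed (use z in auto)
  then have "integral {0..z} (\<lambda>t. v t * w t + v' t * W t) = v z * W z - v 0 * W 0"
    by (simp add: D_def algebra_simps)
  with integrable_integral[OF integrable_Icc_subset[OF fi z]] show ?thesis by metis
qed

lemma W22D:
  assumes "W22 u u' u''"
  shows "edge_L2 u''" "x \<in> {0..1} \<Longrightarrow> u x = u 0 + integral {0..x} u'"
    "x \<in> {0..1} \<Longrightarrow> u' x = u' 0 + integral {0..x} u''"
  using assms unfolding W22_def by blast+

lemma W22_continuous:
  assumes "W22 u u' u''"
  shows "continuous_on {0..1} u'" "continuous_on {0..1} u"
proof -
  show c: "continuous_on {0..1} u'"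
    by (rule continuous_on_Icc_cong_integral[OF edge_L2_integrable[OF W22D(1)[OF assms]] W22D(3)[OF assms]])
  show "continuous_on {0..1} u"
    by (rule continuous_on_Icc_cong_integral[OF integrable_continuous_real[OF c] W22D(2)[OF assms]])
qed

lemma ivp_W22:
  assumes "edge_L2 v" "edge_L2 h" "ivp v h y y'"
  shows "W22 y y' (\<lambda>t. v t * y t + h t)"
proof -
  have "edge_L2 (\<lambda>t. y t * v t + h t)"
    by (intro edge_L2_add edge_L2_mult_continuous assms ivp_continuous[OF assms(3)])
  then have "edge_L2 (\<lambda>t. v t * y t + h t)" by (simp add: mult.commute)
  then show ?thesis unfolding W22_def using ivpD(2,3)[OF assms(3)] by blast
qed

lemma cnj_integral:
  assumes "f integrable_on A" shows "integral A (\<lambda>t. cnj (f t)) = cnj (integral A f)"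
  using integral_linear[OF assms bounded_linear_cnj] by (simp add: o_def)

lemma W22_cnj_primitive:
  assumes "W22 u u' u''" "x \<in> {0..1}"
  shows "cnj (u x) = cnj (u 0) + integral {0..x} (\<lambda>t. cnj (u' t))"
  using W22D(2)[OF assms] cnj_integral[OF integrable_Icc_subset[OF integrable_continuous_real[OF W22_continuous(1)[OF assms(1)]] assms(2)]]
  by (metis complex_cnj_add)

lemma W22_green:
  assumes "W22 u u' u''"
  shows "((\<lambda>t. cnj (u t) * u'' t + cnj (u' t) * u' t) has_integral cnj (u 1) * u' 1 - cnj (u 0) * u' 0) {0..1}"
  by (rule integral_by_parts_AC[OF continuous_on_cnj[OF W22_continuous(1)[OF assms]] W22_cnj_primitive[OF assms]
        edge_L2_absolutely_integrable[OF W22D(1)[OF assms]] W22D(3)[OF assms]]) auto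

lemma W22_green_Im:
  assumes "W22 u u' u''"
  shows "((\<lambda>t. Im (cnj (u t) * u'' t)) has_integral Im (cnj (u 1) * u' 1 - cnj (u 0) * u' 0)) {0..1}"
proof -
  have "Im (cnj (u t) * u'' t) = Im (cnj (u t) * u'' t + cnj (u' t) * u' t)" for t
    by (simp add: algebra_simps)
  then show ?thesis using has_integral_linear[OF W22_green[OF assms] bounded_linear_Im] by (simp add: o_def)
qed

text \<open>Integrating y w'' and w y'' by parts yields the same integrand v y w + y' w' twice, so
  the two boundary terms coincide.\<close>

lemma wronskian_const:
  assumes v: "edge_L2 v" and y: "ivp v (\<lambda>_. 0) y y'" and w: "ivp v (\<lambda>_. 0) w w'"
  shows "y 1 * w' 1 - y' 1 * w 1 = y 0 * w' 0 - y' 0 * w 0"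
proof -
  have vy: "(\<lambda>t. v t * y t + 0) absolutely_integrable_on {0..1}" "(\<lambda>t. v t * w t + 0) absolutely_integrable_on {0..1}"
    using edge_L2_mult_integrable[OF v edge_L2_continuous[OF ivp_continuous(2)[OF y]]]
      edge_L2_mult_integrable[OF v edge_L2_continuous[OF ivp_continuous(2)[OF w]]] by simp_all
  have 1: "((\<lambda>t. y t * (v t * w t + 0) + y' t * w' t) has_integral y 1 * w' 1 - y 0 * w' 0) {0..1}"
    by (rule integral_by_parts_AC[OF ivp_continuous(1)[OF y] ivpD(2)[OF y] vy(2) ivpD(3)[OF w]]) auto
  have 2: "((\<lambda>t. w t * (v t * y t + 0) + w' t * y' t) has_integral w 1 * y' 1 - w 0 * y' 0) {0..1}"
    by (rule integral_by_parts_AC[OF ivp_continuous(1)[OF w] ivpD(2)[OF w] vy(1) ivpD(3)[OF y]]) auto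
  have "(\<lambda>t. w t * (v t * y t + 0) + w' t * y' t) = (\<lambda>t. y t * (v t * w t + 0) + y' t * w' t)"
    by (auto simp: algebra_simps)
  with has_integral_unique[OF 1] 2 have "y 1 * w' 1 - y 0 * w' 0 = w 1 * y' 1 - w 0 * y' 0" by simp
  then show ?thesis by (simp add: algebra_simps)
qed

text \<open>The constant is the reciprocal of 1/16, which lies just below the smallest eigenvalue
  (about 0.0657) of the Gram matrix of 1 and t on the unit interval.\<close>

lemma affine_L2_lower_bound:
  "(cmod a)^2 + (cmod b)^2 \<le> 16 * integral {0..1} (\<lambda>t. (cmod (a + b * of_real t))^2)"
proof -
  have "((\<lambda>t. (cmod a)^2 + 2 * Re (a * cnj b) * t + (cmod b)^2 * t^2) has_integral
      ((cmod a)^2 * 1 + Re (a * cnj b) * 1^2 + (cmod b)^2 * 1^3 / 3) - ((cmod a)^2 * 0 + Re (a * cnj b) * 0^2 + (cmod b)^2 * 0^3 / 3)) {0..1}"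
    by (intro fundamental_theorem_of_calculus)
      (auto intro!: derivative_eq_intros simp: has_real_derivative_iff_has_vector_derivative[symmetric] power2_eq_square)
  moreover have "(cmod (a + b * of_real t))^2 = (cmod a)^2 + 2 * Re (a * cnj b) * t + (cmod b)^2 * t^2" for t
    unfolding cmod_power2 by (simp add: power2_eq_square algebra_simps)
  ultimately have I: "integral {0..1} (\<lambda>t. (cmod (a + b * of_real t))^2) = (cmod a)^2 + Re (a * cnj b) + (cmod b)^2 / 3"
    by (simp add: integral_unique)
  have "- Re (a * cnj b) \<le> cmod a * cmod b"
    using abs_Re_le_cmod[of "a * cnj b"] by (simp add: norm_mult)
  \<comment> \<open>Completing the square: divided by 15 this is 15 |a|^2 - 16 |a| |b| + (64/15)
    |b|^2, and 64/15 is below 13/3, the coefficient of |b|^2 that has to be matched.\<close>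
  moreover have "0 \<le> 225 * (cmod a)^2 - 240 * (cmod a * cmod b) + 64 * (cmod b)^2"
    using zero_le_power2[of "15 * cmod a - 8 * cmod b"] by (simp add: power2_eq_square algebra_simps)
  ultimately show ?thesis unfolding I using zero_le_power2[of "cmod b"] by argo
qed

text \<open>\<open>u\<close> differs from its first-order Taylor polynomial at 0 by at most the L1
  norm of \<open>u''\<close>, so the L2 norm of that polynomial, and with it its two coefficients,
  is controlled by \<open>u\<close> and \<open>u''\<close>. The coefficients account for 192 and the
  remainders for 4 of the 200.\<close>

lemma W22_sobolev:
  assumes u: "W22 u u' u''" and x: "x \<in> {0..1}"
  shows "(cmod (u x))^2 + (cmod (u' x))^2 \<le>
    200 * (integral {0..1} (\<lambda>t. (cmod (u t))^2) + integral {0..1} (\<lambda>t. (cmod (u'' t))^2))"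
proof -
  define M where "M = integral {0..1} (\<lambda>t. cmod (u'' t))"
  define U where "U = integral {0..1} (\<lambda>t. (cmod (u t))^2)"
  define V where "V = integral {0..1} (\<lambda>t. (cmod (u'' t))^2)"
  have M2: "M^2 \<le> V" unfolding M_def V_def by (rule L1_le_L2[OF W22D(1)[OF u]])
  have M0: "0 \<le> M" unfolding M_def
    using edge_L2_absolutely_integrable[OF W22D(1)[OF u]]
    by (intro integral_nonneg) (auto simp: absolutely_integrable_on_def)
  note c = W22_continuous[OF u]
  have d': "cmod (u' t - u' 0) \<le> M" if "t \<in> {0..1}" for t
    using W22D(3)[OF u that] norm_integral_le_L1[OF edge_L2_absolutely_integrable[OF W22D(1)[OF u]] that]
    by (simp add: M_def)
  have d: "cmod (u t - (u 0 + u' 0 * of_real t)) \<le> M" if t: "t \<in> {0..1}" for t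
  proof -
    have "integral {0..t} (\<lambda>s. u' s - u' 0) = integral {0..t} u' - u' 0 * of_real t"
      using integrable_Icc_subset[OF integrable_continuous_real[OF c(1)] t] t
      by (subst integral_diff) (auto simp: scaleR_conv_of_real mult.commute)
    then have "u t - (u 0 + u' 0 * of_real t) = integral {0..t} (\<lambda>s. u' s - u' 0)"
      using W22D(2)[OF u t] by simp
    also have "cmod \<dots> \<le> M * (t - 0)"
      using t d' by (intro integral_bound) (auto intro!: continuous_intros continuous_on_subset[OF c(1)])
    also have "\<dots> \<le> M * 1" using t M0 by (intro mult_left_mono) auto
    finally show ?thesis by simp
  qed
  define I where "I = integral {0..1} (\<lambda>t. (cmod (u 0 + u' 0 * of_real t))^2)"
  have "I \<le> integral {0..1} (\<lambda>t. 2 * (cmod (u t))^2 + 2 * M^2)"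
    unfolding I_def
  proof (rule integral_le)
    show "(\<lambda>t. (cmod (u 0 + u' 0 * of_real t))^2) integrable_on {0..1}"
      by (intro integrable_continuous_real continuous_intros)
    show "(\<lambda>t. 2 * (cmod (u t))^2 + 2 * M^2) integrable_on {0..1}"
      by (intro integrable_continuous_real continuous_intros c)
    fix t :: real assume t: "t \<in> {0..1}"
    have "(cmod (u 0 + u' 0 * of_real t))^2 = (cmod (u t + ((u 0 + u' 0 * of_real t) - u t)))^2" by simp
    also have "\<dots> \<le> 2 * (cmod (u t))^2 + 2 * (cmod ((u 0 + u' 0 * of_real t) - u t))^2" by (rule sq_norm_add_le)
    also have "\<dots> \<le> 2 * (cmod (u t))^2 + 2 * M^2"
      using d[OF t] by (auto simp: norm_minus_commute intro: power_mono)
    finally show "(cmod (u 0 + u' 0 * of_real t))^2 \<le> 2 * (cmod (u t))^2 + 2 * M^2" .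
  qed
  also have "\<dots> = 2 * U + 2 * M^2"
    unfolding U_def by (subst integral_add) (auto intro!: integrable_continuous_real continuous_intros c)
  finally have "I \<le> 2 * U + 2 * M^2" .
  moreover have "(cmod (u 0))^2 + (cmod (u' 0))^2 \<le> 16 * I"
    unfolding I_def by (rule affine_L2_lower_bound)
  ultimately have A: "(cmod (u 0))^2 + (cmod (u' 0))^2 \<le> 32 * (U + V)"
    using M2 by argo
  have "(cmod (u' x))^2 \<le> 2 * (cmod (u' 0))^2 + 2 * (cmod (u' x - u' 0))^2"
    using sq_norm_add_le[of "u' 0" "u' x - u' 0"] by simp
  moreover have "(cmod (u' x - u' 0))^2 \<le> V"
    using power_mono[OF d'[OF x], of 2] M2 by simp
  moreover have "(cmod (u x))^2 \<le> 2 * (cmod (u 0 + u' 0 * of_real x))^2 + 2 * (cmod (u x - (u 0 + u' 0 * of_real x)))^2"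
    using sq_norm_add_le[of "u 0 + u' 0 * of_real x" "u x - (u 0 + u' 0 * of_real x)"] by simp
  moreover have "(cmod (u x - (u 0 + u' 0 * of_real x)))^2 \<le> V"
    using power_mono[OF d[OF x], of 2] M2 by simp
  moreover have "(cmod (u 0 + u' 0 * of_real x))^2 \<le> 2 * (cmod (u 0))^2 + 2 * (cmod (u' 0 * of_real x))^2"
    by (rule sq_norm_add_le)
  moreover have "(cmod (u' 0 * of_real x))^2 \<le> (cmod (u' 0))^2"
    using x by (intro power_mono) (auto simp: norm_mult intro: mult_left_le)
  moreover have "0 \<le> U" unfolding U_def
    by (intro integral_nonneg integrable_continuous_real continuous_intros c) auto
  ultimately show ?thesis using A M2 zero_le_power2[of M] zero_le_power2[of "cmod (u 0)"]
    unfolding U_def[symmetric] V_def[symmetric] by argo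
qed

subsection \<open>Fundamental solutions\<close>

lemma ivp_cong:
  assumes "ivp v h y y'" "\<And>x. x \<in> {0..1} \<Longrightarrow> w x = y x" "\<And>x. x \<in> {0..1} \<Longrightarrow> w' x = y' x"
  shows "ivp v h w w'"
  unfolding ivp_def
proof (intro conjI ballI)
  show "(\<lambda>t. v t * w t + h t) integrable_on {0..1}"
    using ivpD(1)[OF assms(1)] by (rule integrable_eq) (simp add: assms(2))
  fix x :: real assume x: "x \<in> {0..1}"
  have "integral {0..x} w' = integral {0..x} y'"
    by (rule integral_cong) (use assms(3) x in auto)
  then show "w x = w 0 + integral {0..x} w'"
    using ivpD(2)[OF assms(1) x] assms(2)[OF x] assms(2)[of 0] by simp
  have "integral {0..x} (\<lambda>t. v t * w t + h t) = integral {0..x} (\<lambda>t. v t * y t + h t)"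
    by (rule integral_cong) (use assms(2) x in auto)
  then show "w' x = w' 0 + integral {0..x} (\<lambda>t. v t * w t + h t)"
    using ivpD(3)[OF assms(1) x] assms(3)[OF x] assms(3)[of 0] by simp
qed

lemma ivp_cnj:
  assumes "ivp v h y y'"
  shows "ivp (\<lambda>t. cnj (v t)) (\<lambda>t. cnj (h t)) (\<lambda>t. cnj (y t)) (\<lambda>t. cnj (y' t))"
  unfolding ivp_def
proof (intro conjI ballI)
  have eq: "(\<lambda>t. cnj (v t) * cnj (y t) + cnj (h t)) = (\<lambda>t. cnj (v t * y t + h t))" by auto
  show "(\<lambda>t. cnj (v t) * cnj (y t) + cnj (h t)) integrable_on {0..1}"
    unfolding eq using integrable_linear[OF ivpD(1)[OF assms] bounded_linear_cnj] by (simp add: o_def)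
  fix x :: real assume x: "x \<in> {0..1}"
  show "cnj (y x) = cnj (y 0) + integral {0..x} (\<lambda>t. cnj (y' t))"
    using ivpD(2)[OF assms x] cnj_integral[OF integrable_Icc_subset[OF integrable_continuous_real[OF ivp_continuous(1)[OF assms]] x]]
    by (metis complex_cnj_add)
  show "cnj (y' x) = cnj (y' 0) + integral {0..x} (\<lambda>t. cnj (v t) * cnj (y t) + cnj (h t))"
    unfolding eq using ivpD(3)[OF assms x] cnj_integral[OF integrable_Icc_subset[OF ivpD(1)[OF assms] x]]
    by (metis complex_cnj_add)
qed

text \<open>The operator equation holds only almost everywhere, but integrals ignore null sets; this
  turns an identity between L2 classes into integral equations valid at every point.\<close>

lemma W22_ivp_AE:
  assumes "W22 u u' u''" and "AE t in lborel. t \<in> {0..1} \<longrightarrow> u'' t = v t * u t + h t"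
  shows "ivp v h u u'"
proof -
  obtain N where N: "N \<in> null_sets lborel" "{t. \<not> (t \<in> {0..1} \<longrightarrow> u'' t = v t * u t + h t)} \<subseteq> N"
    using assms(2) unfolding eventually_ae_filter by auto
  have neg: "negligible N" using N(1) by (simp add: negligible_iff_null_sets null_sets_completionI)
  have eq: "v t * u t + h t = u'' t" if "t \<in> {0..1} - N" for t using N(2) that by auto
  show ?thesis unfolding ivp_def
  proof (intro conjI ballI)
    show "(\<lambda>t. v t * u t + h t) integrable_on {0..1}"
      by (rule integrable_spike[OF edge_L2_integrable[OF W22D(1)[OF assms(1)]] neg eq])
    fix x :: real assume x: "x \<in> {0..1}"
    show "u x = u 0 + integral {0..x} u'" by (rule W22D(2)[OF assms(1) x])
    have "integral {0..x} (\<lambda>t. v t * u t + h t) = integral {0..x} u''"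
      by (rule integral_spike[OF neg, symmetric]) (use x eq in auto)
    then show "u' x = u' 0 + integral {0..x} (\<lambda>t. v t * u t + h t)" using W22D(3)[OF assms(1) x] by simp
  qed
qed

lemma norm_add_leD:
  assumes "cmod x + cmod y \<le> c" shows "cmod x \<le> c" "cmod y \<le> c"
  using assms norm_ge_zero[of x] norm_ge_zero[of y] by linarith+

lemma has_field_derivative_quadratic_error:
  fixes f :: "complex \<Rightarrow> complex"
  assumes "0 < r" "\<And>z. cmod (z - w) < r \<Longrightarrow> cmod (f z - f w - (z - w) * D) \<le> C * (cmod (z - w))^2"
  shows "(f has_field_derivative D) (at w)"
proof -
  have "((\<lambda>z. (f z - f w) / (z - w) - D) \<longlongrightarrow> 0) (at w)"
  proof (rule Lim_null_comparison)
    show "\<forall>\<^sub>F z in at w. norm ((f z - f w) / (z - w) - D) \<le> C * cmod (z - w)"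
      unfolding eventually_at
    proof (intro exI conjI ballI impI)
      show "0 < r" by fact
      fix z assume z: "z \<noteq> w \<and> dist z w < r"
      then have "(f z - f w) / (z - w) - D = (f z - f w - (z - w) * D) / (z - w)"
        by (simp add: diff_divide_distrib)
      also have "norm \<dots> \<le> C * (cmod (z - w))^2 / cmod (z - w)"
        using assms(2)[of z] z by (simp add: norm_divide divide_right_mono dist_norm)
      also have "\<dots> = C * cmod (z - w)" using z by (simp add: power2_eq_square)
      finally show "norm ((f z - f w) / (z - w) - D) \<le> C * cmod (z - w)" .
    qed
    show "((\<lambda>z. C * cmod (z - w)) \<longlongrightarrow> 0) (at w)" by (auto intro!: tendsto_eq_intros)
  qed
  then have "((\<lambda>z. (f z - f w) / (z - w)) \<longlongrightarrow> D) (at w)" by (rule LIM_zero_cancel)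
  then show ?thesis by (simp add: has_field_derivative_iff)
qed

section \<open>Dependence of the fundamental solutions on the spectral parameter\<close>

locale potential =
  fixes q :: "real \<Rightarrow> real"
  assumes q_meas: "q \<in> borel_measurable (lebesgue_on {0..1})"
    and q_L2: "(\<lambda>t. (q t)^2) integrable_on {0..1}"
begin

definition pot :: "complex \<Rightarrow> real \<Rightarrow> complex" where "pot z t = of_real (q t) - z"

lemma q_edge_L2: "edge_L2 (\<lambda>t. of_real (q t))"
  unfolding edge_L2_def using q_L2
  by (auto intro!: borel_measurable_continuous_on[OF continuous_on_of_real[OF continuous_on_id]] q_meas)

lemma pot_L2: "edge_L2 (pot z)"
  unfolding pot_def by (intro edge_L2_diff q_edge_L2 edge_L2_const)

lemma sol_iff: "sol q z y y' \<longleftrightarrow> ivp (pot z) (\<lambda>_. 0) y y'"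
  unfolding sol_ivp pot_def ..

text \<open>Existence and uniqueness on {0..1} together with the prescribed zero extension single
  out one pair of functions on the whole line, so the definite description in \<open>fund\<close>
  denotes it.\<close>

lemma fund_ex1:
  "\<exists>!p. sol q z (fst p) (snd p) \<and> fst p 0 = a \<and> snd p 0 = b \<and> (\<forall>x. x \<notin> {0..1} \<longrightarrow> fst p x = 0 \<and> snd p x = 0)"
proof -
  obtain y y' where y: "ivp (pot z) (\<lambda>_. 0) y y'" "y 0 = a" "y' 0 = b"
    by (rule ivp_exists[OF pot_L2[of z] absolutely_integrable_zero])
  let ?p = "(\<lambda>x. if x \<in> {0..1} then y x else 0, \<lambda>x. if x \<in> {0..1} then y' x else 0)"
  show ?thesis
  proof (rule ex1I[of _ ?p])
    have "ivp (pot z) (\<lambda>_. 0) (fst ?p) (snd ?p)" by (rule ivp_cong[OF y(1)]) auto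
    with y show "sol q z (fst ?p) (snd ?p) \<and> fst ?p 0 = a \<and> snd ?p 0 = b \<and>
        (\<forall>x. x \<notin> {0..1} \<longrightarrow> fst ?p x = 0 \<and> snd ?p x = 0)"
      by (auto simp: sol_iff)
    fix p assume p: "sol q z (fst p) (snd p) \<and> fst p 0 = a \<and> snd p 0 = b \<and> (\<forall>x. x \<notin> {0..1} \<longrightarrow> fst p x = 0 \<and> snd p x = 0)"
    then have s: "ivp (pot z) (\<lambda>_. 0) (fst p) (snd p)" by (simp add: sol_iff)
    have "fst p x = fst ?p x \<and> snd p x = snd ?p x" for x
      using ivp_unique[OF pot_L2 s y(1), of x] p y(2,3) by auto
    then show "p = ?p" by (auto simp: prod_eq_iff)
  qed
qed

lemma fund_ivp: "ivp (pot z) (\<lambda>_. 0) (fst (fund q z a b)) (snd (fund q z a b))"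
  and fund_0: "fst (fund q z a b) 0 = a" "snd (fund q z a b) 0 = b"
  using theI'[OF fund_ex1[of z a b]] unfolding fund_def[symmetric] by (auto simp: sol_iff)

abbreviation th :: "complex \<Rightarrow> real \<Rightarrow> complex" where "th z \<equiv> fst (fund q z 1 0)"
abbreviation th' :: "complex \<Rightarrow> real \<Rightarrow> complex" where "th' z \<equiv> snd (fund q z 1 0)"
abbreviation ph :: "complex \<Rightarrow> real \<Rightarrow> complex" where "ph z \<equiv> fst (fund q z 0 1)"
abbreviation ph' :: "complex \<Rightarrow> real \<Rightarrow> complex" where "ph' z \<equiv> snd (fund q z 0 1)"

lemma ivp_lincomb_fund: "ivp (pot z) (\<lambda>_. 0) (\<lambda>t. a * th z t + b * ph z t) (\<lambda>t. a * th' z t + b * ph' z t)"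
  using ivp_lincomb[OF fund_ivp[of z 1 0] fund_ivp[of z 0 1], of a b] by simp

lemma ivp_eq_fund:
  assumes "ivp (pot z) (\<lambda>_. 0) y y'" "x \<in> {0..1}"
  shows "y x = y 0 * th z x + y' 0 * ph z x" "y' x = y 0 * th' z x + y' 0 * ph' z x"
  using ivp_unique[OF pot_L2 assms(1) ivp_lincomb_fund[of z "y 0" "y' 0"] _ _ assms(2)] by (auto simp: fund_0)

lemma wronskian: "theta1 q z * phi1' q z - theta1' q z * phi1 q z = 1"
  using wronskian_const[OF pot_L2 fund_ivp[of z 1 0] fund_ivp[of z 0 1]]
  by (simp add: fund_0 theta1_def phi1_def theta1'_def phi1'_def)

lemma ivp_endpoint:
  assumes "ivp (pot z) (\<lambda>_. 0) y y'"
  shows "y 1 = y 0 * theta1 q z + y' 0 * phi1 q z" "y' 1 = y 0 * theta1' q z + y' 0 * phi1' q z"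
  using ivp_eq_fund[OF assms, of 1] by (auto simp: theta1_def phi1_def theta1'_def phi1'_def)

text \<open>\<open>ivp_const\<close> with |q - z| replaced by its majorant |q| + R, which makes the
  bound uniform for \<open>z\<close> in the disc of radius \<open>R\<close>. The embedding into the
  complex numbers gives the weight the shape of \<open>integrable_weight\<close>.\<close>

definition ivp_const_ball :: "real \<Rightarrow> real" where
  "ivp_const_ball R = 2 * exp (2 * integral {0..1} (\<lambda>t. (1 + cmod (complex_of_real (\<bar>q t\<bar> + R)))^2))"

lemma ivp_const_le:
  assumes "cmod z \<le> R" shows "ivp_const (pot z) \<le> ivp_const_ball R"
proof -
  have R: "0 \<le> R" using assms norm_ge_zero[of z] by linarith
  have "edge_L2 (\<lambda>t. complex_of_real \<bar>q t\<bar> + of_real R)"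
    using q_edge_L2 unfolding edge_L2_def
    by (intro edge_L2_add[unfolded edge_L2_def] edge_L2_const[unfolded edge_L2_def] conjI)
      (auto intro!: borel_measurable_continuous_on[OF continuous_on_of_real[OF continuous_on_id]] borel_measurable_abs q_meas)
  then have 1: "(\<lambda>t. (1 + cmod (complex_of_real (\<bar>q t\<bar> + R)))^2) integrable_on {0..1}"
    using integrable_weight by simp
  have "(1 + cmod (pot z t))^2 \<le> (1 + cmod (complex_of_real (\<bar>q t\<bar> + R)))^2" for t
  proof (intro power_mono add_left_mono)
    have "cmod (pot z t) \<le> cmod (of_real (q t)) + cmod z" unfolding pot_def by (rule norm_triangle_ineq4)
    also have "\<dots> \<le> cmod (complex_of_real (\<bar>q t\<bar> + R))" unfolding norm_of_real using assms R by simp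
    finally show "cmod (pot z t) \<le> cmod (complex_of_real (\<bar>q t\<bar> + R))" .
  qed auto
  then show ?thesis unfolding ivp_const_def ivp_const_ball_def
    using integral_le[OF integrable_weight[OF pot_L2] 1] by simp
qed

lemma ivp_const_ball_pos: "0 < ivp_const_ball R"
  by (simp add: ivp_const_ball_def)

lemma ivp_bound_sup:
  assumes "ivp (pot z) h y y'" "y 0 = 0" "y' 0 = 0" "cmod z \<le> R" "h absolutely_integrable_on {0..1}"
    "\<And>t. t \<in> {0..1} \<Longrightarrow> cmod (h t) \<le> B" "x \<in> {0..1}"
  shows "cmod (y x) + cmod (y' x) \<le> ivp_const_ball R * B"
proof -
  have i: "(\<lambda>t. cmod (h t)) integrable_on {0..1}" using assms(5) by (simp add: absolutely_integrable_on_def)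
  have "integral {0..1} (\<lambda>t. cmod (h t)) \<le> integral {0..1} (\<lambda>t::real. B)"
    by (rule integral_le[OF i]) (use assms(6) in auto)
  then have hB: "integral {0..1} (\<lambda>t. cmod (h t)) \<le> B" by simp
  have h0: "0 \<le> integral {0..1} (\<lambda>t. cmod (h t))" by (rule integral_nonneg[OF i]) auto
  have "cmod (y x) + cmod (y' x) \<le> ivp_const (pot z) * integral {0..1} (\<lambda>t. cmod (h t))"
    using ivp_bound[OF pot_L2 assms(5) assms(1) assms(7)] assms(2,3) by simp
  also have "\<dots> \<le> ivp_const_ball R * B"
    using ivp_const_le[OF assms(4)] hB h0 ivp_const_ball_pos[of R] by (intro mult_mono) auto
  finally show ?thesis .
qed

lemma fund_bound:
  assumes "cmod z \<le> R" "x \<in> {0..1}"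
  shows "cmod (fst (fund q z a b) x) + cmod (snd (fund q z a b) x) \<le> ivp_const_ball R * (cmod a + cmod b)"
proof -
  have "cmod (fst (fund q z a b) x) + cmod (snd (fund q z a b) x) \<le> ivp_const (pot z) * (cmod a + cmod b)"
    using ivp_bound[OF pot_L2 _ fund_ivp assms(2), of z a b] by (simp add: fund_0)
  also have "\<dots> \<le> ivp_const_ball R * (cmod a + cmod b)"
    using ivp_const_le[OF assms(1)] by (intro mult_right_mono) auto
  finally show ?thesis .
qed

lemma fund_shift: "ivp (pot w) (\<lambda>t. - (z - w) * fst (fund q z a b) t) (fst (fund q z a b)) (snd (fund q z a b))"
  by (rule ivp_cong_h[OF fund_ivp, where u="\<lambda>_. z - w"]) (auto simp: pot_def algebra_simps)

lemma fund_diff: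
  "ivp (pot w) (\<lambda>t. - (z - w) * fst (fund q z a b) t)
    (\<lambda>t. fst (fund q z a b) t - fst (fund q w a b) t) (\<lambda>t. snd (fund q z a b) t - snd (fund q w a b) t)"
  using ivp_lincomb[OF fund_shift[of w z a b] fund_ivp[of w a b], of 1 "-1"] by simp

lemma fund_continuous:
  "continuous_on {0..1} (fst (fund q z a b))" "continuous_on {0..1} (snd (fund q z a b))"
  using ivp_continuous[OF fund_ivp] by auto

text \<open>The difference of two solutions has zero initial data and, by \<open>fund_diff\<close>,
  a source proportional to z - w. One factor \<open>ivp_const_ball R\<close> bounds the solution
  inside the source, the other the response to it.\<close>

lemma fund_lipschitz:
  assumes "cmod z \<le> R" "cmod w \<le> R" "x \<in> {0..1}"
  shows "cmod (fst (fund q z a b) x - fst (fund q w a b) x) + cmod (snd (fund q z a b) x - snd (fund q w a b) x)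
    \<le> (ivp_const_ball R)^2 * (cmod a + cmod b) * cmod (z - w)"
proof -
  have "cmod (fst (fund q z a b) x - fst (fund q w a b) x) + cmod (snd (fund q z a b) x - snd (fund q w a b) x)
    \<le> ivp_const_ball R * (cmod (z - w) * (ivp_const_ball R * (cmod a + cmod b)))"
  proof (rule ivp_bound_sup[OF fund_diff _ _ assms(2) _ _ assms(3)])
    show "(\<lambda>t. - (z - w) * fst (fund q z a b) t) absolutely_integrable_on {0..1}"
      by (intro absolutely_integrable_continuous_real continuous_intros fund_continuous)
    fix t :: real assume "t \<in> {0..1}"
    from fund_bound[OF assms(1) this, of a b] have "cmod (fst (fund q z a b) t) \<le> ivp_const_ball R * (cmod a + cmod b)"
      using norm_ge_zero[of "snd (fund q z a b) t"] by linarith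
    then show "cmod (- (z - w) * fst (fund q z a b) t) \<le> cmod (z - w) * (ivp_const_ball R * (cmod a + cmod b))"
      unfolding norm_mult norm_minus_cancel by (intro mult_left_mono) auto
  qed (auto simp: fund_0)
  then show ?thesis by (simp add: power2_eq_square mult_ac)
qed

text \<open>The derivative is the solution \<open>e\<close> of the formally differentiated equation,
  with source \<open>- ?Y w\<close> and zero initial data. The error of the linear approximation
  again has zero data and source of size |z - w| times a Lipschitz difference, hence is quadratic in
  z - w.\<close>

lemma fund_field_differentiable:
  assumes x: "x \<in> {0..1}"
  shows "(\<lambda>z. fst (fund q z a b) x) field_differentiable (at w)"
    "(\<lambda>z. snd (fund q z a b) x) field_differentiable (at w)"
proof -
  let ?Y = "\<lambda>z. fst (fund q z a b)" and ?Y' = "\<lambda>z. snd (fund q z a b)"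
  let ?k = "ivp_const_ball (cmod w + 1)"
  have "(\<lambda>t. - ?Y w t) absolutely_integrable_on {0..1}"
    by (intro absolutely_integrable_continuous_real continuous_intros fund_continuous)
  then obtain e e' where e: "ivp (pot w) (\<lambda>t. - ?Y w t) e e'" "e 0 = 0" "e' 0 = 0"
    by (rule ivp_exists[OF pot_L2[of w]])
  define C where "C = ?k * (?k^2 * (cmod a + cmod b))"
  have key: "cmod (?Y z x - ?Y w x - (z - w) * e x) + cmod (?Y' z x - ?Y' w x - (z - w) * e' x) \<le> C * (cmod (z - w))^2"
    if z: "cmod (z - w) < 1" for z
  proof -
    have zR: "cmod z \<le> cmod w + 1" using z norm_triangle_ineq2[of z w] by linarith
    have "ivp (pot w) (\<lambda>t. 1 * (- (z - w) * ?Y z t) + (- (z - w)) * (- ?Y w t))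
        (\<lambda>t. 1 * (?Y z t - ?Y w t) + (- (z - w)) * e t) (\<lambda>t. 1 * (?Y' z t - ?Y' w t) + (- (z - w)) * e' t)"
      by (rule ivp_lincomb[OF fund_diff e(1)])
    then have "cmod (1 * (?Y z x - ?Y w x) + (- (z - w)) * e x) + cmod (1 * (?Y' z x - ?Y' w x) + (- (z - w)) * e' x)
        \<le> ?k * (cmod (z - w) * (?k^2 * (cmod a + cmod b) * cmod (z - w)))"
    proof (rule ivp_bound_sup)
      show "(\<lambda>t. 1 * (- (z - w) * ?Y z t) + (- (z - w)) * (- ?Y w t)) absolutely_integrable_on {0..1}"
        by (intro absolutely_integrable_continuous_real continuous_intros fund_continuous)
      fix t :: real assume t: "t \<in> {0..1}"
      have "1 * (- (z - w) * ?Y z t) + (- (z - w)) * (- ?Y w t) = - (z - w) * (?Y z t - ?Y w t)"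
        by (simp add: algebra_simps)
      also have "cmod \<dots> = cmod (z - w) * cmod (?Y z t - ?Y w t)"
        by (simp only: norm_mult norm_minus_cancel)
      also have "\<dots> \<le> cmod (z - w) * (?k^2 * (cmod a + cmod b) * cmod (z - w))"
        using norm_add_leD[OF fund_lipschitz[OF zR _ t, of w a b]] by (intro mult_left_mono) auto
      finally show "cmod (1 * (- (z - w) * ?Y z t) + (- (z - w)) * (- ?Y w t)) \<le> \<dots>" .
    qed (use e x in \<open>auto simp: fund_0\<close>)
    moreover have "1 * A + (- (z - w)) * B = A - (z - w) * B" for A B :: complex
      by (simp add: algebra_simps)
    moreover have "?k * (cmod (z - w) * (?k^2 * (cmod a + cmod b) * cmod (z - w))) = C * (cmod (z - w))^2"
      by (simp add: C_def power2_eq_square)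
    ultimately show ?thesis by (simp only:)
  qed
  have "((\<lambda>z. ?Y z x) has_field_derivative e x) (at w)"
    by (rule has_field_derivative_quadratic_error[of 1 _ _ _ C])
      (use norm_add_leD[OF key] in auto)
  moreover have "((\<lambda>z. ?Y' z x) has_field_derivative e' x) (at w)"
    by (rule has_field_derivative_quadratic_error[of 1 _ _ _ C])
      (use norm_add_leD[OF key] in auto)
  ultimately show "(\<lambda>z. ?Y z x) field_differentiable (at w)" "(\<lambda>z. ?Y' z x) field_differentiable (at w)"
    by (auto simp: field_differentiable_def)
qed

text \<open>Continuity in t for fixed parameter, plus a Lipschitz bound in the parameter uniform in
  t and locally uniform in the parameter, gives joint continuity.\<close>

lemma fund_continuous_joint:
  "continuous_on ({0..1} \<times> UNIV) (\<lambda>(t, z). fst (fund q z a b) t)"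
  "continuous_on ({0..1} \<times> UNIV) (\<lambda>(t, z). snd (fund q z a b) t)"
proof -
  have *: "continuous_on ({0..1} \<times> UNIV) (\<lambda>(t, z). F z t)"
    if c: "\<And>z. continuous_on {0..1} (F z)"
      and L: "\<And>R z w t. cmod z \<le> R \<Longrightarrow> cmod w \<le> R \<Longrightarrow> t \<in> {0..1} \<Longrightarrow> cmod (F z t - F w t) \<le> K R * cmod (z - w)"
    for F :: "complex \<Rightarrow> real \<Rightarrow> complex" and K
    unfolding continuous_on_def
  proof safe
    fix s :: real and w :: complex assume s: "s \<in> {0..1}"
    let ?A = "at (s, w) within {0..1} \<times> UNIV"
    have ev: "\<forall>\<^sub>F p in ?A. fst p \<in> {0..1} \<and> cmod (snd p - w) < 1"
    proof -
      have "((\<lambda>p. cmod (snd p - w)) \<longlongrightarrow> cmod (snd (s, w) - w)) ?A" by (intro tendsto_intros)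
      then have "\<forall>\<^sub>F p in ?A. cmod (snd p - w) < 1" by (rule order_tendstoD) simp
      moreover have "\<forall>\<^sub>F p in ?A. p \<in> {0..1} \<times> UNIV" by (simp add: eventually_at_filter)
      ultimately show ?thesis by eventually_elim auto
    qed
    have "((\<lambda>p. F (snd p) (fst p) - F w (fst p)) \<longlongrightarrow> 0) ?A"
    proof (rule Lim_null_comparison)
      show "\<forall>\<^sub>F p in ?A. norm (F (snd p) (fst p) - F w (fst p)) \<le> K (cmod w + 1) * cmod (snd p - w)"
        using ev
      proof eventually_elim
        case (elim p)
        then show ?case using norm_triangle_ineq2[of "snd p" w] by (intro L) auto
      qed
      have "((\<lambda>p. K (cmod w + 1) * cmod (snd p - w)) \<longlongrightarrow> K (cmod w + 1) * cmod (snd (s, w) - w)) ?A"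
        by (intro tendsto_intros)
      then show "((\<lambda>p. K (cmod w + 1) * cmod (snd p - w)) \<longlongrightarrow> 0) ?A" by simp
    qed
    moreover have "((\<lambda>p. F w (fst p)) \<longlongrightarrow> F w (fst (s, w))) ?A"
      using continuous_on_compose2[OF c[of w] continuous_on_fst[OF continuous_on_id], of "{0..1} \<times> UNIV"] s
      unfolding continuous_on_def by auto
    ultimately have "((\<lambda>p. (F (snd p) (fst p) - F w (fst p)) + F w (fst p)) \<longlongrightarrow> 0 + F w (fst (s, w))) ?A"
      by (rule tendsto_add)
    then show "((\<lambda>(t, z). F z t) \<longlongrightarrow> F w s) ?A" by (simp add: case_prod_beta')
  qed
  show "continuous_on ({0..1} \<times> UNIV) (\<lambda>(t, z). fst (fund q z a b) t)"
    by (rule *[OF fund_continuous(1), where K="\<lambda>R. (ivp_const_ball R)^2 * (cmod a + cmod b)"])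
      (use norm_add_leD[OF fund_lipschitz] in auto)
  show "continuous_on ({0..1} \<times> UNIV) (\<lambda>(t, z). snd (fund q z a b) t)"
    by (rule *[OF fund_continuous(2), where K="\<lambda>R. (ivp_const_ball R)^2 * (cmod a + cmod b)"])
      (use norm_add_leD[OF fund_lipschitz] in auto)
qed

lemma holomorphic_endpoints:
  "theta1 q holomorphic_on A" "phi1 q holomorphic_on A" "theta1' q holomorphic_on A" "phi1' q holomorphic_on A"
  unfolding holomorphic_on_def theta1_def phi1_def theta1'_def phi1'_def
  using fund_field_differentiable[of 1] by (auto intro: field_differentiable_at_within)

lemma holomorphic_Delta0: "Delta0 q holomorphic_on A"
  unfolding Delta0_def DeltaL_def
  by (intro holomorphic_intros holomorphic_endpoints) auto

lemma fund_cnj: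
  assumes "x \<in> {0..1}"
  shows "fst (fund q (cnj z) (cnj a) (cnj b)) x = cnj (fst (fund q z a b) x)"
    "snd (fund q (cnj z) (cnj a) (cnj b)) x = cnj (snd (fund q z a b) x)"
proof -
  have "ivp (pot (cnj z)) (\<lambda>_. 0) (\<lambda>t. cnj (fst (fund q z a b) t)) (\<lambda>t. cnj (snd (fund q z a b) t))"
    using ivp_cnj[OF fund_ivp[of z a b]] unfolding pot_def[abs_def] by simp
  from ivp_unique[OF pot_L2 fund_ivp this _ _ assms]
  show "fst (fund q (cnj z) (cnj a) (cnj b)) x = cnj (fst (fund q z a b) x)"
    "snd (fund q (cnj z) (cnj a) (cnj b)) x = cnj (snd (fund q z a b) x)"
    by (auto simp: fund_0)
qed

lemma endpoints_cnj:
  "theta1 q (cnj z) = cnj (theta1 q z)" "phi1 q (cnj z) = cnj (phi1 q z)"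
  "theta1' q (cnj z) = cnj (theta1' q z)" "phi1' q (cnj z) = cnj (phi1' q z)"
  using fund_cnj[of 1 z 1 0] fund_cnj[of 1 z 0 1]
  by (auto simp: theta1_def phi1_def theta1'_def phi1'_def)

lemma endpoints_Reals:
  assumes "z \<in> \<real>"
  shows "theta1 q z \<in> \<real>" "phi1 q z \<in> \<real>" "theta1' q z \<in> \<real>" "phi1' q z \<in> \<real>"
  using endpoints_cnj[of z] assms by (auto simp: Reals_cnj_iff)

lemma Delta0_Reals: "z \<in> \<real> \<Longrightarrow> Delta0 q z \<in> \<real>"
  unfolding Delta0_def DeltaL_def by (intro Reals_diff Reals_add Reals_mult Reals_divide Reals_power endpoints_Reals) auto

text \<open>The real potential drops out of the imaginary part, so only the source and Im z remain;
  the right-hand side is the net current through the two ends of the edge.\<close>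

lemma ivp_green_Im:
  assumes y: "ivp (pot z) h y y'" and h: "edge_L2 h"
  shows "((\<lambda>t. Im (cnj (y t) * h t) - Im z * (cmod (y t))^2) has_integral Im (cnj (y 1) * y' 1 - cnj (y 0) * y' 0)) {0..1}"
proof -
  have "Im (cnj (y t) * (pot z t * y t + h t)) = Im (cnj (y t) * h t) - Im z * (cmod (y t))^2" for t
    unfolding pot_def cmod_power2 by (simp add: power2_eq_square algebra_simps)
  with W22_green_Im[OF ivp_W22[OF pot_L2 h y]] show ?thesis by simp
qed

end

subsection \<open>The vertex system\<close>

lemma L2_zero_imp_zero:
  fixes u :: "real \<Rightarrow> complex"
  assumes "continuous_on {0..1} u" "integral {0..1} (\<lambda>t. (cmod (u t))^2) = 0" "x \<in> {0..1}"
  shows "u x = 0"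
proof -
  have "continuous_on (cbox 0 1) (\<lambda>t. (cmod (u t))^2)" using assms(1) unfolding box_real by (intro continuous_intros)
  moreover have "((\<lambda>t. (cmod (u t))^2) has_integral 0) (cbox 0 1)"
    using assms(2) integrable_integral[OF edge_L2_integrable_sq[OF edge_L2_continuous[OF assms(1)]]]
    unfolding box_real by simp
  ultimately have "(cmod (u x))^2 = 0"
    by (intro has_integral_0_cbox_imp_0[of 0 1 "\<lambda>t. (cmod (u t))^2"]) (use assms(3) in auto)
  then show ?thesis by simp
qed

section \<open>Decaying solutions of two-term and three-term recurrences\<close>

lemma quadratic_inverse_pair: "\<exists>w::complex. w \<noteq> 0 \<and> w + 1 / w = 2 * F"
proof -
  define w where "w = F + csqrt (F^2 - 1)"
  have "w * (2 * F - w) = F^2 - (csqrt (F^2 - 1))^2" by (simp add: w_def power2_eq_square algebra_simps)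
  then have "w * (2 * F - w) = 1" by simp
  then have "w \<noteq> 0" "1 / w = 2 * F - w" by (auto simp: divide_eq_eq mult.commute)
  then show ?thesis by (metis add.commute diff_add_cancel)
qed

text \<open>A geometric sequence fails to decay in one of the two directions: backwards when
  |\<tau>| \<le> 1, forwards otherwise.\<close>

lemma geometric_vanishes:
  fixes u :: "int \<Rightarrow> complex"
  assumes "\<tau> \<noteq> 0" "\<And>n. u (n + 1) = \<tau> * u n" "(\<lambda>n. u (int n)) \<longlonglongrightarrow> 0" "(\<lambda>n. u (- int n)) \<longlonglongrightarrow> 0"
  shows "u n = 0"
proof -
  have pos: "u (a + int n) = \<tau>^n * u a" for a n
  proof (induction n)
    case (Suc n)
    have "u (a + int (Suc n)) = \<tau> * u (a + int n)" using assms(2)[of "a + int n"] by (simp add: ac_simps)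
    then show ?case using Suc by simp
  qed simp
  have "u 0 = 0"
  proof (rule ccontr)
    assume u0: "u 0 \<noteq> 0"
    show False
    proof (cases "cmod \<tau> \<le> 1")
      case True
      have "cmod (u 0) \<le> cmod (u (- int n))" for n
      proof -
        have "cmod (u 0) = cmod \<tau> ^ n * cmod (u (- int n))"
          using pos[of "- int n" n] by (simp add: norm_mult norm_power)
        also have "\<dots> \<le> 1 * cmod (u (- int n))" using True by (intro mult_right_mono power_le_one) auto
        finally show ?thesis by simp
      qed
      then have "cmod (u 0) \<le> 0"
        using tendsto_norm[OF assms(4)] by (intro LIMSEQ_le_const[where X="\<lambda>n. cmod (u (- int n))"]) auto
      then show False using u0 by simp
    next
      case False
      have "cmod (u 0) \<le> cmod (u (int n))" for n
      proof -
        have "1 * cmod (u 0) \<le> cmod \<tau> ^ n * cmod (u 0)" using False by (intro mult_right_mono one_le_power) auto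
        then show ?thesis using pos[of 0 n] by (simp add: norm_mult norm_power)
      qed
      then have "cmod (u 0) \<le> 0"
        using tendsto_norm[OF assms(3)] by (intro LIMSEQ_le_const[where X="\<lambda>n. cmod (u (int n))"]) auto
      then show False using u0 by simp
    qed
  qed
  show ?thesis
  proof (cases "0 \<le> n")
    case True then show ?thesis using pos[of 0 "nat n"] \<open>u 0 = 0\<close> by simp
  next
    case False then show ?thesis using pos[of n "nat (- n)"] \<open>u 0 = 0\<close> assms(1) by simp
  qed
qed

text \<open>The recurrence factors: v(n+1) - w v(n) is geometric with ratio 1 / w, hence zero by
  decay at both ends, and then \<open>v\<close> itself is geometric with ratio w. This covers every
  complex value of \<open>F\<close>.\<close>

lemma int_recurrence_vanishes:
  fixes v :: "int \<Rightarrow> complex"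
  assumes rec: "\<And>n. v (n + 1) + v (n - 1) = 2 * F * v n"
    and lim: "(\<lambda>n. v (int n)) \<longlonglongrightarrow> 0" "(\<lambda>n. v (- int n)) \<longlonglongrightarrow> 0"
  shows "v n = 0"
proof -
  obtain w where w: "w \<noteq> 0" "w + 1 / w = 2 * F" using quadratic_inverse_pair by blast
  have "v (n + 1) - w * v n = 0" for n
  proof (rule geometric_vanishes[of "1 / w" "\<lambda>n. v (n + 1) - w * v n"])
    show "v (n + 1 + 1) - w * v (n + 1) = 1 / w * (v (n + 1) - w * v n)" for n
      using rec[of "n + 1"] w(1) unfolding w(2)[symmetric] by (simp add: field_simps)
    have "(\<lambda>n. v (int (Suc n)) - w * v (int n)) \<longlonglongrightarrow> 0 - w * 0"
      by (intro tendsto_intros LIMSEQ_Suc[OF lim(1)] lim)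
    then show "(\<lambda>n. v (int n + 1) - w * v (int n)) \<longlonglongrightarrow> 0" by (simp add: add.commute)
    have "(\<lambda>n. v (- int n) - w * v (- int (Suc n))) \<longlonglongrightarrow> 0 - w * 0"
      by (intro tendsto_intros LIMSEQ_Suc[OF lim(2)] lim)
    then have "(\<lambda>n. v (- int (Suc n) + 1) - w * v (- int (Suc n))) \<longlonglongrightarrow> 0" by simp
    then show "(\<lambda>n. v (- int n + 1) - w * v (- int n)) \<longlonglongrightarrow> 0" by (rule LIMSEQ_imp_Suc)
  qed (use w in auto)
  then have "v (n + 1) = w * v n" for n by (simp only: right_minus_eq)
  then show ?thesis by (rule geometric_vanishes[OF w(1) _ lim])
qed

text \<open>With a unimodular root both first-order factors preserve the modulus, so decay in a
  single direction already forces zero.\<close>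

lemma nat_recurrence_vanishes:
  fixes v :: "nat \<Rightarrow> complex"
  assumes rec: "\<And>n. v (Suc (Suc n)) + v n = 2 * F * v (Suc n)" and lim: "v \<longlonglongrightarrow> 0"
    and w: "cmod w = 1" "w + 1 / w = 2 * F"
  shows "v n = 0"
proof -
  have w0: "w \<noteq> 0" using w by auto
  have const: "u n = 0" if "\<And>n. cmod (u (Suc n)) = cmod (u n)" "u \<longlonglongrightarrow> 0" for u :: "nat \<Rightarrow> complex" and n
  proof -
    have c: "cmod (u n) = cmod (u 0)" for n using that(1) by (induction n) auto
    then have "(\<lambda>n. cmod (u n)) = (\<lambda>n. cmod (u 0))" by (rule ext)
    then have "(\<lambda>n. cmod (u 0)) \<longlonglongrightarrow> 0" using tendsto_norm[OF that(2)] by (simp only: norm_zero)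
    then have "cmod (u 0) = 0" by (simp add: LIMSEQ_const_iff)
    then show ?thesis using c[of n] by simp
  qed
  have "v (Suc n) - w * v n = 0" for n
  proof (rule const[of "\<lambda>n. v (Suc n) - w * v n"])
    fix n
    have "v (Suc (Suc n)) - w * v (Suc n) = 1 / w * (v (Suc n) - w * v n)"
      using rec[of n] w0 unfolding w(2)[symmetric] by (simp add: field_simps)
    then show "cmod (v (Suc (Suc n)) - w * v (Suc n)) = cmod (v (Suc n) - w * v n)"
      using w(1) by (simp add: norm_mult norm_divide)
    have "(\<lambda>n. v (Suc n) - w * v n) \<longlonglongrightarrow> 0 - w * 0"
      by (intro tendsto_intros LIMSEQ_Suc[OF lim] lim)
    then show "(\<lambda>n. v (Suc n) - w * v n) \<longlonglongrightarrow> 0" by simp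
  qed
  then have "v (Suc n) = w * v n" for n by (simp only: right_minus_eq)
  then have "cmod (v (Suc n)) = cmod (v n)" for n using w(1) by (simp add: norm_mult)
  then show ?thesis by (rule const[OF _ lim])
qed

lemma unimodular_root:
  assumes "F \<in> \<real>" "\<bar>Re F\<bar> \<le> 1"
  shows "\<exists>w. cmod w = 1 \<and> w + 1 / w = 2 * F"
proof -
  let ?w = "cis (arccos (Re F))"
  have "?w + 1 / ?w = 2 * of_real (cos (arccos (Re F)))"
    by (simp add: complex_eq_iff cis_divide[symmetric] divide_complex_def cis_inverse)
  also have "cos (arccos (Re F)) = Re F" using assms by (simp add: cos_arccos_abs)
  also have "of_real (Re F) = F" using assms(1) by simp
  finally show ?thesis by (intro exI[of _ ?w]) simp
qed

lemma unimodular_inverse_sum: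
  assumes "cmod w = 1" "w + 1 / w = 2 * F"
  shows "F \<in> \<real>" "\<bar>Re F\<bar> \<le> 1"
proof -
  have "1 / w = cnj w" using assms(1) complex_div_cnj[of 1 w] by simp
  then have "F = of_real (Re w)" using assms(2) by (simp add: complex_eq_iff)
  then show "F \<in> \<real>" "\<bar>Re F\<bar> \<le> 1" using assms(1) abs_Re_le_cmod[of w] by auto
qed

section \<open>One fibre operator: Kirchhoff conditions, vertex recurrence, Bloch solutions\<close>

locale nanotube = potential q for q :: "real \<Rightarrow> real" +
  fixes m k :: nat
  assumes k_less: "k < 2 * m + 1"
begin

text \<open>Half the phase of the twist: \<open>s = cis (2 * al)\<close>, so that 1 + s has the
  phase \<open>al\<close> up to sign. This splitting dictates the gauge factor.\<close>

definition al :: real where "al = pi * real k / real (2 * m + 1)"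
definition s :: complex where "s = sN m ^ k"
definition sg :: complex where "sg = 1 + s"
text \<open>Diagonal coefficients at the two kinds of vertices. Where \<open>(n,0)\<close> and
  \<open>(n,2)\<close> end and \<open>(n,1)\<close> starts, the edges contribute 2
  \<open>phi1'\<close> + \<open>theta1\<close>; at the other kind one edge ends and two
  start.\<close>

definition pA :: "complex \<Rightarrow> complex" where "pA z = 2 * phi1' q z + theta1 q z"
definition pB :: "complex \<Rightarrow> complex" where "pB z = 2 * theta1 q z + phi1' q z"

text \<open>The Lyapunov function in the variable in which the dispersion relation reads \<open>F = cos P\<close>.\<close>
definition F :: "complex \<Rightarrow> complex" where "F z = xi q m k z / of_real (cN m k)"

lemma cN_al: "cN m k = cos al" and sNk_al: "sNk m k = sin al"
  by (simp_all add: cN_def sNk_def al_def)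

lemma s_cis: "s = cis (2 * al)"
proof -
  have "sN m = cis (2 * pi / real (2 * m + 1))"
    unfolding sN_def cis_conv_exp by (simp add: mult_ac)
  then have "s = cis (real k * (2 * pi / real (2 * m + 1)))"
    by (simp only: s_def Complex.DeMoivre)
  then show ?thesis by (simp add: al_def mult_ac)
qed

lemma cmod_s [simp]: "cmod s = 1" by (simp add: s_cis)

lemma s_cnj: "s * cnj s = 1" "cnj s * s = 1"
  by (simp_all add: s_cis cis_cnj cis_mult)

lemma sg_cis: "sg = 2 * of_real (cN m k) * cis al"
proof -
  have "cis (2 * al) = cis al * cis al" by (simp add: cis_mult)
  then show ?thesis unfolding sg_def s_cis cN_al
    by (auto simp: complex_eq_iff cos_double_cos sin_double power2_eq_square)
qed

text \<open>A zero of the cosine would make the even number 2 k an odd multiple of the odd number 2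
  m + 1.\<close>

lemma cN_nz: "cN m k \<noteq> 0"
proof
  assume "cN m k = 0"
  then obtain i :: int where i: "odd i" "pi * real k / real (2 * m + 1) = of_int i * (pi / 2)"
    unfolding cN_def cos_zero_iff_int by blast
  then have "pi * (2 * real k) = pi * (of_int i * real (2 * m + 1))" by (simp add: field_simps)
  then have "2 * real k = of_int i * real (2 * m + 1)" using pi_neq_zero by (metis mult_left_cancel)
  then have "of_int (2 * int k) = (of_int (i * int (2 * m + 1)) :: real)" by simp
  then have "2 * int k = i * int (2 * m + 1)" by (simp only: of_int_eq_iff)
  moreover have "odd (i * int (2 * m + 1))" using i(1) by simp
  ultimately show False by (metis dvd_triv_left)
qed

lemma cN_sNk: "(cN m k)^2 + (sNk m k)^2 = 1" by (simp add: cN_al sNk_al)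

lemma sg_cnj: "sg * cnj sg = 4 * of_real ((cN m k)^2)"
proof -
  have "cis al * cis (- al) = 1" by (simp add: cis_mult)
  then show ?thesis unfolding sg_cis by (simp add: cis_cnj power2_eq_square mult_ac)
qed

lemma sg_nz: "sg \<noteq> 0" using cN_nz by (simp add: sg_cis)

lemma xi_F: "xi q m k z = of_real (cN m k) * F z" using cN_nz by (simp add: F_def)

lemma pA_pB: "pA z * pB z = 4 * Delta0 q z + 5"
proof -
  have "pA z * pB z = 2 * (phi1' q z + theta1 q z)^2 + theta1 q z * phi1' q z"
    by (simp add: pA_def pB_def power2_eq_square algebra_simps)
  also have "theta1 q z * phi1' q z = 1 + theta1' q z * phi1 q z"
    using wronskian[of z] by (simp add: algebra_simps)
  finally show ?thesis by (simp add: Delta0_def DeltaL_def power_divide)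
qed

text \<open>The scalar identity behind the elimination of one vertex component:
  \<open>pA z * pB z - 1 - sg * cnj sg\<close> is what remains on the diagonal. The Wronskian enters
  through \<open>pA_pB\<close>.\<close>

lemma pA_pB_F: "pA z * pB z = 1 + sg * cnj sg + 4 * of_real (cN m k) * F z"
proof -
  have "Delta0 q z = of_real (cN m k) * F z - of_real ((sNk m k)^2)"
    using xi_F[of z] by (simp add: xi_def algebra_simps)
  then have "4 * Delta0 q z = 4 * of_real (cN m k) * F z - 4 * of_real ((sNk m k)^2)"
    by (simp only: right_diff_distrib mult.assoc)
  moreover have "4 * of_real ((sNk m k)^2) + sg * cnj sg = 4"
    unfolding sg_cnj using cN_sNk by (metis (no_types, lifting) add.commute distrib_left mult.right_neutral of_real_1 of_real_add)
  then have "sg * cnj sg = 4 - 4 * of_real ((sNk m k)^2)" by (simp only: eq_diff_eq add.commute)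
  ultimately show ?thesis unfolding pA_pB by simp
qed

lemma F_holomorphic: "F holomorphic_on A"
  unfolding F_def xi_def using cN_nz by (intro holomorphic_intros holomorphic_Delta0) auto

lemma F_Reals: "z \<in> \<real> \<Longrightarrow> F z \<in> \<real>"
  unfolding F_def xi_def by (intro Reals_divide Reals_add Delta0_Reals) auto

lemma K0D:
  assumes "K0 m k f"
  shows "f (n, 0) 1 = f (n, 1) 0" "f (n, 2) 1 = cnj s * f (n, 1) 0"
    "f (n, 1) 1 = f (n, 2) 0" "f (n, 0) 0 = f (n - 1, 2) 0"
proof -
  show "f (n, 0) 1 = f (n, 1) 0" "f (n, 1) 1 = f (n, 2) 0" "f (n, 0) 0 = f (n - 1, 2) 0"
    using assms[unfolded K0_def, rule_format, of n] assms[unfolded K0_def, rule_format, of "n - 1"] by auto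
  have "f (n, 1) 0 = s * f (n, 2) 1" using assms by (simp add: K0_def s_def)
  then show "f (n, 2) 1 = cnj s * f (n, 1) 0" using s_cnj by (simp add: mult.assoc[symmetric])
qed

text \<open>Multiplied by \<open>phi1 q z\<close>, the two Kirchhoff sums become a discrete system for the vertex
  values, without any division; \<open>p\<close> and \<open>r\<close> are the end values of the particular edge solutions.\<close>

definition dA :: "complex \<Rightarrow> (int \<times> nat \<Rightarrow> complex) \<Rightarrow> (int \<times> nat \<Rightarrow> complex) \<Rightarrow> int \<Rightarrow> complex" where
  "dA z p r n = phi1 q z * r (n,0) - phi1' q z * p (n,0) + p (n,1) + s * (phi1 q z * r (n,2) - phi1' q z * p (n,2))"
definition dB :: "complex \<Rightarrow> (int \<times> nat \<Rightarrow> complex) \<Rightarrow> (int \<times> nat \<Rightarrow> complex) \<Rightarrow> int \<Rightarrow> complex" where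
  "dB z p r n = p (n+1,0) + phi1 q z * r (n,1) - phi1' q z * p (n,1) + p (n,2)"

lemma Edges_iff: "(n, j) \<in> Edges \<longleftrightarrow> j = 0 \<or> j = 1 \<or> j = 2"
  by (auto simp: Edges_def)

text \<open>The Kirchhoff sums are computed rather than set to zero, so the same identity serves
  functions satisfying \<open>K1\<close>, functions to be shown to satisfy it, and functions that
  violate it by a known amount.\<close>

lemma kirchhoff_vertex:
  assumes K0: "K0 m k f"
    and l: "\<And>n j. (n, j) \<in> Edges \<Longrightarrow> phi1 q z * f' (n,j) 0 = f (n,j) 1 - p (n,j) - theta1 q z * f (n,j) 0"
    and r: "\<And>n j. (n, j) \<in> Edges \<Longrightarrow> phi1 q z * f' (n,j) 1 = phi1' q z * (f (n,j) 1 - p (n,j)) - f (n,j) 0 + phi1 q z * r (n,j)"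
  shows "phi1 q z * (- f' (n,0) 1 + f' (n,1) 0 - s * f' (n,2) 1) =
      f (n-1,2) 0 + sg * f (n,2) 0 - pA z * f (n,1) 0 - dA z p r n"
    and "phi1 q z * (f' (n+1,0) 0 - f' (n,1) 1 + f' (n,2) 0) =
      f (n+1,1) 0 + cnj sg * f (n,1) 0 - pB z * f (n,2) 0 - dB z p r n"
proof -
  have E: "(n, 0) \<in> Edges" "(n, 1) \<in> Edges" "(n, 2) \<in> Edges" for n by (simp_all add: Edges_iff)
  have "phi1 q z * (- f' (n,0) 1 + f' (n,1) 0 - s * f' (n,2) 1) =
      - (phi1 q z * f' (n,0) 1) + phi1 q z * f' (n,1) 0 - s * (phi1 q z * f' (n,2) 1)"
    by (simp add: algebra_simps)
  also have "\<dots> = f (n-1,2) 0 + sg * f (n,2) 0 - pA z * f (n,1) 0 - dA z p r n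
      + (1 - s * cnj s) * phi1' q z * f (n,1) 0"
    unfolding l[OF E(2)] r[OF E(1)] r[OF E(3)] K0D[OF K0, of n]
    by (simp add: dA_def sg_def pA_def algebra_simps)
  finally show "phi1 q z * (- f' (n,0) 1 + f' (n,1) 0 - s * f' (n,2) 1) =
      f (n-1,2) 0 + sg * f (n,2) 0 - pA z * f (n,1) 0 - dA z p r n" by (simp add: s_cnj)
  have "phi1 q z * (f' (n+1,0) 0 - f' (n,1) 1 + f' (n,2) 0) =
      phi1 q z * f' (n+1,0) 0 - phi1 q z * f' (n,1) 1 + phi1 q z * f' (n,2) 0"
    by (simp add: algebra_simps)
  also have "\<dots> = f (n+1,1) 0 + cnj sg * f (n,1) 0 - pB z * f (n,2) 0 - dB z p r n"
    unfolding l[OF E(1)] r[OF E(2)] l[OF E(3)] K0D[OF K0, of n] K0D[OF K0, of "n+1"]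
    by (simp add: dB_def sg_def pB_def s_cnj algebra_simps)
  finally show "phi1 q z * (f' (n+1,0) 0 - f' (n,1) 1 + f' (n,2) 0) =
      f (n+1,1) 0 + cnj sg * f (n,1) 0 - pB z * f (n,2) 0 - dB z p r n" .
qed

text \<open>The Dirichlet-to-Neumann map of an edge, multiplied by \<open>phi1 q z\<close> so that
  it makes sense on the Dirichlet spectrum; the second formula uses the Wronskian.\<close>

lemma ivp_endpoint_scaled:
  assumes "ivp (pot z) (\<lambda>_. 0) y y'"
  shows "phi1 q z * y' 0 = y 1 - theta1 q z * y 0" "phi1 q z * y' 1 = phi1' q z * y 1 - y 0"
proof -
  show "phi1 q z * y' 0 = y 1 - theta1 q z * y 0" using ivp_endpoint(1)[OF assms] by (simp add: algebra_simps)
  have "phi1' q z * y 1 - y 0 = (theta1 q z * phi1' q z - 1) * y 0 + phi1 q z * phi1' q z * y' 0"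
    unfolding ivp_endpoint(1)[OF assms] by (simp add: algebra_simps)
  also have "theta1 q z * phi1' q z - 1 = theta1' q z * phi1 q z" using wronskian[of z] by (simp add: algebra_simps)
  finally show "phi1 q z * y' 1 = phi1' q z * y 1 - y 0"
    unfolding ivp_endpoint(2)[OF assms] by (simp add: algebra_simps)
qed

text \<open>Adding the second equation at n - 1, \<open>sg\<close> times the second at n and
  \<open>pB z\<close> times the first at n cancels every occurrence of \<open>B\<close>.\<close>

lemma vertex_system_A:
  fixes A B d e :: "int \<Rightarrow> complex"
  assumes "\<And>n. B (n-1) + sg * B n - pA z * A n = d n" "\<And>n. A (n+1) + cnj sg * A n - pB z * B n = e n"
  shows "sg * A (n+1) + cnj sg * A (n-1) - 4 * of_real (cN m k) * F z * A n = e (n-1) + sg * e n + pB z * d n"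
proof -
  have "e (n-1) + sg * e n + pB z * d n =
      sg * A (n+1) + cnj sg * A (n-1) + (1 + sg * cnj sg - pA z * pB z) * A n"
    unfolding assms[symmetric] by (simp add: algebra_simps)
  then show ?thesis unfolding pA_pB_F by (simp add: algebra_simps)
qed

lemma vertex_system_B:
  fixes A B d e :: "int \<Rightarrow> complex"
  assumes "\<And>n. B (n-1) + sg * B n - pA z * A n = d n" "\<And>n. A (n+1) + cnj sg * A n - pB z * B n = e n"
  shows "sg * B (n+1) + cnj sg * B (n-1) - 4 * of_real (cN m k) * F z * B n = d (n+1) + cnj sg * d n + pA z * e n"
proof -
  have "d (n+1) + cnj sg * d n + pA z * e n =
      sg * B (n+1) + cnj sg * B (n-1) + (1 + sg * cnj sg - pA z * pB z) * B n"
    unfolding assms[symmetric] by (simp add: algebra_simps)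
  then show ?thesis unfolding pA_pB_F by (simp add: algebra_simps)
qed

text \<open>Absorbs the phase of \<open>sg\<close>: after multiplication by \<open>gauge\<close>,
  the coefficients \<open>sg\<close> and \<open>cnj sg\<close> of the two neighbours both become
  twice \<open>cN m k\<close>.\<close>

definition gauge :: "int \<Rightarrow> complex" where "gauge n = cis (al * of_int n)"

lemma gauge_norm [simp]: "cmod (gauge n) = 1" by (simp add: gauge_def)

lemma gauge_nz [simp]: "gauge n \<noteq> 0" by (simp add: gauge_def)

lemma gauge_recurrence:
  "sg * A (n+1) + cnj sg * A (n-1) - 4 * of_real (cN m k) * F z * A n =
    2 * of_real (cN m k) * (gauge (n+1) * A (n+1) + gauge (n-1) * A (n-1) - 2 * F z * (gauge n * A n)) / gauge n"
proof -
  have 1: "gauge (n+1) = cis al * gauge n" "gauge (n-1) = cis (- al) * gauge n"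
    by (simp_all add: gauge_def cis_mult algebra_simps)
  have e: "(cis al * gauge n * A (n+1) + cis (- al) * gauge n * A (n-1) - 2 * F z * (gauge n * A n)) / gauge n =
      cis al * A (n+1) + cis (- al) * A (n-1) - 2 * F z * A n"
    by (simp add: diff_divide_distrib add_divide_distrib)
  have "2 * of_real (cN m k) * (gauge (n+1) * A (n+1) + gauge (n-1) * A (n-1) - 2 * F z * (gauge n * A n)) / gauge n
      = 2 * of_real (cN m k) * (cis al * A (n+1) + cis (- al) * A (n-1) - 2 * F z * A n)"
    unfolding 1 e[symmetric] by (rule times_divide_eq_right[symmetric])
  then show ?thesis unfolding sg_cis by (simp add: cis_cnj algebra_simps)
qed

text \<open>\<open>K0\<close> solved for the end values of all edges in terms of one value per
  vertex; \<open>cnj s\<close> stands for the inverse of \<open>s\<close>. Hence any two sequences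
  yield a function satisfying \<open>K0\<close>.\<close>

definition bvalL :: "(int \<Rightarrow> complex) \<Rightarrow> (int \<Rightarrow> complex) \<Rightarrow> int \<times> nat \<Rightarrow> complex" where
  "bvalL A B = (\<lambda>(n, j). if j = 0 then B (n-1) else if j = 1 then A n else B n)"
definition bvalR :: "(int \<Rightarrow> complex) \<Rightarrow> (int \<Rightarrow> complex) \<Rightarrow> int \<times> nat \<Rightarrow> complex" where
  "bvalR A B = (\<lambda>(n, j). if j = 0 then A n else if j = 1 then B n else cnj s * A n)"

text \<open>\<open>A n\<close> and \<open>B n\<close> prescribe the values at the start of the edges \<open>(n,1)\<close> and \<open>(n,2)\<close>; \<open>w\<close> collects
  particular solutions with zero initial data.\<close>

definition slope :: "complex \<Rightarrow> (int \<Rightarrow> complex) \<Rightarrow> (int \<Rightarrow> complex) \<Rightarrow> (int \<times> nat \<Rightarrow> complex) \<Rightarrow> int \<times> nat \<Rightarrow> complex" where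
  "slope z A B p \<alpha> = (bvalR A B \<alpha> - p \<alpha> - theta1 q z * bvalL A B \<alpha>) / phi1 q z"
definition gfun :: "complex \<Rightarrow> (int \<Rightarrow> complex) \<Rightarrow> (int \<Rightarrow> complex) \<Rightarrow> (int \<times> nat \<Rightarrow> real \<Rightarrow> complex) \<Rightarrow> int \<times> nat \<Rightarrow> real \<Rightarrow> complex" where
  "gfun z A B w \<alpha> t = bvalL A B \<alpha> * th z t + slope z A B (\<lambda>\<alpha>. w \<alpha> 1) \<alpha> * ph z t + w \<alpha> t"
definition gfun' :: "complex \<Rightarrow> (int \<Rightarrow> complex) \<Rightarrow> (int \<Rightarrow> complex) \<Rightarrow> (int \<times> nat \<Rightarrow> real \<Rightarrow> complex) \<Rightarrow>
    (int \<times> nat \<Rightarrow> real \<Rightarrow> complex) \<Rightarrow> int \<times> nat \<Rightarrow> real \<Rightarrow> complex" where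
  "gfun' z A B w w' \<alpha> t = bvalL A B \<alpha> * th' z t + slope z A B (\<lambda>\<alpha>. w \<alpha> 1) \<alpha> * ph' z t + w' \<alpha> t"

lemma gfun_ivp:
  assumes "ivp (pot z) h (w \<alpha>) (w' \<alpha>)"
  shows "ivp (pot z) h (gfun z A B w \<alpha>) (gfun' z A B w w' \<alpha>)"
  using ivp_lincomb[OF ivp_lincomb_fund[of z "bvalL A B \<alpha>" "slope z A B (\<lambda>\<alpha>. w \<alpha> 1) \<alpha>"] assms, of 1 1]
  unfolding gfun_def[abs_def] gfun'_def[abs_def] by simp

lemma gfun_boundary:
  assumes "phi1 q z \<noteq> 0" "w \<alpha> 0 = 0" "w' \<alpha> 0 = 0"
  shows "gfun z A B w \<alpha> 0 = bvalL A B \<alpha>" "gfun z A B w \<alpha> 1 = bvalR A B \<alpha>"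
    "gfun' z A B w w' \<alpha> 0 = slope z A B (\<lambda>\<alpha>. w \<alpha> 1) \<alpha>"
    "phi1 q z * gfun' z A B w w' \<alpha> 1 = phi1' q z * (bvalR A B \<alpha> - w \<alpha> 1) - bvalL A B \<alpha> + phi1 q z * w' \<alpha> 1"
proof -
  have ends: "th z 1 = theta1 q z" "ph z 1 = phi1 q z" "th' z 1 = theta1' q z" "ph' z 1 = phi1' q z"
    by (simp_all add: theta1_def phi1_def theta1'_def phi1'_def)
  show 0: "gfun z A B w \<alpha> 0 = bvalL A B \<alpha>" "gfun' z A B w w' \<alpha> 0 = slope z A B (\<lambda>\<alpha>. w \<alpha> 1) \<alpha>"
    using assms by (simp_all add: gfun_def gfun'_def fund_0)
  show 1: "gfun z A B w \<alpha> 1 = bvalR A B \<alpha>"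
    unfolding gfun_def ends slope_def using assms(1) by (simp add: field_simps)
  have "phi1 q z * (bvalL A B \<alpha> * th' z 1 + slope z A B (\<lambda>\<alpha>. w \<alpha> 1) \<alpha> * ph' z 1) =
     phi1' q z * (bvalL A B \<alpha> * th z 1 + slope z A B (\<lambda>\<alpha>. w \<alpha> 1) \<alpha> * ph z 1) - bvalL A B \<alpha>"
    using ivp_endpoint_scaled(2)[OF ivp_lincomb_fund[of z "bvalL A B \<alpha>" "slope z A B (\<lambda>\<alpha>. w \<alpha> 1) \<alpha>"]]
    by (simp add: fund_0)
  then show "phi1 q z * gfun' z A B w w' \<alpha> 1 = phi1' q z * (bvalR A B \<alpha> - w \<alpha> 1) - bvalL A B \<alpha> + phi1 q z * w' \<alpha> 1"
    unfolding 1[symmetric] gfun_def gfun'_def by (simp add: algebra_simps)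
qed

lemma gfun_kirchhoff:
  assumes z: "phi1 q z \<noteq> 0" and w0: "\<And>\<alpha>. \<alpha> \<in> Edges \<Longrightarrow> w \<alpha> 0 = 0 \<and> w' \<alpha> 0 = 0"
    and sys: "\<And>n. B (n-1) + sg * B n - pA z * A n = dA z (\<lambda>\<alpha>. w \<alpha> 1) (\<lambda>\<alpha>. w' \<alpha> 1) n"
      "\<And>n. A (n+1) + cnj sg * A n - pB z * B n = dB z (\<lambda>\<alpha>. w \<alpha> 1) (\<lambda>\<alpha>. w' \<alpha> 1) n"
  shows "K0 m k (gfun z A B w)" "K1 m k (gfun' z A B w w')"
proof -
  note bd = gfun_boundary[OF z, of w _ w' A B]
  have E: "(n, 0) \<in> Edges" "(n, 1) \<in> Edges" "(n, 2) \<in> Edges" for n by (simp_all add: Edges_iff)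
  have sA: "s * (cnj s * A n) = A n" for n by (simp add: mult.assoc[symmetric] s_cnj)
  show K0: "K0 m k (gfun z A B w)"
    unfolding K0_def using bd w0 E sA
    by (simp add: bvalL_def bvalR_def s_def[symmetric])
  have l: "phi1 q z * gfun' z A B w w' (n,j) 0 = gfun z A B w (n,j) 1 - w (n,j) 1 - theta1 q z * gfun z A B w (n,j) 0"
    if "(n,j) \<in> Edges" for n j
    using bd w0 that z by (simp add: slope_def)
  have r: "phi1 q z * gfun' z A B w w' (n,j) 1 =
      phi1' q z * (gfun z A B w (n,j) 1 - w (n,j) 1) - gfun z A B w (n,j) 0 + phi1 q z * w' (n,j) 1"
    if "(n,j) \<in> Edges" for n j
    using bd w0 that by simp
  have v: "gfun z A B w (n,1) 0 = A n" "gfun z A B w (n,2) 0 = B n" for n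
    using bd w0 E by (simp_all add: bvalL_def)
  show "K1 m k (gfun' z A B w w')"
    unfolding K1_def s_def[symmetric]
    using kirchhoff_vertex[OF K0, where p="\<lambda>\<alpha>. w \<alpha> 1" and r="\<lambda>\<alpha>. w' \<alpha> 1", OF l r] sys z
    unfolding v by (metis diff_self mult_eq_0_iff)
qed

lemma ivp_zero: "ivp (pot z) (\<lambda>_. 0) (\<lambda>_. 0) (\<lambda>_. 0)"
  by (auto simp: ivp_def intro: integrable_0)

lemma gfun_homogeneous:
  assumes z: "phi1 q z \<noteq> 0"
    and sys: "\<And>n. B (n-1) + sg * B n = pA z * A n" "\<And>n. A (n+1) + cnj sg * A n = pB z * B n"
  shows "gsol q m k z (gfun z A B (\<lambda>_ _. 0)) (gfun' z A B (\<lambda>_ _. 0) (\<lambda>_ _. 0))"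
  unfolding gsol_def sol_iff
  using gfun_ivp[where w="\<lambda>_ _. 0" and w'="\<lambda>_ _. 0", OF ivp_zero]
    gfun_kirchhoff[OF z, where w="\<lambda>_ _. 0" and w'="\<lambda>_ _. 0" and A=A and B=B] sys
  by (simp add: dA_def dB_def)

lemma gsol_vertex:
  assumes "gsol q m k z f f'"
  shows "f (n-1,2) 0 + sg * f (n,2) 0 = pA z * f (n,1) 0" "f (n+1,1) 0 + cnj sg * f (n,1) 0 = pB z * f (n,2) 0"
proof -
  have K: "K0 m k f" "K1 m k f'" and i: "\<And>\<alpha>. \<alpha> \<in> Edges \<Longrightarrow> ivp (pot z) (\<lambda>_. 0) (f \<alpha>) (f' \<alpha>)"
    using assms by (auto simp: gsol_def sol_iff)
  note e = ivp_endpoint_scaled[OF i]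
  have "phi1 q z * 0 = f (n-1,2) 0 + sg * f (n,2) 0 - pA z * f (n,1) 0 - dA z (\<lambda>_. 0) (\<lambda>_. 0) n"
    "phi1 q z * 0 = f (n+1,1) 0 + cnj sg * f (n,1) 0 - pB z * f (n,2) 0 - dB z (\<lambda>_. 0) (\<lambda>_. 0) n"
    using kirchhoff_vertex[OF K(1), where p="\<lambda>_. 0" and r="\<lambda>_. 0" and f'=f' and z=z and n=n] e K(2)
    by (auto simp: K1_def s_def)
  then show "f (n-1,2) 0 + sg * f (n,2) 0 = pA z * f (n,1) 0" "f (n+1,1) 0 + cnj sg * f (n,1) 0 = pB z * f (n,2) 0"
    by (simp_all add: dA_def dB_def)
qed

text \<open>Boundary term of the imaginary part of Green's identity: the current leaving minus the
  current entering along the edge.\<close>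

definition flux :: "(int \<times> nat \<Rightarrow> real \<Rightarrow> complex) \<Rightarrow> (int \<times> nat \<Rightarrow> real \<Rightarrow> complex) \<Rightarrow> int \<times> nat \<Rightarrow> real" where
  "flux f f' \<alpha> = Im (cnj (f \<alpha> 1) * f' \<alpha> 1 - cnj (f \<alpha> 0) * f' \<alpha> 0)"

text \<open>At a vertex the values agree and the derivatives balance, so currents cancel; on edge
  \<open>(n,2)\<close> the factor \<open>s\<close> enters both conditions and drops out because it
  is unimodular. Only the currents at the starts of \<open>(n,0)\<close> and \<open>(n+1,0)\<close>
  survive.\<close>

lemma cell_flux:
  assumes K0: "K0 m k f" and K1: "K1 m k f'"
  shows "flux f f' (n,0) + flux f f' (n,1) + flux f f' (n,2) =
    Im (cnj (f (n+1,0) 0) * f' (n+1,0) 0) - Im (cnj (f (n,0) 0) * f' (n,0) 0)"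
proof -
  have k: "f' (n,1) 0 = f' (n,0) 1 + s * f' (n,2) 1" "f' (n,1) 1 = f' (n+1,0) 0 + f' (n,2) 0"
    using K1 unfolding K1_def s_def[symmetric] by (simp_all add: algebra_simps eq_neg_iff_add_eq_0)
       (metis add.commute add_diff_cancel_left' diff_add_cancel diff_eq_eq eq_iff_diff_eq_0 minus_add_distrib uminus_add_conv_diff)+
  show ?thesis unfolding flux_def K0D[OF K0, of n] k K0D(4)[OF K0, of "n+1"]
    by (simp add: algebra_simps)
qed

lemma singular_kernel:
  fixes a b c d :: complex
  assumes "a * d = b * c"
  shows "\<exists>x y. (x, y) \<noteq> (0, 0) \<and> a * x = b * y \<and> c * x = d * y"
proof (cases "a = 0 \<and> b = 0")
  case True
  show ?thesis
  proof (cases "c = 0 \<and> d = 0")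
    case True with \<open>a = 0 \<and> b = 0\<close> show ?thesis by (intro exI[of _ 1] exI[of _ 0]) auto
  next
    case False with \<open>a = 0 \<and> b = 0\<close> show ?thesis by (intro exI[of _ d] exI[of _ c]) auto
  qed
next
  case False
  then show ?thesis using assms by (intro exI[of _ b] exI[of _ a]) (auto simp: mult_ac)
qed

text \<open>The dispersion relation: a quasiperiodic ansatz with multiplier \<tau> turns the vertex
  system into a 2 x 2 system, whose determinant vanishes exactly by the second claim.\<close>

lemma bloch_vertex:
  assumes "w \<noteq> 0" "w + 1 / w = 2 * F z"
  defines "\<tau> \<equiv> cis (- al) * w"
  shows "\<tau> \<noteq> 0" "(1 / \<tau> + sg) * (\<tau> + cnj sg) = pA z * pB z"
proof -
  show t: "\<tau> \<noteq> 0" using assms(1) by (simp add: \<tau>_def)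
  have 1: "cis al * cis (- al) = 1" by (simp add: cis_mult)
  then have "sg * \<tau> = 2 * of_real (cN m k) * w"
    unfolding \<tau>_def sg_cis by (simp add: mult.assoc[symmetric])
  moreover have "cnj sg / \<tau> = 2 * of_real (cN m k) * (1 / w)"
    unfolding \<tau>_def sg_cis by (simp add: cis_cnj)
  moreover have "(1 / \<tau> + sg) * (\<tau> + cnj sg) = 1 + sg * cnj sg + (sg * \<tau> + cnj sg / \<tau>)"
    using t by (simp add: field_simps)
  ultimately have "(1 / \<tau> + sg) * (\<tau> + cnj sg) = 1 + sg * cnj sg + 2 * of_real (cN m k) * (w + 1 / w)"
    by (simp add: algebra_simps)
  then show "(1 / \<tau> + sg) * (\<tau> + cnj sg) = pA z * pB z"
    unfolding pA_pB_F assms(2) by simp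
qed

lemma bloch_solution:
  assumes "phi1 q z \<noteq> 0" "\<tau> \<noteq> 0" "(1 / \<tau> + sg) * B0 = pA z * A0" "(\<tau> + cnj sg) * A0 = pB z * B0"
  defines "A \<equiv> \<lambda>n::int. \<tau> powi n * A0" and "B \<equiv> \<lambda>n::int. \<tau> powi n * B0"
  shows "gsol q m k z (gfun z A B (\<lambda>_ _. 0)) (gfun' z A B (\<lambda>_ _. 0) (\<lambda>_ _. 0))"
    "bvalL A B (n, j) = \<tau> powi n * bvalL A B (0, j)" "bvalR A B (n, j) = \<tau> powi n * bvalR A B (0, j)"
proof -
  have p: "\<tau> powi (n + 1) = \<tau> * \<tau> powi n" "\<tau> powi (n - 1) = \<tau> powi n / \<tau>" for n
    using assms(2) by (simp_all add: power_int_add power_int_diff)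
  show "gsol q m k z (gfun z A B (\<lambda>_ _. 0)) (gfun' z A B (\<lambda>_ _. 0) (\<lambda>_ _. 0))"
  proof (rule gfun_homogeneous[OF assms(1)])
    show "B (n - 1) + sg * B n = pA z * A n" for n
      using arg_cong[OF assms(3), of "\<lambda>x. \<tau> powi n * x"] unfolding A_def B_def p by (simp add: algebra_simps)
    show "A (n + 1) + cnj sg * A n = pB z * B n" for n
      using arg_cong[OF assms(4), of "\<lambda>x. \<tau> powi n * x"] unfolding A_def B_def p by (simp add: algebra_simps)
  qed
  show "bvalL A B (n, j) = \<tau> powi n * bvalL A B (0, j)" "bvalR A B (n, j) = \<tau> powi n * bvalR A B (0, j)"
    using assms(2) by (auto simp: bvalL_def bvalR_def A_def B_def power_int_diff divide_inverse mult_ac)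
qed

text \<open>Both the function and its second derivative have zero L2 norm, so the Sobolev bound
  annihilates the first derivative as well.\<close>

lemma ivp_zero_derivative:
  assumes "ivp (pot z) (\<lambda>_. 0) y y'" "\<And>x. x \<in> {0..1} \<Longrightarrow> y x = 0" "x \<in> {0..1}"
  shows "y' x = 0"
proof -
  have W: "W22 y y' (\<lambda>t. pot z t * y t + 0)" by (rule ivp_W22[OF pot_L2 _ assms(1)]) simp
  have "integral {0..1} (\<lambda>t. (cmod (y t))^2) = 0" "integral {0..1} (\<lambda>t. (cmod (pot z t * y t + 0))^2) = 0"
    by (rule integral_unique, rule has_integral_is_0, simp add: assms(2))+
  then show ?thesis using W22_sobolev[OF W assms(3)] by (simp add: sum_power2_le_zero_iff)
qed

lemma green_nonreal:
  assumes "ivp (pot z) (\<lambda>_. 0) y y'"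
  shows "Im (cnj (y 1) * y' 1 - cnj (y 0) * y' 0) = - Im z * integral {0..1} (\<lambda>t. (cmod (y t))^2)"
proof -
  have "(\<lambda>t. (cmod (y t))^2) integrable_on {0..1}"
    by (intro edge_L2_integrable_sq edge_L2_continuous ivp_continuous[OF assms])
  from has_integral_mult_right[OF integrable_integral[OF this], of "- Im z"]
  show ?thesis using ivp_green_Im[OF assms] by (auto dest: has_integral_unique)
qed

text \<open>Otherwise \<open>ph z\<close> would be a Dirichlet eigenfunction with nonreal
  eigenvalue; Green's identity gives it norm zero, against its derivative 1 at the origin.\<close>

lemma phi1_nonreal:
  assumes "Im z \<noteq> 0" shows "phi1 q z \<noteq> 0"
proof
  assume "phi1 q z = 0"
  then have "integral {0..1} (\<lambda>t. (cmod (ph z t))^2) = 0"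
    using green_nonreal[OF fund_ivp[of z 0 1]] assms by (simp add: fund_0 phi1_def)
  then have "ph z x = 0" if "x \<in> {0..1}" for x
    using L2_zero_imp_zero[OF fund_continuous(1) _ that] by blast
  then have "ph' z 0 = 0" by (rule ivp_zero_derivative[OF fund_ivp]) auto
  then show False by (simp add: fund_0)
qed

text \<open>A value of \<open>F\<close> in [-1,1] yields a Bloch solution with unimodular
  multiplier. The currents into and out of a cell then agree, whereas Green's identity makes their
  difference \<open>- Im z\<close> times the squared norm on the cell, so the solution
  vanishes.\<close>

lemma F_nonreal:
  assumes z: "Im z \<noteq> 0" and F: "F z \<in> \<real>" "\<bar>Re (F z)\<bar> \<le> 1"
  shows False
proof -
  obtain w where w: "cmod w = 1" "w + 1 / w = 2 * F z" using unimodular_root[OF F] by blast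
  then have w0: "w \<noteq> 0" by auto
  define \<tau> where "\<tau> = cis (- al) * w"
  have t: "\<tau> \<noteq> 0" "(1 / \<tau> + sg) * (\<tau> + cnj sg) = pA z * pB z" "cmod \<tau> = 1"
    using bloch_vertex[OF w0 w(2)] w(1) by (auto simp: \<tau>_def norm_mult)
  then obtain B0 A0 where AB: "(B0, A0) \<noteq> (0, 0)" "(1 / \<tau> + sg) * B0 = pA z * A0" "pB z * B0 = (\<tau> + cnj sg) * A0"
    using singular_kernel by blast
  note phi = phi1_nonreal[OF z]
  define A B where "A = (\<lambda>n::int. \<tau> powi n * A0)" and "B = (\<lambda>n::int. \<tau> powi n * B0)"
  define f f' where "f = gfun z A B (\<lambda>_ _. 0)" and "f' = gfun' z A B (\<lambda>_ _. 0) (\<lambda>_ _. 0)"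
  note bl = bloch_solution[OF phi t(1) AB(2) AB(3)[symmetric], folded A_def B_def]
  have K: "K0 m k f" "K1 m k f'" and i: "\<And>\<alpha>. \<alpha> \<in> Edges \<Longrightarrow> ivp (pot z) (\<lambda>_. 0) (f \<alpha>) (f' \<alpha>)"
    using bl(1) by (auto simp: gsol_def sol_iff f_def f'_def)
  have bd: "f (n,j) 0 = bvalL A B (n,j)" "f (n,j) 1 = bvalR A B (n,j)" "f' (n,j) 0 = slope z A B (\<lambda>_. 0) (n,j)" for n j
    using gfun_boundary[OF phi, of "\<lambda>_ _. 0" _ "\<lambda>_ _. 0" A B] by (auto simp: f_def f'_def)
  have qp: "f (1,0) 0 = \<tau> * f (0,0) 0" "f' (1,0) 0 = \<tau> * f' (0,0) 0"
    using bl(2)[of 1 0] bl(3)[of 1 0] by (simp_all add: bd slope_def algebra_simps)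
  have "cnj \<tau> * \<tau> = 1" using t(3) complex_norm_square[of \<tau>] by (simp add: mult.commute)
  then have "cnj (f (1,0) 0) * f' (1,0) 0 = cnj (f (0,0) 0) * f' (0,0) 0"
    unfolding qp complex_cnj_mult by (metis (no_types, lifting) mult.assoc mult.left_commute mult_1)
  then have "flux f f' (0,0) + flux f f' (0,1) + flux f f' (0,2) = 0"
    using cell_flux[OF K, of 0] by simp
  then have "- Im z * (integral {0..1} (\<lambda>t. (cmod (f (0,0) t))^2) + integral {0..1} (\<lambda>t. (cmod (f (0,1) t))^2)
      + integral {0..1} (\<lambda>t. (cmod (f (0,2) t))^2)) = 0"
    using green_nonreal[OF i[of "(0,0)"]] green_nonreal[OF i[of "(0,1)"]] green_nonreal[OF i[of "(0,2)"]]
    by (simp add: flux_def Edges_iff algebra_simps)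
  moreover have nn: "0 \<le> integral {0..1} (\<lambda>t. (cmod (f (0,j) t))^2)" if "(0,j) \<in> Edges" for j
    using ivp_continuous(2)[OF i[OF that]] by (intro integral_nonneg edge_L2_integrable_sq edge_L2_continuous) auto
  \<comment> \<open>The edge \<open>(0,1)\<close> alone suffices, since its end values are the two
    amplitudes \<open>A0\<close> and \<open>B0\<close>.\<close>
  ultimately have I1: "integral {0..1} (\<lambda>t. (cmod (f (0,1) t))^2) = 0"
    using z nn[of 0] nn[of 1] nn[of 2] by (simp add: add_nonneg_eq_0_iff Edges_iff)
  have c: "continuous_on {0..1} (f (0,1))" using ivp_continuous[OF i[of "(0,1)"]] by (simp add: Edges_iff)
  have "f (0,1) 0 = 0" "f (0,1) 1 = 0"
    using L2_zero_imp_zero[OF c I1] by auto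
  then have "A0 = 0" "B0 = 0" by (simp_all add: bd bvalL_def bvalR_def A_def B_def)
  then show False using AB(1) by simp
qed

end

subsection \<open>Lyapunov branches and eigenvalues\<close>

lemma half_sum_diff:
  fixes a b x r :: complex
  assumes "a + b = 2 * x" "a - b = 2 * r" shows "a = x + r \<and> b = x - r"
proof -
  have "2 * a = (a + b) + (a - b)" "2 * b = (a + b) - (a - b)" by simp_all
  then have "2 * a = 2 * (x + r)" "2 * b = 2 * (x - r)" by (simp_all only: assms distrib_left right_diff_distrib)
  then show ?thesis by (metis mult_left_cancel zero_neq_numeral)
qed

lemma int_orbit:
  assumes "bij T" shows "\<exists>x::int \<Rightarrow> 'a. x 0 = x0 \<and> (\<forall>n. x (n + 1) = T (x n))"
proof -
  define x where "x n = (if 0 \<le> n then (T ^^ nat n) x0 else (inv T ^^ nat (- n)) x0)" for n :: int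
  have inv: "T (inv T y) = y" for y using assms by (simp add: bij_is_surj surj_f_inv_f)
  have "x (n + 1) = T (x n)" for n
  proof (cases "0 \<le> n")
    case True then show ?thesis by (simp add: x_def nat_add_distrib)
  next
    case False
    then have e: "nat (- n) = Suc (nat (- (n + 1)))" by auto
    show ?thesis
    proof (cases "n = -1")
      case True then show ?thesis by (simp add: x_def inv)
    next
      case False
      with \<open>\<not> 0 \<le> n\<close> have "\<not> 0 \<le> n + 1" by auto
      with \<open>\<not> 0 \<le> n\<close> show ?thesis by (simp only: x_def if_False e funpow.simps o_apply inv)
    qed
  qed
  then show ?thesis by (intro exI[of _ x]) (simp add: x_def)
qed

text \<open>If the derivative vanished, \<open>g w - g x\<close> would behave like \<open>a (w - x)^n\<close> with \<open>n \<ge> 2\<close>, so \<open>Im g\<close>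
  would take both signs on small upper half discs and hence vanish at a nonreal point.\<close>

lemma deriv_nonzero_of_real_preimages:
  fixes g :: "complex \<Rightarrow> complex"
  assumes S: "open S" "of_real x \<in> S" and g: "g holomorphic_on S"
    and real: "\<And>w. w \<in> S \<Longrightarrow> Im w \<noteq> 0 \<Longrightarrow> Im (g w) = 0 \<Longrightarrow> \<bar>Re (g w)\<bar> < 1 \<Longrightarrow> False"
    and gx: "Im (g (of_real x)) = 0" "\<bar>Re (g (of_real x))\<bar> < 1"
  shows "deriv g (of_real x) \<noteq> 0"
proof
  let ?x = "complex_of_real x"
  assume d0: "deriv g ?x = 0"
  obtain r where r: "0 < r" "ball ?x r \<subseteq> S" using S open_contains_ball by blast
  have hol: "(\<lambda>w. g w - g ?x) holomorphic_on ball ?x r"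
    by (intro holomorphic_intros holomorphic_on_subset[OF g r(2)])
  \<comment> \<open>A locally constant \<open>g\<close> would take the real value
    \<open>g ?x\<close> at nonreal points, against \<open>real\<close>.\<close>
  have nc: "\<not> (\<lambda>w. g w - g ?x) constant_on ball ?x r"
  proof
    assume "(\<lambda>w. g w - g ?x) constant_on ball ?x r"
    then obtain y where y: "\<And>w. w \<in> ball ?x r \<Longrightarrow> g w - g ?x = y" unfolding constant_on_def by blast
    have w: "?x + \<i> * of_real (r / 2) \<in> ball ?x r" using r by (simp add: dist_norm norm_mult)
    have "g (?x + \<i> * of_real (r / 2)) = g ?x" using y[OF w] y[of ?x] r(1) by simp
    then show False using real[of "?x + \<i> * of_real (r / 2)"] w r gx by auto
  qed
  obtain h r' n where n: "0 < n" and r': "0 < r'" "ball ?x r' \<subseteq> ball ?x r" and h: "h holomorphic_on ball ?x r'"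
    and fac: "\<And>w. w \<in> ball ?x r' \<Longrightarrow> g w - g ?x = (w - ?x)^n * h w" and h0: "\<And>w. w \<in> ball ?x r' \<Longrightarrow> h w \<noteq> 0"
    by (rule holomorphic_factor_zero_nonconstant[OF hol _ _ _ _ nc, of ?x]) (use r in auto)
  have hx: "h ?x \<noteq> 0" using h0 r' by simp
  have hc: "isCont h ?x" using h r' by (meson centre_in_ball continuous_on_eq_continuous_at holomorphic_on_imp_continuous_on open_ball)
  have "n \<noteq> 1"
  proof
    assume "n = 1"
    have "(g has_field_derivative h ?x) (at ?x)"
    proof -
      have "\<forall>\<^sub>F w in at ?x. w \<in> ball ?x r'" using r' by (intro eventually_at_in_open') auto
      moreover have "\<forall>\<^sub>F w in at ?x. w \<noteq> ?x" by (simp add: eventually_at_filter)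
      ultimately have "\<forall>\<^sub>F w in at ?x. h w = (g w - g ?x) / (w - ?x)"
        by eventually_elim (use fac \<open>n = 1\<close> in simp)
      then show ?thesis unfolding has_field_derivative_iff
        using hc tendsto_cong by (fastforce simp: isCont_def)
    qed
    then show False using d0 hx by (simp add: DERIV_imp_deriv)
  qed
  with n have n2: "2 \<le> n" by simp
  define a where "a = h ?x"
  \<comment> \<open>Since \<open>a\<close> is nonzero, at least one of the phases pi / 4 and pi / 2
    gives a nonzero imaginary part. The bound n \<ge> 2 leaves room for a second ray, turned by pi /
    n, inside the upper half plane.\<close>
  have dir: "\<exists>\<theta>::real. 0 < \<theta> \<and> \<theta> + pi / n < pi \<and> Im (a * cis (n * \<theta>)) \<noteq> 0"
  proof (cases "Im (a * cis (pi / 4)) = 0")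
    case False
    moreover have "pi / (4 * n) + pi / n < pi"
    proof -
      have "pi * (5 / (4 * real n)) < pi * 1" using n2 by (intro mult_strict_left_mono) (auto simp: field_simps)
      then show ?thesis using n by (simp add: field_simps)
    qed
    ultimately show ?thesis using n by (intro exI[of _ "pi / (4 * n)"]) auto
  next
    case True
    have "Im (a * cis (pi / 2)) \<noteq> 0"
    proof
      assume "Im (a * cis (pi / 2)) = 0"
      then have "Re a = 0" by simp
      moreover then have "Im a = 0" using True by (simp add: cos_45)
      ultimately show False using hx by (simp add: a_def complex_eq_iff)
    qed
    moreover have "pi / (2 * n) + pi / n < pi"
    proof -
      have "pi * (3 / (2 * real n)) < pi * 1" using n2 by (intro mult_strict_left_mono) (auto simp: field_simps)
      then show ?thesis using n by (simp add: field_simps)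
    qed
    ultimately show ?thesis using n by (intro exI[of _ "pi / (2 * n)"]) auto
  qed
  then obtain \<theta> :: real where th: "0 < \<theta>" "\<theta> + pi / n < pi" "Im (a * cis (n * \<theta>)) \<noteq> 0"
    by (elim exE conjE)
  define p where "p t = ?x + of_real t * cis \<theta>" for t :: real
  define p' where "p' t = ?x + of_real t * cis (\<theta> + pi / n)" for t :: real
  have lim: "((\<lambda>t. Im (cis (n * \<theta>) * h (p t))) \<longlongrightarrow> Im (a * cis (n * \<theta>))) (at_right 0)"
    "((\<lambda>t. Im (cis (n * (\<theta> + pi / n)) * h (p' t))) \<longlongrightarrow> - Im (a * cis (n * \<theta>))) (at_right 0)"
  proof -
    have c: "((\<lambda>t. h (?x + of_real t * u)) \<longlongrightarrow> a) (at_right 0)" for u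
    proof -
      have "isCont (\<lambda>t. h (?x + of_real t * u)) (0::real)"
        by (rule continuous_at_compose[unfolded o_def, where g=h]) (auto intro!: continuous_intros simp: hc)
      then have "((\<lambda>t. h (?x + of_real t * u)) \<longlongrightarrow> h (?x + of_real 0 * u)) (at 0)" by (simp add: isCont_def)
      then show ?thesis by (auto simp: a_def intro: filterlim_at_within_not_equal tendsto_mono[OF at_le])
    qed
    show "((\<lambda>t. Im (cis (n * \<theta>) * h (p t))) \<longlongrightarrow> Im (a * cis (n * \<theta>))) (at_right 0)"
      unfolding p_def using tendsto_Im[OF tendsto_mult[OF tendsto_const[of "cis (n * \<theta>)"] c]] by (simp add: mult.commute)
    \<comment> \<open>Turning by pi / n reverses the sign of the leading term
      \<open>a * (w - ?x)^n\<close>, so the imaginary parts along the two rays have opposite signs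
      near \<open>?x\<close>.\<close>
    have cis_eq: "cis (n * (\<theta> + pi / n)) = - cis (n * \<theta>)"
    proof -
      have "n * (\<theta> + pi / n) = n * \<theta> + pi" using n by (simp add: field_simps)
      then show ?thesis by (simp add: complex_eq_iff)
    qed
    have "((\<lambda>t. Im (- cis (n * \<theta>) * h (?x + of_real t * cis (\<theta> + pi / n)))) \<longlongrightarrow> Im (- cis (n * \<theta>) * a)) (at_right 0)"
      by (intro tendsto_intros c)
    moreover have "Im (- cis (n * \<theta>) * a) = - Im (a * cis (n * \<theta>))" by (simp add: mult.commute)
    ultimately show "((\<lambda>t. Im (cis (n * (\<theta> + pi / n)) * h (p' t))) \<longlongrightarrow> - Im (a * cis (n * \<theta>))) (at_right 0)"
      unfolding p'_def cis_eq by (simp only:)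
  qed
  have gc: "continuous_on (ball ?x r') g"
    using holomorphic_on_imp_continuous_on[OF g] r r' by (meson continuous_on_subset order_trans)
  then have "isCont g ?x" using r' by (simp add: continuous_on_eq_continuous_at)
  then have "\<forall>\<^sub>F w in nhds ?x. dist (g w) (g ?x) < 1 - \<bar>Re (g ?x)\<bar>"
    using gx(2) by (intro tendstoD) (auto simp: isCont_def tendsto_at_iff_tendsto_nhds)
  then obtain \<delta> where \<delta>: "0 < \<delta>" "\<And>w. dist w ?x < \<delta> \<Longrightarrow> dist (g w) (g ?x) < 1 - \<bar>Re (g ?x)\<bar>"
    unfolding eventually_nhds_metric by auto
  have "\<forall>\<^sub>F t in at_right 0. t \<in> {0<..<min r' \<delta>}"
    using r' \<delta> by (intro eventually_at_right_real) auto
  moreover have "\<forall>\<^sub>F t in at_right (0::real). Im (cis (n * \<theta>) * h (p t)) * Im (cis (n * (\<theta> + pi / n)) * h (p' t)) < 0"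
  proof (rule order_tendstoD(2)[OF tendsto_mult[OF lim]])
    show "Im (a * cis (n * \<theta>)) * - Im (a * cis (n * \<theta>)) < 0"
      using th(3) by (metis mult_minus_right neg_less_0_iff_less not_square_less_zero mult_eq_0_iff linorder_neqE_linordered_idom)
  qed
  ultimately have "\<forall>\<^sub>F t in at_right (0::real). t < min r' \<delta> \<and> 0 < t \<and>
      Im (cis (n * \<theta>) * h (p t)) * Im (cis (n * (\<theta> + pi / n)) * h (p' t)) < 0"
    by eventually_elim auto
  then obtain t where t: "t < r'" "t < \<delta>" "0 < t"
    and sg: "Im (cis (n * \<theta>) * h (p t)) * Im (cis (n * (\<theta> + pi / n)) * h (p' t)) < 0"
    using eventually_happens[of _ "at_right (0::real)"] by (auto simp: trivial_limit_at_right_real)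
  have in_ball: "?x + of_real t * cis \<phi> \<in> ball ?x (min r' \<delta>)" for \<phi>
    using t by (simp add: dist_norm norm_mult)
  have gp: "Im (g (?x + of_real t * cis \<phi>)) = t^n * Im (cis (n * \<phi>) * h (?x + of_real t * cis \<phi>))" for \<phi> :: real
  proof -
    have "g (?x + of_real t * cis \<phi>) = g ?x + (of_real t * cis \<phi>)^n * h (?x + of_real t * cis \<phi>)"
      using fac[of "?x + of_real t * cis \<phi>"] in_ball[of \<phi>] by (simp add: algebra_simps)
    also have "(of_real t * cis \<phi>)^n = of_real (t^n) * cis (n * \<phi>)"
      by (simp add: power_mult_distrib Complex.DeMoivre)
    finally show ?thesis using gx(1) by (simp add: mult.assoc)
  qed
  have "Im (g (p t)) * Im (g (p' t)) = (t^n * t^n) * (Im (cis (n * \<theta>) * h (p t)) * Im (cis (n * (\<theta> + pi / n)) * h (p' t)))"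
    unfolding p_def p'_def gp by (simp only: mult_ac)
  also have "\<dots> < 0" by (rule mult_pos_neg[OF _ sg]) (use t in simp)
  finally have neg: "Im (g (p t)) * Im (g (p' t)) < 0" .
  \<comment> \<open>By convexity the segment between the two points stays in the small disc and off
    the real axis, so the intermediate value theorem yields a nonreal point with real value of
    \<open>g\<close>.\<close>
  let ?seg = "closed_segment (p t) (p' t)"
  have seg: "?seg \<subseteq> ball ?x (min r' \<delta>) \<inter> {w. 0 < Im w}"
  proof (rule closed_segment_subset)
    show "convex (ball ?x (min r' \<delta>) \<inter> {w. 0 < Im w})"
      by (intro convex_Int convex_ball convex_halfspace_Im_gt)
    have "0 < sin \<theta>" "0 < sin (\<theta> + pi / n)"
      using th n by (auto intro!: sin_gt_zero add_pos_pos divide_pos_pos) (smt (verit) divide_pos_pos pi_gt_zero of_nat_0_less_iff)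
    then show "p t \<in> ball ?x (min r' \<delta>) \<inter> {w. 0 < Im w}" "p' t \<in> ball ?x (min r' \<delta>) \<inter> {w. 0 < Im w}"
      using in_ball t(3) unfolding p_def p'_def by auto
  qed
  have cI: "continuous_on ?seg (\<lambda>w. Im (g w))"
    using seg by (intro continuous_intros continuous_on_subset[OF gc]) auto
  have conn: "connected ((\<lambda>w. Im (g w)) ` ?seg)" by (intro connected_continuous_image cI convex_connected convex_closed_segment)
  have "0 \<in> (\<lambda>w. Im (g w)) ` ?seg"
  proof (cases "Im (g (p t)) < 0")
    case True
    with neg have "0 < Im (g (p' t))" by (simp add: mult_less_0_iff)
    with True show ?thesis using connectedD_interval[OF conn, of "Im (g (p t))" "Im (g (p' t))" 0] by auto
  next
    case False
    with neg have "0 < Im (g (p t))" "Im (g (p' t)) < 0" by (auto simp: mult_less_0_iff)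
    then show ?thesis using connectedD_interval[OF conn, of "Im (g (p' t))" "Im (g (p t))" 0] by auto
  qed
  then obtain w where w: "w \<in> ?seg" "Im (g w) = 0" by auto
  then have wb: "w \<in> ball ?x (min r' \<delta>)" "0 < Im w" using seg by auto
  then have "dist (g w) (g ?x) < 1 - \<bar>Re (g ?x)\<bar>" by (intro \<delta>(2)) (simp add: dist_commute)
  then have "\<bar>Re (g w)\<bar> < 1" using abs_Re_le_cmod[of "g w - g ?x"] by (simp add: dist_norm)
  moreover have "w \<in> S" by (rule subsetD[OF r(2) subsetD[OF r'(2)]]) (use wb(1) in simp)
  ultimately show False using real[of w] wb(2) w(2) by simp
qed

section \<open>Square summable functions on the graph and their boundary traces\<close>

lemma finite_support_gL2:
  assumes "\<And>\<alpha>. \<alpha> \<in> Edges \<Longrightarrow> edge_L2 (f \<alpha>)" "finite X" "\<And>\<alpha> t. \<alpha> \<in> Edges - X \<Longrightarrow> f \<alpha> t = 0"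
  shows "gL2 f"
proof -
  have "(\<lambda>\<alpha>. integral {0..1} (\<lambda>t. (cmod (f \<alpha> t))^2)) summable_on X" using assms(2) by simp
  then have "(\<lambda>\<alpha>. integral {0..1} (\<lambda>t. (cmod (f \<alpha> t))^2)) summable_on (Edges \<inter> X)"
    using assms(2) by (intro summable_on_finite) auto
  then have "(\<lambda>\<alpha>. integral {0..1} (\<lambda>t. (cmod (f \<alpha> t))^2)) summable_on Edges"
    by (subst summable_on_cong_neutral[where T="Edges \<inter> X"]) (auto simp: assms(3))
  then show ?thesis using assms(1) by (auto simp: gL2_def)
qed

lemma gnorm_sq: "gnorm f ^ 2 = (\<Sum>\<^sub>\<infinity>\<alpha>\<in>Edges. integral {0..1} (\<lambda>t. (cmod (f \<alpha> t))^2))"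
  unfolding gnorm_def by (intro real_sqrt_pow2 infsum_nonneg) (metis integral_nonneg not_integrable_integral order_refl zero_le_power2)

lemma edge_integral_nonneg: "0 \<le> integral {0..1::real} (\<lambda>t. (cmod (f t))^2)"
  by (metis integral_nonneg not_integrable_integral order_refl zero_le_power2)

lemma gnorm_nonneg: "0 \<le> gnorm f"
  unfolding gnorm_def by (intro real_sqrt_ge_zero infsum_nonneg edge_integral_nonneg)

lemma gnorm_eq_0:
  assumes "gL2 f" "gnorm f = 0" "\<alpha> \<in> Edges"
  shows "integral {0..1} (\<lambda>t. (cmod (f \<alpha> t))^2) = 0"
proof (rule nonneg_infsum_le_0D[where f="\<lambda>\<alpha>. integral {0..1} (\<lambda>t. (cmod (f \<alpha> t))^2)" and A=Edges])
  show "(\<Sum>\<^sub>\<infinity>\<alpha>\<in>Edges. integral {0..1} (\<lambda>t. (cmod (f \<alpha> t))^2)) \<le> 0"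
    using gnorm_sq[of f] assms(2) by simp
qed (use assms edge_integral_nonneg in \<open>auto simp: gL2_def\<close>)

lemma gnorm_zero: "(\<And>\<alpha>. \<alpha> \<in> Edges \<Longrightarrow> integral {0..1} (\<lambda>t. (cmod (f \<alpha> t))^2) = 0) \<Longrightarrow> gnorm f = 0"
  unfolding gnorm_def by (simp add: infsum_0)

lemma Edges_Un: "Edges = (\<lambda>n. (n, 0)) ` UNIV \<union> ((\<lambda>n. (n, 1)) ` UNIV \<union> (\<lambda>n. (n, 2)) ` UNIV)"
  by (auto simp: Edges_def)

lemma summable_on_edge:
  fixes g :: "int \<times> nat \<Rightarrow> 'a::banach"
  assumes "g summable_on Edges" "j \<in> {0,1,2}"
  shows "(\<lambda>n. g (n, j)) summable_on UNIV"
proof -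
  have "g summable_on (\<lambda>n. (n, j)) ` UNIV"
    by (rule summable_on_subset_banach[OF assms(1)]) (use assms(2) in \<open>auto simp: Edges_def\<close>)
  then show ?thesis by (subst (asm) summable_on_reindex) (auto simp: inj_on_def o_def)
qed

lemma has_sum_Edges:
  fixes g :: "int \<times> nat \<Rightarrow> 'a::{comm_monoid_add,topological_comm_monoid_add}"
  assumes "\<And>j. j \<in> {0,1,2} \<Longrightarrow> ((\<lambda>n. g (n, j)) has_sum S j) UNIV"
  shows "(g has_sum (S 0 + (S 1 + S 2))) Edges"
proof -
  have "(g has_sum S j) ((\<lambda>n. (n, j)) ` UNIV)" if "j \<in> {0,1,2}" for j
    using assms[OF that] by (subst has_sum_reindex) (auto simp: inj_on_def o_def)
  then show ?thesis unfolding Edges_Un by (intro has_sum_Un_disjoint) auto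
qed

lemma summable_on_Edges:
  fixes g :: "int \<times> nat \<Rightarrow> 'a::real_normed_vector"
  assumes "\<And>j. j \<in> {0,1,2} \<Longrightarrow> (\<lambda>n. g (n, j)) summable_on UNIV"
  shows "g summable_on Edges"
proof -
  have "((\<lambda>n. g (n, j)) has_sum infsum (\<lambda>n. g (n, j)) UNIV) UNIV" if "j \<in> {0,1,2}" for j
    using assms[OF that] by (rule has_sum_infsum)
  from has_sum_Edges[of g "\<lambda>j. infsum (\<lambda>n. g (n, j)) UNIV", OF this] show ?thesis by (rule has_sum_imp_summable)
qed

lemma l2_int_tendsto_0:
  fixes u :: "int \<Rightarrow> complex"
  assumes "(\<lambda>n. (cmod (u n))^2) summable_on UNIV" "inj (e :: nat \<Rightarrow> int)"
  shows "(\<lambda>n. u (e n)) \<longlonglongrightarrow> 0"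
proof -
  have "(\<lambda>n. (cmod (u n))^2) summable_on range e"
    by (rule summable_on_subset_banach[OF assms(1)]) auto
  then have "(\<lambda>n. (cmod (u (e n)))^2) summable_on UNIV"
    using assms(2) by (subst (asm) summable_on_reindex) (auto simp: o_def)
  then have "(\<lambda>n. (cmod (u (e n)))^2) \<longlonglongrightarrow> 0"
    by (intro summable_LIMSEQ_zero summable_on_imp_summable)
  then have "(\<lambda>n. sqrt ((cmod (u (e n)))^2)) \<longlonglongrightarrow> sqrt 0" by (rule tendsto_real_sqrt)
  then show ?thesis by (simp add: tendsto_norm_zero_iff)
qed

lemma HdomD:
  assumes "Hdom m k f f' f''"
  shows "gL2 f" "gL2 f''" "\<alpha> \<in> Edges \<Longrightarrow> W22 (f \<alpha>) (f' \<alpha>) (f'' \<alpha>)" "K0 m k f" "K1 m k f'"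
  using assms by (auto simp: Hdom_def)

text \<open>The Sobolev bound on one edge has a constant common to all edges, so summability of the
  norms passes to the boundary values and derivatives.\<close>

lemma Hdom_boundary_l2:
  assumes "Hdom m k f f' f''" "j \<in> {0,1,2}" "x \<in> {0..1}"
  shows "(\<lambda>n. (cmod (f (n,j) x))^2) summable_on UNIV" "(\<lambda>n. (cmod (f' (n,j) x))^2) summable_on UNIV"
proof -
  let ?g = "\<lambda>n. 200 * (integral {0..1} (\<lambda>t. (cmod (f (n,j) t))^2) + integral {0..1} (\<lambda>t. (cmod (f'' (n,j) t))^2))"
  have g: "?g summable_on UNIV"
    using HdomD(1,2)[OF assms(1)] assms(2) unfolding gL2_def
    by (intro summable_on_cmult_right summable_on_add summable_on_edge[where j=j]) auto
  have E: "(n,j) \<in> Edges" for n using assms(2) by (auto simp: Edges_def)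
  have le: "(cmod (f (n,j) x))^2 + (cmod (f' (n,j) x))^2 \<le> ?g n" for n
    by (rule W22_sobolev[OF HdomD(3)[OF assms(1) E] assms(3)])
  have le1: "(cmod (f (n,j) x))^2 \<le> ?g n" "(cmod (f' (n,j) x))^2 \<le> ?g n" for n
    using le[of n] zero_le_power2[of "cmod (f (n,j) x)"] zero_le_power2[of "cmod (f' (n,j) x)"] by linarith+
  show "(\<lambda>n. (cmod (f (n,j) x))^2) summable_on UNIV" "(\<lambda>n. (cmod (f' (n,j) x))^2) summable_on UNIV"
    by (rule summable_on_comparison_test[OF g]; use le1 in auto)+
qed

section \<open>Eigenvalues and the range of the Lyapunov branches\<close>

context nanotube
begin

lemma Hminus_ivp:
  assumes "Hdom m k f f' f''" "ae_eq (Hminus q f f'' z) g" "\<alpha> \<in> Edges"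
  shows "ivp (pot z) (\<lambda>t. - g \<alpha> t) (f \<alpha>) (f' \<alpha>)"
proof (rule W22_ivp_AE[OF HdomD(3)[OF assms(1,3)]])
  have "AE t in lborel. t \<in> {0..1} \<longrightarrow> Hminus q f f'' z \<alpha> t = g \<alpha> t" using assms(2,3) by (auto simp: ae_eq_def)
  then show "AE t in lborel. t \<in> {0..1} \<longrightarrow> f'' \<alpha> t = pot z t * f \<alpha> t + - g \<alpha> t"
    by eventually_elim (auto simp: Hminus_def pot_def algebra_simps)
qed

text \<open>The vertex operator has trivial kernel among square summable sequences, for every
  \<open>z\<close>. This replaces injectivity arguments for the differential operator later
  on.\<close>

lemma vertex_recurrence_vanishes:
  fixes A :: "int \<Rightarrow> complex"
  assumes "\<And>n. sg * A (n+1) + cnj sg * A (n-1) - 4 * of_real (cN m k) * F z * A n = 0"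
    "(\<lambda>n. (cmod (A n))^2) summable_on UNIV"
  shows "A n = 0"
proof -
  have "gauge n * A n = 0"
  proof (rule int_recurrence_vanishes[where F="F z" and v="\<lambda>n. gauge n * A n"])
    fix n
    have "gauge (n+1) * A (n+1) + gauge (n-1) * A (n-1) - 2 * F z * (gauge n * A n) = 0"
      using assms(1)[of n] cN_nz unfolding gauge_recurrence by simp
    then show "gauge (n+1) * A (n+1) + gauge (n-1) * A (n-1) = 2 * F z * (gauge n * A n)" by (simp only: right_minus_eq)
  next
    have l2: "(\<lambda>n. (cmod (gauge n * A n))^2) summable_on UNIV" using assms(2) by (simp add: norm_mult)
    show "(\<lambda>n. gauge (int n) * A (int n)) \<longlonglongrightarrow> 0" "(\<lambda>n. gauge (- int n) * A (- int n)) \<longlonglongrightarrow> 0"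
      using l2_int_tendsto_0[OF l2, of int] l2_int_tendsto_0[OF l2, of "\<lambda>n. - int n"] by (auto simp: inj_on_def)
  qed
  then show ?thesis by simp
qed

text \<open>The vertex values form square summable solutions of the homogeneous recurrence, hence
  vanish; where \<open>phi1\<close> is nonzero, an edge solution with zero end values is
  zero.\<close>

lemma no_eigenfunction:
  assumes z: "phi1 q z \<noteq> 0" and f: "Hdom m k f f' f''" "ae_eq (Hminus q f f'' z) (\<lambda>_ _. 0)"
    and \<alpha>: "\<alpha> \<in> Edges" and t: "t \<in> {0..1}"
  shows "f \<alpha> t = 0"
proof -
  have i: "ivp (pot z) (\<lambda>_. 0) (f \<alpha>) (f' \<alpha>)" if "\<alpha> \<in> Edges" for \<alpha>
    using Hminus_ivp[OF f that] by simp
  then have gs: "gsol q m k z f f'" using HdomD(4,5)[OF f(1)] by (simp add: gsol_def sol_iff)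
  define A B where "A n = f (n,1) 0" and "B n = f (n,2) 0" for n
  have sys: "B (n-1) + sg * B n - pA z * A n = 0" "A (n+1) + cnj sg * A n - pB z * B n = 0" for n
    using gsol_vertex[OF gs] by (simp_all add: A_def B_def)
  have A0: "A n = 0" for n
  proof (rule vertex_recurrence_vanishes)
    show "sg * A (n+1) + cnj sg * A (n-1) - 4 * of_real (cN m k) * F z * A n = 0" for n
      using vertex_system_A[where d="\<lambda>_. 0" and e="\<lambda>_. 0", OF sys] by simp
    show "(\<lambda>n. (cmod (A n))^2) summable_on UNIV" unfolding A_def by (rule Hdom_boundary_l2[OF f(1)]) auto
  qed
  have B0: "B n = 0" for n
  proof (rule vertex_recurrence_vanishes)
    show "sg * B (n+1) + cnj sg * B (n-1) - 4 * of_real (cN m k) * F z * B n = 0" for n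
      using vertex_system_B[where d="\<lambda>_. 0" and e="\<lambda>_. 0", OF sys] by simp
    show "(\<lambda>n. (cmod (B n))^2) summable_on UNIV" unfolding B_def by (rule Hdom_boundary_l2[OF f(1)]) auto
  qed
  obtain n j where nj: "\<alpha> = (n, j)" "j \<in> {0,1,2}" using \<alpha> by (auto simp: Edges_def)
  have "f \<alpha> 0 = 0" "f \<alpha> 1 = 0"
    using K0D[OF HdomD(4)[OF f(1)], of n] nj A0[of n] B0[of n] B0[of "n-1"] by (auto simp: A_def B_def)
  with ivp_endpoint_scaled(1)[OF i[OF \<alpha>]] z have "f' \<alpha> 0 = 0" by simp
  with ivp_eq_fund(1)[OF i[OF \<alpha>] t] \<open>f \<alpha> 0 = 0\<close> show ?thesis by simp
qed

lemma flat_band: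
  assumes z: "phi1 q z = 0" shows "z \<in> Heigen q m k"
proof -
  define \<kappa> where "\<kappa> = phi1' q z"
  \<comment> \<open>Multiples of \<open>ph z\<close> satisfy \<open>K0\<close> trivially, as
    \<open>ph z\<close> vanishes at both ends; the coefficients solve \<open>K1\<close> on two
    neighbouring cells. Starting from 1 on \<open>(0,2)\<close>, the first conditions give
    \<open>(0,1)\<close> and \<open>(1,0)\<close>, and requiring zero on \<open>(2,0)\<close> fixes
    \<open>(1,1)\<close> and \<open>(1,2)\<close>; these formulas remain valid when
    \<open>s * \<kappa>^2 = 1\<close>.\<close>
  define c :: "int \<times> nat \<Rightarrow> complex" where
    "c \<alpha> = (if \<alpha> = (0,2) then 1 else if \<alpha> = (0,1) then s * \<kappa> else if \<alpha> = (1,0) then s * \<kappa>^2 - 1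
      else if \<alpha> = (1,1) then - \<kappa> else if \<alpha> = (1,2) then - (\<kappa>^2) else 0)" for \<alpha>
  define f where "f \<alpha> t = c \<alpha> * ph z t" for \<alpha> t
  define f' where "f' \<alpha> t = c \<alpha> * ph' z t" for \<alpha> t
  define f'' where "f'' \<alpha> t = pot z t * f \<alpha> t + 0" for \<alpha> t
  have ends: "ph z 0 = 0" "ph z 1 = 0" "ph' z 0 = 1" "ph' z 1 = \<kappa>"
    using z by (auto simp: fund_0 phi1_def \<kappa>_def phi1'_def)
  have i: "ivp (pot z) (\<lambda>_. 0) (f \<alpha>) (f' \<alpha>)" for \<alpha>
    using ivp_lincomb_fund[of z 0 "c \<alpha>"] by (simp add: f_def[abs_def] f'_def[abs_def])
  have W: "W22 (f \<alpha>) (f' \<alpha>) (f'' \<alpha>)" for \<alpha>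
    unfolding f''_def[abs_def] by (rule ivp_W22[OF pot_L2 _ i]) simp
  let ?X = "{(0,2),(0,1),(1,0),(1,1),(1,2)} :: (int \<times> nat) set"
  have c0: "c \<alpha> = 0" if "\<alpha> \<notin> ?X" for \<alpha> using that by (auto simp: c_def)
  have gf: "gL2 f"
    by (rule finite_support_gL2[where X="?X"]) (auto simp: f_def c0 intro!: edge_L2_continuous ivp_continuous(2)[OF i])
  have "gL2 f''"
  proof (rule finite_support_gL2[where X="?X"])
    show "f'' \<alpha> t = 0" if "\<alpha> \<in> Edges - ?X" for \<alpha> t
      using c0[of \<alpha>] that by (simp add: f''_def f_def)
  qed (simp_all add: W22D(1)[OF W])
  moreover have "K0 m k f" by (simp add: K0_def f_def ends)
  moreover have "K1 m k f'"
    unfolding K1_def f'_def ends s_def[symmetric]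
  proof (intro allI)
    fix n :: int
    consider "n = 0" | "n = 1" | "n = -1" | "n \<noteq> 0" "n \<noteq> 1" "n \<noteq> -1" by blast
    then show "- (c (n,0) * \<kappa>) + c (n,1) * 1 - s * (c (n,2) * \<kappa>) = 0 \<and> c (n+1,0) * 1 - c (n,1) * \<kappa> + c (n,2) * 1 = 0"
      by cases (auto simp: c_def power2_eq_square algebra_simps)
  qed
  ultimately have dom: "Hdom m k f f' f''" using gf W by (simp add: Hdom_def)
  have "gnorm f \<noteq> 0"
  proof
    assume "gnorm f = 0"
    from gnorm_eq_0[OF gf this, of "(0,2)"] have "integral {0..1} (\<lambda>t. (cmod (ph z t))^2) = 0"
      by (simp add: Edges_def f_def c_def)
    then have "ph z t = 0" if "t \<in> {0..1}" for t
      using L2_zero_imp_zero[OF fund_continuous(1) _ that] by blast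
    then have "ph' z 0 = 0" by (rule ivp_zero_derivative[OF fund_ivp]) auto
    then show False by (simp add: ends)
  qed
  moreover have "ae_eq (Hminus q f f'' z) (\<lambda>_ _. 0)"
    by (simp add: ae_eq_def Hminus_def f''_def pot_def)
  ultimately show ?thesis using dom unfolding Heigen_def by blast
qed

lemma Heigen_eq: "Heigen q m k = sigmaD q"
proof
  show "sigmaD q \<subseteq> Heigen q m k" using flat_band by (auto simp: sigmaD_def)
  show "Heigen q m k \<subseteq> sigmaD q"
  proof
    fix z assume "z \<in> Heigen q m k"
    then obtain f f' f'' where f: "Hdom m k f f' f''" "gnorm f \<noteq> 0" "ae_eq (Hminus q f f'' z) (\<lambda>_ _. 0)"
      unfolding Heigen_def by blast
    show "z \<in> sigmaD q"
    proof (rule ccontr)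
      assume "z \<notin> sigmaD q"
      then have "f \<alpha> t = 0" if "\<alpha> \<in> Edges" "t \<in> {0..1}" for \<alpha> t
        using no_eigenfunction[OF _ f(1,3) that] by (simp add: sigmaD_def)
      then have "gnorm f = 0"
        by (intro gnorm_zero integral_unique has_integral_is_0) simp
      then show False using f(2) by simp
    qed
  qed
qed

lemma closed_sigmaD: "closed (sigmaD q)"
proof -
  have "continuous_on UNIV (phi1 q)" by (intro holomorphic_on_imp_continuous_on holomorphic_endpoints)
  then have "closed (phi1 q -` {0})" by (intro closed_vimage) auto
  then show ?thesis by (simp add: sigmaD_def vimage_def)
qed

lemma Hpp_eq: "Hpp q m k = sigmaD q"
  unfolding Hpp_def Heigen_eq by (simp add: closed_sigmaD)

text \<open>\<open>phi1 q\<close> is entire and nonzero at nonreal points, so its zeros are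
  isolated. The disc is punctured: \<open>z\<close> itself may be a zero.\<close>

lemma sigmaD_isolated:
  obtains r where "0 < r" "\<And>w. w \<noteq> z \<Longrightarrow> dist w z < r \<Longrightarrow> phi1 q w \<noteq> 0"
proof (cases "phi1 q z = 0")
  case False
  have "isCont (phi1 q) z" using holomorphic_on_imp_continuous_on[OF holomorphic_endpoints(2)[of UNIV]]
    by (simp add: continuous_on_eq_continuous_at)
  then have "\<forall>\<^sub>F w in at z. phi1 q w \<noteq> 0" using False by (auto simp: isCont_def intro: tendsto_imp_eventually_ne)
  then show ?thesis using that unfolding eventually_at by auto
next
  case True
  have "\<not> phi1 q constant_on UNIV"
    using True phi1_nonreal[of \<i>] unfolding constant_on_def by (metis UNIV_I imaginary_unit.simps(2) zero_neq_one)
  then obtain w where "phi1 q w \<noteq> 0" using phi1_nonreal[of \<i>] by force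
  then obtain r where "0 < r" "\<And>w. w \<in> ball z r - {z} \<Longrightarrow> phi1 q w \<noteq> 0"
    using isolated_zeros[OF holomorphic_endpoints(2)[of UNIV] open_UNIV connected_UNIV _ True] by auto
  then show ?thesis using that by (auto simp: dist_commute)
qed

text \<open>Expanding gives F^2 - 2 \<gamma> c F + \<gamma>^2 = s^2, symmetric in \<gamma> and
  \<open>F\<close>; here c = cos al, s = sin al. Solved for \<open>F\<close> it reads (F - \<gamma>
  c)^2 = s^2 (1 - \<gamma>^2), so \<open>F\<close> is real; solved for \<gamma> it reads (\<gamma> -
  c F)^2 = s^2 (1 - F^2), so |F| \<le> 1. When s = 0 the relation is \<gamma> = c F with |c| =
  1.\<close>

lemma branch_real:
  assumes "(of_real \<gamma> - xi q m k z)^2 = rho q m k z" "\<bar>\<gamma>\<bar> \<le> 1"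
  shows "F z \<in> \<real>" "\<bar>Re (F z)\<bar> \<le> 1"
proof -
  let ?c = "cN m k" and ?s = "sNk m k"
  have rho: "rho q m k z = of_real (?s^2) * (1 - (F z)^2)"
    using cN_nz unfolding rho_def xi_F by (simp add: field_simps)
  have cs: "complex_of_real (?c^2) + of_real (?s^2) = 1" using cN_sNk by (metis of_real_1 of_real_add)
  have "(of_real \<gamma> - of_real ?c * F z)^2 = of_real (?s^2) * (1 - (F z)^2)" using assms(1) unfolding rho xi_F .
  then have "(F z)^2 * (of_real (?c^2) + of_real (?s^2)) - 2 * of_real \<gamma> * of_real ?c * F z + (of_real \<gamma>)^2 = of_real (?s^2)"
    by (simp add: power2_eq_square algebra_simps)
  then have q: "(F z)^2 - 2 * of_real \<gamma> * of_real ?c * F z + (of_real \<gamma>)^2 = of_real (?s^2)" by (simp only: cs mult_1_right)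
  have "(F z - of_real (\<gamma> * ?c))^2 = of_real (?s^2) - (of_real \<gamma>)^2 + (of_real (\<gamma> * ?c))^2"
    unfolding q[symmetric] by (simp add: power2_eq_square algebra_simps)
  also have "\<dots> = of_real (?s^2 - \<gamma>^2 + \<gamma>^2 * ?c^2)" by (simp add: power_mult_distrib)
  also have "?s^2 - \<gamma>^2 + \<gamma>^2 * ?c^2 = ?s^2 * (1 - \<gamma>^2)"
  proof -
    have "?c^2 = 1 - ?s^2" using cN_sNk by simp
    then show ?thesis unfolding \<open>?c^2 = 1 - ?s^2\<close> by (simp add: algebra_simps)
  qed
  finally have sq: "(F z - of_real (\<gamma> * ?c))^2 = of_real (?s^2 * (1 - \<gamma>^2))" .
  have "\<gamma>^2 \<le> 1" using assms(2) by (simp add: abs_square_le_1)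
  then have nn: "0 \<le> ?s^2 * (1 - \<gamma>^2)" by simp
  have "(F z - of_real (\<gamma> * ?c))^2 = (of_real (sqrt (?s^2 * (1 - \<gamma>^2))))^2"
    unfolding sq of_real_power[symmetric] using nn by simp
  then have "F z - of_real (\<gamma> * ?c) = of_real (sqrt (?s^2 * (1 - \<gamma>^2))) \<or> F z - of_real (\<gamma> * ?c) = - of_real (sqrt (?s^2 * (1 - \<gamma>^2)))"
    by (simp only: power2_eq_iff)
  then have "F z - of_real (\<gamma> * ?c) \<in> \<real>" by auto
  then have "F z - of_real (\<gamma> * ?c) + of_real (\<gamma> * ?c) \<in> \<real>" by (intro Reals_add) auto
  then show R: "F z \<in> \<real>" by simp
  then obtain X where X: "F z = of_real X" by (auto elim: Reals_cases)
  have "(\<gamma> - ?c * X)^2 = ?s^2 * (1 - X^2)"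
  proof -
    have "complex_of_real ((\<gamma> - ?c * X)^2) = of_real (?s^2 * (1 - X^2))"
      using assms(1) unfolding rho xi_F X by simp
    then show ?thesis by (simp only: of_real_eq_iff)
  qed
  then have le: "0 \<le> ?s^2 * (1 - X^2)" "?s = 0 \<Longrightarrow> \<gamma> = ?c * X" using zero_le_power2[of "\<gamma> - ?c * X"] by auto
  have "X^2 \<le> 1"
  proof (cases "?s = 0")
    case True
    then have "?c^2 = 1" using cN_sNk by simp
    then have "X^2 = \<gamma>^2" using le(2)[OF True] by (simp add: power_mult_distrib)
    then show ?thesis using \<open>\<gamma>^2 \<le> 1\<close> by simp
  next
    case False
    then have "0 < ?s^2" by simp
    then show ?thesis using le(1) by (simp add: zero_le_mult_iff)
  qed
  then show "\<bar>Re (F z)\<bar> \<le> 1" by (simp add: X abs_square_le_1)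
qed

lemma band_iff:
  "(\<exists>r. r^2 = rho q m k (of_real x) \<and> Im (xi q m k (of_real x) + r) = 0 \<and> \<bar>Re (xi q m k (of_real x) + r)\<bar> \<le> 1)
    \<longleftrightarrow> \<bar>Re (F (of_real x))\<bar> \<le> 1"
proof
  assume "\<exists>r. r^2 = rho q m k (of_real x) \<and> Im (xi q m k (of_real x) + r) = 0 \<and> \<bar>Re (xi q m k (of_real x) + r)\<bar> \<le> 1"
  then obtain r where r: "r^2 = rho q m k (of_real x)" "Im (xi q m k (of_real x) + r) = 0" "\<bar>Re (xi q m k (of_real x) + r)\<bar> \<le> 1"
    by blast
  have "of_real (Re (xi q m k (of_real x) + r)) - xi q m k (of_real x) = r"
    using r(2) by (simp add: complex_eq_iff)
  then show "\<bar>Re (F (of_real x))\<bar> \<le> 1" using branch_real(2)[OF _ r(3)] r(1) by simp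
next
  let ?c = "cN m k" and ?s = "sNk m k"
  assume le: "\<bar>Re (F (of_real x))\<bar> \<le> 1"
  define X where "X = Re (F (of_real x))"
  have X: "F (of_real x) = of_real X" using F_Reals[of "of_real x"] by (simp add: X_def)
  have X1: "X^2 \<le> 1" using le by (simp add: X_def abs_square_le_1)
  have rho: "rho q m k (of_real x) = of_real (?s^2 * (1 - X^2))"
    using cN_nz unfolding rho_def xi_F X by (simp add: field_simps)
  let ?r = "complex_of_real (?s * sqrt (1 - X^2))"
  have "?r^2 = rho q m k (of_real x)"
    unfolding rho of_real_power[symmetric] using X1 by (simp add: power_mult_distrib)
  moreover have "xi q m k (of_real x) + ?r = of_real (?c * X + ?s * sqrt (1 - X^2))" unfolding xi_F X by simp
  moreover have "(?c * X + ?s * sqrt (1 - X^2))^2 \<le> 1"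
  proof -
    define Y where "Y = sqrt (1 - X^2)"
    have Y: "X^2 + Y^2 = 1" using X1 by (simp add: Y_def)
    \<comment> \<open>The vectors (c, s) and (X, Y) are unit vectors; the value of the branch is
      their scalar product.\<close>
    have "(?c * X + ?s * Y)^2 + (?c * Y - ?s * X)^2 = (?c^2 + ?s^2) * (X^2 + Y^2)"
      by (simp add: power2_eq_square algebra_simps)
    also have "\<dots> = 1" by (simp add: cN_sNk Y)
    finally show ?thesis using zero_le_power2[of "?c * Y - ?s * X"] unfolding Y_def by linarith
  qed
  ultimately show "\<exists>r. r^2 = rho q m k (of_real x) \<and> Im (xi q m k (of_real x) + r) = 0 \<and> \<bar>Re (xi q m k (of_real x) + r)\<bar> \<le> 1"
    by (intro exI[of _ ?r]) (auto simp: abs_square_le_1)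
qed

text \<open>A value of the branch in (-1,1) at a nonreal point would put \<open>F\<close> in [-1,1]
  there, which \<open>F_nonreal\<close> excludes; the local argument for
  \<open>deriv_nonzero_of_real_preimages\<close> then applies to the branch itself.\<close>

lemma branch_deriv_nonzero:
  assumes "open S" "of_real x \<in> S" "g holomorphic_on S" "\<And>z. z \<in> S \<Longrightarrow> (g z - xi q m k z)^2 = rho q m k z"
    "Im (g (of_real x)) = 0" "\<bar>Re (g (of_real x))\<bar> < 1"
  shows "deriv g (of_real x) \<noteq> 0"
proof (rule deriv_nonzero_of_real_preimages[OF assms(1-3) _ assms(5,6)])
  fix w assume w: "w \<in> S" "Im w \<noteq> 0" "Im (g w) = 0" "\<bar>Re (g w)\<bar> < 1"
  have "g w = of_real (Re (g w))" using w(3) by (simp add: complex_eq_iff)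
  then have "(of_real (Re (g w)) - xi q m k w)^2 = rho q m k w" using assms(4)[OF w(1)] by simp
  from branch_real[OF this] w(4) F_nonreal[OF w(2)] show False by auto
qed

section \<open>The monodromy matrix and its eigenvalues\<close>

lemma gsol_step:
  assumes z: "phi1 q z \<noteq> 0" and f: "gsol q m k z f f'"
  shows "f (1,0) 0 = ((pA z * theta1 q z - 1) * f (0,0) 0 + pA z * phi1 q z * f' (0,0) 0) / sg"
    "f' (1,0) 0 = ((pB z - theta1 q z) * f (1,0) 0 - cnj sg * (theta1 q z * f (0,0) 0 + phi1 q z * f' (0,0) 0)) / phi1 q z"
proof -
  have K: "K0 m k f" and i: "\<And>n. ivp (pot z) (\<lambda>_. 0) (f (n,0)) (f' (n,0))"
    using f by (auto simp: gsol_def sol_iff Edges_iff)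
  note k0 = K0D[OF K]
  have A0: "f (0,1) 0 = theta1 q z * f (0,0) 0 + phi1 q z * f' (0,0) 0"
    using ivp_endpoint(1)[OF i[of 0]] k0(1)[of 0] by simp
  have B: "f (1,0) 0 = f (0,2) 0" using k0(4)[of 1] by simp
  have "sg * f (0,2) 0 = pA z * f (0,1) 0 - f (0,0) 0"
    using gsol_vertex(1)[OF f, of 0] k0(4)[of 0] by (simp add: algebra_simps)
  then show "f (1,0) 0 = ((pA z * theta1 q z - 1) * f (0,0) 0 + pA z * phi1 q z * f' (0,0) 0) / sg"
    using sg_nz unfolding B A0 by (simp add: field_simps)
  have "f (1,1) 0 = pB z * f (0,2) 0 - cnj sg * f (0,1) 0" using gsol_vertex(2)[OF f, of 0] by (simp add: algebra_simps)
  then have "phi1 q z * f' (1,0) 0 = pB z * f (0,2) 0 - cnj sg * f (0,1) 0 - theta1 q z * f (0,2) 0"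
    using ivp_endpoint_scaled(1)[OF i[of 1]] k0(1)[of 1] B by simp
  then show "f' (1,0) 0 = ((pB z - theta1 q z) * f (1,0) 0 - cnj sg * (theta1 q z * f (0,0) 0 + phi1 q z * f' (0,0) 0)) / phi1 q z"
    using z unfolding A0[symmetric] B by (simp add: field_simps)
qed

text \<open>Since \<open>sg\<close> is nonzero, the vertex system determines each pair of
  neighbouring vertex values from the preceding one by a bijection \<open>T\<close>; a two-sided
  orbit of \<open>T\<close> gives the whole solution.\<close>

lemma gsol_exists:
  assumes z: "phi1 q z \<noteq> 0"
  shows "\<exists>f f'. gsol q m k z f f' \<and> f (0,0) 0 = a \<and> f' (0,0) 0 = b"
proof -
  \<comment> \<open>The state is the pair (B (n-1), A n), mapped to (B n, A (n+1)). The initial data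
    on edge \<open>(0,0)\<close> fix it at n = 0.\<close>
  define T where "T = (\<lambda>(b, a). ((pA z * a - b) / sg, pB z * ((pA z * a - b) / sg) - cnj sg * a))"
  define T' where "T' = (\<lambda>(b', a'). (pA z * ((pB z * b' - a') / cnj sg) - sg * b', (pB z * b' - a') / cnj sg))"
  have "bij T"
  proof (rule bij_betw_byWitness[where f'=T'])
    show "\<forall>p\<in>UNIV. T' (T p) = p" "\<forall>p\<in>UNIV. T (T' p) = p" using sg_nz by (auto simp: T_def T'_def)
  qed auto
  from int_orbit[OF this, of "(a, theta1 q z * a + phi1 q z * b)"] obtain x :: "int \<Rightarrow> complex \<times> complex"
    where x: "x 0 = (a, theta1 q z * a + phi1 q z * b)" "\<And>n. x (n + 1) = T (x n)" by blast
  define A B where "A n = snd (x n)" and "B n = fst (x (n + 1))" for n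
  have B: "B n = (pA z * A n - B (n-1)) / sg" for n
    using x(2)[of n] by (simp add: A_def B_def T_def case_prod_beta)
  have A: "A (n+1) = pB z * B n - cnj sg * A n" for n
    using x(2)[of n] by (simp add: A_def B_def T_def case_prod_beta)
  have sys: "B (n-1) + sg * B n = pA z * A n" "A (n+1) + cnj sg * A n = pB z * B n" for n
  proof -
    show "B (n-1) + sg * B n = pA z * A n" using sg_nz B[of n] by (simp add: field_simps)
    show "A (n+1) + cnj sg * A n = pB z * B n" using A[of n] by simp
  qed
  have v: "A 0 = theta1 q z * a + phi1 q z * b" "B (-1) = a" using x(1) by (simp_all add: A_def B_def)
  have "gfun z A B (\<lambda>_ _. 0) (0,0) 0 = a" "gfun' z A B (\<lambda>_ _. 0) (\<lambda>_ _. 0) (0,0) 0 = b"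
    using gfun_boundary[OF z, where w="\<lambda>_ _. 0" and w'="\<lambda>_ _. 0" and A=A and B=B and \<alpha>="(0,0)"] z v
    by (simp_all add: slope_def bvalL_def bvalR_def)
  then show ?thesis using gfun_homogeneous[OF z sys] by blast
qed

text \<open>The determinant \<open>cnj sg / sg\<close> equals 1 / s. Unless it is 1, the eigenvalues
  are not mutually inverse, which is how one matrix yields two different Lyapunov values.\<close>

lemma monodromy_trace_det:
  assumes z: "phi1 q z \<noteq> 0" and M: "monodromy q m k z = (a, b, c, d)"
  shows "a + d = 4 * xi q m k z / sg" "a * d - b * c = cnj sg / sg"
proof -
  define a0 b0 c0 d0 where "a0 = (pA z * theta1 q z - 1) / sg" and "b0 = pA z * phi1 q z / sg"
    and "c0 = ((pB z - theta1 q z) * a0 - cnj sg * theta1 q z) / phi1 q z"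
    and "d0 = ((pB z - theta1 q z) * b0 - cnj sg * phi1 q z) / phi1 q z"
  obtain f f' g g' where f: "gsol q m k z f f'" "f (0,0) 0 = 1" "f' (0,0) 0 = 0"
    and g: "gsol q m k z g g'" "g (0,0) 0 = 0" "g' (0,0) 0 = 1"
    using gsol_exists[OF z, of 1 0] gsol_exists[OF z, of 0 1] by blast
  have uniq: "(f (1,0) 0, g (1,0) 0, f' (1,0) 0, g' (1,0) 0) = (a0, b0, c0, d0)"
    if "gsol q m k z f f'" "f (0,0) 0 = 1" "f' (0,0) 0 = 0" "gsol q m k z g g'" "g (0,0) 0 = 0" "g' (0,0) 0 = 1" for f f' g g'
    using gsol_step[OF z that(1)] gsol_step[OF z that(4)] that
    by (simp add: a0_def b0_def c0_def d0_def)
  have "monodromy q m k z = (a0, b0, c0, d0)"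
    unfolding monodromy_def
  proof (rule the_equality)
    show "\<exists>f f' g g'. gsol q m k z f f' \<and> f (0, 0) 0 = 1 \<and> f' (0, 0) 0 = 0 \<and> gsol q m k z g g' \<and> g (0, 0) 0 = 0 \<and>
       g' (0, 0) 0 = 1 \<and> (a0, b0, c0, d0) = (f (1, 0) 0, g (1, 0) 0, f' (1, 0) 0, g' (1, 0) 0)"
      using f g uniq[OF f g] by metis
  qed (use uniq in metis)
  with M have e: "a = a0" "b = b0" "c = c0" "d = d0" by auto
  have d': "d0 = (pB z - theta1 q z) * pA z / sg - cnj sg"
  proof -
    have "(pB z - theta1 q z) * b0 - cnj sg * phi1 q z = ((pB z - theta1 q z) * pA z / sg - cnj sg) * phi1 q z"
      by (simp add: b0_def left_diff_distrib)
    then show ?thesis using z unfolding d0_def by simp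
  qed
  have "a + d = (pA z * pB z - 1 - sg * cnj sg) / sg"
    unfolding e d' a0_def using sg_nz by (simp add: field_simps)
  then show "a + d = 4 * xi q m k z / sg" unfolding pA_pB_F xi_F by simp
  have "a * d - b * c = cnj sg * (theta1 q z * b0 - phi1 q z * a0) / phi1 q z"
    unfolding e c0_def d0_def using z by (simp add: field_simps)
  also have "theta1 q z * b0 - phi1 q z * a0 = phi1 q z / sg"
    using sg_nz by (simp add: a0_def b0_def field_simps)
  finally show "a * d - b * c = cnj sg / sg" using z by simp
qed

text \<open>The product 1 / e^2 of the eigenvalues turns 1 / t1 into e^2 t2 and conversely. So sum
  and difference of the two Lyapunov values are (1 + e^2) (t1 + t2) / 2 and (1 - e^2) (t1 - t2) / 2;
  the trace gives the sum, and the discriminant gives the square of the difference as 4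
  \<open>rho\<close>.\<close>

lemma lyapunov_branches:
  assumes z: "phi1 q z \<noteq> 0" and M: "monodromy q m k z = (a, b, c, d)"
    and t: "t1 + t2 = a + d" "t1 * t2 = a * d - b * c" and r: "r^2 = rho q m k z"
  shows "((t1 + 1/t1) / 2 = xi q m k z + r \<and> (t2 + 1/t2) / 2 = xi q m k z - r) \<or>
    ((t1 + 1/t1) / 2 = xi q m k z - r \<and> (t2 + 1/t2) / 2 = xi q m k z + r)"
proof -
  define e where "e = cis al"
  let ?c = "complex_of_real (cN m k)" and ?s = "complex_of_real (sNk m k)"
  have en: "e \<noteq> 0" "cnj e * e = 1" by (simp_all add: e_def cis_cnj cis_mult)
  have se: "s = e^2" by (simp add: s_cis e_def power2_eq_square cis_mult)
  have sge: "sg = 2 * ?c * e" by (simp add: sg_cis e_def)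
  have cn: "?c \<noteq> 0" using cN_nz by simp
  have sum: "t1 + t2 = 2 * xi q m k z / (?c * e)"
    using monodromy_trace_det(1)[OF z M] t(1) by (simp add: sge)
  have "cnj sg / sg = cnj e / e" unfolding sge using cn en by simp
  also have "\<dots> = cnj e * e / e^2" using en(1) by (metis mult_divide_mult_cancel_right power2_eq_square)
  finally have prod: "t1 * t2 = 1 / e^2"
    using monodromy_trace_det(2)[OF z M] t(2) en by simp
  then have nz: "t1 \<noteq> 0" "t2 \<noteq> 0" using en by auto
  have inv: "1 / t1 = e^2 * t2" "1 / t2 = e^2 * t1" using prod nz en by (simp_all add: field_simps)
  have "1 - e^2 = - 2 * \<i> * ?s * e"
    unfolding se[symmetric] s_cis by (simp add: e_def sNk_al complex_eq_iff cos_double_sin sin_double power2_eq_square)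
  define D1 D2 where "D1 = (t1 + 1/t1) / 2" and "D2 = (t2 + 1/t2) / 2"
  have "D1 + D2 = (1 + e^2) * (t1 + t2) / 2" unfolding D1_def D2_def inv by (simp add: algebra_simps add_divide_distrib)
  also have "1 + e^2 = 2 * ?c * e" using sge se by (simp add: sg_def)
  also have "2 * ?c * e * (t1 + t2) / 2 = 2 * xi q m k z" unfolding sum using cn en by simp
  finally have plus: "D1 + D2 = 2 * xi q m k z" .
  have "D1 - D2 = (1 - e^2) * (t1 - t2) / 2" unfolding D1_def D2_def inv by (simp add: algebra_simps add_divide_distrib diff_divide_distrib)
  also have "\<dots> = - \<i> * ?s * (e * (t1 - t2))" unfolding \<open>1 - e^2 = - 2 * \<i> * ?s * e\<close> by simp
  finally have "(D1 - D2)^2 = - (?s^2) * (e * (t1 - t2))^2" by (simp add: power_mult_distrib)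
  also have "(e * (t1 - t2))^2 = (e * (t1 + t2))^2 - 4 * (e^2 * (t1 * t2))" by (simp add: power2_eq_square algebra_simps)
  also have "e * (t1 + t2) = 2 * xi q m k z / ?c" unfolding sum using en by simp
  also have "e^2 * (t1 * t2) = 1" unfolding prod using en by simp
  also have "- (?s^2) * ((2 * xi q m k z / ?c)^2 - 4 * 1) = 4 * rho q m k z"
    unfolding rho_def using cn by (simp add: field_simps)
  finally have "(D1 - D2)^2 = (2 * r)^2" by (simp add: r power_mult_distrib)
  then have "D1 - D2 = 2 * r \<or> D1 - D2 = - (2 * r)" by (simp only: power2_eq_iff)
  then have "D1 = xi q m k z + r \<and> D2 = xi q m k z - r \<or> D1 = xi q m k z - r \<and> D2 = xi q m k z + r"
    using half_sum_diff[OF plus, of r] half_sum_diff[OF plus, of "- r"] by auto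
  then show ?thesis unfolding D1_def D2_def .
qed

end

subsection \<open>The resolvent outside the bands\<close>

lemma infsum_Cauchy_Schwarz:
  fixes a b :: "'a \<Rightarrow> real"
  assumes a: "\<And>x. 0 \<le> a x" "a summable_on UNIV" and ab: "(\<lambda>x. a x * (b x)^2) summable_on UNIV" and b: "\<And>x. 0 \<le> b x"
  shows "(\<lambda>x. a x * b x) summable_on UNIV"
    "(infsum (\<lambda>x. a x * b x) UNIV)^2 \<le> infsum a UNIV * infsum (\<lambda>x. a x * (b x)^2) UNIV"
proof -
  show s: "(\<lambda>x. a x * b x) summable_on UNIV"
  proof (rule summable_on_comparison_test[OF summable_on_add[OF a(2) ab]])
    fix x
    have "b x \<le> 1 + (b x)^2" using mult_le_sum_squares[of 1 "b x"] by simp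
    from mult_left_mono[OF this a(1)[of x]] show "a x * b x \<le> a x + a x * (b x)^2" by (simp add: distrib_left)
  qed (use a b in auto)
  let ?A = "infsum a UNIV" and ?B = "infsum (\<lambda>x. a x * (b x)^2) UNIV"
  have A0: "0 \<le> ?A" "0 \<le> ?B" using a(1) by (auto intro!: infsum_nonneg)
  have "infsum (\<lambda>x. a x * b x) UNIV \<le> sqrt (?A * ?B)"
  proof (rule infsum_le_finite_sums[OF s])
    fix X :: "'a set" assume X: "finite X"
    have "(\<Sum>x\<in>X. a x * b x) = (\<Sum>x\<in>X. sqrt (a x) * (sqrt (a x) * b x))"
      using a(1) by (simp add: mult.assoc[symmetric])
    then have "(\<Sum>x\<in>X. a x * b x)^2 \<le> (\<Sum>x\<in>X. (sqrt (a x))^2) * (\<Sum>x\<in>X. (sqrt (a x) * b x)^2)"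
      using Cauchy_Schwarz_ineq_sum[of "\<lambda>x. sqrt (a x)" "\<lambda>x. sqrt (a x) * b x" X] by simp
    also have "\<dots> = (\<Sum>x\<in>X. a x) * (\<Sum>x\<in>X. a x * (b x)^2)" using a(1) by (simp add: power_mult_distrib)
    also have "\<dots> \<le> ?A * ?B"
      using A0 a ab X by (intro mult_mono finite_sum_le_infsum sum_nonneg) auto
    finally show "(\<Sum>x\<in>X. a x * b x) \<le> sqrt (?A * ?B)" by (rule real_le_rsqrt)
  qed
  moreover have "0 \<le> infsum (\<lambda>x. a x * b x) UNIV" using a(1) b by (auto intro!: infsum_nonneg)
  ultimately have "(infsum (\<lambda>x. a x * b x) UNIV)^2 \<le> (sqrt (?A * ?B))^2" by (intro power_mono)
  then show "(infsum (\<lambda>x. a x * b x) UNIV)^2 \<le> ?A * ?B" using A0 by simp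
qed

lemma summable_geometric_int:
  assumes "0 \<le> (\<kappa>::real)" "\<kappa> < 1"
  shows "(\<lambda>n::int. \<kappa> ^ nat \<bar>n\<bar>) summable_on UNIV"
proof -
  have U: "(UNIV :: int set) = range int \<union> range (\<lambda>n. - int (Suc n))"
  proof -
    have "n \<in> range int \<union> range (\<lambda>n. - int (Suc n))" for n by (cases n) auto
    then show ?thesis by auto
  qed
  have "(\<lambda>n. \<kappa> ^ n) summable_on UNIV" "(\<lambda>n. \<kappa> ^ Suc n) summable_on UNIV"
    using assms by (auto simp: summable_on_UNIV_nonneg_real_iff summable_mult)
  then have "(\<lambda>n::int. \<kappa> ^ nat \<bar>n\<bar>) summable_on range int" "(\<lambda>n::int. \<kappa> ^ nat \<bar>n\<bar>) summable_on range (\<lambda>n. - int (Suc n))"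
    by (subst summable_on_reindex; auto simp: inj_on_def o_def nat_add_distrib)+
  then show ?thesis unfolding U by (intro summable_on_Un_disjoint) auto
qed

lemma geometric_int_translate:
  fixes \<kappa> :: real
  assumes "0 \<le> \<kappa>" "\<kappa> < 1"
  shows "((\<lambda>m::int. \<kappa> ^ nat \<bar>n - m\<bar>) has_sum infsum (\<lambda>n::int. \<kappa> ^ nat \<bar>n\<bar>) UNIV) UNIV"
    "((\<lambda>m::int. \<kappa> ^ nat \<bar>m - n\<bar>) has_sum infsum (\<lambda>n::int. \<kappa> ^ nat \<bar>n\<bar>) UNIV) UNIV"
proof -
  have h: "((\<lambda>n::int. \<kappa> ^ nat \<bar>n\<bar>) has_sum infsum (\<lambda>n::int. \<kappa> ^ nat \<bar>n\<bar>) UNIV) UNIV"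
    by (rule has_sum_infsum[OF summable_geometric_int[OF assms]])
  have "bij (\<lambda>m::int. n - m)" "bij (\<lambda>m::int. m - n)"
    by (rule bij_betw_byWitness[where f'="\<lambda>m. n - m"], auto) (rule bij_betw_byWitness[where f'="\<lambda>m. m + n"], auto)
  then show "((\<lambda>m::int. \<kappa> ^ nat \<bar>n - m\<bar>) has_sum infsum (\<lambda>n::int. \<kappa> ^ nat \<bar>n\<bar>) UNIV) UNIV"
    "((\<lambda>m::int. \<kappa> ^ nat \<bar>m - n\<bar>) has_sum infsum (\<lambda>n::int. \<kappa> ^ nat \<bar>n\<bar>) UNIV) UNIV"
    using has_sum_reindex_bij_betw[of "\<lambda>m. n - m" UNIV UNIV "\<lambda>n. \<kappa> ^ nat \<bar>n\<bar>"]
      has_sum_reindex_bij_betw[of "\<lambda>m. m - n" UNIV UNIV "\<lambda>n. \<kappa> ^ nat \<bar>n\<bar>"] h by auto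
qed

text \<open>Summability is bundled with the bound on the squared norm because \<open>infsum\<close>
  defaults to 0 on sequences that are not summable.\<close>

definition l2le :: "(int \<Rightarrow> complex) \<Rightarrow> real \<Rightarrow> bool" where
  "l2le u M \<longleftrightarrow> (\<lambda>n. (cmod (u n))^2) summable_on UNIV \<and> infsum (\<lambda>n. (cmod (u n))^2) UNIV \<le> M"

lemma l2le_dominated:
  assumes "g summable_on UNIV" "infsum g UNIV \<le> M" "\<And>n. (cmod (u n))^2 \<le> g n"
  shows "l2le u M"
proof -
  have s: "(\<lambda>n. (cmod (u n))^2) summable_on UNIV"
    by (rule summable_on_comparison_test[OF assms(1)]) (use assms(3) in auto)
  with infsum_mono[OF s assms(1,3)] assms(2) show ?thesis by (simp add: l2le_def)
qed

lemma l2le_mono: "l2le u M \<Longrightarrow> M \<le> K \<Longrightarrow> l2le u K"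
  by (auto simp: l2le_def)

lemma l2le_add: "l2le u M \<Longrightarrow> l2le v K \<Longrightarrow> l2le (\<lambda>n. u n + v n) (2 * M + 2 * K)"
  unfolding l2le_def[of u] l2le_def[of v]
  by (rule l2le_dominated[where g="\<lambda>n. 2 * (cmod (u n))^2 + 2 * (cmod (v n))^2"])
    (auto intro!: summable_on_add summable_on_cmult_right sq_norm_add_le
      simp: infsum_add[OF summable_on_cmult_right summable_on_cmult_right] infsum_cmult_right')

lemma l2le_cmult: "l2le u M \<Longrightarrow> l2le (\<lambda>n. c * u n) ((cmod c)^2 * M)"
  unfolding l2le_def by (auto simp: norm_mult power_mult_distrib infsum_cmult_right' intro!: summable_on_cmult_right mult_left_mono)

lemma l2le_unimodular: "l2le u M \<Longrightarrow> (\<And>n. cmod (c n) = 1) \<Longrightarrow> l2le (\<lambda>n. c n * u n) M"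
  unfolding l2le_def by (simp add: norm_mult)

lemma l2le_shift: "l2le u M \<Longrightarrow> l2le (\<lambda>n. u (n + a)) M"
proof -
  have "bij (\<lambda>n::int. n + a)" by (rule bij_betw_byWitness[where f'="\<lambda>n. n - a"]) auto
  then show "l2le u M \<Longrightarrow> ?thesis"
    unfolding l2le_def
    using summable_on_reindex_bij_betw[of "\<lambda>n. n + a" UNIV UNIV "\<lambda>n. (cmod (u n))^2"]
      infsum_reindex_bij_betw[of "\<lambda>n. n + a" UNIV UNIV "\<lambda>n. (cmod (u n))^2"] by simp
qed

definition geo_conv :: "complex \<Rightarrow> (int \<Rightarrow> complex) \<Rightarrow> int \<Rightarrow> complex" where
  "geo_conv w d n = infsum (\<lambda>m. w ^ nat \<bar>n - m\<bar> * d m) UNIV"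

context
  fixes w :: complex and d :: "int \<Rightarrow> complex"
  assumes w: "cmod w < 1" and d: "(\<lambda>n. (cmod (d n))^2) summable_on UNIV"
begin

lemma geo_conv_weights:
  "(\<lambda>m. cmod w ^ nat \<bar>n - m\<bar> * (cmod (d m))^2) summable_on UNIV"
  by (rule summable_on_comparison_test[OF d]) (use w in \<open>auto intro!: mult_left_le_one_le power_le_one\<close>)

lemma geo_conv_abs_summable: "(\<lambda>m. cmod w ^ nat \<bar>n - m\<bar> * cmod (d m)) summable_on UNIV"
  by (rule infsum_Cauchy_Schwarz(1)[OF _ has_sum_imp_summable[OF geometric_int_translate(1)] geo_conv_weights]) (use w in auto)

lemma geo_conv_has_sum: "((\<lambda>m. w ^ nat \<bar>n - m\<bar> * d m) has_sum geo_conv w d n) UNIV"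
  unfolding geo_conv_def
  by (rule has_sum_infsum[OF abs_summable_summable])
    (use geo_conv_abs_summable in \<open>simp add: norm_mult norm_power\<close>)

text \<open>The kernel \<open>w ^ nat \<bar>j\<bar>\<close> solves the homogeneous recurrence on
  either side of 0, and at 0 leaves the defect 2 w - (w + 1 / w), so it is a Green kernel up to the
  factor w - 1 / w.\<close>

lemma geo_conv_recurrence:
  assumes "w \<noteq> 0"
  shows "geo_conv w d (n + 1) + geo_conv w d (n - 1) - (w + 1 / w) * geo_conv w d n = (w - 1 / w) * d n"
proof -
  let ?K = "\<lambda>j::int. w ^ nat \<bar>j\<bar>"
  have K: "?K (j + 1) + ?K (j - 1) - (w + 1 / w) * ?K j = (if j = 0 then w - 1 / w else 0)" for j
  proof -
    consider "j = 0" | "0 < j" | "j < 0" by linarith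
    then show ?thesis
    proof cases
      case 2
      then obtain i where i: "j = int (Suc i)" by (metis Suc_pred' zero_less_imp_eq_int)
      have "nat \<bar>j + 1\<bar> = Suc (Suc i)" "nat \<bar>j - 1\<bar> = i" "nat \<bar>j\<bar> = Suc i" using i by auto
      then show ?thesis using 2 assms by (simp add: field_simps)
    next
      case 3
      then obtain i where i: "j = - int (Suc i)" by (metis Suc_pred' minus_minus neg_0_less_iff_less zero_less_imp_eq_int)
      have "nat \<bar>j - 1\<bar> = Suc (Suc i)" "nat \<bar>j + 1\<bar> = i" "nat \<bar>j\<bar> = Suc i" using i by auto
      then show ?thesis using 3 assms by (simp add: field_simps)
    qed simp
  qed
  have "((\<lambda>m. ?K (n + 1 - m) * d m + ?K (n - 1 - m) * d m + (- (w + 1 / w)) * (?K (n - m) * d m)) has_sum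
      (geo_conv w d (n + 1) + geo_conv w d (n - 1) + (- (w + 1 / w)) * geo_conv w d n)) UNIV"
    by (intro has_sum_add has_sum_cmult_right geo_conv_has_sum)
  moreover have "?K (n + 1 - m) * d m + ?K (n - 1 - m) * d m + (- (w + 1 / w)) * (?K (n - m) * d m) =
      (if m = n then (w - 1 / w) * d n else 0)" for m
  proof -
    have "?K (n + 1 - m) * d m + ?K (n - 1 - m) * d m + (- (w + 1 / w)) * (?K (n - m) * d m) =
        (?K ((n - m) + 1) + ?K ((n - m) - 1) - (w + 1 / w) * ?K (n - m)) * d m"
      by (simp add: algebra_simps)
    then show ?thesis unfolding K by auto
  qed
  moreover have "((\<lambda>m. if m = n then (w - 1 / w) * d n else 0) has_sum (w - 1 / w) * d n) UNIV"
  proof (rule iffD2[OF has_sum_cong_neutral[where T="{n}"]])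
    show "((\<lambda>m. (w - 1 / w) * d n) has_sum (w - 1 / w) * d n) {n}"
      using has_sum_finite[of "{n}" "\<lambda>m. (w - 1 / w) * d n"] by simp
  qed auto
  ultimately have "geo_conv w d (n + 1) + geo_conv w d (n - 1) + (- (w + 1 / w)) * geo_conv w d n = (w - 1 / w) * d n"
    using has_sum_unique by (simp only:) blast
  then show ?thesis by (simp only: mult_minus_left add_uminus_conv_diff)
qed

lemma geo_conv_l2:
  "(cmod (geo_conv w d n))^2 \<le> infsum (\<lambda>n::int. cmod w ^ nat \<bar>n\<bar>) UNIV * infsum (\<lambda>m. cmod w ^ nat \<bar>n - m\<bar> * (cmod (d m))^2) UNIV"
proof -
  have "cmod (geo_conv w d n) \<le> infsum (\<lambda>m. cmod (w ^ nat \<bar>n - m\<bar> * d m)) UNIV"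
    unfolding geo_conv_def using geo_conv_abs_summable by (intro norm_infsum_bound) (simp add: norm_mult norm_power)
  also have "\<dots> = infsum (\<lambda>m. cmod w ^ nat \<bar>n - m\<bar> * cmod (d m)) UNIV" by (simp add: norm_mult norm_power)
  finally have "(cmod (geo_conv w d n))^2 \<le> (infsum (\<lambda>m. cmod w ^ nat \<bar>n - m\<bar> * cmod (d m)) UNIV)^2"
    by (intro power_mono) auto
  also have "\<dots> \<le> infsum (\<lambda>m. cmod w ^ nat \<bar>n - m\<bar>) UNIV * infsum (\<lambda>m. cmod w ^ nat \<bar>n - m\<bar> * (cmod (d m))^2) UNIV"
    by (rule infsum_Cauchy_Schwarz(2)[OF _ has_sum_imp_summable[OF geometric_int_translate(1)] geo_conv_weights]) (use w in auto)
  finally show ?thesis using infsumI[OF geometric_int_translate(1)[of "cmod w" n]] w by simp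
qed

text \<open>Schur test: the weighted Cauchy-Schwarz inequality in each row contributes one factor
  \<open>?S\<close>, and summing the columns after exchanging the order of summation contributes the
  other.\<close>

lemma l2le_geo_conv:
  "l2le (geo_conv w d) ((infsum (\<lambda>n::int. cmod w ^ nat \<bar>n\<bar>) UNIV)^2 * infsum (\<lambda>n. (cmod (d n))^2) UNIV)"
proof -
  let ?S = "infsum (\<lambda>n::int. cmod w ^ nat \<bar>n\<bar>) UNIV"
  let ?f = "\<lambda>(n::int, m::int). cmod w ^ nat \<bar>n - m\<bar> * (cmod (d m))^2"
  have col: "((\<lambda>n. cmod w ^ nat \<bar>n - m\<bar> * (cmod (d m))^2) has_sum ?S * (cmod (d m))^2) UNIV" for m
    by (intro has_sum_cmult_left geometric_int_translate(2)) (use w in auto)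
  have "(\<lambda>p. ?f (snd p, fst p)) summable_on Sigma UNIV (\<lambda>_. UNIV)"
    by (rule summable_on_SigmaI[where g="\<lambda>m. ?S * (cmod (d m))^2"]) (use col d in \<open>auto intro: summable_on_cmult_right\<close>)
  then have s: "?f summable_on UNIV \<times> UNIV"
    by (subst summable_on_swap) (simp add: case_prod_unfold)
  have g: "(\<lambda>n. infsum (\<lambda>m. cmod w ^ nat \<bar>n - m\<bar> * (cmod (d m))^2) UNIV) summable_on UNIV"
    using summable_on_Sigma_banach[OF s] by simp
  have "infsum (\<lambda>n. infsum (\<lambda>m. cmod w ^ nat \<bar>n - m\<bar> * (cmod (d m))^2) UNIV) UNIV =
      infsum (\<lambda>m. infsum (\<lambda>n. cmod w ^ nat \<bar>n - m\<bar> * (cmod (d m))^2) UNIV) UNIV"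
    by (rule infsum_swap_banach[OF s])
  also have "\<dots> = ?S * infsum (\<lambda>n. (cmod (d n))^2) UNIV"
    by (simp add: infsumI[OF col] infsum_cmult_right')
  finally have e: "infsum (\<lambda>n. infsum (\<lambda>m. cmod w ^ nat \<bar>n - m\<bar> * (cmod (d m))^2) UNIV) UNIV = ?S * infsum (\<lambda>n. (cmod (d n))^2) UNIV" .
  show ?thesis
    by (rule l2le_dominated[OF summable_on_cmult_right[OF g, of ?S] _ geo_conv_l2])
      (simp only: infsum_cmult_right' e power2_eq_square[of ?S] mult.assoc order_refl)
qed

end

text \<open>Boundedness from the graph space to sequences, with one constant for all arguments. Its
  closure rules assemble the resolvent estimate without tracking constants.\<close>

definition bounded_op :: "((int \<times> nat \<Rightarrow> real \<Rightarrow> complex) \<Rightarrow> int \<Rightarrow> complex) \<Rightarrow> bool" where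
  "bounded_op T \<longleftrightarrow> (\<exists>C\<ge>0. \<forall>g. gL2 g \<longrightarrow> l2le (T g) (C * (gnorm g)^2))"

lemma bounded_op_add: "bounded_op S \<Longrightarrow> bounded_op T \<Longrightarrow> bounded_op (\<lambda>g n. S g n + T g n)"
proof -
  assume "bounded_op S" "bounded_op T"
  then obtain C D where C: "C \<ge> 0" "\<And>g. gL2 g \<Longrightarrow> l2le (S g) (C * (gnorm g)^2)"
    and D: "D \<ge> 0" "\<And>g. gL2 g \<Longrightarrow> l2le (T g) (D * (gnorm g)^2)" by (auto simp: bounded_op_def)
  show ?thesis unfolding bounded_op_def
  proof (intro exI[of _ "2 * C + 2 * D"] conjI allI impI)
    fix g :: "int \<times> nat \<Rightarrow> real \<Rightarrow> complex" assume "gL2 g"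
    from l2le_add[OF C(2)[OF this] D(2)[OF this]]
    show "l2le (\<lambda>n. S g n + T g n) ((2 * C + 2 * D) * (gnorm g)^2)" by (simp add: algebra_simps)
  qed (use C D in auto)
qed

lemma bounded_op_cmult: "bounded_op T \<Longrightarrow> bounded_op (\<lambda>g n. c * T g n)"
proof -
  assume "bounded_op T"
  then obtain C where C: "C \<ge> 0" "\<And>g. gL2 g \<Longrightarrow> l2le (T g) (C * (gnorm g)^2)" by (auto simp: bounded_op_def)
  show ?thesis unfolding bounded_op_def
    using l2le_cmult[OF C(2), of _ c] C(1) by (intro exI[of _ "(cmod c)^2 * C"]) (auto simp: mult.assoc)
qed

lemma bounded_op_diff: "bounded_op S \<Longrightarrow> bounded_op T \<Longrightarrow> bounded_op (\<lambda>g n. S g n - T g n)"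
  using bounded_op_add[of S "\<lambda>g n. (-1) * T g n"] bounded_op_cmult[of T "-1"] by simp

lemma bounded_op_divide: "bounded_op T \<Longrightarrow> bounded_op (\<lambda>g n. T g n / c)"
  using bounded_op_cmult[of T "1 / c"] by simp

lemma bounded_op_shift: "bounded_op T \<Longrightarrow> bounded_op (\<lambda>g n. T g (n + a))"
  unfolding bounded_op_def using l2le_shift by blast

lemma bounded_op_unimodular: "bounded_op T \<Longrightarrow> (\<And>n. cmod (c n) = 1) \<Longrightarrow> bounded_op (\<lambda>g n. c n * T g n)"
  unfolding bounded_op_def using l2le_unimodular by blast

lemma bounded_op_geo_conv:
  assumes "bounded_op T" "cmod w < 1" shows "bounded_op (\<lambda>g. geo_conv w (T g))"
proof -
  let ?S = "infsum (\<lambda>n::int. cmod w ^ nat \<bar>n\<bar>) UNIV"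
  obtain C where C: "C \<ge> 0" "\<And>g. gL2 g \<Longrightarrow> l2le (T g) (C * (gnorm g)^2)" using assms(1) by (auto simp: bounded_op_def)
  show ?thesis unfolding bounded_op_def
  proof (intro exI[of _ "?S^2 * C"] conjI allI impI)
    fix g :: "int \<times> nat \<Rightarrow> real \<Rightarrow> complex" assume g: "gL2 g"
    then have T: "(\<lambda>n. (cmod (T g n))^2) summable_on UNIV" "infsum (\<lambda>n. (cmod (T g n))^2) UNIV \<le> C * (gnorm g)^2"
      using C(2) by (auto simp: l2le_def)
    have "?S^2 * infsum (\<lambda>n. (cmod (T g n))^2) UNIV \<le> ?S^2 * C * (gnorm g)^2"
      using mult_left_mono[OF T(2), of "?S^2"] by (simp add: mult.assoc)
    then show "l2le (geo_conv w (T g)) (?S^2 * C * (gnorm g)^2)"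
      using l2le_geo_conv[OF assms(2) T(1)] by (auto simp: l2le_def)
  qed (use C in auto)
qed

lemma bounded_op_summable: "bounded_op T \<Longrightarrow> gL2 g \<Longrightarrow> (\<lambda>n. (cmod (T g n))^2) summable_on UNIV"
  unfolding bounded_op_def l2le_def by blast

lemma gL2D:
  assumes "gL2 g" "\<alpha> \<in> Edges"
  shows "edge_L2 (g \<alpha>)"
  using assms by (auto simp: gL2_def)

lemma infsum_edge_le:
  assumes g: "gL2 g" and j: "j \<in> {0,1,2}"
  shows "(\<lambda>n. integral {0..1} (\<lambda>t. (cmod (g (n,j) t))^2)) summable_on UNIV"
    "infsum (\<lambda>n. integral {0..1} (\<lambda>t. (cmod (g (n,j) t))^2)) UNIV \<le> (gnorm g)^2"
proof -
  let ?f = "\<lambda>\<alpha>. integral {0..1} (\<lambda>t. (cmod (g \<alpha> t))^2)"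
  have s: "?f summable_on Edges" using g by (simp add: gL2_def)
  show "(\<lambda>n. ?f (n,j)) summable_on UNIV" by (rule summable_on_edge[OF s j])
  have "infsum (\<lambda>n. ?f (n,j)) UNIV = infsum ?f ((\<lambda>n. (n,j)) ` UNIV)"
    by (subst infsum_reindex) (auto simp: inj_on_def o_def)
  also have "\<dots> \<le> infsum ?f Edges"
    by (rule infsum_mono_neutral[OF summable_on_subset_banach[OF s] s])
      (use j edge_integral_nonneg in \<open>auto simp: Edges_def\<close>)
  finally show "infsum (\<lambda>n. ?f (n,j)) UNIV \<le> (gnorm g)^2" unfolding gnorm_sq .
qed

lemma bounded_op_edge:
  assumes "j \<in> {0,1,2}" "0 \<le> C"
    "\<And>g n. gL2 g \<Longrightarrow> (cmod (T g n))^2 \<le> C * integral {0..1} (\<lambda>t. (cmod (g (n,j) t))^2)"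
  shows "bounded_op T"
  unfolding bounded_op_def
proof (intro exI[of _ C] conjI allI impI)
  fix g :: "int \<times> nat \<Rightarrow> real \<Rightarrow> complex" assume g: "gL2 g"
  show "l2le (T g) (C * (gnorm g)^2)"
    by (rule l2le_dominated[OF summable_on_cmult_right[OF infsum_edge_le(1)[OF g assms(1)], of C] _ assms(3)[OF g]])
      (use mult_left_mono[OF infsum_edge_le(2)[OF g assms(1)] assms(2)] in \<open>simp add: infsum_cmult_right'\<close>)
qed (rule assms)

lemma edge_L2_integral_add_le:
  assumes "edge_L2 u" "edge_L2 v"
  shows "integral {0..1} (\<lambda>t. (cmod (u t + v t))^2) \<le>
    2 * integral {0..1} (\<lambda>t. (cmod (u t))^2) + 2 * integral {0..1} (\<lambda>t. (cmod (v t))^2)"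
proof -
  note i = edge_L2_integrable_sq[OF assms(1)] edge_L2_integrable_sq[OF assms(2)]
  have "integral {0..1} (\<lambda>t. (cmod (u t + v t))^2) \<le> integral {0..1} (\<lambda>t. 2 * (cmod (u t))^2 + 2 * (cmod (v t))^2)"
    by (intro integral_le edge_L2_integrable_sq edge_L2_add assms integrable_add integrable_on_mult_right i sq_norm_add_le)
  also have "\<dots> = 2 * integral {0..1} (\<lambda>t. (cmod (u t))^2) + 2 * integral {0..1} (\<lambda>t. (cmod (v t))^2)"
    using i by (subst integral_add) (auto intro: integrable_on_mult_right)
  finally show ?thesis .
qed

lemma gL2_add:
  assumes "gL2 f" "gL2 g" shows "gL2 (\<lambda>\<alpha> t. f \<alpha> t + g \<alpha> t)"
proof -
  let ?I = "\<lambda>f \<alpha>. integral {0..1} (\<lambda>t. (cmod (f \<alpha> t))^2)"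
  have "(\<lambda>\<alpha>. 2 * ?I f \<alpha> + 2 * ?I g \<alpha>) summable_on Edges"
    using assms by (intro summable_on_add summable_on_cmult_right) (auto simp: gL2_def)
  then have "?I (\<lambda>\<alpha> t. f \<alpha> t + g \<alpha> t) summable_on Edges"
    by (rule summable_on_comparison_test)
      (use assms edge_integral_nonneg in \<open>auto intro!: edge_L2_integral_add_le simp: gL2_def\<close>)
  then show ?thesis using assms by (auto simp: gL2_def intro: edge_L2_add)
qed

lemma gL2_cmult: "gL2 f \<Longrightarrow> gL2 (\<lambda>\<alpha> t. c * f \<alpha> t)"
  unfolding gL2_def by (auto simp: norm_mult power_mult_distrib intro: edge_L2_cmult summable_on_cmult_right)

lemma gL2_diff: "gL2 f \<Longrightarrow> gL2 g \<Longrightarrow> gL2 (\<lambda>\<alpha> t. f \<alpha> t - g \<alpha> t)"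
  using gL2_add[of f "\<lambda>\<alpha> t. (-1) * g \<alpha> t"] gL2_cmult[of g "-1"] by simp

lemma W22_lincomb:
  assumes u: "W22 u u' u''" and v: "W22 v v' v''"
  shows "W22 (\<lambda>t. u t + c * v t) (\<lambda>t. u' t + c * v' t) (\<lambda>t. u'' t + c * v'' t)"
  unfolding W22_def
proof (intro conjI ballI)
  show "edge_L2 (\<lambda>t. u'' t + c * v'' t)" by (intro edge_L2_add edge_L2_cmult W22D(1)[OF u] W22D(1)[OF v])
  fix x :: real assume x: "x \<in> {0..1}"
  have lin: "integral {0..x} (\<lambda>t. a t + c * b t) = integral {0..x} a + c * integral {0..x} b"
    if "a integrable_on {0..1}" "b integrable_on {0..1}" for a b :: "real \<Rightarrow> complex"
    using integrable_Icc_subset[OF that(1) x] integrable_Icc_subset[OF that(2) x]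
    by (subst integral_add) (auto intro: integrable_on_mult_right)
  show "u x + c * v x = u 0 + c * v 0 + integral {0..x} (\<lambda>t. u' t + c * v' t)"
    unfolding lin[OF integrable_continuous_real[OF W22_continuous(1)[OF u]] integrable_continuous_real[OF W22_continuous(1)[OF v]]]
    using W22D(2)[OF u x] W22D(2)[OF v x] by (simp only: algebra_simps)
  show "u' x + c * v' x = u' 0 + c * v' 0 + integral {0..x} (\<lambda>t. u'' t + c * v'' t)"
    unfolding lin[OF edge_L2_integrable[OF W22D(1)[OF u]] edge_L2_integrable[OF W22D(1)[OF v]]]
    using W22D(3)[OF u x] W22D(3)[OF v x] by (simp only: algebra_simps)
qed

lemma K0_lincomb: "K0 m k f \<Longrightarrow> K0 m k g \<Longrightarrow> K0 m k (\<lambda>\<alpha> t. f \<alpha> t + c * g \<alpha> t)"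
  unfolding K0_def by (simp add: distrib_left mult.left_commute)

lemma K1_lincomb:
  assumes "K1 m k f" "K1 m k g" shows "K1 m k (\<lambda>\<alpha> t. f \<alpha> t + c * g \<alpha> t)"
proof -
  have *: "- (a + c * a') + (b + c * b') - r * (d + c * d') = (- a + b - r * d) + c * (- a' + b' - r * d')"
    "a + c * a' - (b + c * b') + (d + c * d') = (a - b + d) + c * (a' - b' + d')" for a a' b b' d d' r :: complex
    by (simp_all add: algebra_simps)
  show ?thesis unfolding K1_def * using assms unfolding K1_def by (metis add_0 mult_zero_right)
qed

lemma Hdom_lincomb:
  assumes "Hdom m k f f' f''" "Hdom m k g g' g''"
  shows "Hdom m k (\<lambda>\<alpha> t. f \<alpha> t + c * g \<alpha> t) (\<lambda>\<alpha> t. f' \<alpha> t + c * g' \<alpha> t) (\<lambda>\<alpha> t. f'' \<alpha> t + c * g'' \<alpha> t)"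
  using assms unfolding Hdom_def
  by (auto intro!: gL2_add gL2_cmult W22_lincomb K0_lincomb K1_lincomb)

lemma gL2_dominated:
  assumes "\<And>\<alpha>. \<alpha> \<in> Edges \<Longrightarrow> edge_L2 (f \<alpha>)" "X summable_on Edges"
    "\<And>\<alpha>. \<alpha> \<in> Edges \<Longrightarrow> integral {0..1} (\<lambda>t. (cmod (f \<alpha> t))^2) \<le> X \<alpha>"
  shows "gL2 f" "(gnorm f)^2 \<le> infsum X Edges"
proof -
  have s: "(\<lambda>\<alpha>. integral {0..1} (\<lambda>t. (cmod (f \<alpha> t))^2)) summable_on Edges"
    by (rule summable_on_comparison_test[OF assms(2,3)]) (auto simp: edge_integral_nonneg)
  then show "gL2 f" using assms(1) by (auto simp: gL2_def)
  show "(gnorm f)^2 \<le> infsum X Edges" unfolding gnorm_sq by (rule infsum_mono[OF s assms(2,3)])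
qed

lemma edge_L2_mult_bound:
  assumes "edge_L2 v" "edge_L2 (\<lambda>t. v t * u t)" "\<And>t. t \<in> {0..1} \<Longrightarrow> (cmod (u t))^2 \<le> X"
  shows "integral {0..1} (\<lambda>t. (cmod (v t * u t))^2) \<le> X * integral {0..1} (\<lambda>t. (cmod (v t))^2)"
proof -
  have "integral {0..1} (\<lambda>t. (cmod (v t * u t))^2) \<le> integral {0..1} (\<lambda>t. X * (cmod (v t))^2)"
    using assms by (intro integral_le edge_L2_integrable_sq integrable_on_mult_right)
      (auto simp: norm_mult power_mult_distrib mult.commute[of X] intro!: mult_left_mono)
  then show ?thesis by simp
qed

section \<open>Construction and boundedness of the resolvent\<close>

context nanotube
begin

text \<open>The potential is unbounded in general, so an L2 bound on \<open>f\<close> is not enough: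
  the sup norm over each edge has to be square summable, while the L2 norm of the potential is the
  same on all edges.\<close>

lemma gL2_pot_mult:
  assumes c: "\<And>\<alpha>. \<alpha> \<in> Edges \<Longrightarrow> continuous_on {0..1} (f \<alpha>)" and X: "X summable_on Edges"
    and le: "\<And>\<alpha> t. \<alpha> \<in> Edges \<Longrightarrow> t \<in> {0..1} \<Longrightarrow> (cmod (f \<alpha> t))^2 \<le> X \<alpha>"
  shows "gL2 (\<lambda>\<alpha> t. pot z t * f \<alpha> t)"
proof (rule gL2_dominated(1))
  show L: "edge_L2 (\<lambda>t. pot z t * f \<alpha> t)" if "\<alpha> \<in> Edges" for \<alpha>
    using edge_L2_mult_continuous[OF pot_L2 c[OF that], of z] by (simp add: mult.commute)
  show "(\<lambda>\<alpha>. X \<alpha> * integral {0..1} (\<lambda>t. (cmod (pot z t))^2)) summable_on Edges"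
    by (rule summable_on_cmult_left[OF X])
  show "integral {0..1} (\<lambda>t. (cmod (pot z t * f \<alpha> t))^2) \<le> X \<alpha> * integral {0..1} (\<lambda>t. (cmod (pot z t))^2)"
    if "\<alpha> \<in> Edges" for \<alpha>
    by (rule edge_L2_mult_bound[OF pot_L2 L[OF that] le[OF that]])
qed

lemma Hminus_pot: "Hminus q f f'' z = (\<lambda>\<alpha> t. pot z t * f \<alpha> t - f'' \<alpha> t)"
  by (simp add: Hminus_def pot_def algebra_simps fun_eq_iff)

lemma gL2_Hminus:
  assumes f: "Hdom m k f f' f''" shows "gL2 (Hminus q f f'' z)"
proof -
  let ?X = "\<lambda>\<alpha>. 200 * (integral {0..1} (\<lambda>t. (cmod (f \<alpha> t))^2) + integral {0..1} (\<lambda>t. (cmod (f'' \<alpha> t))^2))"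
  have "gL2 (\<lambda>\<alpha> t. pot z t * f \<alpha> t)"
  proof (rule gL2_pot_mult)
    show "?X summable_on Edges"
      using HdomD(1,2)[OF f] by (intro summable_on_cmult_right summable_on_add) (auto simp: gL2_def)
    show "(cmod (f \<alpha> t))^2 \<le> ?X \<alpha>" if "\<alpha> \<in> Edges" "t \<in> {0..1}" for \<alpha> t
      using W22_sobolev[OF HdomD(3)[OF f that(1)] that(2)] zero_le_power2[of "cmod (f' \<alpha> t)"] by linarith
  qed (use W22_continuous[OF HdomD(3)[OF f]] in blast)
  then show ?thesis unfolding Hminus_pot by (intro gL2_diff HdomD(2)[OF f])
qed

text \<open>A choice rather than a definite description, because an initial value problem leaves the
  values outside {0..1} open.\<close>

definition part :: "complex \<Rightarrow> (real \<Rightarrow> complex) \<Rightarrow> (real \<Rightarrow> complex) \<times> (real \<Rightarrow> complex)" where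
  "part z h = (SOME p. ivp (pot z) h (fst p) (snd p) \<and> fst p 0 = 0 \<and> snd p 0 = 0)"

lemma part_spec:
  assumes "edge_L2 h"
  shows "ivp (pot z) h (fst (part z h)) (snd (part z h))" "fst (part z h) 0 = 0" "snd (part z h) 0 = 0"
proof -
  obtain y y' where "ivp (pot z) h y y'" "y 0 = 0" "y' 0 = 0"
    by (rule ivp_exists[OF pot_L2[of z] edge_L2_absolutely_integrable[OF assms]])
  then have "\<exists>p. ivp (pot z) h (fst p) (snd p) \<and> fst p 0 = 0 \<and> snd p 0 = 0" by (intro exI[of _ "(y, y')"]) auto
  from someI_ex[OF this] show "ivp (pot z) h (fst (part z h)) (snd (part z h))" "fst (part z h) 0 = 0" "snd (part z h) 0 = 0"
    unfolding part_def by auto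
qed

lemma part_bound:
  assumes h: "edge_L2 h" and x: "x \<in> {0..1}"
  shows "(cmod (fst (part z h) x))^2 \<le> (ivp_const (pot z))^2 * integral {0..1} (\<lambda>t. (cmod (h t))^2)"
    "(cmod (snd (part z h) x))^2 \<le> (ivp_const (pot z))^2 * integral {0..1} (\<lambda>t. (cmod (h t))^2)"
proof -
  let ?I = "integral {0..1} (\<lambda>t. cmod (h t))"
  have b: "cmod (fst (part z h) x) + cmod (snd (part z h) x) \<le> ivp_const (pot z) * ?I"
    using ivp_bound[OF pot_L2 edge_L2_absolutely_integrable[OF h] part_spec(1)[OF h] x, of z]
    by (simp add: part_spec(2,3)[OF h])
  have "a^2 \<le> (ivp_const (pot z))^2 * integral {0..1} (\<lambda>t. (cmod (h t))^2)" if "0 \<le> a" "a \<le> ivp_const (pot z) * ?I" for a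
  proof -
    have "a^2 \<le> (ivp_const (pot z) * ?I)^2" using that by (intro power_mono) auto
    also have "\<dots> \<le> (ivp_const (pot z))^2 * integral {0..1} (\<lambda>t. (cmod (h t))^2)"
      unfolding power_mult_distrib by (intro mult_left_mono L1_le_L2 h) auto
    finally show ?thesis .
  qed
  then show "(cmod (fst (part z h) x))^2 \<le> (ivp_const (pot z))^2 * integral {0..1} (\<lambda>t. (cmod (h t))^2)"
    "(cmod (snd (part z h) x))^2 \<le> (ivp_const (pot z))^2 * integral {0..1} (\<lambda>t. (cmod (h t))^2)"
    using norm_add_leD[OF b] by auto
qed

text \<open>The source is \<open>- g\<close> because (H - z) f = g reads f'' = (q - z) f - g on
  every edge.\<close>

definition W :: "complex \<Rightarrow> (int \<times> nat \<Rightarrow> real \<Rightarrow> complex) \<Rightarrow> int \<times> nat \<Rightarrow> real \<Rightarrow> complex" where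
  "W z g \<alpha> = fst (part z (\<lambda>t. - g \<alpha> t))"
definition W' :: "complex \<Rightarrow> (int \<times> nat \<Rightarrow> real \<Rightarrow> complex) \<Rightarrow> int \<times> nat \<Rightarrow> real \<Rightarrow> complex" where
  "W' z g \<alpha> = snd (part z (\<lambda>t. - g \<alpha> t))"

lemma W_spec:
  assumes "gL2 g" "\<alpha> \<in> Edges"
  shows "ivp (pot z) (\<lambda>t. - g \<alpha> t) (W z g \<alpha>) (W' z g \<alpha>)" "W z g \<alpha> 0 = 0" "W' z g \<alpha> 0 = 0"
    "x \<in> {0..1} \<Longrightarrow> (cmod (W z g \<alpha> x))^2 \<le> (ivp_const (pot z))^2 * integral {0..1} (\<lambda>t. (cmod (g \<alpha> t))^2)"
    "x \<in> {0..1} \<Longrightarrow> (cmod (W' z g \<alpha> x))^2 \<le> (ivp_const (pot z))^2 * integral {0..1} (\<lambda>t. (cmod (g \<alpha> t))^2)"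
  using part_spec[OF edge_L2_uminus[OF gL2D[OF assms]]] part_bound[OF edge_L2_uminus[OF gL2D[OF assms]]]
  by (auto simp: W_def W'_def)

lemma bounded_op_W:
  assumes "j \<in> {0,1,2}" "x \<in> {0..1}"
  shows "bounded_op (\<lambda>g n. W z g (n,j) x)" "bounded_op (\<lambda>g n. W' z g (n,j) x)"
proof -
  have "(n,j) \<in> Edges" for n using assms(1) by (auto simp: Edges_def)
  then show "bounded_op (\<lambda>g n. W z g (n,j) x)" "bounded_op (\<lambda>g n. W' z g (n,j) x)"
    using assms W_spec(4,5) by (auto intro!: bounded_op_edge[OF assms(1), of "(ivp_const (pot z))^2"])
qed

definition rA :: "complex \<Rightarrow> (int \<times> nat \<Rightarrow> real \<Rightarrow> complex) \<Rightarrow> int \<Rightarrow> complex" where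
  "rA z g = dA z (\<lambda>\<alpha>. W z g \<alpha> 1) (\<lambda>\<alpha>. W' z g \<alpha> 1)"
definition rB :: "complex \<Rightarrow> (int \<times> nat \<Rightarrow> real \<Rightarrow> complex) \<Rightarrow> int \<Rightarrow> complex" where
  "rB z g = dB z (\<lambda>\<alpha>. W z g \<alpha> 1) (\<lambda>\<alpha>. W' z g \<alpha> 1)"

lemma bounded_op_rA: "bounded_op (rA z)"
  unfolding rA_def[abs_def] dA_def[abs_def]
  by (intro bounded_op_add bounded_op_diff bounded_op_cmult bounded_op_W) auto

lemma bounded_op_rB: "bounded_op (rB z)"
  unfolding rB_def[abs_def] dB_def[abs_def]
  by (intro bounded_op_add bounded_op_diff bounded_op_cmult bounded_op_W
      bounded_op_shift[where T="\<lambda>g n. W z g (n,0) 1"]) auto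

text \<open>Inverse of the vertex operator: conjugated by the gauge, it is the convolution with the Green kernel
  \<open>w ^ |n| / (w - 1 / w)\<close>.\<close>

definition vinv :: "complex \<Rightarrow> (int \<Rightarrow> complex) \<Rightarrow> int \<Rightarrow> complex" where
  "vinv w d n = geo_conv w (\<lambda>n. gauge n * d n) n / (gauge n * (2 * of_real (cN m k) * (w - 1 / w)))"

lemma bounded_op_vinv:
  assumes "bounded_op T" "cmod w < 1" shows "bounded_op (\<lambda>g. vinv w (T g))"
proof -
  have "bounded_op (\<lambda>g n. (1 / gauge n) * geo_conv w (\<lambda>n. gauge n * T g n) n)"
    by (intro bounded_op_unimodular bounded_op_geo_conv assms) (auto simp: norm_divide)
  from bounded_op_divide[OF this, of "2 * of_real (cN m k) * (w - 1 / w)"]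
  show ?thesis unfolding vinv_def by simp
qed

lemma vinv_solves:
  assumes w: "cmod w < 1" "w \<noteq> 0" "w + 1 / w = 2 * F z" and d: "(\<lambda>n. (cmod (d n))^2) summable_on UNIV"
  shows "sg * vinv w d (n+1) + cnj sg * vinv w d (n-1) - 4 * of_real (cN m k) * F z * vinv w d n = d n"
proof -
  have "w - 1 / w \<noteq> 0"
  proof
    assume "w - 1 / w = 0"
    then have "w * w = 1" using w(2) by (simp add: field_simps)
    then have "cmod w * cmod w = 1" by (metis norm_mult norm_one)
    moreover have "cmod w * cmod w < 1" using w(1) by (metis mult_le_one norm_ge_zero less_eq_real_def mult_strict_mono' mult_1)
    ultimately show False by simp
  qed
  define D where "D = 2 * complex_of_real (cN m k) * (w - 1 / w)"
  have D: "D \<noteq> 0" using cN_nz \<open>w - 1 / w \<noteq> 0\<close> by (simp add: D_def)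
  let ?G = "geo_conv w (\<lambda>n. gauge n * d n)"
  have gv: "gauge n * vinv w d n = ?G n / D" for n by (simp add: vinv_def D_def)
  have "(\<lambda>n. (cmod (gauge n * d n))^2) summable_on UNIV" using d by (simp add: norm_mult)
  from geo_conv_recurrence[OF w(1) this w(2), of n]
  have "?G (n + 1) + ?G (n - 1) - 2 * F z * ?G n = (w - 1 / w) * (gauge n * d n)" unfolding w(3) .
  then have "(?G (n + 1) + ?G (n - 1) - 2 * F z * ?G n) / D = (w - 1 / w) * (gauge n * d n) / D" by simp
  then have "?G (n + 1) / D + ?G (n - 1) / D - 2 * F z * (?G n / D) = (w - 1 / w) * (gauge n * d n) / D"
    by (simp add: add_divide_distrib diff_divide_distrib)
  then show ?thesis
    unfolding gauge_recurrence gv using cN_nz \<open>w - 1 / w \<noteq> 0\<close> by (simp add: D_def)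
qed

text \<open>The two roots are w and 1 / w; unless they are unimodular, which is the excluded case,
  one of them lies inside the unit disc.\<close>

lemma inner_root:
  assumes "\<not> (F z \<in> \<real> \<and> \<bar>Re (F z)\<bar> \<le> 1)"
  obtains w where "cmod w < 1" "w \<noteq> 0" "w + 1 / w = 2 * F z"
proof -
  obtain v where v: "v \<noteq> 0" "v + 1 / v = 2 * F z" using quadratic_inverse_pair by blast
  have "cmod v \<noteq> 1" using unimodular_inverse_sum[OF _ v(2)] assms by blast
  then have "cmod v < 1 \<or> cmod (1 / v) < 1" using v(1) by (auto simp: norm_divide)
  then show ?thesis using that[of v] that[of "1 / v"] v by (auto simp: add.commute)
qed

text \<open>The argument of \<open>vinv\<close> is the right-hand side of
  \<open>vertex_system_A\<close>, respectively \<open>vertex_system_B\<close>, for d =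
  \<open>rA z g\<close> and e = \<open>rB z g\<close>.\<close>

definition solA :: "complex \<Rightarrow> complex \<Rightarrow> (int \<times> nat \<Rightarrow> real \<Rightarrow> complex) \<Rightarrow> int \<Rightarrow> complex" where
  "solA z w g = vinv w (\<lambda>n. rB z g (n-1) + sg * rB z g n + pB z * rA z g n)"
definition solB :: "complex \<Rightarrow> complex \<Rightarrow> (int \<times> nat \<Rightarrow> real \<Rightarrow> complex) \<Rightarrow> int \<Rightarrow> complex" where
  "solB z w g = vinv w (\<lambda>n. rA z g (n+1) + cnj sg * rA z g n + pA z * rB z g n)"

lemma bounded_op_rhs:
  "bounded_op (\<lambda>g n. rB z g (n-1) + sg * rB z g n + pB z * rA z g n)"
  "bounded_op (\<lambda>g n. rA z g (n+1) + cnj sg * rA z g n + pA z * rB z g n)"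
  using bounded_op_shift[OF bounded_op_rB, of z "-1"] bounded_op_shift[OF bounded_op_rA, of z 1]
  by (auto intro!: bounded_op_add bounded_op_cmult bounded_op_rA bounded_op_rB)

lemma bounded_op_sol:
  assumes "cmod w < 1" shows "bounded_op (solA z w)" "bounded_op (solB z w)"
  unfolding solA_def[abs_def] solB_def[abs_def] by (intro bounded_op_vinv bounded_op_rhs assms)+

text \<open>The residuals of the vertex system are square summable and annihilated by the vertex operator,
  so they vanish; no commutation property of the inverse is needed.\<close>

lemma sol_vertex_system:
  assumes w: "cmod w < 1" "w \<noteq> 0" "w + 1 / w = 2 * F z" and g: "gL2 g"
  shows "solB z w g (n-1) + sg * solB z w g n - pA z * solA z w g n = rA z g n"
    "solA z w g (n+1) + cnj sg * solA z w g n - pB z * solB z w g n = rB z g n"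
proof -
  define A B d e where "A = solA z w g" and "B = solB z w g" and "d = rA z g" and "e = rB z g"
  have LA: "sg * A (n+1) + cnj sg * A (n-1) - 4 * of_real (cN m k) * F z * A n = e (n-1) + sg * e n + pB z * d n" for n
    unfolding A_def solA_def d_def e_def by (rule vinv_solves[OF w bounded_op_summable[OF bounded_op_rhs(1) g]])
  have LB: "sg * B (n+1) + cnj sg * B (n-1) - 4 * of_real (cN m k) * F z * B n = d (n+1) + cnj sg * d n + pA z * e n" for n
    unfolding B_def solB_def d_def e_def by (rule vinv_solves[OF w bounded_op_summable[OF bounded_op_rhs(2) g]])
  have hF: "4 * of_real (cN m k) * F z = pA z * pB z - 1 - sg * cnj sg" by (simp add: pA_pB_F)
  note bo = bounded_op_sol[OF w(1), of z] bounded_op_rA[of z] bounded_op_rB[of z]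
  have "bounded_op (\<lambda>g n. solB z w g (n + - 1) + sg * solB z w g n - pA z * solA z w g n - rA z g n)"
    by (intro bounded_op_diff bounded_op_add bounded_op_cmult bo bounded_op_shift[OF bo(2)])
  from bounded_op_summable[OF this g]
  have s1: "(\<lambda>n. (cmod (B (n-1) + sg * B n - pA z * A n - d n))^2) summable_on UNIV"
    by (simp add: A_def B_def d_def)
  have "bounded_op (\<lambda>g n. solA z w g (n + 1) + cnj sg * solA z w g n - pB z * solB z w g n - rB z g n)"
    by (intro bounded_op_diff bounded_op_add bounded_op_cmult bo bounded_op_shift[OF bo(1)])
  from bounded_op_summable[OF this g]
  have s2: "(\<lambda>n. (cmod (A (n+1) + cnj sg * A n - pB z * B n - e n))^2) summable_on UNIV"
    by (simp add: A_def B_def e_def)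
  have "B (n-1) + sg * B n - pA z * A n - d n = 0"
  proof (rule vertex_recurrence_vanishes[OF _ s1])
    fix n
    let ?h = "4 * of_real (cN m k) * F z"
    have "sg * (B (n+1-1) + sg * B (n+1) - pA z * A (n+1) - d (n+1)) + cnj sg * (B (n-1-1) + sg * B (n-1) - pA z * A (n-1) - d (n-1))
        - ?h * (B (n-1) + sg * B n - pA z * A n - d n)
      = (sg * B (n-1+1) + cnj sg * B (n-1-1) - ?h * B (n-1)) + sg * (sg * B (n+1) + cnj sg * B (n-1) - ?h * B n)
        - pA z * (sg * A (n+1) + cnj sg * A (n-1) - ?h * A n) - (sg * d (n+1) + cnj sg * d (n-1) - ?h * d n)"
      by (simp add: algebra_simps)
    also have "\<dots> = 0" unfolding LA LB unfolding hF by (simp add: algebra_simps)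
    finally show "sg * (B (n+1-1) + sg * B (n+1) - pA z * A (n+1) - d (n+1)) + cnj sg * (B (n-1-1) + sg * B (n-1) - pA z * A (n-1) - d (n-1))
        - ?h * (B (n-1) + sg * B n - pA z * A n - d n) = 0" .
  qed
  then show "solB z w g (n-1) + sg * solB z w g n - pA z * solA z w g n = rA z g n"
    by (simp add: A_def B_def d_def)
  have "A (n+1) + cnj sg * A n - pB z * B n - e n = 0"
  proof (rule vertex_recurrence_vanishes[OF _ s2])
    fix n
    let ?h = "4 * of_real (cN m k) * F z"
    have "sg * (A (n+1+1) + cnj sg * A (n+1) - pB z * B (n+1) - e (n+1)) + cnj sg * (A (n-1+1) + cnj sg * A (n-1) - pB z * B (n-1) - e (n-1))
        - ?h * (A (n+1) + cnj sg * A n - pB z * B n - e n)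
      = (sg * A (n+1+1) + cnj sg * A (n+1-1) - ?h * A (n+1)) + cnj sg * (sg * A (n+1) + cnj sg * A (n-1) - ?h * A n)
        - pB z * (sg * B (n+1) + cnj sg * B (n-1) - ?h * B n) - (sg * e (n+1) + cnj sg * e (n-1) - ?h * e n)"
      by (simp add: algebra_simps)
    also have "\<dots> = 0" unfolding LA LB unfolding hF by (simp add: algebra_simps)
    finally show "sg * (A (n+1+1) + cnj sg * A (n+1) - pB z * B (n+1) - e (n+1)) + cnj sg * (A (n-1+1) + cnj sg * A (n-1) - pB z * B (n-1) - e (n-1))
        - ?h * (A (n+1) + cnj sg * A n - pB z * B n - e n) = 0" .
  qed
  then show "solA z w g (n+1) + cnj sg * solA z w g n - pB z * solB z w g n = rB z g n"
    by (simp add: A_def B_def e_def)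
qed

text \<open>The solution is a combination of \<open>th z\<close> and \<open>ph z\<close> plus a
  particular solution on each edge; both coefficients are bounded operators of \<open>g\<close>. The
  same estimate controls the sup norms, so the second derivative is square summable too.\<close>

lemma resolvent_solution:
  assumes z: "phi1 q z \<noteq> 0" and F: "\<not> (F z \<in> \<real> \<and> \<bar>Re (F z)\<bar> \<le> 1)"
  obtains C where "\<And>g. gL2 g \<Longrightarrow> \<exists>f f' f''. Hdom m k f f' f'' \<and> Hminus q f f'' z = g \<and> (gnorm f)^2 \<le> C * (gnorm g)^2"
proof -
  obtain w where w: "cmod w < 1" "w \<noteq> 0" "w + 1 / w = 2 * F z" using inner_root[OF F] .
  let ?L = "\<lambda>g \<alpha>. bvalL (solA z w g) (solB z w g) \<alpha>"
  let ?S = "\<lambda>g \<alpha>. slope z (solA z w g) (solB z w g) (\<lambda>\<alpha>. W z g \<alpha> 1) \<alpha>"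
  note bo = bounded_op_sol[OF w(1), of z]
  have bL: "bounded_op (\<lambda>g n. ?L g (n,j))" if "j \<in> {0,1,2}" for j
    using that bo bounded_op_shift[OF bo(2), of "-1"] by (auto simp: bvalL_def)
  have bR: "bounded_op (\<lambda>g n. bvalR (solA z w g) (solB z w g) (n,j))" if "j \<in> {0,1,2}" for j
    using that bo bounded_op_cmult[OF bo(1), of "cnj s"] by (auto simp: bvalR_def)
  have bS: "bounded_op (\<lambda>g n. ?S g (n,j))" if "j \<in> {0,1,2}" for j
    unfolding slope_def by (intro bounded_op_divide bounded_op_diff bounded_op_cmult bL bR bounded_op_W that) auto
  have "\<exists>C\<ge>0. \<forall>j\<in>{0,1,2}. \<forall>g. gL2 g \<longrightarrow> l2le (\<lambda>n. ?L g (n,j)) (C * (gnorm g)^2) \<and> l2le (\<lambda>n. ?S g (n,j)) (C * (gnorm g)^2)"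
  proof -
    have "\<exists>C\<ge>0. \<forall>g. gL2 g \<longrightarrow> l2le (\<lambda>n. ?L g (n,j)) (C * (gnorm g)^2) \<and> l2le (\<lambda>n. ?S g (n,j)) (C * (gnorm g)^2)"
      if j: "j \<in> {0,1,2}" for j
    proof -
      obtain C D where C: "C \<ge> 0" "\<And>g. gL2 g \<Longrightarrow> l2le (\<lambda>n. ?L g (n,j)) (C * (gnorm g)^2)"
        and D: "D \<ge> 0" "\<And>g. gL2 g \<Longrightarrow> l2le (\<lambda>n. ?S g (n,j)) (D * (gnorm g)^2)"
        using bL[OF j] bS[OF j] unfolding bounded_op_def by blast
      have "C * (gnorm g)^2 \<le> max C D * (gnorm g)^2" "D * (gnorm g)^2 \<le> max C D * (gnorm g)^2" for g
        by (intro mult_right_mono; simp)+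
      then show ?thesis using C D l2le_mono by (intro exI[of _ "max C D"]) (simp add: max.coboundedI1, blast)
    qed
    then obtain c where c: "\<And>j. j \<in> {0,1,2} \<Longrightarrow> 0 \<le> c j" "\<And>j g. j \<in> {0,1,2} \<Longrightarrow> gL2 g \<Longrightarrow>
        l2le (\<lambda>n. ?L g (n,j)) (c j * (gnorm g)^2) \<and> l2le (\<lambda>n. ?S g (n,j)) (c j * (gnorm g)^2)"
      by metis
    have le: "c j * (gnorm g)^2 \<le> (c 0 + c 1 + c 2) * (gnorm g)^2" if "j \<in> {0,1,2}" for j g
      using that c(1) by (intro mult_right_mono) auto
    show ?thesis
    proof (intro exI[of _ "c 0 + c 1 + c 2"] conjI ballI allI impI)
      show "0 \<le> c 0 + c 1 + c 2" using c(1) by simp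
      fix j :: nat and g :: "int \<times> nat \<Rightarrow> real \<Rightarrow> complex" assume j: "j \<in> {0,1,2}" and g: "gL2 g"
      show "l2le (\<lambda>n. ?L g (n,j)) ((c 0 + c 1 + c 2) * (gnorm g)^2)" "l2le (\<lambda>n. ?S g (n,j)) ((c 0 + c 1 + c 2) * (gnorm g)^2)"
        using l2le_mono[OF _ le[OF j]] c(2)[OF j g] by blast+
    qed
  qed
  then obtain C where C: "0 \<le> C" "\<And>j g. j \<in> {0,1,2} \<Longrightarrow> gL2 g \<Longrightarrow> l2le (\<lambda>n. ?L g (n,j)) (C * (gnorm g)^2)"
    "\<And>j g. j \<in> {0,1,2} \<Longrightarrow> gL2 g \<Longrightarrow> l2le (\<lambda>n. ?S g (n,j)) (C * (gnorm g)^2)" by blast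
  define K where "K = ivp_const_ball (cmod z)"
  have K: "cmod (th z t) \<le> K" "cmod (ph z t) \<le> K" if "t \<in> {0..1}" for t
    using norm_add_leD(1)[OF fund_bound[OF order_refl that, of z 1 0]] norm_add_leD(1)[OF fund_bound[OF order_refl that, of z 0 1]]
    by (auto simp: K_def)
  define c where "c = (ivp_const (pot z))^2"
  show thesis
  \<comment> \<open>\<open>X\<close> bounds the squared sup norm on an edge, with 4 K^2 for each of
    the two coefficients and 2 c for the particular solution. Summing over the cells gives 8 K^2 C +
    2 c for each of the three kinds of edges.\<close>
  proof (rule that[of "3 * (8 * K^2 * C + 2 * c)"])
    fix g :: "int \<times> nat \<Rightarrow> real \<Rightarrow> complex" assume g: "gL2 g"
    define f where "f = gfun z (solA z w g) (solB z w g) (W z g)"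
    define f' where "f' = gfun' z (solA z w g) (solB z w g) (W z g) (W' z g)"
    define f'' where "f'' \<alpha> t = pot z t * f \<alpha> t + - g \<alpha> t" for \<alpha> t
    let ?I = "\<lambda>\<alpha>. integral {0..1} (\<lambda>t. (cmod (g \<alpha> t))^2)"
    define X where "X \<alpha> = 4 * K^2 * (cmod (?L g \<alpha>))^2 + 4 * K^2 * (cmod (?S g \<alpha>))^2 + 2 * c * ?I \<alpha>" for \<alpha>
    have i: "ivp (pot z) (\<lambda>t. - g \<alpha> t) (f \<alpha>) (f' \<alpha>)" if "\<alpha> \<in> Edges" for \<alpha>
      unfolding f_def f'_def by (rule gfun_ivp[where w="W z g" and w'="W' z g", OF W_spec(1)[OF g that]])
    have W22: "W22 (f \<alpha>) (f' \<alpha>) (f'' \<alpha>)" if "\<alpha> \<in> Edges" for \<alpha>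
      unfolding f''_def[abs_def] by (rule ivp_W22[OF pot_L2 edge_L2_uminus[OF gL2D[OF g that]] i[OF that]])
    have X: "(cmod (f \<alpha> t))^2 \<le> X \<alpha>" if "\<alpha> \<in> Edges" "t \<in> {0..1}" for \<alpha> t
    proof -
      have "(cmod (f \<alpha> t))^2 \<le> 2 * (cmod (?L g \<alpha> * th z t + ?S g \<alpha> * ph z t))^2 + 2 * (cmod (W z g \<alpha> t))^2"
        unfolding f_def gfun_def by (rule sq_norm_add_le)
      also have "\<dots> \<le> 2 * (2 * (cmod (?L g \<alpha> * th z t))^2 + 2 * (cmod (?S g \<alpha> * ph z t))^2) + 2 * (c * ?I \<alpha>)"
        unfolding c_def by (intro add_mono mult_left_mono sq_norm_add_le W_spec(4) g that) auto
      also have "\<dots> \<le> 2 * (2 * (K^2 * (cmod (?L g \<alpha>))^2) + 2 * (K^2 * (cmod (?S g \<alpha>))^2)) + 2 * (c * ?I \<alpha>)"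
      proof -
        have "(cmod (th z t))^2 \<le> K^2" "(cmod (ph z t))^2 \<le> K^2" using K[OF that(2)] by (auto intro: power_mono)
        then have "(cmod (?L g \<alpha> * th z t))^2 \<le> K^2 * (cmod (?L g \<alpha>))^2" "(cmod (?S g \<alpha> * ph z t))^2 \<le> K^2 * (cmod (?S g \<alpha>))^2"
          by (auto simp: norm_mult power_mult_distrib mult.commute[of "K^2"] intro!: mult_left_mono)
        then show ?thesis by argo
      qed
      finally show ?thesis by (simp add: X_def)
    qed
    have hs: "((\<lambda>\<alpha>. X \<alpha>) has_sum (infsum (\<lambda>n. X (n,0)) UNIV + (infsum (\<lambda>n. X (n,1)) UNIV + infsum (\<lambda>n. X (n,2)) UNIV))) Edges"
      and XC: "\<And>j. j \<in> {0,1,2} \<Longrightarrow> infsum (\<lambda>n. X (n,j)) UNIV \<le> (8 * K^2 * C + 2 * c) * (gnorm g)^2"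
    proof -
      have j: "(\<lambda>n. X (n,j)) summable_on UNIV \<and> infsum (\<lambda>n. X (n,j)) UNIV \<le> (8 * K^2 * C + 2 * c) * (gnorm g)^2"
        if j: "j \<in> {0,1,2}" for j
      proof -
        have s: "(\<lambda>n. (cmod (?L g (n,j)))^2) summable_on UNIV" "infsum (\<lambda>n. (cmod (?L g (n,j)))^2) UNIV \<le> C * (gnorm g)^2"
          "(\<lambda>n. (cmod (?S g (n,j)))^2) summable_on UNIV" "infsum (\<lambda>n. (cmod (?S g (n,j)))^2) UNIV \<le> C * (gnorm g)^2"
          using C(2,3)[OF j g] by (auto simp: l2le_def)
        note s3 = infsum_edge_le[OF g j]
        have "infsum (\<lambda>n. X (n,j)) UNIV = 4 * K^2 * infsum (\<lambda>n. (cmod (?L g (n,j)))^2) UNIV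
            + 4 * K^2 * infsum (\<lambda>n. (cmod (?S g (n,j)))^2) UNIV + 2 * c * infsum (\<lambda>n. ?I (n,j)) UNIV"
          unfolding X_def
          by (subst infsum_add | intro summable_on_add summable_on_cmult_right s s3 | simp only: infsum_cmult_right')+
        also have "\<dots> \<le> 4 * K^2 * (C * (gnorm g)^2) + 4 * K^2 * (C * (gnorm g)^2) + 2 * c * (gnorm g)^2"
          by (intro add_mono mult_left_mono s s3) (auto simp: c_def)
        finally show ?thesis
          unfolding X_def using s s3 by (auto simp: algebra_simps intro!: summable_on_add summable_on_cmult_right)
      qed
      then show "infsum (\<lambda>n. X (n,j)) UNIV \<le> (8 * K^2 * C + 2 * c) * (gnorm g)^2" if "j \<in> {0,1,2}" for j
        using that by blast
      show "((\<lambda>\<alpha>. X \<alpha>) has_sum (infsum (\<lambda>n. X (n,0)) UNIV + (infsum (\<lambda>n. X (n,1)) UNIV + infsum (\<lambda>n. X (n,2)) UNIV))) Edges"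
        by (rule has_sum_Edges[where S="\<lambda>j. infsum (\<lambda>n. X (n,j)) UNIV"]) (use j in \<open>blast intro: has_sum_infsum\<close>)
    qed
    have XE: "infsum X Edges \<le> 3 * (8 * K^2 * C + 2 * c) * (gnorm g)^2"
      using infsumI[OF hs] XC[of 0] XC[of 1] XC[of 2] by (simp add: algebra_simps)
    have Xs: "X summable_on Edges" using hs by (rule has_sum_imp_summable)
    have fc: "continuous_on {0..1} (f \<alpha>)" if "\<alpha> \<in> Edges" for \<alpha> using ivp_continuous(2)[OF i[OF that]] .
    have le: "integral {0..1} (\<lambda>t. (cmod (f \<alpha> t))^2) \<le> X \<alpha>" if "\<alpha> \<in> Edges" for \<alpha>
    proof -
      have "integral {0..1} (\<lambda>t. (cmod (f \<alpha> t))^2) \<le> integral {0..1::real} (\<lambda>t. X \<alpha>)"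
        using X[OF that] by (intro integral_le edge_L2_integrable_sq edge_L2_continuous fc[OF that]) auto
      then show ?thesis by simp
    qed
    note gf = gL2_dominated[OF edge_L2_continuous[OF fc] Xs le]
    have "gL2 (\<lambda>\<alpha> t. pot z t * f \<alpha> t - g \<alpha> t)" by (intro gL2_diff gL2_pot_mult[OF fc Xs X] g)
    then have gf'': "gL2 f''" by (simp add: f''_def[abs_def])
    have "K0 m k f \<and> K1 m k f'"
      unfolding f_def f'_def
      using gfun_kirchhoff[OF z, where A="solA z w g" and B="solB z w g" and w="W z g" and w'="W' z g"]
        W_spec(2,3)[OF g] sol_vertex_system[OF w g] by (auto simp: rA_def rB_def)
    then have "Hdom m k f f' f''" using gf(1) gf'' W22 by (simp add: Hdom_def)
    moreover have "Hminus q f f'' z = g" unfolding Hminus_pot by (simp add: f''_def fun_eq_iff)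
    moreover have "(gnorm f)^2 \<le> 3 * (8 * K^2 * C + 2 * c) * (gnorm g)^2" using gf(2) XE by simp
    ultimately show "\<exists>f f' f''. Hdom m k f f' f'' \<and> Hminus q f f'' z = g \<and> (gnorm f)^2 \<le> 3 * (8 * K^2 * C + 2 * c) * (gnorm g)^2"
      by blast
  qed
qed

text \<open>The constructed solution satisfies the bound, and by the absence of eigenfunctions any
  element of the domain agrees with the solution constructed from its own image.\<close>

lemma resolvent_bound:
  assumes z: "phi1 q z \<noteq> 0" and F: "\<not> (F z \<in> \<real> \<and> \<bar>Re (F z)\<bar> \<le> 1)"
  obtains C where "0 \<le> C" "\<And>f f' f''. Hdom m k f f' f'' \<Longrightarrow> (gnorm f)^2 \<le> C * (gnorm (Hminus q f f'' z))^2"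
proof -
  obtain C where C: "\<And>g. gL2 g \<Longrightarrow> \<exists>f f' f''. Hdom m k f f' f'' \<and> Hminus q f f'' z = g \<and> (gnorm f)^2 \<le> C * (gnorm g)^2"
    using resolvent_solution[OF z F] by blast
  show thesis
  proof (rule that[of "max C 0"])
    fix f f' f'' assume f: "Hdom m k f f' f''"
    let ?g = "Hminus q f f'' z"
    obtain u u' u'' where u: "Hdom m k u u' u''" "Hminus q u u'' z = ?g" "(gnorm u)^2 \<le> C * (gnorm ?g)^2"
      using C[OF gL2_Hminus[OF f]] by blast
    note d = Hdom_lincomb[OF f u(1), of "-1"]
    have "Hminus q (\<lambda>\<alpha> t. f \<alpha> t + (-1) * u \<alpha> t) (\<lambda>\<alpha> t. f'' \<alpha> t + (-1) * u'' \<alpha> t) z \<alpha> t = Hminus q f f'' z \<alpha> t - Hminus q u u'' z \<alpha> t" for \<alpha> t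
      by (simp add: Hminus_def algebra_simps)
    then have "ae_eq (Hminus q (\<lambda>\<alpha> t. f \<alpha> t + (-1) * u \<alpha> t) (\<lambda>\<alpha> t. f'' \<alpha> t + (-1) * u'' \<alpha> t) z) (\<lambda>_ _. 0)"
      unfolding ae_eq_def by (simp only: u(2)) simp
    from no_eigenfunction[OF z d this] have "f \<alpha> t = u \<alpha> t" if "\<alpha> \<in> Edges" "t \<in> {0..1}" for \<alpha> t
      using that by fastforce
    then have "gnorm f = gnorm u"
      unfolding gnorm_def by (intro arg_cong[where f=sqrt] infsum_cong integral_cong) simp
    with u(3) have "(gnorm f)^2 \<le> C * (gnorm ?g)^2" by simp
    also have "\<dots> \<le> max C 0 * (gnorm ?g)^2" by (intro mult_right_mono) auto
    finally show "(gnorm f)^2 \<le> max C 0 * (gnorm ?g)^2" .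
  qed simp
qed

text \<open>A cubic bump with a prescribed derivative at one end violates the Kirchhoff condition at a single
  vertex; compensating it would require a square summable solution of the vertex recurrence with a point source,
  which does not exist when the characteristic roots are unimodular.\<close>

lemma band_subset_Hspec:
  assumes z: "phi1 q z \<noteq> 0" and F: "F z \<in> \<real>" "\<bar>Re (F z)\<bar> \<le> 1"
  shows "z \<in> Hspec q m k"
proof (rule ccontr)
  assume "z \<notin> Hspec q m k"
  then have surj: "\<And>g. gL2 g \<Longrightarrow> \<exists>f f' f''. Hdom m k f f' f'' \<and> ae_eq (Hminus q f f'' z) g"
    by (auto simp: Hspec_def)
  \<comment> \<open>The cubic t (1 - t)^2 vanishes at both ends and has derivative 1 at 0 and 0 at
    1, so it disturbs exactly one derivative at one vertex.\<close>
  define b b' b'' where "b t = complex_of_real (t * (1 - t)^2)" and "b' t = complex_of_real (1 - 4 * t + 3 * t^2)"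
    and "b'' t = complex_of_real (6 * t - 4)" for t :: real
  have Wb: "W22 b b' b''"
    unfolding W22_def
  proof (intro conjI ballI)
    show "edge_L2 b''" unfolding b''_def by (intro edge_L2_continuous continuous_intros)
    fix x :: real assume x: "x \<in> {0..1}"
    have "((\<lambda>t. t * (1 - t)^2) has_real_derivative (1 - 4 * t + 3 * t^2)) (at t within {0..x})" for t
      by (rule derivative_eq_intros refl | simp add: power2_eq_square algebra_simps)+
    then have "(b' has_integral b x - b 0) {0..x}"
      unfolding b_def b'_def using x
      by (intro fundamental_theorem_of_calculus has_vector_derivative_of_real)
        (auto simp: has_real_derivative_iff_has_vector_derivative)
    then show "b x = b 0 + integral {0..x} b'" by (simp add: integral_unique)
    have "((\<lambda>t. 1 - 4 * t + 3 * t^2) has_real_derivative (6 * t - 4)) (at t within {0..x})" for t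
      by (rule derivative_eq_intros refl | simp add: power2_eq_square algebra_simps)+
    then have "(b'' has_integral b' x - b' 0) {0..x}"
      unfolding b'_def b''_def using x
      by (intro fundamental_theorem_of_calculus has_vector_derivative_of_real)
        (auto simp: has_real_derivative_iff_has_vector_derivative)
    then show "b' x = b' 0 + integral {0..x} b''" by (simp add: integral_unique)
  qed
  have bb: "b 0 = 0" "b 1 = 0" "b' 0 = 1" "b' 1 = 0" by (simp_all add: b_def b'_def)
  define \<epsilon> :: "int \<times> nat \<Rightarrow> complex" where "\<epsilon> \<alpha> = (if \<alpha> = (0,1) then 1 else 0)" for \<alpha>
  define g where "g \<alpha> t = \<epsilon> \<alpha> * (pot z t * b t - b'' t)" for \<alpha> t
  have "edge_L2 (\<lambda>t. b t * pot z t - b'' t)"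
    by (intro edge_L2_diff edge_L2_mult_continuous pot_L2 W22_continuous[OF Wb] W22D[OF Wb])
  then have "edge_L2 (g \<alpha>)" for \<alpha> unfolding g_def by (intro edge_L2_cmult) (simp add: mult.commute)
  then have "gL2 g" by (intro finite_support_gL2[where X="{(0,1)}"]) (auto simp: g_def \<epsilon>_def)
  then obtain f f' f'' where f: "Hdom m k f f' f''" "ae_eq (Hminus q f f'' z) g" using surj by blast
  define h where "h \<alpha> t = f \<alpha> t - \<epsilon> \<alpha> * b t" for \<alpha> t
  define h' where "h' \<alpha> t = f' \<alpha> t - \<epsilon> \<alpha> * b' t" for \<alpha> t
  have ib: "ivp (pot z) (\<lambda>t. b'' t - pot z t * b t) b b'"
    by (rule W22_ivp_AE[OF Wb]) simp
  have ih: "ivp (pot z) (\<lambda>_. 0) (h \<alpha>) (h' \<alpha>)" if "\<alpha> \<in> Edges" for \<alpha>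
  proof -
    have "ivp (pot z) (\<lambda>t. 1 * (- g \<alpha> t) + (- \<epsilon> \<alpha>) * (b'' t - pot z t * b t)) (\<lambda>t. 1 * f \<alpha> t + (- \<epsilon> \<alpha>) * b t) (\<lambda>t. 1 * f' \<alpha> t + (- \<epsilon> \<alpha>) * b' t)"
      by (rule ivp_lincomb[OF Hminus_ivp[OF f that] ib])
    moreover have "1 * (- g \<alpha> t) + (- \<epsilon> \<alpha>) * (b'' t - pot z t * b t) = 0" for t by (simp add: g_def algebra_simps)
    ultimately show ?thesis by (simp add: h_def[abs_def] h'_def[abs_def])
  qed
  have K0: "K0 m k h" using HdomD(4)[OF f(1)] by (simp add: K0_def h_def bb)
  have K1f: "- f' (n,0) 1 + f' (n,1) 0 - s * f' (n,2) 1 = 0" "f' (n+1,0) 0 - f' (n,1) 1 + f' (n,2) 0 = 0" for n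
    using HdomD(5)[OF f(1)] unfolding K1_def s_def by blast+
  define A B where "A n = h (n,1) 0" and "B n = h (n,2) 0" for n
  define d :: "int \<Rightarrow> complex" where "d n = (if n = 0 then - phi1 q z else 0)" for n
  note kv = kirchhoff_vertex[OF K0, where p="\<lambda>_. 0" and r="\<lambda>_. 0" and f'=h' and z=z]
  have sys: "B (n-1) + sg * B n - pA z * A n = d n" "A (n+1) + cnj sg * A n - pB z * B n = 0" for n
  proof -
    have "- h' (n,0) 1 + h' (n,1) 0 - s * h' (n,2) 1 = (if n = 0 then -1 else 0)"
    proof -
      have "- h' (n,0) 1 + h' (n,1) 0 - s * h' (n,2) 1 = (- f' (n,0) 1 + f' (n,1) 0 - s * f' (n,2) 1) - \<epsilon> (n,1)"
        by (simp add: h'_def \<epsilon>_def bb)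
      then show ?thesis unfolding K1f(1) by (simp add: \<epsilon>_def)
    qed
    moreover have "phi1 q z * (- h' (n,0) 1 + h' (n,1) 0 - s * h' (n,2) 1) = B (n-1) + sg * B n - pA z * A n - dA z (\<lambda>_. 0) (\<lambda>_. 0) n"
      unfolding A_def B_def by (rule kv(1)) (use ivp_endpoint_scaled[OF ih] in auto)
    ultimately show "B (n-1) + sg * B n - pA z * A n = d n" by (cases "n = 0"; simp add: d_def dA_def)
    have "h' (n+1,0) 0 - h' (n,1) 1 + h' (n,2) 0 = 0"
      using K1f(2)[of n] by (simp add: h'_def \<epsilon>_def bb)
    moreover have "phi1 q z * (h' (n+1,0) 0 - h' (n,1) 1 + h' (n,2) 0) = A (n+1) + cnj sg * A n - pB z * B n - dB z (\<lambda>_. 0) (\<lambda>_. 0) n"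
      unfolding A_def B_def by (rule kv(2)) (use ivp_endpoint_scaled[OF ih] in auto)
    ultimately show "A (n+1) + cnj sg * A n - pB z * B n = 0" by (simp add: dB_def)
  qed
  have LB: "sg * B (n+1) + cnj sg * B (n-1) - 4 * of_real (cN m k) * F z * B n = d (n+1) + cnj sg * d n" for n
    using vertex_system_B[where e="\<lambda>_. 0", OF sys] by simp
  define v where "v n = gauge n * B n" for n
  \<comment> \<open>The source sits at n = 0 and n = -1 only, so the nonnegative and the negative
    integers decouple into two half-line recurrences, each with only the zero decaying
    solution.\<close>
  have rec: "v (n+1) + v (n-1) = 2 * F z * v n" if "n \<noteq> 0" "n \<noteq> -1" for n
  proof -
    have "d (n+1) + cnj sg * d n = 0" using that by (simp add: d_def)
    then have "v (n+1) + v (n-1) - 2 * F z * v n = 0"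
      using LB[of n] cN_nz unfolding gauge_recurrence v_def by simp
    then show ?thesis by (simp only: right_minus_eq)
  qed
  have "(\<lambda>n. (cmod (B n))^2) summable_on UNIV"
    using Hdom_boundary_l2(1)[OF f(1), of 2 0] by (simp add: B_def h_def \<epsilon>_def)
  then have vl2: "(\<lambda>n. (cmod (v n))^2) summable_on UNIV" by (simp add: v_def norm_mult)
  obtain w where w: "cmod w = 1" "w + 1 / w = 2 * F z" using unimodular_root[OF F] by blast
  have v1: "v (int n) = 0" for n
  proof (rule nat_recurrence_vanishes[where v="\<lambda>n. v (int n)", OF _ _ w])
    show "v (int (Suc (Suc n))) + v (int n) = 2 * F z * v (int (Suc n))" for n
      using rec[of "int n + 1"] by (simp add: add.commute)
    show "(\<lambda>n. v (int n)) \<longlonglongrightarrow> 0" by (rule l2_int_tendsto_0[OF vl2]) (simp add: inj_on_def)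
  qed
  have v2: "v (- 1 - int n) = 0" for n
  proof (rule nat_recurrence_vanishes[where v="\<lambda>n. v (- 1 - int n)", OF _ _ w])
    show "v (- 1 - int (Suc (Suc n))) + v (- 1 - int n) = 2 * F z * v (- 1 - int (Suc n))" for n
    proof -
      have e: "- 1 - int (Suc n) + 1 = - 1 - int n" "- 1 - int (Suc n) - 1 = - 1 - int (Suc (Suc n))" by simp_all
      show ?thesis using rec[of "- 1 - int (Suc n)"] unfolding e by (simp only: add.commute)
    qed
    show "(\<lambda>n. v (- 1 - int n)) \<longlonglongrightarrow> 0" by (rule l2_int_tendsto_0[OF vl2]) (simp add: inj_on_def)
  qed
  have "B n = 0" for n
  proof (cases "0 \<le> n")
    case True then show ?thesis using v1[of "nat n"] by (simp add: v_def)
  next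
    case False then show ?thesis using v2[of "nat (- 1 - n)"] by (simp add: v_def)
  qed
  \<comment> \<open>With \<open>B\<close> identically zero the recurrence at n = -1 reads 0 = d 0,
    that is \<open>phi1 q z = 0\<close>.\<close>
  with LB[of "-1"] z show False by (simp add: d_def)
qed

lemma resolvent_set:
  assumes "phi1 q z \<noteq> 0" "\<not> (F z \<in> \<real> \<and> \<bar>Re (F z)\<bar> \<le> 1)"
  shows "z \<notin> Hspec q m k"
proof -
  obtain C where C: "0 \<le> C" "\<And>f f' f''. Hdom m k f f' f'' \<Longrightarrow> (gnorm f)^2 \<le> C * (gnorm (Hminus q f f'' z))^2"
    using resolvent_bound[OF assms] by blast
  have "gnorm f \<le> sqrt C * gnorm (Hminus q f f'' z)" if "Hdom m k f f' f''" for f f' f''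
    using real_sqrt_le_mono[OF C(2)[OF that]] gnorm_nonneg C(1) by (simp add: real_sqrt_mult)
  moreover have "\<exists>f f' f''. Hdom m k f f' f'' \<and> ae_eq (Hminus q f f'' z) g" if "gL2 g" for g
  proof -
    obtain C' where "\<And>g. gL2 g \<Longrightarrow> \<exists>f f' f''. Hdom m k f f' f'' \<and> Hminus q f f'' z = g \<and> (gnorm f)^2 \<le> C' * (gnorm g)^2"
      using resolvent_solution[OF assms] by blast
    from this[OF that] obtain f f' f'' where "Hdom m k f f' f''" "Hminus q f f'' z = g" by blast
    then show ?thesis by (intro exI conjI) (auto simp: ae_eq_def)
  qed
  ultimately show ?thesis unfolding Hspec_def by blast
qed

lemma Heigen_subset_Hspec: "Heigen q m k \<subseteq> Hspec q m k"
proof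
  fix z assume "z \<in> Heigen q m k"
  then obtain f f' f'' where f: "Hdom m k f f' f''" "gnorm f \<noteq> 0" "ae_eq (Hminus q f f'' z) (\<lambda>_ _. 0)"
    unfolding Heigen_def by blast
  have "gnorm (Hminus q f f'' z) = 0"
  proof (rule gnorm_zero)
    fix \<alpha> assume \<alpha>: "\<alpha> \<in> Edges"
    have "AE t in lborel. t \<in> {0..1} \<longrightarrow> Hminus q f f'' z \<alpha> t = 0" using f(3) \<alpha> by (auto simp: ae_eq_def)
    then obtain N where N: "N \<in> null_sets lborel" "{t. \<not> (t \<in> {0..1} \<longrightarrow> Hminus q f f'' z \<alpha> t = 0)} \<subseteq> N"
      unfolding eventually_ae_filter by auto
    have neg: "negligible N" using N(1) by (simp add: negligible_iff_null_sets null_sets_completionI)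
    have "integral {0..1} (\<lambda>t. (cmod (Hminus q f f'' z \<alpha> t))^2) = integral {0..1::real} (\<lambda>t. 0)"
      by (rule integral_spike[OF neg]) (use N(2) in auto)
    then show "integral {0..1} (\<lambda>t. (cmod (Hminus q f f'' z \<alpha> t))^2) = 0" by simp
  qed
  with f show "z \<in> Hspec q m k" unfolding Hspec_def using gnorm_nonneg[of f] by fastforce
qed

lemma Hspec_eq: "Hspec q m k = sigmaD q \<union> {complex_of_real x |x. \<bar>Re (F (of_real x))\<bar> \<le> 1}"
proof (intro equalityI subsetI)
  fix z assume "z \<in> Hspec q m k"
  then have "phi1 q z = 0 \<or> (F z \<in> \<real> \<and> \<bar>Re (F z)\<bar> \<le> 1)" using resolvent_set by blast
  moreover have "Im z = 0" if "F z \<in> \<real>" "\<bar>Re (F z)\<bar> \<le> 1" using F_nonreal[of z] that by blast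
  moreover have "z = of_real (Re z)" if "Im z = 0" using that by (simp add: complex_eq_iff)
  ultimately show "z \<in> sigmaD q \<union> {complex_of_real x |x. \<bar>Re (F (of_real x))\<bar> \<le> 1}"
    unfolding sigmaD_def by (smt (verit) UnCI mem_Collect_eq)
next
  fix z assume "z \<in> sigmaD q \<union> {complex_of_real x |x. \<bar>Re (F (of_real x))\<bar> \<le> 1}"
  then consider "z \<in> sigmaD q" | x where "z = of_real x" "\<bar>Re (F (of_real x))\<bar> \<le> 1" by blast
  then show "z \<in> Hspec q m k"
  proof cases
    case 1 then show ?thesis using Heigen_subset_Hspec Heigen_eq by blast
  next
    case 2
    show ?thesis
    proof (cases "phi1 q z = 0")
      case True then show ?thesis using Heigen_subset_Hspec Heigen_eq by (auto simp: sigmaD_def)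
    next
      case False then show ?thesis using 2 F_Reals[of z] by (intro band_subset_Hspec) auto
    qed
  qed
qed

end

subsection \<open>Spectral measures outside the bands\<close>

lemma gL2_mult_summable:
  assumes "gL2 u" "gL2 f"
  shows "(\<lambda>\<alpha>. integral {0..1} (\<lambda>t. u \<alpha> t * cnj (f \<alpha> t))) summable_on Edges"
proof (rule abs_summable_summable[OF Infinite_Sum.abs_summable_on_comparison_test'])
  let ?I = "\<lambda>f \<alpha>. integral {0..1} (\<lambda>t. (cmod (f \<alpha> t))^2)"
  show "(\<lambda>\<alpha>. ?I u \<alpha> + ?I f \<alpha>) summable_on Edges"
    using assms by (intro summable_on_add) (auto simp: gL2_def)
  fix \<alpha> assume \<alpha>: "\<alpha> \<in> Edges"
  note L = gL2D[OF assms(1) \<alpha>] gL2D[OF assms(2) \<alpha>]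
  note i = edge_L2_integrable_sq[OF L(1)] edge_L2_integrable_sq[OF L(2)]
  have "cmod (integral {0..1} (\<lambda>t. u \<alpha> t * cnj (f \<alpha> t))) \<le> integral {0..1} (\<lambda>t. (cmod (u \<alpha> t))^2 + (cmod (f \<alpha> t))^2)"
    using edge_L2_mult_integrable[OF L(1) edge_L2_cnj[OF L(2)]]
    by (intro integral_norm_bound_integral integrable_add i)
      (auto simp: norm_mult mult_le_sum_squares absolutely_integrable_on_def)
  also have "\<dots> = ?I u \<alpha> + ?I f \<alpha>" by (rule integral_add[OF i])
  finally show "cmod (integral {0..1} (\<lambda>t. u \<alpha> t * cnj (f \<alpha> t))) \<le> ?I u \<alpha> + ?I f \<alpha>" .
qed

lemma ae_eq_integral:
  fixes \<Phi> :: "real \<Rightarrow> complex \<Rightarrow> 'b::euclidean_space"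
  assumes "ae_eq f g" "\<alpha> \<in> Edges"
  shows "integral {0..1} (\<lambda>t. \<Phi> t (f \<alpha> t)) = integral {0..1} (\<lambda>t. \<Phi> t (g \<alpha> t))"
proof -
  have "AE t in lborel. t \<in> {0..1} \<longrightarrow> f \<alpha> t = g \<alpha> t" using assms by (auto simp: ae_eq_def)
  then obtain N where N: "N \<in> null_sets lborel" "{t. \<not> (t \<in> {0..1} \<longrightarrow> f \<alpha> t = g \<alpha> t)} \<subseteq> N"
    unfolding eventually_ae_filter by auto
  have neg: "negligible N" using N(1) by (simp add: negligible_iff_null_sets null_sets_completionI)
  show ?thesis by (rule integral_spike[OF neg]) (use N(2) in force)
qed

context nanotube
begin

text \<open>The flux of a cell is a difference of shifted currents, and a summable sequence and its
  shift have the same sum. This is the symmetry of the operator on its domain.\<close>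

lemma has_sum_flux:
  assumes u: "Hdom m k u u' u''"
  shows "(flux u u' has_sum 0) Edges"
proof -
  define G where "G n = Im (cnj (u (n,0) 0) * u' (n,0) 0)" for n
  have prod: "(\<lambda>n. Im (cnj (u (n,j) x) * u' (n,j) x)) summable_on UNIV" if "j \<in> {0,1,2}" "x \<in> {0..1}" for j x
  proof (rule abs_summable_summable[OF Infinite_Sum.abs_summable_on_comparison_test'])
    show "(\<lambda>n. (cmod (u (n,j) x))^2 + (cmod (u' (n,j) x))^2) summable_on UNIV"
      by (intro summable_on_add Hdom_boundary_l2[OF u that])
    fix n
    have "norm (Im (cnj (u (n,j) x) * u' (n,j) x)) \<le> cmod (cnj (u (n,j) x) * u' (n,j) x)"
      unfolding real_norm_def by (rule abs_Im_le_cmod)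
    also have "\<dots> \<le> (cmod (u (n,j) x))^2 + (cmod (u' (n,j) x))^2" by (simp add: norm_mult mult_le_sum_squares)
    finally show "norm (Im (cnj (u (n,j) x) * u' (n,j) x)) \<le> (cmod (u (n,j) x))^2 + (cmod (u' (n,j) x))^2" .
  qed
  have fs: "(\<lambda>n. flux u u' (n,j)) summable_on UNIV" if "j \<in> {0,1,2}" for j
  proof -
    have "flux u u' (n,j) = Im (cnj (u (n,j) 1) * u' (n,j) 1) + (-1) * Im (cnj (u (n,j) 0) * u' (n,j) 0)" for n
      by (simp add: flux_def)
    then show ?thesis
      using summable_on_add[OF prod[OF that, of 1] summable_on_cmult_right[OF prod[OF that, of 0], of "-1"]]
      by (simp only:) simp
  qed
  define T where "T j = infsum (\<lambda>n. flux u u' (n,j)) UNIV" for j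
  have T: "((\<lambda>n. flux u u' (n,j)) has_sum T j) UNIV" if "j \<in> {0,1,2}" for j
    unfolding T_def by (rule has_sum_infsum[OF fs[OF that]])
  have "((\<lambda>n. flux u u' (n,0) + (flux u u' (n,1) + flux u u' (n,2))) has_sum (T 0 + (T 1 + T 2))) UNIV"
    by (intro has_sum_add T) auto
  moreover have "flux u u' (n,0) + (flux u u' (n,1) + flux u u' (n,2)) = G (n+1) + (-1) * G n" for n
    using cell_flux[OF HdomD(4,5)[OF u], of n] by (simp add: G_def)
  moreover have "((\<lambda>n. G (n+1) + (-1) * G n) has_sum 0) UNIV"
  proof -
    have G: "(G has_sum infsum G UNIV) UNIV" using prod[of 0 0] by (intro has_sum_infsum) (simp add: G_def[abs_def])
    have "bij (\<lambda>n::int. n + 1)" by (rule bij_betw_byWitness[where f'="\<lambda>n. n - 1"]) auto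
    then have "((\<lambda>n. G (n+1)) has_sum infsum G UNIV) UNIV"
      using has_sum_reindex_bij_betw[of "\<lambda>n. n + 1" UNIV UNIV G] G by simp
    from has_sum_add[OF this has_sum_cmult_right[OF G, of "-1"]] show ?thesis by simp
  qed
  ultimately have "T 0 + (T 1 + T 2) = 0" using has_sum_unique by (simp only:) blast
  then show ?thesis using has_sum_Edges[of "flux u u'" T, OF T] by simp
qed

text \<open>The inner product is conjugate linear in its second argument, whence \<open>Im z\<close>
  with a plus sign; the total flux contributes nothing.\<close>

lemma symmetric_quadratic_form:
  assumes u: "Hdom m k u u' u''" and f: "ae_eq (Hminus q u u'' z) f" "gL2 f"
  shows "Im (ginner u f) = Im z * (gnorm u)^2"
proof -
  let ?I = "\<lambda>\<alpha>. integral {0..1} (\<lambda>t. (cmod (u \<alpha> t))^2)"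
  have e: "Im (integral {0..1} (\<lambda>t. u \<alpha> t * cnj (f \<alpha> t))) = flux u u' \<alpha> + Im z * ?I \<alpha>" if \<alpha>: "\<alpha> \<in> Edges" for \<alpha>
  proof -
    let ?h = "Hminus q u u'' z \<alpha>"
    have "integral {0..1} (\<lambda>t. u \<alpha> t * cnj (f \<alpha> t)) = integral {0..1} (\<lambda>t. u \<alpha> t * cnj (?h t))"
      using ae_eq_integral[OF f(1) \<alpha>, where \<Phi>="\<lambda>t x. u \<alpha> t * cnj x"] by simp
    moreover have "(\<lambda>t. u \<alpha> t * cnj (?h t)) integrable_on {0..1}"
      using edge_L2_mult_integrable[OF gL2D[OF HdomD(1)[OF u] \<alpha>] edge_L2_cnj[OF gL2D[OF gL2_Hminus[OF u] \<alpha>]]]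
      by (auto simp: absolutely_integrable_on_def)
    then have "Im (integral {0..1} (\<lambda>t. u \<alpha> t * cnj (?h t))) = integral {0..1} (\<lambda>t. Im (u \<alpha> t * cnj (?h t)))"
      using integral_linear[OF _ bounded_linear_Im] by (fastforce simp: o_def)
    moreover have "Im (u \<alpha> t * cnj (?h t)) = Im (cnj (u \<alpha> t) * u'' \<alpha> t) + Im z * (cmod (u \<alpha> t))^2" for t
      unfolding Hminus_def cmod_power2 by (simp add: power2_eq_square algebra_simps)
    moreover have "((\<lambda>t. Im (cnj (u \<alpha> t) * u'' \<alpha> t) + Im z * (cmod (u \<alpha> t))^2) has_integral flux u u' \<alpha> + Im z * ?I \<alpha>) {0..1}"
      unfolding flux_def
      by (intro has_integral_add has_integral_mult_right integrable_integral W22_green_Im HdomD(3)[OF u \<alpha>]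
          edge_L2_integrable_sq gL2D[OF HdomD(1)[OF u] \<alpha>])
    ultimately show ?thesis by (simp add: integral_unique)
  qed
  have "((\<lambda>\<alpha>. Im (integral {0..1} (\<lambda>t. u \<alpha> t * cnj (f \<alpha> t)))) has_sum Im (ginner u f)) Edges"
    unfolding ginner_def by (intro has_sum_Im has_sum_infsum gL2_mult_summable HdomD(1)[OF u] f(2))
  moreover have "((\<lambda>\<alpha>. flux u u' \<alpha> + Im z * ?I \<alpha>) has_sum (0 + Im z * (gnorm u)^2)) Edges"
    unfolding gnorm_sq using HdomD(1)[OF u]
    by (intro has_sum_add has_sum_flux[OF u] has_sum_cmult_right has_sum_infsum) (auto simp: gL2_def)
  ultimately show ?thesis using has_sum_cong[of Edges, OF e] has_sum_unique by fastforce
qed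

text \<open>By symmetry the cross term in |(H - y) u - i \<delta> u|^2 sums to zero, so the squared
  norm of \<open>f\<close> is that of (H - y) u plus \<delta>^2 times that of
  \<open>u\<close>.\<close>

lemma gnorm_Hminus_real_le:
  assumes u: "Hdom m k u u' u''" and f: "Hminus q u u'' (Complex y \<delta>) = f"
  shows "(gnorm (Hminus q u u'' (of_real y)))^2 \<le> (gnorm f)^2"
proof -
  have fL: "gL2 f" using gL2_Hminus[OF u] f by blast
  have ae: "ae_eq (Hminus q u u'' (Complex y \<delta>)) f" unfolding f by (simp add: ae_eq_def)
  let ?I = "\<lambda>f \<alpha>. integral {0..1} (\<lambda>t. (cmod (f \<alpha> t))^2)"
  let ?k = "Hminus q u u'' (of_real y)"
  have e: "?I ?k \<alpha> = ?I f \<alpha> + \<delta>^2 * ?I u \<alpha> + (- 2 * \<delta>) * Im (integral {0..1} (\<lambda>t. u \<alpha> t * cnj (f \<alpha> t)))" if \<alpha>: "\<alpha> \<in> Edges" for \<alpha>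
  proof -
    have pw: "(cmod (?k \<alpha> t))^2 = (cmod (f \<alpha> t))^2 + \<delta>^2 * (cmod (u \<alpha> t))^2 + (- 2 * \<delta>) * Im (u \<alpha> t * cnj (f \<alpha> t))" for t
    proof -
      have "?k \<alpha> t = f \<alpha> t + \<i> * of_real \<delta> * u \<alpha> t"
        unfolding f[symmetric] by (simp add: Hminus_def complex_eq_iff algebra_simps)
      then show ?thesis unfolding cmod_power2 by (simp add: power2_eq_square algebra_simps)
    qed
    have i: "(\<lambda>t. u \<alpha> t * cnj (f \<alpha> t)) integrable_on {0..1}"
      using edge_L2_mult_integrable[OF gL2D[OF HdomD(1)[OF u] \<alpha>] edge_L2_cnj[OF gL2D[OF fL \<alpha>]]]
      by (auto simp: absolutely_integrable_on_def)
    have "((\<lambda>t. Im (u \<alpha> t * cnj (f \<alpha> t))) has_integral Im (integral {0..1} (\<lambda>t. u \<alpha> t * cnj (f \<alpha> t)))) {0..1}"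
      using has_integral_linear[OF integrable_integral[OF i] bounded_linear_Im] by (simp add: o_def)
    then have "((\<lambda>t. (cmod (?k \<alpha> t))^2) has_integral ?I f \<alpha> + \<delta>^2 * ?I u \<alpha> + (- 2 * \<delta>) * Im (integral {0..1} (\<lambda>t. u \<alpha> t * cnj (f \<alpha> t)))) {0..1}"
      unfolding pw
      by (intro has_integral_add has_integral_mult_right integrable_integral edge_L2_integrable_sq
          gL2D[OF HdomD(1)[OF u] \<alpha>] gL2D[OF fL \<alpha>])
    then show ?thesis by (rule integral_unique)
  qed
  have "((\<lambda>\<alpha>. ?I f \<alpha> + \<delta>^2 * ?I u \<alpha> + (- 2 * \<delta>) * Im (integral {0..1} (\<lambda>t. u \<alpha> t * cnj (f \<alpha> t)))) has_sum
      ((gnorm f)^2 + \<delta>^2 * (gnorm u)^2 + (- 2 * \<delta>) * Im (ginner u f))) Edges"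
    unfolding gnorm_sq ginner_def using HdomD(1)[OF u] fL
    by (intro has_sum_add has_sum_cmult_right has_sum_infsum has_sum_Im gL2_mult_summable) (auto simp: gL2_def)
  then have "(gnorm ?k)^2 = (gnorm f)^2 + \<delta>^2 * (gnorm u)^2 + (- 2 * \<delta>) * Im (ginner u f)"
    unfolding gnorm_sq[of ?k] using has_sum_cong[of Edges, OF e] infsumI by fastforce
  also have "Im (ginner u f) = \<delta> * (gnorm u)^2"
    using symmetric_quadratic_form[OF u ae fL] by simp
  finally show ?thesis using zero_le_power2[of "\<delta> * gnorm u"] by (simp add: power2_eq_square algebra_simps)
qed

text \<open>The imaginary part of the Cauchy transform at y + i \<delta> is a Poisson integral,
  whose kernel is at least 1 / (2 \<delta>) on the ball. It equals \<delta> times the squared norm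
  of the resolvent applied to \<open>f\<close>, which stays bounded since \<open>y\<close> lies in
  the resolvent set.\<close>

lemma spec_meas_resolvent:
  assumes y: "phi1 q (of_real y) \<noteq> 0" "1 < \<bar>Re (F (of_real y))\<bar>" and f: "gL2 f" and \<mu>: "spec_meas q m k f \<mu>"
  obtains M where "0 \<le> M" "\<And>\<delta>. 0 < \<delta> \<Longrightarrow> measure \<mu> (ball y \<delta>) \<le> M * \<delta>^2"
proof -
  interpret finite_measure \<mu> using \<mu> by (simp add: spec_meas_def)
  have sets: "sets \<mu> = sets borel" using \<mu> by (simp add: spec_meas_def)
  obtain C where C: "0 \<le> C" "\<And>u u' u''. Hdom m k u u' u'' \<Longrightarrow> (gnorm u)^2 \<le> C * (gnorm (Hminus q u u'' (of_real y)))^2"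
    using resolvent_bound[OF y(1)] y(2) by (metis not_less)
  show thesis
  proof (rule that[of "2 * C * (gnorm f)^2"])
    show "0 \<le> 2 * C * (gnorm f)^2" using C(1) by simp
    fix \<delta> :: real assume \<delta>: "0 < \<delta>"
    let ?z = "Complex y \<delta>"
    have "phi1 q ?z \<noteq> 0" "\<not> (F ?z \<in> \<real> \<and> \<bar>Re (F ?z)\<bar> \<le> 1)" using phi1_nonreal[of ?z] F_nonreal[of ?z] \<delta> by auto
    then obtain C' where "\<And>g. gL2 g \<Longrightarrow> \<exists>f f' f''. Hdom m k f f' f'' \<and> Hminus q f f'' ?z = g \<and> (gnorm f)^2 \<le> C' * (gnorm g)^2"
      using resolvent_solution by blast
    from this[OF f] obtain u u' u'' where u: "Hdom m k u u' u''" "Hminus q u u'' ?z = f" by blast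
    then have ae: "ae_eq (Hminus q u u'' ?z) f" by (simp add: ae_eq_def)
    have g: "ginner u f = integral\<^sup>L \<mu> (\<lambda>t. 1 / (of_real t - ?z))"
      using \<mu> u(1) ae \<delta> unfolding spec_meas_def by (metis complex.sel(2) less_irrefl)
    have im: "Im (1 / (of_real t - ?z)) = \<delta> / ((t - y)^2 + \<delta>^2)" for t
    proof -
      have "of_real t - ?z = Complex (t - y) (- \<delta>)" by (simp add: complex_eq_iff)
      then show ?thesis by (simp add: Im_divide)
    qed
    have integ: "integrable \<mu> (\<lambda>t. 1 / (of_real t - ?z))"
    proof (rule integrable_const_bound[of _ "1 / \<delta>"])
      show "AE t in \<mu>. cmod (1 / (of_real t - ?z)) \<le> 1 / \<delta>"
      proof (intro always_eventually allI)
        fix t :: real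
        have "\<delta> \<le> cmod (of_real t - ?z)" using abs_Im_le_cmod[of "of_real t - ?z"] \<delta> by simp
        then show "cmod (1 / (of_real t - ?z)) \<le> 1 / \<delta>" using \<delta> by (simp add: norm_divide frac_le)
      qed
      show "(\<lambda>t. 1 / (of_real t - ?z)) \<in> borel_measurable \<mu>"
        unfolding measurable_cong_sets[OF sets refl] by measurable
    qed
    have "Im (ginner u f) = integral\<^sup>L \<mu> (\<lambda>t. \<delta> / ((t - y)^2 + \<delta>^2))"
      unfolding g using integral_Im[OF integ] by (simp add: im)
    also have "integral\<^sup>L \<mu> (\<lambda>t. \<delta> / ((t - y)^2 + \<delta>^2)) \<ge> integral\<^sup>L \<mu> (\<lambda>t. (1 / (2 * \<delta>)) * indicator (ball y \<delta>) t)"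
    proof (rule integral_mono)
      show "integrable \<mu> (\<lambda>t. (1 / (2 * \<delta>)) * indicator (ball y \<delta>) t :: real)"
        using sets by (intro integrable_mult_right) (auto intro!: integrable_real_indicator simp: emeasure_eq_measure)
      show "integrable \<mu> (\<lambda>t. \<delta> / ((t - y)^2 + \<delta>^2))" using integrable_Im[OF integ] by (simp add: im)
      fix t
      show "(1 / (2 * \<delta>)) * indicator (ball y \<delta>) t \<le> \<delta> / ((t - y)^2 + \<delta>^2)"
      proof (cases "t \<in> ball y \<delta>")
        case True
        then have "\<bar>t - y\<bar> \<le> \<delta>" by (simp add: dist_real_def)
        then have "(t - y)^2 \<le> \<delta>^2" using \<delta> by (simp add: abs_le_square_iff[symmetric])
        then have "\<delta> / (\<delta>^2 + \<delta>^2) \<le> \<delta> / ((t - y)^2 + \<delta>^2)"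
          using \<delta> by (intro divide_left_mono mult_pos_pos add_nonneg_pos) auto
        moreover have "\<delta> / (\<delta>^2 + \<delta>^2) = 1 / (2 * \<delta>)" using \<delta> by (simp add: power2_eq_square)
        ultimately show ?thesis using True by simp
      qed (use \<delta> in auto)
    qed
    finally have "(1 / (2 * \<delta>)) * measure \<mu> (ball y \<delta>) \<le> Im (ginner u f)"
      using sets by simp
    also have "\<dots> = \<delta> * (gnorm u)^2" using symmetric_quadratic_form[OF u(1) ae f] by simp
    also have "\<dots> \<le> \<delta> * (C * (gnorm f)^2)"
    proof (intro mult_left_mono)
      have "(gnorm u)^2 \<le> C * (gnorm (Hminus q u u'' (of_real y)))^2" by (rule C(2)[OF u(1)])
      also have "\<dots> \<le> C * (gnorm f)^2" by (intro mult_left_mono gnorm_Hminus_real_le[OF u] C(1))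
      finally show "(gnorm u)^2 \<le> C * (gnorm f)^2" .
    qed (use \<delta> in simp)
    finally show "measure \<mu> (ball y \<delta>) \<le> 2 * C * (gnorm f)^2 * \<delta>^2"
      using \<delta> by (simp add: field_simps power2_eq_square)
  qed
qed

text \<open>Near a point with |F| > 1 the measure of a ball is quadratic in the radius, so the
  distribution function has derivative zero there and is constant: an absolutely continuous spectral
  measure has no mass.\<close>

lemma Hac_subset: "Hac q m k \<subseteq> {complex_of_real x |x. \<bar>Re (F (of_real x))\<bar> \<le> 1}"
proof
  fix z assume "z \<in> Hac q m k"
  then obtain x where x: "z = of_real x" and ac: "\<And>\<epsilon>. 0 < \<epsilon> \<Longrightarrow>
      \<exists>f \<mu>. gL2 f \<and> spec_meas q m k f \<mu> \<and> absolutely_continuous lborel \<mu> \<and> emeasure \<mu> (ball x \<epsilon>) > 0"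
    unfolding Hac_def by blast
  have "\<bar>Re (F (of_real x))\<bar> \<le> 1"
  proof (rule ccontr)
    assume "\<not> \<bar>Re (F (of_real x))\<bar> \<le> 1"
    then have gt: "1 < \<bar>Re (F (of_real x))\<bar>" by simp
    have "continuous_on UNIV (\<lambda>y::real. \<bar>Re (F (of_real y))\<bar>)"
      by (intro continuous_intros continuous_on_compose2[OF holomorphic_on_imp_continuous_on[OF F_holomorphic[of UNIV]]]) auto
    then have "\<forall>\<^sub>F y in at x. 1 < \<bar>Re (F (of_real y))\<bar>"
      using gt by (auto simp: continuous_on_def intro!: order_tendstoD)
    then obtain r1 where r1: "0 < r1" "\<And>y. y \<noteq> x \<Longrightarrow> dist y x < r1 \<Longrightarrow> 1 < \<bar>Re (F (of_real y))\<bar>"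
      unfolding eventually_at by auto
    obtain r2 where r2: "0 < r2" "\<And>w. w \<noteq> of_real x \<Longrightarrow> dist w (of_real x) < r2 \<Longrightarrow> phi1 q w \<noteq> 0"
      using sigmaD_isolated[of "of_real x"] by blast
    define e where "e = min r1 r2 / 2"
    have e: "0 < e" "e < r1" "e < r2" using r1 r2 by (auto simp: e_def min_def)
    obtain f \<mu> where f: "gL2 f" "spec_meas q m k f \<mu>" "absolutely_continuous lborel \<mu>" "emeasure \<mu> (ball x e) > 0"
      using ac[OF e(1)] by blast
    interpret finite_measure \<mu> using f(2) by (simp add: spec_meas_def)
    have sets: "sets \<mu> = sets borel" using f(2) by (simp add: spec_meas_def)
    interpret finite_borel_measure \<mu> by unfold_locales (rule sets)
    have atom: "measure \<mu> {t} = 0" for t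
    proof -
      have "{t} \<in> null_sets lborel" by (intro null_setsI) auto
      then have "{t} \<in> null_sets \<mu>" using f(3) unfolding absolutely_continuous_def by blast
      then show ?thesis by (simp add: measure_def null_sets_def)
    qed
    have der: "(cdf \<mu> has_derivative (\<lambda>h. 0)) (at y within {x - e..x + e})" if y: "y \<in> {x - e..x + e} - {x}" for y
    proof -
      have "phi1 q (of_real y) \<noteq> 0"
      proof (rule r2(2))
        show "complex_of_real y \<noteq> of_real x" using y by simp
        have "dist (complex_of_real y) (of_real x) = \<bar>y - x\<bar>" by (simp add: dist_norm flip: of_real_diff)
        then show "dist (complex_of_real y) (of_real x) < r2" using y e by auto
      qed
      moreover have "1 < \<bar>Re (F (of_real y))\<bar>" using y e by (intro r1(2)) (auto simp: dist_real_def)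
      ultimately obtain M where M: "0 \<le> M" "\<And>\<delta>. 0 < \<delta> \<Longrightarrow> measure \<mu> (ball y \<delta>) \<le> M * \<delta>^2"
        using spec_meas_resolvent[OF _ _ f(1,2)] by blast
      \<comment> \<open>The radius is doubled because the half-open interval includes its right end,
        which an open ball of radius |t - y| would miss.\<close>
      have diff: "\<bar>cdf \<mu> t - cdf \<mu> y\<bar> \<le> M * (2 * \<bar>t - y\<bar>)^2" if "t \<noteq> y" for t
      proof -
        let ?a = "min t y" and ?b = "max t y"
        have "\<bar>cdf \<mu> t - cdf \<mu> y\<bar> = cdf \<mu> ?b - cdf \<mu> ?a"
          using cdf_nondecreasing[of t y] cdf_nondecreasing[of y t] by (auto simp: min_def max_def)
        also have "\<dots> = measure \<mu> {?a<..?b}" using that by (intro cdf_diff_eq) (auto simp: min_def max_def)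
        also have "\<dots> \<le> measure \<mu> (ball y (2 * \<bar>t - y\<bar>))"
          using that sets by (intro finite_measure_mono) (auto simp: dist_real_def min_def max_def split: if_splits)
        also have "\<dots> \<le> M * (2 * \<bar>t - y\<bar>)^2" using that by (intro M) auto
        finally show ?thesis .
      qed
      have "((\<lambda>t. (1 / norm (t - y)) *\<^sub>R (cdf \<mu> t - (cdf \<mu> y + 0))) \<longlongrightarrow> 0) (at y within {x - e..x + e})"
      proof (rule Lim_null_comparison)
        show "\<forall>\<^sub>F t in at y within {x - e..x + e}. norm ((1 / norm (t - y)) *\<^sub>R (cdf \<mu> t - (cdf \<mu> y + 0))) \<le> 4 * M * \<bar>t - y\<bar>"
          unfolding eventually_at_filter
        proof (intro always_eventually allI impI)
          fix t assume t: "t \<noteq> y"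
          have "norm ((1 / norm (t - y)) *\<^sub>R (cdf \<mu> t - (cdf \<mu> y + 0))) = \<bar>cdf \<mu> t - cdf \<mu> y\<bar> / \<bar>t - y\<bar>" by simp
          also have "\<dots> \<le> M * (2 * \<bar>t - y\<bar>)^2 / \<bar>t - y\<bar>" by (intro divide_right_mono diff t) auto
          also have "M * (2 * d)^2 / d = 4 * M * d" for d by (simp add: power2_eq_square)
          finally show "norm ((1 / norm (t - y)) *\<^sub>R (cdf \<mu> t - (cdf \<mu> y + 0))) \<le> 4 * M * \<bar>t - y\<bar>" .
        qed
        show "((\<lambda>t. 4 * M * \<bar>t - y\<bar>) \<longlongrightarrow> 0) (at y within {x - e..x + e})" by (auto intro!: tendsto_eq_intros)
      qed
      then show ?thesis by (simp add: has_derivative_within)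
    qed
    have "cdf \<mu> (x + e) = cdf \<mu> (x - e)"
    \<comment> \<open>The centre \<open>x\<close> may be a Dirichlet eigenvalue, where no derivative
      is known. Continuity at this one exceptional point, from the absence of atoms, is
      enough.\<close>
    proof (rule has_derivative_zero_unique_strong_interval[where k="{x}" and a="x - e" and b="x + e" and f="cdf \<mu>" and x="x + e"])
      show "continuous_on {x - e..x + e} (cdf \<mu>)"
        using atom by (intro continuous_at_imp_continuous_on) (auto simp: isCont_cdf)
    qed (use der e in auto)
    then have "measure \<mu> {x - e<..x + e} = 0" using cdf_diff_eq[of "x - e" "x + e"] e(1) by simp
    moreover have "measure \<mu> (ball x e) \<le> measure \<mu> {x - e<..x + e}"
      using sets by (intro finite_measure_mono) (auto simp: dist_real_def)
    ultimately have "measure \<mu> (ball x e) = 0" using measure_nonneg[of \<mu> "ball x e"] by linarith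
    then show False using f(4) by (simp add: emeasure_eq_measure)
  qed
  then show "z \<in> {complex_of_real x |x. \<bar>Re (F (of_real x))\<bar> \<le> 1}" using x by blast
qed

end

subsection \<open>Parseval's identity\<close>

text \<open>Fourier coefficients with positive sign and no normalising factor, matching the way a
  superposition of Bloch waves depends on the cell; hence the factors 2 pi in Parseval's
  identity.\<close>

definition fc :: "(real \<Rightarrow> complex) \<Rightarrow> int \<Rightarrow> complex" where
  "fc h n = integral {-pi..pi} (\<lambda>P. h P * cis (of_int n * P))"

lemma integral_cis: "integral {-pi..pi} (\<lambda>P. cis (of_int n * P)) = (if n = 0 then 2 * of_real pi else 0)"
proof (cases "n = 0")
  case True then show ?thesis by (simp add: scaleR_conv_of_real)
next
  case False
  have "((\<lambda>P. cis (of_int n * P)) has_integral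
      (cis (of_int n * pi) / (\<i> * of_int n) - cis (of_int n * (- pi)) / (\<i> * of_int n))) {-pi..pi}"
  proof (rule fundamental_theorem_of_calculus)
    fix P :: real
    have "((\<lambda>P. exp (\<i> * of_int n * of_real P) / (\<i> * of_int n)) has_vector_derivative exp (\<i> * of_int n * of_real P)) (at P within {-pi..pi})"
      using False by (auto intro!: derivative_eq_intros has_vector_derivative_real_field)
    then show "((\<lambda>P. cis (of_int n * P) / (\<i> * of_int n)) has_vector_derivative cis (of_int n * P)) (at P within {-pi..pi})"
      by (simp add: cis_conv_exp mult_ac)
  qed auto
  moreover have "cis (of_int n * pi) = cis (of_int n * (- pi))"
    by (auto simp: complex_eq_iff sin_zero_iff_int2)
  ultimately show ?thesis using False by (simp add: integral_unique)
qed

lemma integrable_mult_cis: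
  "continuous_on {-pi..pi} h \<Longrightarrow> (\<lambda>P. h P * cis (of_int n * P)) integrable_on {-pi..pi}"
  by (intro integrable_continuous_real continuous_intros)

lemma fc_add:
  assumes "continuous_on {-pi..pi} f" "continuous_on {-pi..pi} g"
  shows "fc (\<lambda>P. f P + c * g P) n = fc f n + c * fc g n"
proof -
  have "fc (\<lambda>P. f P + c * g P) n = integral {-pi..pi} (\<lambda>P. f P * cis (of_int n * P) + c * (g P * cis (of_int n * P)))"
    unfolding fc_def by (simp add: algebra_simps)
  also have "\<dots> = fc f n + c * fc g n"
    unfolding fc_def by (subst integral_add) (auto intro!: integrable_mult_cis integrable_on_mult_right assms)
  finally show ?thesis .
qed

text \<open>The defect in Parseval's identity when only the frequencies in \<open>X\<close> are
  kept, as a quadratic functional of \<open>h\<close>.\<close>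

definition bessel_gap :: "int set \<Rightarrow> (real \<Rightarrow> complex) \<Rightarrow> real" where
  "bessel_gap X h = 2 * pi * integral {-pi..pi} (\<lambda>P. (cmod (h P))^2) - (\<Sum>n\<in>X. (cmod (fc h n))^2)"

text \<open>Bessel's inequality: 2 pi times the gap is the squared norm of 2 pi h - S, with
  \<open>S\<close> the partial Fourier sum.\<close>

lemma bessel_gap_nonneg:
  assumes h: "continuous_on {-pi..pi} h" and X: "finite X"
  shows "0 \<le> bessel_gap X h"
proof -
  define S where "S P = (\<Sum>n\<in>X. fc h n * cis (of_int (- n) * P))" for P
  have cS: "continuous_on A S" for A unfolding S_def by (intro continuous_intros)
  let ?I = "integral {-pi..pi} (\<lambda>P. (cmod (h P))^2)" and ?F = "\<Sum>n\<in>X. (cmod (fc h n))^2"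
  have hS: "((\<lambda>P. h P * cnj (S P)) has_integral of_real ?F) {-pi..pi}"
  proof -
    have "((\<lambda>P. \<Sum>n\<in>X. cnj (fc h n) * (h P * cis (of_int n * P))) has_integral (\<Sum>n\<in>X. cnj (fc h n) * fc h n)) {-pi..pi}"
      unfolding fc_def by (intro has_integral_sum X has_integral_mult_right integrable_integral integrable_mult_cis h)
    moreover have "(\<Sum>n\<in>X. cnj (fc h n) * fc h n) = of_real ?F"
      by (simp only: of_real_sum complex_norm_square mult.commute)
    moreover have "(\<Sum>n\<in>X. cnj (fc h n) * (h P * cis (of_int n * P))) = h P * cnj (S P)" for P
      by (simp add: S_def sum_distrib_left cis_cnj mult_ac)
    ultimately show ?thesis by simp
  qed
  have SS: "((\<lambda>P. S P * cnj (S P)) has_integral of_real (2 * pi * ?F)) {-pi..pi}"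
  proof -
    have "((\<lambda>P. \<Sum>n\<in>X. \<Sum>l\<in>X. fc h n * cnj (fc h l) * cis (of_int (l - n) * P)) has_integral
        (\<Sum>n\<in>X. \<Sum>l\<in>X. fc h n * cnj (fc h l) * (if l - n = 0 then 2 * of_real pi else 0))) {-pi..pi}"
      unfolding integral_cis[symmetric]
      by (intro has_integral_sum X has_integral_mult_right integrable_integral integrable_continuous_real continuous_intros)
    moreover have "(\<Sum>n\<in>X. \<Sum>l\<in>X. fc h n * cnj (fc h l) * (if l - n = 0 then 2 * of_real pi else 0)) = of_real (2 * pi * ?F)"
    proof -
      have "(\<Sum>n\<in>X. \<Sum>l\<in>X. fc h n * cnj (fc h l) * (if l - n = 0 then 2 * of_real pi else 0)) =
          (\<Sum>n\<in>X. \<Sum>l\<in>X. if l = n then fc h n * cnj (fc h n) * (2 * of_real pi) else 0)"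
        by (intro sum.cong refl) auto
      also have "\<dots> = (\<Sum>n\<in>X. fc h n * cnj (fc h n) * (2 * of_real pi))" using X by (simp add: sum.delta)
      also have "\<dots> = of_real (2 * pi * ?F)"
        by (simp only: of_real_mult of_real_sum complex_norm_square sum_distrib_left of_real_numeral mult.commute)
      finally show ?thesis .
    qed
    moreover have "(\<Sum>n\<in>X. \<Sum>l\<in>X. fc h n * cnj (fc h l) * cis (of_int (l - n) * P)) = S P * cnj (S P)" for P
      by (simp add: S_def sum_product cis_cnj cis_mult mult_ac algebra_simps)
    ultimately show ?thesis by simp
  qed
  have "((\<lambda>P. (cmod (of_real (2 * pi) * h P - S P))^2) has_integral
      4 * pi^2 * ?I - 2 * (2 * pi) * ?F + 2 * pi * ?F) {-pi..pi}"
  proof -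
    have i: "((\<lambda>P. (cmod (h P))^2) has_integral ?I) {-pi..pi}"
      by (intro integrable_integral integrable_continuous_real continuous_intros h)
    have r1: "((\<lambda>P. Re (h P * cnj (S P))) has_integral ?F) {-pi..pi}"
      using has_integral_linear[OF hS bounded_linear_Re] by (simp add: o_def)
    have r2: "((\<lambda>P. Re (S P * cnj (S P))) has_integral 2 * pi * ?F) {-pi..pi}"
      using has_integral_linear[OF SS bounded_linear_Re] by (simp add: o_def)
    have "((\<lambda>P. 4 * pi^2 * (cmod (h P))^2 - 2 * (2 * pi) * Re (h P * cnj (S P)) + Re (S P * cnj (S P))) has_integral
      4 * pi^2 * ?I - 2 * (2 * pi) * ?F + 2 * pi * ?F) {-pi..pi}"
      by (intro has_integral_add has_integral_diff has_integral_mult_right i r1 r2)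
    moreover have "(cmod (of_real (2 * pi) * h P - S P))^2 =
        4 * pi^2 * (cmod (h P))^2 - 2 * (2 * pi) * Re (h P * cnj (S P)) + Re (S P * cnj (S P))" for P
      unfolding cmod_power2 by (simp add: power2_eq_square algebra_simps)
    ultimately show ?thesis by simp
  qed
  then have "0 \<le> 4 * pi^2 * ?I - 2 * (2 * pi) * ?F + 2 * pi * ?F"
    by (rule has_integral_nonneg) auto
  also have "\<dots> = 2 * pi * bessel_gap X h"
    unfolding bessel_gap_def by (simp add: power2_eq_square algebra_simps)
  finally show ?thesis using pi_gt_zero by (simp add: zero_le_mult_iff)
qed

text \<open>The gap obeys the parallelogram law, and the gap of the difference is
  nonnegative.\<close>

lemma bessel_gap_add_le:
  assumes f: "continuous_on {-pi..pi} f" and g: "continuous_on {-pi..pi} g" and X: "finite X"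
  shows "bessel_gap X (\<lambda>P. f P + g P) \<le> 2 * bessel_gap X f + 2 * bessel_gap X g"
proof -
  have par: "(cmod (a + b))^2 + (cmod (a + (-1) * b))^2 = 2 * (cmod a)^2 + 2 * (cmod b)^2" for a b
    unfolding cmod_power2 by (simp add: power2_eq_square algebra_simps)
  let ?I = "\<lambda>h. integral {-pi..pi} (\<lambda>P. (cmod (h P))^2)"
  have i: "(\<lambda>P. (cmod (h P))^2) integrable_on {-pi..pi}" if "continuous_on {-pi..pi} h" for h :: "real \<Rightarrow> complex"
    by (intro integrable_continuous_real continuous_intros that)
  have "?I (\<lambda>P. f P + g P) + ?I (\<lambda>P. f P + (-1) * g P) = integral {-pi..pi} (\<lambda>P. 2 * (cmod (f P))^2 + 2 * (cmod (g P))^2)"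
    unfolding par[symmetric] by (rule integral_add[symmetric]) (intro i continuous_intros f g)+
  also have "\<dots> = 2 * ?I f + 2 * ?I g"
    using i[OF f] i[OF g] by (subst integral_add) (auto intro: integrable_on_mult_right)
  finally have I: "?I (\<lambda>P. f P + g P) + ?I (\<lambda>P. f P + (-1) * g P) = 2 * ?I f + 2 * ?I g" .
  have "(\<Sum>n\<in>X. (cmod (fc (\<lambda>P. f P + g P) n))^2) + (\<Sum>n\<in>X. (cmod (fc (\<lambda>P. f P + (-1) * g P) n))^2)
      = (\<Sum>n\<in>X. (cmod (fc f n + fc g n))^2 + (cmod (fc f n + (-1) * fc g n))^2)"
    using fc_add[OF f g, of 1] fc_add[OF f g, of "-1"] by (simp add: sum.distrib)
  also have "\<dots> = 2 * (\<Sum>n\<in>X. (cmod (fc f n))^2) + 2 * (\<Sum>n\<in>X. (cmod (fc g n))^2)"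
    unfolding par by (simp add: sum.distrib sum_distrib_left)
  finally have S: "(\<Sum>n\<in>X. (cmod (fc (\<lambda>P. f P + g P) n))^2) + (\<Sum>n\<in>X. (cmod (fc (\<lambda>P. f P + (-1) * g P) n))^2)
      = 2 * (\<Sum>n\<in>X. (cmod (fc f n))^2) + 2 * (\<Sum>n\<in>X. (cmod (fc g n))^2)" .
  have "bessel_gap X (\<lambda>P. f P + g P) + bessel_gap X (\<lambda>P. f P + (-1) * g P) = 2 * bessel_gap X f + 2 * bessel_gap X g"
    using arg_cong[OF I, of "\<lambda>x. 2 * pi * x"] S unfolding bessel_gap_def by (simp add: algebra_simps)
  moreover have "0 \<le> bessel_gap X (\<lambda>P. f P + (-1) * g P)"
    by (intro bessel_gap_nonneg continuous_intros f g X)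
  ultimately show ?thesis by linarith
qed

inductive trig :: "(real \<Rightarrow> complex) \<Rightarrow> bool" where
  zero: "trig (\<lambda>_. 0)"
| step: "trig p \<Longrightarrow> trig (\<lambda>P. p P + c * cis (of_int n * P))"

lemma trig_continuous: "trig p \<Longrightarrow> continuous_on A p"
  by (induction rule: trig.induct) (auto intro!: continuous_intros)

lemma trig_monomial: "trig (\<lambda>P. c * cis (of_int n * P))"
  using trig.step[OF trig.zero, of c n] by simp

lemma trig_add: "trig p \<Longrightarrow> trig r \<Longrightarrow> trig (\<lambda>P. p P + r P)"
proof (induction rule: trig.induct)
  case (step p c n)
  from trig.step[OF step.IH[OF step.prems], of c n] show ?case by (simp add: algebra_simps)
qed simp

lemma trig_mult_monomial: "trig p \<Longrightarrow> trig (\<lambda>P. p P * (c * cis (of_int n * P)))"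
proof (induction rule: trig.induct)
  case zero show ?case using trig.zero by simp
next
  case (step p d l)
  have "(p P + d * cis (of_int l * P)) * (c * cis (of_int n * P)) = p P * (c * cis (of_int n * P)) + (d * c) * cis (of_int (l + n) * P)" for P
    by (simp add: algebra_simps cis_mult[symmetric])
  with trig.step[OF step.IH, of "d * c" "l + n"] show ?case by simp
qed

lemma trig_mult: "trig p \<Longrightarrow> trig r \<Longrightarrow> trig (\<lambda>P. p P * r P)"
proof (induction arbitrary: r rule: trig.induct)
  case zero show ?case using trig.zero by simp
next
  case (step p c n)
  from trig_add[OF step.IH[OF step.prems] trig_mult_monomial[OF step.prems, of c n]]
  show ?case by (simp add: algebra_simps)
qed

lemma trig_const: "trig (\<lambda>_. c)"
  using trig_monomial[of c 0] by simp

lemma trig_real_polynomial: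
  assumes "real_polynomial_function (f :: complex \<Rightarrow> real)"
  shows "trig (\<lambda>P. of_real (f (cis P)))"
  using assms
proof (induction rule: real_polynomial_function.induct)
  case (linear f)
  have "f (cis P) = cos P * f 1 + sin P * f \<i>" for P
  proof -
    have "cis P = cos P *\<^sub>R 1 + sin P *\<^sub>R \<i>" by (simp add: complex_eq_iff)
    then have "f (cis P) = f (cos P *\<^sub>R 1 + sin P *\<^sub>R \<i>)" by simp
    also have "\<dots> = cos P * f 1 + sin P * f \<i>"
      using linear by (simp add: linear_add linear_scale bounded_linear.linear)
    finally show ?thesis .
  qed
  moreover have "complex_of_real (cos P) = 1/2 * cis (of_int 1 * P) + 1/2 * cis (of_int (-1) * P)"
    "complex_of_real (sin P) = (- \<i>/2) * cis (of_int 1 * P) + (\<i>/2) * cis (of_int (-1) * P)" for P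
    by (simp_all add: complex_eq_iff)
  ultimately have "complex_of_real (f (cis P)) =
     (1/2 * cis (of_int 1 * P) + 1/2 * cis (of_int (-1) * P)) * of_real (f 1)
     + ((- \<i>/2) * cis (of_int 1 * P) + (\<i>/2) * cis (of_int (-1) * P)) * of_real (f \<i>)" for P
    by (simp only: of_real_add of_real_mult)
  then show ?case by (simp only:) (intro trig_add trig_mult trig_const trig_monomial)
qed (auto intro: trig_const trig_add trig_mult)

lemma trig_polynomial:
  assumes "polynomial_function (g :: complex \<Rightarrow> complex)"
  shows "trig (\<lambda>P. g (cis P))"
proof -
  have "real_polynomial_function (\<lambda>w. Re (g w))" "real_polynomial_function (\<lambda>w. Im (g w))"
    using assms bounded_linear_Re bounded_linear_Im by (auto simp: polynomial_function_def o_def)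
  then have "trig (\<lambda>P. of_real (Re (g (cis P))) + \<i> * of_real (Im (g (cis P))))"
    by (intro trig_add trig_mult trig_const) (auto dest: trig_real_polynomial)
  then show ?thesis by (simp add: complex_eq[symmetric])
qed

text \<open>With the sign convention of \<open>fc\<close>, the monomial of frequency
  \<open>n\<close> lives at the coefficient \<open>- n\<close>, and its gap vanishes once
  \<open>- n\<close> is in \<open>X\<close>. The factor 2 in the subadditivity is harmless, both
  gaps being at most 0.\<close>

lemma bessel_gap_trig:
  assumes "trig p" shows "\<exists>X0. finite X0 \<and> (\<forall>X. finite X \<longrightarrow> X0 \<subseteq> X \<longrightarrow> bessel_gap X p \<le> 0)"
  using assms
proof (induction rule: trig.induct)
  case zero show ?case by (intro exI[of _ "{}"]) (simp add: bessel_gap_def fc_def)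
next
  case (step p c n)
  then obtain X0 where X0: "finite X0" "\<And>X. finite X \<Longrightarrow> X0 \<subseteq> X \<Longrightarrow> bessel_gap X p \<le> 0" by blast
  show ?case
  proof (intro exI[of _ "insert (- n) X0"] conjI allI impI)
    fix X :: "int set" assume X: "finite X" "insert (- n) X0 \<subseteq> X"
    have fc: "fc (\<lambda>P. c * cis (of_int n * P)) l = (if l = - n then 2 * of_real pi * c else 0)" for l
    proof -
      have "fc (\<lambda>P. c * cis (of_int n * P)) l = integral {-pi..pi} (\<lambda>P. c * cis (of_int (n + l) * P))"
        unfolding fc_def by (simp add: cis_mult mult.assoc distrib_right)
      also have "\<dots> = c * (if n + l = 0 then 2 * of_real pi else 0)" unfolding integral_cis[symmetric] by simp
      finally show ?thesis by (auto simp: add_eq_0_iff)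
    qed
    have "(\<Sum>l\<in>X. (cmod (fc (\<lambda>P. c * cis (of_int n * P)) l))^2) = (\<Sum>l\<in>X. if l = - n then (2 * pi * cmod c)^2 else 0)"
      unfolding fc by (intro sum.cong refl) (auto simp: norm_mult)
    also have "\<dots> = (2 * pi * cmod c)^2" using X by (simp add: sum.delta)
    finally have "bessel_gap X (\<lambda>P. c * cis (of_int n * P)) = 0"
      unfolding bessel_gap_def by (simp add: norm_mult power2_eq_square)
    moreover have "bessel_gap X (\<lambda>P. p P + c * cis (of_int n * P)) \<le> 2 * bessel_gap X p + 2 * bessel_gap X (\<lambda>P. c * cis (of_int n * P))"
      by (intro bessel_gap_add_le X trig_continuous step.hyps trig_monomial)
    ultimately show "bessel_gap X (\<lambda>P. p P + c * cis (of_int n * P)) \<le> 0" using X0(2)[of X] X by simp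
  qed (use X0 in auto)
qed

text \<open>As the support lies inside (0, pi), \<open>h\<close> can be carried to the upper half
  circle by the arccosine and extended by zero to a continuous function on the circle, where
  Stone-Weierstrass applies.\<close>

lemma trig_approx:
  assumes h: "continuous_on {-pi..pi} h" and ab: "0 < a" "b < pi" and supp: "\<And>P. P \<notin> {a..b} \<Longrightarrow> h P = 0" and e: "0 < e"
  obtains p where "trig p" "\<And>P. P \<in> {-pi..pi} \<Longrightarrow> cmod (h P - p P) < e"
proof -
  define H where "H w = (if 0 \<le> Im w then h (arccos (Re w)) else 0)" for w
  have R: "- 1 \<le> Re w \<and> Re w \<le> 1" if "cmod w = 1" for w
    using abs_Re_le_cmod[of w] that by auto
  have "continuous_on ({w \<in> sphere 0 1. 0 \<le> Im w} \<union> {w \<in> sphere 0 1. Im w \<le> 0}) H"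
    unfolding H_def
  proof (rule continuous_on_cases)
    show "closed {w \<in> sphere 0 1. 0 \<le> Im w}" "closed {w \<in> sphere 0 1. Im w \<le> 0}"
      by (auto simp: Collect_conj_eq intro!: closed_Int closed_Collect_le closed_Collect_eq continuous_intros)
    have "continuous_on {w \<in> sphere 0 1. 0 \<le> Im w} (\<lambda>w. arccos (Re w))"
      by (intro continuous_on_compose2[OF continuous_on_arccos'] continuous_intros)
        (use R in auto)
    then show "continuous_on {w \<in> sphere 0 1. 0 \<le> Im w} (\<lambda>w. h (arccos (Re w)))"
    proof (rule continuous_on_compose2[OF h])
      show "(\<lambda>w. arccos (Re w)) ` {w \<in> sphere 0 1. 0 \<le> Im w} \<subseteq> {- pi..pi}"
      proof safe
        fix w :: complex assume "w \<in> sphere 0 1"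
        then have "\<bar>Re w\<bar> \<le> 1" using abs_Re_le_cmod[of w] by simp
        then have "0 \<le> arccos (Re w)" "arccos (Re w) \<le> pi" by (auto intro: arccos_lbound arccos_ubound)
        then show "arccos (Re w) \<in> {- pi..pi}" using pi_gt_zero by simp
      qed
    qed
    show "\<forall>w. w \<in> {w \<in> sphere 0 1. 0 \<le> Im w} \<and> \<not> 0 \<le> Im w \<or> w \<in> {w \<in> sphere 0 1. Im w \<le> 0} \<and> 0 \<le> Im w \<longrightarrow> h (arccos (Re w)) = 0"
    proof (intro allI impI)
      fix w :: complex
      assume "w \<in> {w \<in> sphere 0 1. 0 \<le> Im w} \<and> \<not> 0 \<le> Im w \<or> w \<in> {w \<in> sphere 0 1. Im w \<le> 0} \<and> 0 \<le> Im w"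
      then have "Im w = 0" "cmod w = 1" by auto
      then have "Re w = 1 \<or> Re w = -1" by (simp add: cmod_def abs_eq_iff')
      then show "h (arccos (Re w)) = 0" using supp[of 0] supp[of pi] ab by auto
    qed
  qed (auto intro: continuous_on_const)
  moreover have "{w \<in> sphere 0 1. 0 \<le> Im w} \<union> {w \<in> sphere 0 1. Im w \<le> 0} = sphere 0 1" by auto
  ultimately have "continuous_on (sphere 0 1) H" by simp
  from Stone_Weierstrass_polynomial_function[OF compact_sphere this e]
  obtain g where "polynomial_function g \<and> (\<forall>w\<in>sphere 0 1. cmod (H w - g w) < e)" ..
  then have g: "polynomial_function g" "\<And>w. w \<in> sphere 0 1 \<Longrightarrow> cmod (H w - g w) < e" by simp_all
  have Hh: "H (cis P) = h P" if P: "P \<in> {-pi..pi}" for P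
  proof (cases "0 \<le> P")
    case True
    then have "0 \<le> sin P" using P by (auto intro: sin_ge_zero)
    then show ?thesis using True P by (simp add: H_def arccos_cos)
  next
    case False
    then have "h P = 0" using supp[of P] ab by auto
    moreover have "sin P < 0 \<or> P = - pi"
      using False P sin_gt_zero[of "- P"] by (cases "P = - pi") auto
    ultimately show ?thesis using supp[of pi] ab by (auto simp: H_def)
  qed
  show thesis
  proof (rule that[OF trig_polynomial[OF g(1)]])
    fix P assume "P \<in> {-pi..pi}"
    from Hh[OF this] g(2)[of "cis P"] show "cmod (h P - g (cis P)) < e" by simp
  qed
qed

text \<open>The gap of \<open>h\<close> is at most twice the gap of h - p for a trigonometric
  polynomial \<open>p\<close> close to \<open>h\<close>, as soon as \<open>X\<close> contains the
  frequencies of \<open>p\<close>.\<close>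

lemma parseval:
  assumes h: "continuous_on {-pi..pi} h" and ab: "0 < a" "b < pi" and supp: "\<And>P. P \<notin> {a..b} \<Longrightarrow> h P = 0"
  shows "((\<lambda>n. (cmod (fc h n))^2) has_sum 2 * pi * integral {-pi..pi} (\<lambda>P. (cmod (h P))^2)) UNIV"
  unfolding has_sum_def tendsto_iff eventually_finite_subsets_at_top
proof (intro allI impI)
  fix \<epsilon> :: real assume eps: "0 < \<epsilon>"
  \<comment> \<open>With this value the gap of h - p is at most 4 pi^2 e^2 = \<epsilon> / 4, so that
    of \<open>h\<close> is at most \<epsilon> / 2.\<close>
  define e where "e = sqrt (\<epsilon> / (16 * pi^2))"
  have e: "0 < e" "e^2 = \<epsilon> / (16 * pi^2)" using eps by (auto simp: e_def)
  obtain p where p: "trig p" "\<And>P. P \<in> {-pi..pi} \<Longrightarrow> cmod (h P - p P) < e"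
    using trig_approx[OF h ab supp e(1)] by blast
  obtain X0 where X0: "finite X0" "\<And>X. finite X \<Longrightarrow> X0 \<subseteq> X \<Longrightarrow> bessel_gap X p \<le> 0"
    using bessel_gap_trig[OF p(1)] by blast
  show "\<exists>X. finite X \<and> X \<subseteq> UNIV \<and> (\<forall>Y. finite Y \<and> X \<subseteq> Y \<and> Y \<subseteq> UNIV \<longrightarrow>
      dist (\<Sum>n\<in>Y. (cmod (fc h n))^2) (2 * pi * integral {-pi..pi} (\<lambda>P. (cmod (h P))^2)) < \<epsilon>)"
  proof (intro exI[of _ X0] conjI allI impI)
    fix Y :: "int set" assume Y: "finite Y \<and> X0 \<subseteq> Y \<and> Y \<subseteq> UNIV"
    note cp = trig_continuous[OF p(1)]
    have cd: "continuous_on {-pi..pi} (\<lambda>P. h P - p P)" by (intro continuous_intros h cp)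
    have "bessel_gap Y (\<lambda>P. p P + (h P - p P)) \<le> 2 * bessel_gap Y p + 2 * bessel_gap Y (\<lambda>P. h P - p P)"
      using Y by (intro bessel_gap_add_le cp cd) auto
    then have 1: "bessel_gap Y h \<le> 2 * bessel_gap Y (\<lambda>P. h P - p P)"
      using X0(2)[of Y] Y by simp
    have "bessel_gap Y (\<lambda>P. h P - p P) \<le> 2 * pi * integral {-pi..pi} (\<lambda>P. (cmod (h P - p P))^2)"
      unfolding bessel_gap_def by (simp add: sum_nonneg)
    also have "integral {-pi..pi} (\<lambda>P. (cmod (h P - p P))^2) \<le> integral {-pi..pi} (\<lambda>P. e^2)"
      using p(2) by (intro integral_le integrable_continuous_real continuous_intros h cp power_mono) (auto intro: less_imp_le)
    finally have "bessel_gap Y (\<lambda>P. h P - p P) \<le> 2 * pi * (2 * pi * e^2)" by simp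
    also have "\<dots> = \<epsilon> / 4" unfolding e(2) by (simp add: power2_eq_square)
    finally have "bessel_gap Y h < \<epsilon>" using 1 eps by simp
    moreover have "0 \<le> bessel_gap Y h" using Y by (intro bessel_gap_nonneg h) auto
    ultimately show "dist (\<Sum>n\<in>Y. (cmod (fc h n))^2) (2 * pi * integral {-pi..pi} (\<lambda>P. (cmod (h P))^2)) < \<epsilon>"
      by (simp add: bessel_gap_def dist_real_def)
  qed (use X0 in auto)
qed

lemma has_sum_symmetric_limit:
  fixes f :: "int \<Rightarrow> real"
  assumes "(f has_sum S) UNIV"
  shows "(\<lambda>N. \<Sum>n\<in>{- int N..int N}. f n) \<longlonglongrightarrow> S"
proof -
  have "filterlim (\<lambda>N. {- int N..int N}) (finite_subsets_at_top UNIV) sequentially"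
    unfolding filterlim_finite_subsets_at_top
  proof (intro allI impI)
    fix X :: "int set" assume X: "finite X \<and> X \<subseteq> UNIV"
    define B where "B = (\<Sum>n\<in>X. \<bar>n\<bar>)"
    have B: "\<bar>n\<bar> \<le> B" if "n \<in> X" for n
      unfolding B_def using X that by (intro member_le_sum) auto
    have "X \<subseteq> {- int N..int N}" if "nat B \<le> N" for N using B that by fastforce
    then show "\<forall>\<^sub>F N in sequentially. finite {- int N..int N} \<and> X \<subseteq> {- int N..int N} \<and> {- int N..int N} \<subseteq> UNIV"
      by (auto simp: eventually_sequentially)
  qed
  from filterlim_compose[OF assms[unfolded has_sum_def] this] show ?thesis .
qed

text \<open>Parseval's identity at each \<open>t\<close>, integrated over the edge. Sum and integral
  are exchanged by dominated convergence along symmetric partial sums, which are majorised by their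
  continuous limit \<open>Q\<close>.\<close>

lemma parseval_edge:
  fixes \<Psi> :: "real \<Rightarrow> real \<Rightarrow> complex"
  assumes h: "continuous_on ({0..1} \<times> UNIV) (\<lambda>(t, P). \<Psi> t P)" and ab: "0 < a" "b < pi"
    and supp: "\<And>t P. P \<notin> {a..b} \<Longrightarrow> \<Psi> t P = 0"
  shows "((\<lambda>n. integral {0..1} (\<lambda>t. (cmod (fc (\<Psi> t) n))^2)) has_sum
      2 * pi * integral {-pi..pi} (\<lambda>P. integral {0..1} (\<lambda>t. (cmod (\<Psi> t P))^2))) UNIV"
    "continuous_on {0..1} (\<lambda>t. fc (\<Psi> t) n)"
proof -
  have cP: "continuous_on A (\<Psi> t)" if "t \<in> {0..1}" for t A
  proof -
    have c: "continuous_on A (\<lambda>P. (t, P))" by (intro continuous_intros)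
    have "(\<lambda>P. (t, P)) ` A \<subseteq> {0..1} \<times> UNIV" using that by auto
    from continuous_on_compose2[OF h c this] show ?thesis by simp
  qed
  have cfc: "continuous_on {0..1} (\<lambda>t. fc (\<Psi> t) n)" for n
  proof -
    have "continuous_on ({0..1} \<times> cbox (-pi) pi) (\<lambda>(t, P). \<Psi> t P * cis (of_int n * P))"
      unfolding split_beta
      by (intro continuous_intros continuous_on_compose2[OF h[unfolded split_beta]]) auto
    from integral_continuous_on_param[OF this] show ?thesis by (simp add: fc_def box_real)
  qed
  then show "continuous_on {0..1} (\<lambda>t. fc (\<Psi> t) n)" .
  define Q where "Q t = 2 * pi * integral {-pi..pi} (\<lambda>P. (cmod (\<Psi> t P))^2)" for t
  have pt: "((\<lambda>n. (cmod (fc (\<Psi> t) n))^2) has_sum Q t) UNIV" if "t \<in> {0..1}" for t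
    unfolding Q_def by (rule parseval[OF cP[OF that] ab supp])
  have cQ: "continuous_on {0..1} Q"
  proof -
    have "continuous_on ({0..1} \<times> cbox (-pi) pi) (\<lambda>(t, P). (cmod (\<Psi> t P))^2)"
      unfolding split_beta
      by (intro continuous_intros continuous_on_compose2[OF h[unfolded split_beta]]) auto
    from integral_continuous_on_param[OF this] show ?thesis unfolding Q_def by (intro continuous_intros) (simp add: box_real)
  qed
  have Qi: "Q integrable_on {0..1}" by (rule integrable_continuous_real[OF cQ])
  let ?I = "\<lambda>n. integral {0..1} (\<lambda>t. (cmod (fc (\<Psi> t) n))^2)"
  have fi: "(\<lambda>t. (cmod (fc (\<Psi> t) n))^2) integrable_on {0..1}" for n
    by (intro integrable_continuous_real continuous_intros cfc)
  have sumI: "sum ?I X = integral {0..1} (\<lambda>t. \<Sum>n\<in>X. (cmod (fc (\<Psi> t) n))^2)" if "finite X" for X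
    by (rule integral_sum[symmetric]) (use that fi in auto)
  have le: "(\<Sum>n\<in>X. (cmod (fc (\<Psi> t) n))^2) \<le> Q t" if "finite X" "t \<in> {0..1}" for X t
    using finite_sum_le_has_sum[OF pt[OF that(2)] that(1)] by auto
  have "?I summable_on UNIV"
  proof (rule nonneg_bounded_partial_sums_imp_summable_on)
    show "\<forall>\<^sub>F X in finite_subsets_at_top UNIV. sum ?I X \<le> integral {0..1} Q"
      unfolding eventually_finite_subsets_at_top
      by (intro exI[of _ "{}"])
        (auto simp: sumI intro!: integral_le integrable_sum fi Qi le)
  qed (rule edge_integral_nonneg)
  then have hs: "(?I has_sum infsum ?I UNIV) UNIV" by (rule has_sum_infsum)
  have "(\<lambda>N. integral {0..1} (\<lambda>t. \<Sum>n\<in>{- int N..int N}. (cmod (fc (\<Psi> t) n))^2)) \<longlonglongrightarrow> integral {0..1} Q"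
  proof (rule dominated_convergence(2)[OF _ Qi])
    show "norm (\<Sum>n\<in>{- int N..int N}. (cmod (fc (\<Psi> t) n))^2) \<le> Q t" if "t \<in> {0..1}" for N t
      using le[OF _ that, of "{- int N..int N}"] by (simp add: sum_nonneg)
    show "(\<lambda>N. \<Sum>n\<in>{- int N..int N}. (cmod (fc (\<Psi> t) n))^2) \<longlonglongrightarrow> Q t" if "t \<in> {0..1}" for t
      by (rule has_sum_symmetric_limit[OF pt[OF that]])
  qed (auto intro!: integrable_sum fi)
  then have "infsum ?I UNIV = integral {0..1} Q"
    using LIMSEQ_unique[OF has_sum_symmetric_limit[OF hs]] by (simp add: sumI)
  also have "\<dots> = 2 * pi * integral {0..1} (\<lambda>t. integral {-pi..pi} (\<lambda>P. (cmod (\<Psi> t P))^2))"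
    unfolding Q_def by simp
  also have "integral {0..1} (\<lambda>t. integral {-pi..pi} (\<lambda>P. (cmod (\<Psi> t P))^2)) = integral {-pi..pi} (\<lambda>P. integral {0..1} (\<lambda>t. (cmod (\<Psi> t P))^2))"
  proof -
    have "continuous_on (cbox (0, -pi) (1, pi)) (\<lambda>(t, P). (cmod (\<Psi> t P))^2)"
      unfolding split_beta cbox_Pair_eq
      by (intro continuous_intros continuous_on_compose2[OF h[unfolded split_beta]]) (auto simp: box_real)
    from integral_swap_continuous[OF this] show ?thesis by (simp add: box_real)
  qed
  finally show "(?I has_sum 2 * pi * integral {-pi..pi} (\<lambda>P. integral {0..1} (\<lambda>t. (cmod (\<Psi> t P))^2))) UNIV"
    using hs by simp
qed

subsection \<open>Energy as a function of quasimomentum\<close>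

lemma integral_swap_Icc:
  fixes k :: "real \<Rightarrow> real \<Rightarrow> complex"
  assumes "continuous_on ({0..1} \<times> {l..u}) (\<lambda>(t, P). k t P)" "x \<in> {0..1}"
  shows "integral {0..x} (\<lambda>t. integral {l..u} (k t)) = integral {l..u} (\<lambda>P. integral {0..x} (\<lambda>t. k t P))"
proof -
  have "continuous_on (cbox (0, l) (x, u)) (\<lambda>(t, P). k t P)"
    by (rule continuous_on_subset[OF assms(1)]) (use assms(2) in \<open>auto simp: cbox_Pair_eq\<close>)
  from integral_swap_continuous[OF this] show ?thesis by (simp add: box_real)
qed

lemma continuous_on_slice:
  assumes "continuous_on (A \<times> B) (\<lambda>(t, P). k t P)"
  shows "t \<in> A \<Longrightarrow> continuous_on B (k t)" "P \<in> B \<Longrightarrow> continuous_on A (\<lambda>t. k t P)"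
proof -
  have c: "continuous_on B (\<lambda>P. (t, P))" "continuous_on A (\<lambda>t. (t, P))" by (intro continuous_intros)+
  show "continuous_on B (k t)" if "t \<in> A"
  proof -
    have "(\<lambda>P. (t, P)) ` B \<subseteq> A \<times> B" using that by auto
    from continuous_on_compose2[OF assms c(1) this] show ?thesis by simp
  qed
  show "continuous_on A (\<lambda>t. k t P)" if "P \<in> B"
  proof -
    have "(\<lambda>t. (t, P)) ` A \<subseteq> A \<times> B" using that by auto
    from continuous_on_compose2[OF assms c(2) this] show ?thesis by simp
  qed
qed

lemma continuous_on_integral_param:
  fixes k :: "real \<Rightarrow> real \<Rightarrow> complex"
  assumes "continuous_on ({0..1} \<times> {l..u}) (\<lambda>(t, P). k t P)"
  shows "continuous_on {0..1} (\<lambda>t. integral {l..u} (k t))"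
  using integral_continuous_on_param[of "{0..1}" l u k] assms by (simp add: box_real)

context potential
begin

text \<open>The potential is only square integrable, so the order of integration is exchanged after an
  integration by parts, where only continuous integrands remain.\<close>

lemma ivp_superpose:
  fixes y y' :: "real \<Rightarrow> real \<Rightarrow> complex" and lam :: "real \<Rightarrow> complex"
  assumes cy: "continuous_on ({0..1} \<times> {l..u}) (\<lambda>(t, P). y t P)" and cy': "continuous_on ({0..1} \<times> {l..u}) (\<lambda>(t, P). y' t P)"
    and lam: "continuous_on {l..u} lam"
    and ivp: "\<And>P. P \<in> {l..u} \<Longrightarrow> ivp (pot (lam P)) (\<lambda>_. 0) (\<lambda>t. y t P) (\<lambda>t. y' t P)"
  shows "ivp (pot 0) (\<lambda>t. - integral {l..u} (\<lambda>P. lam P * y t P)) (\<lambda>t. integral {l..u} (y t)) (\<lambda>t. integral {l..u} (y' t))"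
proof -
  define Y Y' G where "Y t = integral {l..u} (y t)" and "Y' t = integral {l..u} (y' t)"
    and "G t = integral {l..u} (\<lambda>P. lam P * y t P)" for t
  have cly: "continuous_on ({0..1} \<times> {l..u}) (\<lambda>(t, P). lam P * y t P)"
    unfolding split_beta
    by (intro continuous_intros continuous_on_compose2[OF lam] cy[unfolded split_beta]) auto
  have cY: "continuous_on {0..1} Y" "continuous_on {0..1} Y'" "continuous_on {0..1} G"
    unfolding Y_def Y'_def G_def by (intro continuous_on_integral_param cy cy' cly)+
  have yi: "y x integrable_on {l..u}" "y' x integrable_on {l..u}" if "x \<in> {0..1}" for x
    using continuous_on_slice(1)[OF cy that] continuous_on_slice(1)[OF cy' that] by (auto intro: integrable_continuous_real)
  have Yx: "Y x = Y 0 + integral {0..x} Y'" if x: "x \<in> {0..1}" for x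
  proof -
    have "Y x - Y 0 = integral {l..u} (\<lambda>P. y x P - y 0 P)"
      unfolding Y_def using yi[OF x] yi[of 0] by (intro integral_diff[symmetric]) auto
    also have "\<dots> = integral {l..u} (\<lambda>P. integral {0..x} (\<lambda>t. y' t P))"
    proof (rule integral_cong)
      fix P assume P: "P \<in> {l..u}"
      from ivpD(2)[OF ivp[OF P] x] show "y x P - y 0 P = integral {0..x} (\<lambda>t. y' t P)" by (simp only: add_diff_cancel_left')
    qed
    also have "\<dots> = integral {0..x} Y'" unfolding Y'_def by (rule integral_swap_Icc[OF cy' x, symmetric])
    finally show ?thesis by (simp add: algebra_simps)
  qed
  have qa: "pot 0 absolutely_integrable_on {0..1}" by (rule edge_L2_absolutely_integrable[OF pot_L2])
  define Q where "Q x = integral {0..x} (pot 0)" for x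
  have cQ: "continuous_on {0..1} Q"
    unfolding Q_def by (rule indefinite_integral_continuous_1) (use qa in \<open>simp add: absolutely_integrable_on_def\<close>)
  have ibp: "integral {0..x} (\<lambda>t. pot 0 t * v t) = v x * Q x - integral {0..x} (\<lambda>t. v' t * Q t)"
    if c: "continuous_on {0..1} v'" and v: "\<And>x. x \<in> {0..1} \<Longrightarrow> v x = v 0 + integral {0..x} v'" and x: "x \<in> {0..1}"
    for v v' :: "real \<Rightarrow> complex" and x
  proof -
    have h: "((\<lambda>t. v t * pot 0 t + v' t * Q t) has_integral v x * Q x - v 0 * Q 0) {0..x}"
      by (rule integral_by_parts_AC[OF c v qa _ x]) (auto simp: Q_def)
    have "(\<lambda>t. v' t * Q t) integrable_on {0..1}" by (intro integrable_continuous_real continuous_intros c cQ)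
    from has_integral_diff[OF h integrable_integral[OF integrable_Icc_subset[OF this x]]]
    have "((\<lambda>t. v t * pot 0 t) has_integral v x * Q x - v 0 * Q 0 - integral {0..x} (\<lambda>t. v' t * Q t)) {0..x}" by simp
    then show ?thesis by (simp add: integral_unique mult.commute Q_def)
  qed
  have qY: "(\<lambda>t. pot 0 t * v t) integrable_on {0..1}" if "continuous_on {0..1} v" for v
    using edge_L2_mult_integrable[OF pot_L2 edge_L2_continuous[OF that]] by (simp add: absolutely_integrable_on_def)
  have Y'x: "Y' x = Y' 0 + integral {0..x} (\<lambda>t. pot 0 t * Y t + - G t)" if x: "x \<in> {0..1}" for x
  proof -
    have ck: "continuous_on ({0..1} \<times> {l..u}) (\<lambda>(t, P). y' t P * Q t)"
      unfolding split_beta by (intro continuous_intros continuous_on_compose2[OF cQ] cy'[unfolded split_beta]) auto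
    have cq: "continuous_on {l..u} (\<lambda>P. integral {0..x} (\<lambda>t. k t P))" if "continuous_on ({0..1} \<times> {l..u}) (\<lambda>(t, P). k t P)"
      for k :: "real \<Rightarrow> real \<Rightarrow> complex"
    proof -
      have "continuous_on ({l..u} \<times> cbox 0 x) (\<lambda>(P, t). k t P)"
        unfolding split_beta box_real
        by (rule continuous_on_compose2[OF that[unfolded split_beta], of _ "\<lambda>p. (snd p, fst p)", simplified])
          (use x in \<open>auto intro!: continuous_intros\<close>)
      from integral_continuous_on_param[OF this] show ?thesis by (simp add: box_real)
    qed
    have "Y' x - Y' 0 = integral {l..u} (\<lambda>P. y' x P - y' 0 P)"
      unfolding Y'_def using yi[OF x] yi[of 0] by (intro integral_diff[symmetric]) auto
    also have "\<dots> = integral {l..u} (\<lambda>P. (y x P * Q x - integral {0..x} (\<lambda>t. y' t P * Q t)) - integral {0..x} (\<lambda>t. lam P * y t P))"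
    proof (rule integral_cong)
      fix P assume P: "P \<in> {l..u}"
      note c = continuous_on_slice(2)[OF cy P]
      have "y' x P - y' 0 P = integral {0..x} (\<lambda>t. pot (lam P) t * y t P + 0)"
        using ivpD(3)[OF ivp[OF P] x] by (simp only: add_diff_cancel_left')
      also have "\<dots> = integral {0..x} (\<lambda>t. pot 0 t * y t P - lam P * y t P)"
        by (simp add: pot_def algebra_simps)
      also have "\<dots> = integral {0..x} (\<lambda>t. pot 0 t * y t P) - integral {0..x} (\<lambda>t. lam P * y t P)"
        using integrable_Icc_subset[OF qY[OF c] x] integrable_Icc_subset[OF integrable_continuous_real[OF c] x]
        by (intro integral_diff integrable_on_mult_right) auto
      also have "integral {0..x} (\<lambda>t. pot 0 t * y t P) = y x P * Q x - integral {0..x} (\<lambda>t. y' t P * Q t)"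
        by (rule ibp[OF continuous_on_slice(2)[OF cy' P] ivpD(2)[OF ivp[OF P]] x])
      finally show "y' x P - y' 0 P = (y x P * Q x - integral {0..x} (\<lambda>t. y' t P * Q t)) - integral {0..x} (\<lambda>t. lam P * y t P)" .
    qed
    also have "\<dots> = (Y x * Q x - integral {l..u} (\<lambda>P. integral {0..x} (\<lambda>t. y' t P * Q t))) - integral {l..u} (\<lambda>P. integral {0..x} (\<lambda>t. lam P * y t P))"
      unfolding Y_def
      by (intro integral_unique has_integral_diff has_integral_mult_left integrable_integral yi x integrable_continuous_real cq ck cly)
    also have "integral {l..u} (\<lambda>P. integral {0..x} (\<lambda>t. y' t P * Q t)) = integral {0..x} (\<lambda>t. Y' t * Q t)"
      using integral_swap_Icc[OF ck x] by (simp add: Y'_def)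
    also have "Y x * Q x - integral {0..x} (\<lambda>t. Y' t * Q t) = integral {0..x} (\<lambda>t. pot 0 t * Y t)"
      by (rule ibp[OF cY(2) Yx x, symmetric])
    also have "integral {l..u} (\<lambda>P. integral {0..x} (\<lambda>t. lam P * y t P)) = integral {0..x} G"
      unfolding G_def by (rule integral_swap_Icc[OF cly x, symmetric])
    also have "integral {0..x} (\<lambda>t. pot 0 t * Y t) - integral {0..x} G = integral {0..x} (\<lambda>t. pot 0 t * Y t - G t)"
      by (intro integral_diff[symmetric] integrable_Icc_subset[OF qY[OF cY(1)] x] integrable_Icc_subset[OF integrable_continuous_real[OF cY(3)] x])
    finally show ?thesis by (simp add: algebra_simps)
  qed
  have "(\<lambda>t. pot 0 t * Y t + - G t) integrable_on {0..1}"
    by (intro integrable_add qY cY integrable_continuous_real continuous_intros)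
  then have "ivp (pot 0) (\<lambda>t. - G t) Y Y'" unfolding ivp_def using Yx Y'x by blast
  then show ?thesis unfolding Y_def Y'_def G_def .
qed

lemma fund_continuous_compose:
  assumes "continuous_on UNIV (L :: real \<Rightarrow> real)"
  shows "continuous_on ({0..1} \<times> UNIV) (\<lambda>p. fst (fund q (of_real (L (snd p))) a b) (fst p))"
    "continuous_on ({0..1} \<times> UNIV) (\<lambda>p. snd (fund q (of_real (L (snd p))) a b) (fst p))"
proof -
  have c: "continuous_on ({0..1::real} \<times> UNIV) (\<lambda>p. (fst p, complex_of_real (L (snd p))))"
    by (intro continuous_intros continuous_on_compose2[OF assms]) auto
  have s: "(\<lambda>p. (fst p, complex_of_real (L (snd p)))) ` ({0..1::real} \<times> UNIV) \<subseteq> {0..1} \<times> UNIV" by auto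
  show "continuous_on ({0..1} \<times> UNIV) (\<lambda>p. fst (fund q (of_real (L (snd p))) a b) (fst p))"
    "continuous_on ({0..1} \<times> UNIV) (\<lambda>p. snd (fund q (of_real (L (snd p))) a b) (fst p))"
    using continuous_on_compose2[OF fund_continuous_joint(1)[of a b] c s] continuous_on_compose2[OF fund_continuous_joint(2)[of a b] c s]
    by simp_all
qed

end

context nanotube
begin

text \<open>\<open>F\<close> is nonconstant, hence open, so it takes the slightly smaller value (1 -
  \<eta>) v near \<open>x\<close>; a point with such a value must be real by
  \<open>F_nonreal\<close>. Thus a band cannot degenerate to a single point.\<close>

lemma band_interior_point:
  assumes x: "\<bar>Re (F (of_real x))\<bar> \<le> 1" and e: "0 < e"
  obtains y where "\<bar>y - x\<bar> < e" "\<bar>Re (F (of_real y))\<bar> < 1"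
proof -
  define v where "v = Re (F (of_real x))"
  have Fx: "F (of_real x) = of_real v" using F_Reals[of "of_real x"] by (simp add: v_def)
  have nc: "\<not> F constant_on UNIV"
  proof
    assume "F constant_on UNIV"
    then have "F \<i> = F (of_real x)" unfolding constant_on_def by auto
    then show False using F_nonreal[of \<i>] F_Reals[of "of_real x"] x by simp
  qed
  have "open (F ` ball (of_real x) e)"
    by (rule open_mapping_thm[OF F_holomorphic[of UNIV] open_UNIV connected_UNIV open_ball _ nc]) simp
  moreover have "F (of_real x) \<in> F ` ball (of_real x) e" using e by simp
  ultimately obtain d where d: "0 < d" "ball (F (of_real x)) d \<subseteq> F ` ball (of_real x) e"
    unfolding open_contains_ball by blast
  define \<eta> where "\<eta> = min 1 (d / 2)"
  have eta: "0 < \<eta>" "\<eta> \<le> 1" "\<eta> < d" using d by (auto simp: \<eta>_def)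
  have "dist (F (of_real x)) (of_real ((1 - \<eta>) * v)) = \<bar>\<eta> * v\<bar>"
    unfolding Fx dist_norm of_real_diff[symmetric] norm_of_real by (simp add: algebra_simps)
  also have "\<dots> \<le> \<eta> * 1" unfolding abs_mult using x eta by (intro mult_mono) (auto simp: v_def)
  finally have "of_real ((1 - \<eta>) * v) \<in> ball (F (of_real x)) d" using eta by simp
  then obtain w where w: "w \<in> ball (of_real x) e" "F w = of_real ((1 - \<eta>) * v)" using d(2) by (metis imageE subsetD)
  have lt: "\<bar>(1 - \<eta>) * v\<bar> < 1"
  proof -
    have "\<bar>1 - \<eta>\<bar> * \<bar>v\<bar> \<le> (1 - \<eta>) * 1" using x eta by (intro mult_mono) (auto simp: v_def)
    then show ?thesis using eta by (simp add: abs_mult)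
  qed
  have "Im w = 0" using F_nonreal[of w] w(2) lt by (auto simp: less_imp_le)
  then have wr: "w = of_real (Re w)" by (simp add: complex_eq_iff)
  show thesis
  proof (rule that[of "Re w"])
    have "dist (of_real x) w = \<bar>Re w - x\<bar>" by (subst wr) (simp add: dist_norm norm_minus_commute flip: of_real_diff)
    then show "\<bar>Re w - x\<bar> < e" using w(1) by simp
    show "\<bar>Re (F (of_real (Re w)))\<bar> < 1" using wr w(2) lt by simp
  qed
qed

lemma F_deriv_nonzero:
  assumes "\<bar>Re (F (of_real y))\<bar> < 1" shows "deriv F (of_real y) \<noteq> 0"
proof (rule deriv_nonzero_of_real_preimages[OF open_UNIV _ F_holomorphic])
  fix w assume w: "Im w \<noteq> 0" "Im (F w) = 0" "\<bar>Re (F w)\<bar> < 1"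
  show False using F_nonreal[OF w(1)] w(2,3) by (auto simp: complex_is_Real_iff)
next
  show "Im (F (of_real y)) = 0" using F_Reals[of "of_real y"] by (simp add: complex_is_Real_iff)
qed (use assms in auto)

lemma F_real_differentiable: "(\<lambda>y. Re (F (of_real y))) differentiable (at y)"
proof -
  have "F field_differentiable (at (of_real y))"
    using F_holomorphic[of UNIV] by (simp add: holomorphic_on_def)
  then obtain D where "(F has_field_derivative D) (at (of_real y))" by (auto simp: field_differentiable_def)
  then have "((\<lambda>y. F (of_real y)) has_vector_derivative D) (at y)"
    by (rule has_vector_derivative_real_field)
  then have "((\<lambda>y. Re (F (of_real y))) has_derivative (\<lambda>h. Re (h *\<^sub>R D))) (at y)"
    unfolding has_vector_derivative_def by (rule has_derivative_Re)
  then show ?thesis by (rule differentiableI)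
qed

text \<open>On a short interval inside a band, the energy is parametrised by the quasimomentum \<open>P\<close>.\<close>

lemma band_chart:
  assumes x: "\<bar>Re (F (of_real x))\<bar> \<le> 1" and e: "0 < e"
  obtains a b L where "0 < a" "a < b" "b < pi" "continuous_on UNIV (L :: real \<Rightarrow> real)"
    "\<And>P. \<bar>L P - x\<bar> < e" "\<And>P. phi1 q (of_real (L P)) \<noteq> 0"
    "\<And>P. P \<in> {a..b} \<Longrightarrow> F (of_real (L P)) = of_real (cos P)"
    "\<And>N. negligible N \<Longrightarrow> negligible {P \<in> {a..b}. L P \<in> N}"
proof -
  obtain y where y: "\<bar>y - x\<bar> < e" "\<bar>Re (F (of_real y))\<bar> < 1" using band_interior_point[OF x e] .
  define f where "f t = Re (F (of_real t))" for t
  have Ff: "F (of_real t) = of_real (f t)" for t using F_Reals[of "of_real t"] by (simp add: f_def)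
  have cf: "continuous_on A f" for A
    unfolding f_def
    by (intro continuous_intros continuous_on_compose2[OF holomorphic_on_imp_continuous_on[OF F_holomorphic[of UNIV]]]) auto
  obtain r0 where r0: "0 < r0" "inj_on F (ball (of_real y) r0)"
    using has_complex_derivative_locally_injective[OF F_holomorphic[of UNIV] _ open_UNIV F_deriv_nonzero[OF y(2)]] by auto
  obtain r1 where r1: "0 < r1" "\<And>w. w \<noteq> of_real y \<Longrightarrow> dist w (of_real y) < r1 \<Longrightarrow> phi1 q w \<noteq> 0"
    using sigmaD_isolated[of "of_real y"] by blast
  have "\<forall>\<^sub>F t in at y. \<bar>f t\<bar> < 1"
    using cf[of UNIV] y(2) by (intro order_tendstoD[where y="\<bar>f y\<bar>"] tendsto_intros) (auto simp: continuous_on_def f_def)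
  then obtain r2 where r2: "0 < r2" "\<And>t. t \<noteq> y \<Longrightarrow> dist t y < r2 \<Longrightarrow> \<bar>f t\<bar> < 1"
    unfolding eventually_at by auto
  define r where "r = Min {r0, r1, r2, e - \<bar>y - x\<bar>}"
  have r: "0 < r" "r \<le> r0" "r \<le> r1" "r \<le> r2" "r \<le> e - \<bar>y - x\<bar>" using r0 r1 r2 y by (auto simp: r_def)
  \<comment> \<open>The interval lies to the right of \<open>y\<close> and omits it, because
    \<open>y\<close> itself may be a Dirichlet eigenvalue.\<close>
  define y1 y2 where "y1 = y + r / 3" and "y2 = y + 2 * r / 3"
  let ?I = "{y1..y2}"
  have I: "t \<noteq> y" "\<bar>t - y\<bar> < r" if "t \<in> ?I" for t using that r(1) by (auto simp: y1_def y2_def)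
  have y12: "y1 < y2" using r(1) by (simp add: y1_def y2_def)
  have dd: "dist (complex_of_real t) (of_real y) = \<bar>t - y\<bar>" for t by (simp add: dist_norm flip: of_real_diff)
  have inj: "inj_on f ?I"
  proof (rule inj_onI)
    fix s t assume st: "s \<in> ?I" "t \<in> ?I" "f s = f t"
    have "complex_of_real s = of_real t"
    proof (rule inj_onD[OF r0(2)])
      show "F (of_real s) = F (of_real t)" using st(3) by (simp add: Ff)
      show "complex_of_real s \<in> ball (of_real y) r0" "complex_of_real t \<in> ball (of_real y) r0"
        using I[OF st(1)] I[OF st(2)] r(2) dd[of s] dd[of t] by (auto simp: dist_commute)
    qed
    then show "s = t" by simp
  qed
  have f1: "\<bar>f t\<bar> < 1" if "t \<in> ?I" for t using I[OF that] r(4) by (intro r2(2)) (auto simp: dist_real_def)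
  define g where "g = the_inv_into ?I f"
  have gf: "g v \<in> ?I" "f (g v) = v" if "v \<in> f ` ?I" for v
    using that inj by (auto simp: g_def the_inv_into_f_f)
  have cg: "continuous_on (f ` ?I) g" unfolding g_def by (rule continuous_on_inv_into[OF cf compact_Icc inj])
  define v1 v2 where "v1 = min (f y1) (f y2)" and "v2 = max (f y1) (f y2)"
  have ne: "f y1 \<noteq> f y2" using inj_onD[OF inj, of y1 y2] y12 by auto
  have v: "v1 < v2" "-1 < v1" "v2 < 1"
    using ne f1[of y1] f1[of y2] y12 by (auto simp: v1_def v2_def min_def max_def)
  have img: "{v1..v2} \<subseteq> f ` ?I"
  proof -
    have "connected (f ` ?I)" by (intro connected_continuous_image cf) auto
    moreover have "f y1 \<in> f ` ?I" "f y2 \<in> f ` ?I" using y12 by auto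
    ultimately show ?thesis unfolding v1_def v2_def min_def max_def by (auto intro: connectedD_interval)
  qed
  define a b where "a = arccos v2" and "b = arccos v1"
  have ab: "0 < a" "a < b" "b < pi"
    using v arccos_lt_bounded[of v1] arccos_lt_bounded[of v2] arccos_less_arccos[of v1 v2] by (auto simp: a_def b_def)
  have cosP: "cos P \<in> {v1..v2}" if "P \<in> {a..b}" for P
  proof -
    have "cos b \<le> cos P" "cos P \<le> cos a" using that ab by (auto intro!: cos_monotone_0_pi_le)
    moreover have "cos a = v2" "cos b = v1" using v by (auto simp: a_def b_def)
    ultimately show ?thesis by simp
  qed
  \<comment> \<open>Clamping makes \<open>L\<close> continuous on the whole line with all values in
    the chosen interval; the relation to the cosine is kept on {a..b}.\<close>
  define cl where "cl P = max a (min b P)" for P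
  have cl: "cl P \<in> {a..b}" for P using ab by (auto simp: cl_def)
  have cl_id: "cl P = P" if "P \<in> {a..b}" for P using that by (auto simp: cl_def max_def min_def)
  define L where "L P = g (cos (cl P))" for P
  have Lg: "L P \<in> ?I" "f (L P) = cos (cl P)" for P
    using gf[of "cos (cl P)"] img cosP[OF cl[of P]] by (auto simp: L_def)
  show thesis
  proof (rule that[OF ab])
    show "continuous_on UNIV L" unfolding L_def
    proof (rule continuous_on_compose2[OF cg])
      show "continuous_on UNIV (\<lambda>P. cos (cl P))" unfolding cl_def by (intro continuous_intros)
      show "(\<lambda>P. cos (cl P)) ` UNIV \<subseteq> f ` ?I" using img cosP[OF cl] by blast
    qed
    show "\<bar>L P - x\<bar> < e" for P using I[OF Lg(1)[of P]] r(5) by linarith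
    show "phi1 q (of_real (L P)) \<noteq> 0" for P
      using I[OF Lg(1)[of P]] r(3) dd[of "L P"] by (intro r1(2)) auto
    show "F (of_real (L P)) = of_real (cos P)" if "P \<in> {a..b}" for P
      using Lg(2)[of P] that by (simp add: Ff cl_id)
    fix N :: "real set" assume N: "negligible N"
    \<comment> \<open>On {a..b} the map arccos o f inverts \<open>L\<close>. It is differentiable
      since |f| < 1, so it carries null sets of energies to null sets of quasimomenta.\<close>
    have "negligible ((\<lambda>t. arccos (f t)) ` (N \<inter> ?I))"
    proof (rule negligible_differentiable_image_negligible[OF order_refl])
      show "negligible (N \<inter> ?I)" by (rule negligible_subset[OF N]) auto
      show "(\<lambda>t. arccos (f t)) differentiable_on (N \<inter> ?I)"
        unfolding differentiable_on_def
      proof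
        fix t assume "t \<in> N \<inter> ?I"
        then have "\<bar>f t\<bar> < 1" using f1 by auto
        then have "(arccos has_real_derivative inverse (- sqrt (1 - (f t)^2))) (at (f t))"
          by (intro DERIV_arccos) auto
        then have "arccos differentiable (at (f t))" using real_differentiable_def by blast
        moreover have "f differentiable (at t)" using F_real_differentiable by (simp add: f_def[abs_def])
        ultimately have "(\<lambda>t. arccos (f t)) differentiable (at t)"
          using differentiable_chain_at[of f t arccos] by (simp add: o_def)
        then show "(\<lambda>t. arccos (f t)) differentiable (at t within N \<inter> ?I)" by (rule differentiable_at_withinI)
      qed
    qed
    moreover have "{P \<in> {a..b}. L P \<in> N} \<subseteq> (\<lambda>t. arccos (f t)) ` (N \<inter> ?I)"
    proof safe
      fix P assume P: "P \<in> {a..b}" "L P \<in> N"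
      have "f (L P) = cos P" using Lg(2)[of P] P(1) by (simp add: cl_id)
      then have "P = arccos (f (L P))" using P(1) ab by (simp add: arccos_cos)
      then show "P \<in> (\<lambda>t. arccos (f t)) ` (N \<inter> ?I)" using P(2) Lg(1) by blast
    qed
    ultimately show "negligible {P \<in> {a..b}. L P \<in> N}" by (rule negligible_subset)
  qed
qed

end

subsection \<open>Wave packets\<close>

locale band_packets = nanotube q m k for q :: "real \<Rightarrow> real" and m k :: nat +
  fixes a b :: real and L :: "real \<Rightarrow> real"
  assumes a_pos: "0 < a" and ab: "a < b" and b_pi: "b < pi" and L_cont: "continuous_on UNIV L"
    and L_phi1: "phi1 q (of_real (L P)) \<noteq> 0"
    and L_F: "P \<in> {a..b} \<Longrightarrow> F (of_real (L P)) = of_real (cos P)"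
begin

text \<open>With \<tau> = cis (P - al), the amplitudes in cell 0 are the kernel vector (pB, \<tau> +
  cnj sg) of the Bloch system. It is left unnormalised so that it depends continuously on
  \<open>P\<close>; the second entry does not vanish for \<open>P\<close> in {a..b}.\<close>

definition bloch_A :: "int \<Rightarrow> real \<Rightarrow> complex" where
  "bloch_A n P = cis (P - al) powi n * pB (of_real (L P))"
definition bloch_B :: "int \<Rightarrow> real \<Rightarrow> complex" where
  "bloch_B n P = cis (P - al) powi n * (cis (P - al) + cnj sg)"
definition bloch :: "int \<times> nat \<Rightarrow> real \<Rightarrow> real \<Rightarrow> complex" where
  "bloch \<alpha> t P = gfun (of_real (L P)) (\<lambda>n. bloch_A n P) (\<lambda>n. bloch_B n P) (\<lambda>_ _. 0) \<alpha> t"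
definition bloch' :: "int \<times> nat \<Rightarrow> real \<Rightarrow> real \<Rightarrow> complex" where
  "bloch' \<alpha> t P = gfun' (of_real (L P)) (\<lambda>n. bloch_A n P) (\<lambda>n. bloch_B n P) (\<lambda>_ _. 0) (\<lambda>_ _. 0) \<alpha> t"

text \<open>Joint continuity is global in \<open>P\<close>, the relation between cells only on
  {a..b}, where the energy is tied to the quasimomentum; packets vanish elsewhere.\<close>

definition quasiperiodic :: "(int \<times> nat \<Rightarrow> real \<Rightarrow> real \<Rightarrow> complex) \<Rightarrow> bool" where
  "quasiperiodic \<kappa> \<longleftrightarrow> (\<forall>n j. (n, j) \<in> Edges \<longrightarrow> continuous_on ({0..1} \<times> UNIV) (\<lambda>(t, P). \<kappa> (n, j) t P)) \<and>
     (\<forall>n j t P. P \<in> {a..b} \<longrightarrow> \<kappa> (n, j) t P = cis (of_int n * (P - al)) * \<kappa> (0, j) t P)"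

lemma bloch_solves:
  assumes "P \<in> {a..b}"
  shows "gsol q m k (of_real (L P)) (\<lambda>\<alpha> t. bloch \<alpha> t P) (\<lambda>\<alpha> t. bloch' \<alpha> t P)"
    "bvalL (\<lambda>n. bloch_A n P) (\<lambda>n. bloch_B n P) (n, j) = cis (P - al) powi n * bvalL (\<lambda>n. bloch_A n P) (\<lambda>n. bloch_B n P) (0, j)"
    "bvalR (\<lambda>n. bloch_A n P) (\<lambda>n. bloch_B n P) (n, j) = cis (P - al) powi n * bvalR (\<lambda>n. bloch_A n P) (\<lambda>n. bloch_B n P) (0, j)"
proof -
  let ?z = "complex_of_real (L P)"
  have e: "cis (- al) * cis P = cis (P - al)" by (simp add: cis_mult add.commute)
  have "1 / cis P = cis (- P)" by (simp add: field_simps cis_mult)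
  then have "cis P + 1 / cis P = 2 * F ?z" by (simp add: L_F[OF assms] complex_eq_iff)
  note v = bloch_vertex[OF cis_neq_zero this, unfolded e]
  have h: "(1 / cis (P - al) + sg) * (cis (P - al) + cnj sg) = pA ?z * pB ?z"
    "(cis (P - al) + cnj sg) * pB ?z = pB ?z * (cis (P - al) + cnj sg)"
    using v(2) by (simp_all add: mult.commute)
  note B = bloch_solution[OF L_phi1 v(1) h]
  show "gsol q m k ?z (\<lambda>\<alpha> t. bloch \<alpha> t P) (\<lambda>\<alpha> t. bloch' \<alpha> t P)"
    using B(1) unfolding bloch_def bloch'_def bloch_A_def bloch_B_def .
  show "bvalL (\<lambda>n. bloch_A n P) (\<lambda>n. bloch_B n P) (n, j) = cis (P - al) powi n * bvalL (\<lambda>n. bloch_A n P) (\<lambda>n. bloch_B n P) (0, j)"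
    "bvalR (\<lambda>n. bloch_A n P) (\<lambda>n. bloch_B n P) (n, j) = cis (P - al) powi n * bvalR (\<lambda>n. bloch_A n P) (\<lambda>n. bloch_B n P) (0, j)"
    unfolding bloch_A_def bloch_B_def by (rule B(2), rule B(3))
qed

lemma continuous_of_L: "continuous_on A g \<Longrightarrow> (\<And>P. of_real (L P) \<in> A) \<Longrightarrow> continuous_on UNIV (\<lambda>P. g (complex_of_real (L P)))"
  by (rule continuous_on_compose2[of A g UNIV "\<lambda>P. of_real (L P)"]) (auto intro!: continuous_intros L_cont)

lemma bloch_data_continuous: "continuous_on UNIV (bloch_A n)" "continuous_on UNIV (bloch_B n)"
proof -
  have c: "continuous_on UNIV (\<lambda>P. cis (P - al) powi n)"
    unfolding cis_power_int by (intro continuous_intros)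
  have "continuous_on UNIV (\<lambda>P. pB (of_real (L P)))" unfolding pB_def
    by (intro continuous_intros continuous_of_L[of UNIV] holomorphic_on_imp_continuous_on[OF holomorphic_endpoints(1)]
       holomorphic_on_imp_continuous_on[OF holomorphic_endpoints(4)]) auto
  moreover have "continuous_on UNIV (\<lambda>P. cis (P - al) + cnj sg)" by (intro continuous_intros)
  ultimately show "continuous_on UNIV (bloch_A n)" "continuous_on UNIV (bloch_B n)"
    unfolding bloch_A_def bloch_B_def by (auto intro: continuous_on_mult[OF c])
qed

lemma bval_continuous:
  "continuous_on UNIV (\<lambda>P. bvalL (\<lambda>n. bloch_A n P) (\<lambda>n. bloch_B n P) \<alpha>)"
  "continuous_on UNIV (\<lambda>P. bvalR (\<lambda>n. bloch_A n P) (\<lambda>n. bloch_B n P) \<alpha>)"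
  using bloch_data_continuous unfolding bvalL_def bvalR_def
  by (cases "snd \<alpha> = 0"; cases "snd \<alpha> = 1"; auto simp: case_prod_beta intro!: continuous_intros)+

lemma slope_continuous:
  "continuous_on UNIV (\<lambda>P. slope (of_real (L P)) (\<lambda>n. bloch_A n P) (\<lambda>n. bloch_B n P) (\<lambda>_. 0) \<alpha>)"
  unfolding slope_def
  by (intro continuous_intros bval_continuous continuous_of_L[of UNIV] holomorphic_on_imp_continuous_on[OF holomorphic_endpoints(1)]
      holomorphic_on_imp_continuous_on[OF holomorphic_endpoints(2)]) (auto simp: L_phi1)

lemma quasiperiodic_bloch: "quasiperiodic bloch" "quasiperiodic bloch'"
proof -
  have s: "continuous_on ({0..1::real} \<times> UNIV) (\<lambda>p. g (snd p))" if "continuous_on UNIV g" for g :: "real \<Rightarrow> complex"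
    by (rule continuous_on_compose2[OF that]) (auto intro: continuous_intros)
  note f = fund_continuous_compose[OF L_cont]
  have c: "continuous_on ({0..1} \<times> UNIV) (\<lambda>(t, P). bloch \<alpha> t P)" "continuous_on ({0..1} \<times> UNIV) (\<lambda>(t, P). bloch' \<alpha> t P)" for \<alpha>
    unfolding bloch_def bloch'_def gfun_def gfun'_def case_prod_beta
    by (intro continuous_intros f s[OF bval_continuous(1)] s[OF slope_continuous])+
  have t: "bloch (n, j) t P = cis (of_int n * (P - al)) * bloch (0, j) t P"
    "bloch' (n, j) t P = cis (of_int n * (P - al)) * bloch' (0, j) t P" if P: "P \<in> {a..b}" for n j t P
    unfolding bloch_def bloch'_def gfun_def gfun'_def slope_def
    unfolding bloch_solves(2,3)[OF P, of n j] cis_power_int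
    using L_phi1[of P] by (simp_all add: field_simps)
  show "quasiperiodic bloch" "quasiperiodic bloch'" unfolding quasiperiodic_def using c t by blast+
qed

definition packet :: "(real \<Rightarrow> complex) \<Rightarrow> bool" where
  "packet c \<longleftrightarrow> continuous_on UNIV c \<and> (\<forall>P. P \<notin> {a..b} \<longrightarrow> c P = 0)"

lemma packet_lincomb: "packet c \<Longrightarrow> packet d \<Longrightarrow> packet (\<lambda>P. c P + e * d P)"
  by (auto simp: packet_def intro!: continuous_intros)

lemma packet_mult: "packet c \<Longrightarrow> continuous_on UNIV g \<Longrightarrow> packet (\<lambda>P. g P * c P)"
  by (auto simp: packet_def intro!: continuous_intros)

definition superpose :: "(int \<times> nat \<Rightarrow> real \<Rightarrow> real \<Rightarrow> complex) \<Rightarrow> (real \<Rightarrow> complex) \<Rightarrow> int \<times> nat \<Rightarrow> real \<Rightarrow> complex" where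
  "superpose \<kappa> c \<alpha> t = integral {-pi..pi} (\<lambda>P. c P * \<kappa> \<alpha> t P)"

lemma packet_wave_continuous:
  assumes "quasiperiodic \<kappa>" "packet c" "\<alpha> \<in> Edges"
  shows "continuous_on ({0..1} \<times> UNIV) (\<lambda>(t, P). c P * \<kappa> \<alpha> t P)"
proof -
  obtain n j where "\<alpha> = (n, j)" by (cases \<alpha>)
  then have k: "continuous_on ({0..1} \<times> UNIV) (\<lambda>p. \<kappa> \<alpha> (fst p) (snd p))"
    using assms(1,3) by (auto simp: quasiperiodic_def case_prod_beta)
  have "continuous_on ({0..1::real} \<times> UNIV) (\<lambda>p. c (snd p))"
    by (rule continuous_on_compose2[of UNIV c]) (use assms(2) in \<open>auto simp: packet_def intro: continuous_intros\<close>)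
  with k show ?thesis unfolding case_prod_beta by (intro continuous_intros)
qed

lemma packet_wave_integrable:
  assumes "quasiperiodic \<kappa>" "packet c" "\<alpha> \<in> Edges" "t \<in> {0..1}"
  shows "(\<lambda>P. c P * \<kappa> \<alpha> t P) integrable_on {l..u}"
  by (rule integrable_continuous_real)
    (rule continuous_on_subset[OF continuous_on_slice(1)[OF packet_wave_continuous[OF assms(1-3)] assms(4)]], simp)

lemma superpose_lincomb:
  assumes "quasiperiodic \<kappa>" "packet c" "packet d" "\<alpha> \<in> Edges" "t \<in> {0..1}"
  shows "superpose \<kappa> (\<lambda>P. c P + e * d P) \<alpha> t = superpose \<kappa> c \<alpha> t + e * superpose \<kappa> d \<alpha> t"
proof -
  have "((\<lambda>P. c P * \<kappa> \<alpha> t P + e * (d P * \<kappa> \<alpha> t P)) has_integral superpose \<kappa> c \<alpha> t + e * superpose \<kappa> d \<alpha> t) {-pi..pi}"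
    unfolding superpose_def using packet_wave_integrable[OF assms(1)] assms(2-5)
    by (intro has_integral_add has_integral_mult_right integrable_integral)
  moreover have "c P * \<kappa> \<alpha> t P + e * (d P * \<kappa> \<alpha> t P) = (c P + e * d P) * \<kappa> \<alpha> t P" for P by (simp add: algebra_simps)
  ultimately show ?thesis unfolding superpose_def by (simp add: integral_unique)
qed

text \<open>Passing from cell 0 to cell \<open>n\<close> multiplies the integrand by cis (n (P -
  al)), so up to a unimodular factor the superposition in cell \<open>n\<close> is the n-th Fourier
  coefficient of its integrand in cell 0.\<close>

lemma superpose_fc:
  assumes "quasiperiodic \<kappa>" "packet c"
  shows "superpose \<kappa> c (n, j) t = cis (- (of_int n * al)) * fc (\<lambda>P. c P * \<kappa> (0, j) t P) n"
proof -
  have e: "c P * \<kappa> (n, j) t P = cis (- (of_int n * al)) * (c P * \<kappa> (0, j) t P * cis (of_int n * P))" for P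
  proof (cases "P \<in> {a..b}")
    case True
    have "\<kappa> (n, j) t P = cis (of_int n * (P - al)) * \<kappa> (0, j) t P" using assms(1) True unfolding quasiperiodic_def by blast
    moreover have "cis (of_int n * (P - al)) = cis (- (of_int n * al)) * cis (of_int n * P)"
      by (simp add: cis_mult algebra_simps)
    ultimately show ?thesis by (simp add: algebra_simps)
  qed (use assms(2) in \<open>auto simp: packet_def\<close>)
  show ?thesis unfolding superpose_def fc_def by (simp only: e integral_mult_right)
qed

lemma Edges_cell: "j \<in> {0,1,2} \<Longrightarrow> (n, j) \<in> Edges" by (auto simp: Edges_def)

lemma superpose_parseval:
  assumes k: "quasiperiodic \<kappa>" and c: "packet c" and j: "j \<in> {0,1,2}"
  shows "((\<lambda>n. integral {0..1} (\<lambda>t. (cmod (superpose \<kappa> c (n, j) t))^2)) has_sum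
      2 * pi * integral {-pi..pi} (\<lambda>P. (cmod (c P))^2 * integral {0..1} (\<lambda>t. (cmod (\<kappa> (0, j) t P))^2))) UNIV"
    "continuous_on {0..1} (superpose \<kappa> c (n, j))"
    "t \<in> {0..1} \<Longrightarrow> (\<lambda>n. (cmod (superpose \<kappa> c (n, j) t))^2) summable_on UNIV"
proof -
  note w = packet_wave_continuous[OF k c Edges_cell[OF j]]
  have s: "c P * \<kappa> (0, j) t P = 0" if "P \<notin> {a..b}" for t P using c that by (simp add: packet_def)
  note pe = parseval_edge[OF w[of 0] a_pos b_pi s]
  show "((\<lambda>n. integral {0..1} (\<lambda>t. (cmod (superpose \<kappa> c (n, j) t))^2)) has_sum
      2 * pi * integral {-pi..pi} (\<lambda>P. (cmod (c P))^2 * integral {0..1} (\<lambda>t. (cmod (\<kappa> (0, j) t P))^2))) UNIV"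
    using pe(1) by (simp add: superpose_fc[OF k c] norm_mult power_mult_distrib)
  show "continuous_on {0..1} (superpose \<kappa> c (n, j))"
    unfolding superpose_fc[OF k c, abs_def] by (intro continuous_intros pe(2))
  show "(\<lambda>n. (cmod (superpose \<kappa> c (n, j) t))^2) summable_on UNIV" if t: "t \<in> {0..1}"
  proof -
    have "continuous_on {-pi..pi} (\<lambda>P. c P * \<kappa> (0, j) t P)"
      by (rule continuous_on_subset[OF continuous_on_slice(1)[OF w t]]) simp
    from parseval[OF this a_pos b_pi s] show ?thesis
      by (auto simp: superpose_fc[OF k c] norm_mult has_sum_imp_summable)
  qed
qed

lemma superpose_gL2:
  assumes "quasiperiodic \<kappa>" "packet c" shows "gL2 (superpose \<kappa> c)"
  unfolding gL2_def
proof
  show "\<forall>\<alpha>\<in>Edges. edge_L2 (superpose \<kappa> c \<alpha>)"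
    by (auto simp: Edges_def intro!: edge_L2_continuous superpose_parseval(2)[OF assms])
  show "(\<lambda>\<alpha>. integral {0..1} (\<lambda>t. (cmod (superpose \<kappa> c \<alpha> t))^2)) summable_on Edges"
    by (rule summable_on_Edges) (rule has_sum_imp_summable[OF superpose_parseval(1)[OF assms]])
qed

lemma superpose_ivp:
  assumes c: "packet c" and \<alpha>: "\<alpha> \<in> Edges"
  shows "ivp (pot 0) (\<lambda>t. - superpose bloch (\<lambda>P. of_real (L P) * c P) \<alpha> t) (superpose bloch c \<alpha>) (superpose bloch' c \<alpha>)"
proof -
  have sub: "{0..1::real} \<times> {-pi..pi} \<subseteq> {0..1} \<times> UNIV" by auto
  have "ivp (pot 0) (\<lambda>t. - integral {-pi..pi} (\<lambda>P. of_real (L P) * (c P * bloch \<alpha> t P)))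
    (\<lambda>t. integral {-pi..pi} (\<lambda>P. c P * bloch \<alpha> t P)) (\<lambda>t. integral {-pi..pi} (\<lambda>P. c P * bloch' \<alpha> t P))"
  proof (rule ivp_superpose)
    show "continuous_on ({0..1} \<times> {- pi..pi}) (\<lambda>(t, P). c P * bloch \<alpha> t P)"
      "continuous_on ({0..1} \<times> {- pi..pi}) (\<lambda>(t, P). c P * bloch' \<alpha> t P)"
      by (rule continuous_on_subset[OF packet_wave_continuous[OF quasiperiodic_bloch(1) c \<alpha>] sub],
          rule continuous_on_subset[OF packet_wave_continuous[OF quasiperiodic_bloch(2) c \<alpha>] sub])
    show "continuous_on {- pi..pi} (\<lambda>P. complex_of_real (L P))"
      by (intro continuous_intros continuous_on_subset[OF L_cont]) simp
    show "ivp (pot (of_real (L P))) (\<lambda>_. 0) (\<lambda>t. c P * bloch \<alpha> t P) (\<lambda>t. c P * bloch' \<alpha> t P)" for P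
    proof (cases "P \<in> {a..b}")
      case True
      have "ivp (pot (of_real (L P))) (\<lambda>_. 0) (\<lambda>t. bloch \<alpha> t P) (\<lambda>t. bloch' \<alpha> t P)"
        using bloch_solves(1)[OF True] \<alpha> by (simp add: gsol_def sol_iff)
      from ivp_lincomb[OF this ivp_zero, of "c P" 0] show ?thesis by simp
    qed (use c ivp_zero in \<open>auto simp: packet_def\<close>)
  qed
  then show ?thesis unfolding superpose_def[abs_def] by (simp add: mult.assoc)
qed

text \<open>The delicate point is square summability of the second derivative, because of the
  potential. The bound for initial value problems controls the sup norm on an edge by initial data
  and source, which are square summable over the cells by Parseval; the 3 in \<open>X\<close> comes
  from squaring a sum of three terms.\<close>

lemma superpose_Hdom:
  assumes c: "packet c"
  shows "Hdom m k (superpose bloch c) (superpose bloch' c)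
    (\<lambda>\<alpha> t. pot 0 t * superpose bloch c \<alpha> t - superpose bloch (\<lambda>P. of_real (L P) * c P) \<alpha> t)"
proof -
  let ?f = "superpose bloch c" and ?f' = "superpose bloch' c" and ?g = "superpose bloch (\<lambda>P. of_real (L P) * c P)"
  have Lc: "packet (\<lambda>P. of_real (L P) * c P)" by (intro packet_mult c continuous_intros L_cont)
  note q1 = quasiperiodic_bloch(1) and q2 = quasiperiodic_bloch(2)
  have gc: "continuous_on {0..1} (?g \<alpha>)" "continuous_on {0..1} (?f \<alpha>)" if "\<alpha> \<in> Edges" for \<alpha>
    using that superpose_parseval(2)[OF q1 Lc] superpose_parseval(2)[OF q1 c] by (auto simp: Edges_def)
  define C where "C = ivp_const (pot 0)"
  define X where "X \<alpha> = 3 * C^2 * ((cmod (?f \<alpha> 0))^2 + (cmod (?f' \<alpha> 0))^2 + integral {0..1} (\<lambda>t. (cmod (?g \<alpha> t))^2))" for \<alpha>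
  have X: "X summable_on Edges"
  proof (rule summable_on_Edges)
    fix j :: nat assume j: "j \<in> {0,1,2}"
    show "(\<lambda>n. X (n, j)) summable_on UNIV" unfolding X_def
      by (intro summable_on_cmult_right summable_on_add superpose_parseval(3)[OF q1 c j] superpose_parseval(3)[OF q2 c j]
          has_sum_imp_summable[OF superpose_parseval(1)[OF q1 Lc j]]) auto
  qed
  have fX: "(cmod (?f \<alpha> t))^2 \<le> X \<alpha>" if \<alpha>: "\<alpha> \<in> Edges" and t: "t \<in> {0..1}" for \<alpha> t
  proof -
    have ge: "edge_L2 (?g \<alpha>)" by (rule edge_L2_continuous[OF gc(1)[OF \<alpha>]])
    let ?I = "integral {0..1} (\<lambda>t. cmod (?g \<alpha> t))"
    have "cmod (?f \<alpha> t) + cmod (?f' \<alpha> t) \<le> C * (cmod (?f \<alpha> 0) + cmod (?f' \<alpha> 0) + ?I)"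
      using ivp_bound[OF pot_L2 edge_L2_absolutely_integrable[OF edge_L2_uminus[OF ge]] superpose_ivp[OF c \<alpha>] t]
      by (simp add: C_def)
    then have "cmod (?f \<alpha> t) \<le> C * (cmod (?f \<alpha> 0) + cmod (?f' \<alpha> 0) + ?I)" by (rule norm_add_leD(1))
    then have "(cmod (?f \<alpha> t))^2 \<le> (C * (cmod (?f \<alpha> 0) + cmod (?f' \<alpha> 0) + ?I))^2" by (rule power_mono) simp
    also have "\<dots> = C^2 * (cmod (?f \<alpha> 0) + cmod (?f' \<alpha> 0) + ?I)^2" by (rule power_mult_distrib)
    also have "\<dots> \<le> C^2 * (3 * ((cmod (?f \<alpha> 0))^2 + (cmod (?f' \<alpha> 0))^2 + ?I^2))"
    proof (rule mult_left_mono)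
      have "(x + y + z)^2 \<le> 3 * (x^2 + y^2 + z^2)" for x y z :: real
        using sum_squares_ge_zero[of "x - y" "y - z"] zero_le_power2[of "x - z"] by (simp add: power2_eq_square algebra_simps)
      then show "(cmod (?f \<alpha> 0) + cmod (?f' \<alpha> 0) + ?I)^2 \<le> 3 * ((cmod (?f \<alpha> 0))^2 + (cmod (?f' \<alpha> 0))^2 + ?I^2)" .
    qed simp
    also have "\<dots> \<le> C^2 * (3 * ((cmod (?f \<alpha> 0))^2 + (cmod (?f' \<alpha> 0))^2 + integral {0..1} (\<lambda>t. (cmod (?g \<alpha> t))^2)))"
      by (intro mult_left_mono add_mono order_refl L1_le_L2[OF ge]) simp_all
    also have "\<dots> = X \<alpha>" by (simp add: X_def)
    finally show ?thesis .
  qed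
  have integ: "(\<lambda>P. c P * bloch \<alpha> t P) integrable_on {-pi..pi}" "(\<lambda>P. c P * bloch' \<alpha> t P) integrable_on {-pi..pi}"
    if "\<alpha> \<in> Edges" "t \<in> {0..1}" for \<alpha> t
    using packet_wave_integrable[OF q1 c that] packet_wave_integrable[OF q2 c that] by blast+
  have K: "K0 m k (\<lambda>\<alpha> t. c P * bloch \<alpha> t P)" "K1 m k (\<lambda>\<alpha> t. c P * bloch' \<alpha> t P)" for P
  proof -
    show "K0 m k (\<lambda>\<alpha> t. c P * bloch \<alpha> t P)"
    proof (cases "P \<in> {a..b}")
      case True
      then have "K0 m k (\<lambda>\<alpha> t. bloch \<alpha> t P)" using bloch_solves(1) by (simp add: gsol_def)
      then show ?thesis by (simp add: K0_def mult.left_commute)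
    qed (use c in \<open>auto simp: packet_def K0_def\<close>)
    show "K1 m k (\<lambda>\<alpha> t. c P * bloch' \<alpha> t P)"
    proof (cases "P \<in> {a..b}")
      case True
      then have "K1 m k (\<lambda>\<alpha> t. bloch' \<alpha> t P)" using bloch_solves(1) by (simp add: gsol_def)
      from K1_lincomb[OF this this, of "c P - 1"] show ?thesis by (simp add: algebra_simps)
    qed (use c in \<open>auto simp: packet_def K1_def\<close>)
  qed
  show ?thesis unfolding Hdom_def
  proof (intro conjI ballI)
    show "gL2 ?f" by (rule superpose_gL2[OF q1 c])
    show "gL2 (\<lambda>\<alpha> t. pot 0 t * ?f \<alpha> t - ?g \<alpha> t)"
      by (intro gL2_diff gL2_pot_mult[OF gc(2) X fX] superpose_gL2[OF q1 Lc])
    show "W22 (?f \<alpha>) (?f' \<alpha>) (\<lambda>t. pot 0 t * ?f \<alpha> t - ?g \<alpha> t)" if \<alpha>: "\<alpha> \<in> Edges" for \<alpha>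
      using ivp_W22[OF pot_L2 edge_L2_uminus[OF edge_L2_continuous[OF gc(1)[OF \<alpha>]]] superpose_ivp[OF c \<alpha>]] by simp
    show "K0 m k ?f"
      unfolding K0_def superpose_def integral_mult_right[symmetric]
      by (intro allI conjI integral_cong; insert K(1); unfold K0_def; blast)
    show "K1 m k ?f'" unfolding K1_def
    proof (intro allI conjI)
      fix n :: int
      note i = integrable_integral[OF integ(2)]
      have "((\<lambda>P. - (c P * bloch' (n,0) 1 P) + c P * bloch' (n,1) 0 P - sN m ^ k * (c P * bloch' (n,2) 1 P)) has_integral
        - ?f' (n,0) 1 + ?f' (n,1) 0 - sN m ^ k * ?f' (n,2) 1) {-pi..pi}"
        unfolding superpose_def by (intro has_integral_diff has_integral_add has_integral_neg has_integral_mult_right i Edges_cell) auto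
      moreover have "- (c P * bloch' (n,0) 1 P) + c P * bloch' (n,1) 0 P - sN m ^ k * (c P * bloch' (n,2) 1 P) = 0" for P
        using K(2)[of P] by (simp add: K1_def)
      ultimately show "- ?f' (n,0) 1 + ?f' (n,1) 0 - sN m ^ k * ?f' (n,2) 1 = 0"
        by (simp only: has_integral_0_eq)
      have "((\<lambda>P. c P * bloch' (n+1,0) 0 P - c P * bloch' (n,1) 1 P + c P * bloch' (n,2) 0 P) has_integral
        ?f' (n+1,0) 0 - ?f' (n,1) 1 + ?f' (n,2) 0) {-pi..pi}"
        unfolding superpose_def by (intro has_integral_diff has_integral_add i Edges_cell) auto
      moreover have "c P * bloch' (n+1,0) 0 P - c P * bloch' (n,1) 1 P + c P * bloch' (n,2) 0 P = 0" for P
        using K(2)[of P] by (simp add: K1_def)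
      ultimately show "?f' (n+1,0) 0 - ?f' (n,1) 1 + ?f' (n,2) 0 = 0" by (simp only: has_integral_0_eq)
    qed
  qed
qed

text \<open>In the packet representation the operator is multiplication of the amplitude by the
  energy \<open>L\<close>.\<close>

lemma superpose_Hminus:
  assumes c: "packet c" and \<alpha>: "\<alpha> \<in> Edges" and t: "t \<in> {0..1}"
  shows "Hminus q (superpose bloch c)
      (\<lambda>\<alpha> t. pot 0 t * superpose bloch c \<alpha> t - superpose bloch (\<lambda>P. of_real (L P) * c P) \<alpha> t) z \<alpha> t =
    superpose bloch (\<lambda>P. (of_real (L P) - z) * c P) \<alpha> t"
proof -
  have Lc: "packet (\<lambda>P. of_real (L P) * c P)" by (intro packet_mult c continuous_intros L_cont)
  have "superpose bloch (\<lambda>P. of_real (L P) * c P + - z * c P) \<alpha> t =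
    superpose bloch (\<lambda>P. of_real (L P) * c P) \<alpha> t + - z * superpose bloch c \<alpha> t"
    by (rule superpose_lincomb[OF quasiperiodic_bloch(1) Lc c \<alpha> t])
  then show ?thesis unfolding Hminus_def pot_def by (simp add: algebra_simps)
qed

end

subsection \<open>Spectral measures of wave packets\<close>

text \<open>Parseval is available for norms only; this combination of four squared norms recovers
  the inner product and commutes with sums and integrals.\<close>

definition polarize :: "(complex \<Rightarrow> real) \<Rightarrow> complex" where
  "polarize J = (of_real (J 1) - of_real (J (-1)) + \<i> * of_real (J \<i>) - \<i> * of_real (J (-\<i>))) / 4"

lemma polarization: "polarize (\<lambda>e. w * (cmod (x + e * y))^2) = of_real w * (x * cnj y)"
  unfolding polarize_def cmod_power2 by (simp add: complex_eq_iff power2_eq_square field_simps)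

lemma has_integral_polarize:
  fixes f :: "complex \<Rightarrow> real \<Rightarrow> real"
  assumes "\<And>e. (f e has_integral J e) S"
  shows "((\<lambda>t. polarize (\<lambda>e. f e t)) has_integral polarize J) S"
proof -
  have c: "((\<lambda>t. complex_of_real (f e t)) has_integral of_real (J e)) S" for e
    using has_integral_linear[OF assms bounded_linear_of_real] by (simp add: o_def)
  show ?thesis unfolding polarize_def by (intro has_integral_divide has_integral_add has_integral_diff has_integral_mult_right c)
qed

lemma has_sum_polarize:
  fixes f :: "complex \<Rightarrow> 'a \<Rightarrow> real"
  assumes "\<And>e. (f e has_sum J e) S"
  shows "((\<lambda>\<alpha>. polarize (\<lambda>e. f e \<alpha>)) has_sum polarize J) S"
proof -
  have c: "((\<lambda>\<alpha>. z * complex_of_real (f e \<alpha>)) has_sum z * of_real (J e)) S" for e z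
    by (intro has_sum_cmult_right has_sum_of_real assms)
  have "((\<lambda>\<alpha>. (1 / 4) * of_real (f 1 \<alpha>) + (- 1 / 4) * of_real (f (-1) \<alpha>) + (\<i> / 4) * of_real (f \<i> \<alpha>) + (- \<i> / 4) * of_real (f (-\<i>) \<alpha>))
    has_sum ((1 / 4) * of_real (J 1) + (- 1 / 4) * of_real (J (-1)) + (\<i> / 4) * of_real (J \<i>) + (- \<i> / 4) * of_real (J (-\<i>)))) S"
    by (intro has_sum_add c)
  then show ?thesis unfolding polarize_def by (simp add: add_divide_distrib diff_divide_distrib)
qed

text \<open>A density in the quasimomentum, transported to the energy axis by \<open>L\<close>: the
  shape of the spectral measure of a packet.\<close>

definition push :: "(real \<Rightarrow> real) \<Rightarrow> (real \<Rightarrow> real) \<Rightarrow> real measure" where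
  "push g L = distr (density lborel (\<lambda>P. ennreal (g P))) borel L"

context
  fixes g L :: "real \<Rightarrow> real" and a b :: real
  assumes g: "continuous_on UNIV g" "\<And>P. 0 \<le> g P" "\<And>P. P \<notin> {a..b} \<Longrightarrow> g P = 0" and L: "continuous_on UNIV L"
begin

lemma push_measurable: "g \<in> borel_measurable borel" "L \<in> borel_measurable borel"
  using g L by (auto intro: borel_measurable_continuous_onI)

lemma push_indicator: "indicator {a..b} P *\<^sub>R (g P *\<^sub>R x) = g P *\<^sub>R (x :: 'v::real_vector)"
  using g(3)[of P] by (auto simp: indicator_def)

lemma emeasure_push: "A \<in> sets borel \<Longrightarrow> emeasure (push g L) A = (\<integral>\<^sup>+P. ennreal (g P) * indicator (L -` A) P \<partial>lborel)"
  using push_measurable unfolding push_def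
  by (subst emeasure_distr) (auto simp: emeasure_density measurable_sets_borel)

lemma finite_measure_push: "finite_measure (push g L)"
proof (rule finite_measureI)
  have "integrable lborel (\<lambda>P. indicator {a..b} P *\<^sub>R g P)"
    by (rule borel_integrable_compact) (auto intro: continuous_on_subset[OF g(1)])
  moreover have "(\<lambda>P. indicator {a..b} P *\<^sub>R g P) = g" using g(3) by (auto simp: fun_eq_iff indicator_def)
  ultimately have "integrable lborel g" by (simp only:)
  then have "(\<integral>\<^sup>+P. ennreal (g P) \<partial>lborel) = ennreal (integral\<^sup>L lborel g)" using g(2) by (intro nn_integral_eq_integral) auto
  then show "emeasure (push g L) (space (push g L)) \<noteq> \<infinity>" using emeasure_push[of UNIV] by (simp add: push_def)
qed

lemma integral_push:
  fixes \<phi> :: "real \<Rightarrow> complex"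
  assumes \<phi>: "continuous_on UNIV \<phi>"
  shows "integral\<^sup>L (push g L) \<phi> = integral {a..b} (\<lambda>P. g P *\<^sub>R \<phi> (L P))"
proof -
  have c: "continuous_on UNIV (\<lambda>P. \<phi> (L P))" by (rule continuous_on_compose2[OF \<phi> L]) auto
  have "integral\<^sup>L (push g L) \<phi> = integral\<^sup>L (density lborel (\<lambda>P. ennreal (g P))) (\<lambda>P. \<phi> (L P))"
    unfolding push_def using push_measurable \<phi> by (intro integral_distr) (auto intro: borel_measurable_continuous_onI)
  also have "\<dots> = integral\<^sup>L lborel (\<lambda>P. g P *\<^sub>R \<phi> (L P))"
    using push_measurable g(2) c by (intro integral_density) (auto intro: borel_measurable_continuous_onI)
  also have "\<dots> = (LINT P:{a..b}|lborel. g P *\<^sub>R \<phi> (L P))"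
    unfolding set_lebesgue_integral_def push_indicator ..
  also have "\<dots> = integral {a..b} (\<lambda>P. g P *\<^sub>R \<phi> (L P))"
    by (intro set_borel_integral_eq_integral borel_integrable_atLeastAtMost' continuous_on_scaleR
        continuous_on_subset[OF g(1)] continuous_on_subset[OF c]) auto
  finally show ?thesis .
qed

text \<open>A null set of energies has a null preimage in {a..b}, and the density vanishes outside
  {a..b}.\<close>

lemma absolutely_continuous_push:
  assumes neg: "\<And>N :: real set. negligible N \<Longrightarrow> negligible {P \<in> {a..b}. L P \<in> N}"
  shows "absolutely_continuous lborel (push g L)"
  unfolding absolutely_continuous_def
proof
  fix N :: "real set" assume N: "N \<in> null_sets lborel"
  then have Ns: "N \<in> sets borel" by auto
  let ?T = "{P \<in> {a..b}. L P \<in> N}"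
  have Ts: "?T \<in> sets lborel"
  proof -
    have "L -` N \<in> sets borel" using measurable_sets_borel[OF push_measurable(2) Ns] .
    moreover have "?T = {a..b} \<inter> L -` N" by auto
    ultimately show ?thesis by simp
  qed
  have "negligible N" using N by (simp add: negligible_iff_null_sets null_sets_completionI)
  then have "?T \<in> null_sets lborel"
    using neg null_sets_completion_iff[OF Ts] by (simp add: negligible_iff_null_sets)
  then have "AE P in lborel. P \<notin> ?T" by (rule AE_not_in)
  then have "AE P in lborel. ennreal (g P) * indicator (L -` N) P = 0"
  proof (rule AE_mp, intro AE_I2 impI)
    fix P assume "P \<notin> ?T"
    then show "ennreal (g P) * indicator (L -` N) P = 0" using g(3)[of P] by (auto simp: indicator_def)
  qed
  then have "emeasure (push g L) N = 0"
    unfolding emeasure_push[OF Ns] using nn_integral_cong_AE by fastforce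
  then show "N \<in> null_sets (push g L)" using Ns by (auto simp: null_sets_def push_def)
qed

lemma emeasure_push_pos:
  assumes ab: "a < b" and pos: "\<And>P. P \<in> {a<..<b} \<Longrightarrow> 0 < g P" and A: "A \<in> sets borel" "\<And>P. L P \<in> A"
  shows "0 < emeasure (push g L) A"
proof (rule ccontr)
  assume "\<not> 0 < emeasure (push g L) A"
  then have "(\<integral>\<^sup>+P. ennreal (g P) \<partial>lborel) = 0" unfolding emeasure_push[OF A(1)] using A(2) by (simp add: indicator_def)
  then have "AE P in lborel. ennreal (g P) = 0" using push_measurable by (subst (asm) nn_integral_0_iff_AE) auto
  then have "AE P in lborel. P \<notin> {a<..<b}"
  proof (rule AE_mp, intro AE_I2 impI)
    fix P assume "ennreal (g P) = 0"
    then show "P \<notin> {a<..<b}" using pos[of P] by (auto simp: ennreal_eq_0_iff)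
  qed
  then have "{a<..<b} \<in> null_sets lborel" by (subst AE_iff_null_sets) auto
  then show False using ab by (simp add: null_sets_def)
qed

end

section \<open>Resolvent and spectral measure of a packet\<close>

context band_packets
begin

definition cell_norm :: "nat \<Rightarrow> real \<Rightarrow> real" where
  "cell_norm j P = integral {0..1} (\<lambda>t. (cmod (bloch (0, j) t P))^2)"
definition cell_density :: "real \<Rightarrow> real" where
  "cell_density P = cell_norm 0 P + (cell_norm 1 P + cell_norm 2 P)"

lemma cell_norm_continuous:
  assumes "j \<in> {0,1,2}" shows "continuous_on UNIV (cell_norm j)"
proof -
  have k: "continuous_on ({0..1} \<times> UNIV) (\<lambda>p. bloch (0, j) (fst p) (snd p))"
    using quasiperiodic_bloch(1) Edges_cell[OF assms, of 0] by (auto simp: quasiperiodic_def case_prod_beta)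
  have "continuous_on (UNIV \<times> cbox 0 1) (\<lambda>p::real \<times> real. bloch (0, j) (snd p) (fst p))"
  proof -
    have "continuous_on (UNIV \<times> cbox 0 1) (\<lambda>p::real \<times> real. (snd p, fst p))" by (intro continuous_intros)
    moreover have "(\<lambda>p::real \<times> real. (snd p, fst p)) ` (UNIV \<times> cbox 0 1) \<subseteq> {0..1} \<times> UNIV" by auto
    ultimately show ?thesis using continuous_on_compose2[OF k] by fastforce
  qed
  then have "continuous_on (UNIV \<times> cbox 0 1) (\<lambda>(P, t). (cmod (bloch (0, j) t P))^2)"
    unfolding case_prod_beta by (intro continuous_intros)
  from integral_continuous_on_param[OF this] show ?thesis by (simp add: cell_norm_def[abs_def] box_real)
qed

lemma cell_density_continuous: "continuous_on UNIV cell_density"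
  unfolding cell_density_def by (intro continuous_intros cell_norm_continuous) auto

lemma cell_norm_nonneg: "0 \<le> cell_norm j P"
  unfolding cell_norm_def by (rule edge_integral_nonneg)

text \<open>The wave is nonzero at the end of edge \<open>(0,1)\<close>: up to a phase its value is
  cis P + 2 \<open>cN m k\<close>, whose imaginary part sin P is positive on {a..b}.\<close>

lemma cell_density_pos:
  assumes P: "P \<in> {a..b}" shows "0 < cell_density P"
proof -
  have "bloch (0, 1) 1 P = bloch_B 0 P"
    unfolding bloch_def by (subst gfun_boundary(2)[OF L_phi1, where w'="\<lambda>_ _. 0"]) (simp_all add: bvalR_def)
  also have "\<dots> = cis (- al) * (cis P + 2 * of_real (cN m k))"
  proof -
    have "cis (P - al) = cis (- al) * cis P" by (simp add: cis_mult)
    then show ?thesis by (simp add: bloch_B_def sg_cis cis_cnj algebra_simps)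
  qed
  finally have "bloch (0, 1) 1 P = cis (- al) * (cis P + 2 * of_real (cN m k))" .
  moreover have "Im (cis P + 2 * of_real (cN m k)) \<noteq> 0" using P a_pos b_pi sin_gt_zero[of P] by simp
  then have "cis P + 2 * of_real (cN m k) \<noteq> 0" by (metis zero_complex.sel(2))
  ultimately have "bloch (0, 1) 1 P \<noteq> 0" by simp
  moreover have "continuous_on {0..1} (\<lambda>t. bloch (0, 1) t P)"
  proof (rule continuous_on_slice(2)[where B=UNIV])
    show "continuous_on ({0..1} \<times> UNIV) (\<lambda>(t, P). bloch (0, 1) t P)"
      using quasiperiodic_bloch(1) Edges_cell[of 1 0] unfolding quasiperiodic_def by blast
  qed simp
  ultimately have "cell_norm 1 P \<noteq> 0" unfolding cell_norm_def using L2_zero_imp_zero[of "\<lambda>t. bloch (0, 1) t P" 1] by auto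
  then show ?thesis unfolding cell_density_def using cell_norm_nonneg[of 0 P] cell_norm_nonneg[of 1 P] cell_norm_nonneg[of 2 P] by linarith
qed

lemma packet_norm:
  assumes c: "packet c"
  shows "((\<lambda>\<alpha>. integral {0..1} (\<lambda>t. (cmod (superpose bloch c \<alpha> t))^2)) has_sum
    integral {-pi..pi} (\<lambda>P. 2 * pi * cell_density P * (cmod (c P))^2)) Edges"
proof -
  have cc: "continuous_on {-pi..pi} (\<lambda>P. (cmod (c P))^2 * cell_norm j P)" if "j \<in> {0,1,2}" for j
    by (rule continuous_on_subset[of UNIV]) (use c cell_norm_continuous[OF that] in \<open>auto simp: packet_def intro!: continuous_intros\<close>)
  let ?I = "\<lambda>j. 2 * pi * integral {-pi..pi} (\<lambda>P. (cmod (c P))^2 * cell_norm j P)"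
  have "((\<lambda>\<alpha>. integral {0..1} (\<lambda>t. (cmod (superpose bloch c \<alpha> t))^2)) has_sum ?I 0 + (?I 1 + ?I 2)) Edges"
    by (rule has_sum_Edges) (use superpose_parseval(1)[OF quasiperiodic_bloch(1) c] in \<open>simp add: cell_norm_def\<close>)
  moreover have "((\<lambda>P. 2 * pi * ((cmod (c P))^2 * cell_norm 0 P) + (2 * pi * ((cmod (c P))^2 * cell_norm 1 P) + 2 * pi * ((cmod (c P))^2 * cell_norm 2 P)))
      has_integral ?I 0 + (?I 1 + ?I 2)) {-pi..pi}"
    by (intro has_integral_add has_integral_mult_right integrable_integral integrable_continuous_real cc) auto
  then have "?I 0 + (?I 1 + ?I 2) = integral {-pi..pi} (\<lambda>P. 2 * pi * cell_density P * (cmod (c P))^2)"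
    by (simp add: integral_unique[symmetric] cell_density_def algebra_simps)
  ultimately show ?thesis by simp
qed

lemma packet_inner:
  assumes c: "packet c" and d: "packet d"
  shows "ginner (superpose bloch c) (superpose bloch d) =
    integral {-pi..pi} (\<lambda>P. of_real (2 * pi * cell_density P) * (c P * cnj (d P)))"
proof -
  let ?u = "superpose bloch c" and ?f = "superpose bloch d"
  define J where "J e = integral {-pi..pi} (\<lambda>P. 2 * pi * cell_density P * (cmod (c P + e * d P))^2)" for e
  have ce: "superpose bloch (\<lambda>P. c P + e * d P) \<alpha> t = ?u \<alpha> t + e * ?f \<alpha> t" if "\<alpha> \<in> Edges" "t \<in> {0..1}" for e \<alpha> t
    by (rule superpose_lincomb[OF quasiperiodic_bloch(1) c d that])
  have "((\<lambda>\<alpha>. integral {0..1} (\<lambda>t. (cmod (?u \<alpha> t + e * ?f \<alpha> t))^2)) has_sum J e) Edges" for e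
  proof -
    have "integral {0..1} (\<lambda>t. (cmod (?u \<alpha> t + e * ?f \<alpha> t))^2) =
      integral {0..1} (\<lambda>t. (cmod (superpose bloch (\<lambda>P. c P + e * d P) \<alpha> t))^2)" if "\<alpha> \<in> Edges" for \<alpha>
      by (rule integral_cong) (simp add: ce[OF that])
    from has_sum_cong[of Edges, OF this] packet_norm[OF packet_lincomb[OF c d, of e]] show ?thesis by (simp add: J_def)
  qed
  from has_sum_polarize[OF this]
  have S: "((\<lambda>\<alpha>. polarize (\<lambda>e. integral {0..1} (\<lambda>t. (cmod (?u \<alpha> t + e * ?f \<alpha> t))^2))) has_sum polarize J) Edges" .
  have E: "polarize (\<lambda>e. integral {0..1} (\<lambda>t. (cmod (?u \<alpha> t + e * ?f \<alpha> t))^2)) = integral {0..1} (\<lambda>t. ?u \<alpha> t * cnj (?f \<alpha> t))"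
    if \<alpha>: "\<alpha> \<in> Edges" for \<alpha>
  proof -
    have uf: "continuous_on {0..1} (?u \<alpha>)" "continuous_on {0..1} (?f \<alpha>)"
      using \<alpha> superpose_parseval(2)[OF quasiperiodic_bloch(1) c] superpose_parseval(2)[OF quasiperiodic_bloch(1) d]
      by (auto simp: Edges_def)
    have "((\<lambda>t. (cmod (?u \<alpha> t + e * ?f \<alpha> t))^2) has_integral integral {0..1} (\<lambda>t. (cmod (?u \<alpha> t + e * ?f \<alpha> t))^2)) {0..1}" for e
      by (intro integrable_integral integrable_continuous_real continuous_intros uf)
    from has_integral_polarize[of "\<lambda>e t. (cmod (?u \<alpha> t + e * ?f \<alpha> t))^2" _ "{0..1}", OF this] show ?thesis
      using polarization[of 1] by (simp add: integral_unique)
  qed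
  have "(\<lambda>P. 2 * pi * cell_density P * (cmod (c P + e * d P))^2) integrable_on {-pi..pi}" for e
    by (rule integrable_continuous_real, rule continuous_on_subset[of UNIV])
      (use c d cell_density_continuous in \<open>auto simp: packet_def intro!: continuous_intros\<close>)
  then have "((\<lambda>P. 2 * pi * cell_density P * (cmod (c P + e * d P))^2) has_integral J e) {-pi..pi}" for e
    unfolding J_def by (rule integrable_integral)
  from has_integral_polarize[of "\<lambda>e P. 2 * pi * cell_density P * (cmod (c P + e * d P))^2" J, OF this]
  have "polarize J = integral {-pi..pi} (\<lambda>P. of_real (2 * pi * cell_density P) * (c P * cnj (d P)))"
    unfolding polarization by (rule integral_unique[symmetric])
  moreover have "ginner ?u ?f = polarize J"
    unfolding ginner_def using S has_sum_cong[of Edges, OF E] by (simp add: infsumI)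
  ultimately show ?thesis by simp
qed

text \<open>Dividing the amplitude by L - z gives a packet \<open>c\<close> solving the resolvent
  equation, and uniqueness at nonreal \<open>z\<close> identifies it with any other solution; the
  inner product formula then displays a Cauchy transform.\<close>

lemma packet_resolvent:
  fixes z :: complex
  assumes d: "packet d" and z: "Im z \<noteq> 0" and u: "Hdom m k u u' u''" "ae_eq (Hminus q u u'' z) (superpose bloch d)"
  shows "ginner u (superpose bloch d) = integral {-pi..pi} (\<lambda>P. of_real (2 * pi * cell_density P * (cmod (d P))^2) / (of_real (L P) - z))"
proof -
  have Lz: "of_real (L P) - z \<noteq> 0" for P using z by (auto simp: complex_eq_iff)
  define c where "c = (\<lambda>P. 1 / (of_real (L P) - z) * d P)"
  have c: "packet c" unfolding c_def
    by (intro packet_mult d continuous_intros L_cont) (use Lz in auto)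
  have cd: "(\<lambda>P. (of_real (L P) - z) * c P) = d" using Lz by (auto simp: c_def)
  let ?v = "superpose bloch c"
  let ?v'' = "\<lambda>\<alpha> t. pot 0 t * ?v \<alpha> t - superpose bloch (\<lambda>P. of_real (L P) * c P) \<alpha> t"
  note D = Hdom_lincomb[OF u(1) superpose_Hdom[OF c], of "-1"]
  have "ae_eq (Hminus q (\<lambda>\<alpha> t. u \<alpha> t + - 1 * ?v \<alpha> t) (\<lambda>\<alpha> t. u'' \<alpha> t + - 1 * ?v'' \<alpha> t) z) (\<lambda>_ _. 0)"
    unfolding ae_eq_def
  proof
    fix \<alpha> assume \<alpha>: "\<alpha> \<in> Edges"
    have e: "Hminus q (\<lambda>\<alpha> t. u \<alpha> t + - 1 * ?v \<alpha> t) (\<lambda>\<alpha> t. u'' \<alpha> t + - 1 * ?v'' \<alpha> t) z \<alpha> t =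
      Hminus q u u'' z \<alpha> t - superpose bloch d \<alpha> t" if "t \<in> {0..1}" for t
    proof -
      have "Hminus q ?v ?v'' z \<alpha> t = superpose bloch d \<alpha> t" using superpose_Hminus[OF c \<alpha> that, of z] by (simp only: cd)
      then show ?thesis unfolding Hminus_def by (simp add: algebra_simps)
    qed
    have "AE t in lborel. t \<in> {0..1} \<longrightarrow> Hminus q u u'' z \<alpha> t = superpose bloch d \<alpha> t" using u(2) \<alpha> by (auto simp: ae_eq_def)
    then show "AE t in lborel. t \<in> {0..1} \<longrightarrow> Hminus q (\<lambda>\<alpha> t. u \<alpha> t + - 1 * ?v \<alpha> t) (\<lambda>\<alpha> t. u'' \<alpha> t + - 1 * ?v'' \<alpha> t) z \<alpha> t = 0"
      by (rule AE_mp) (use e in \<open>auto intro!: AE_I2\<close>)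
  qed
  from no_eigenfunction[OF phi1_nonreal[OF z] D this]
  have "u \<alpha> t = ?v \<alpha> t" if "\<alpha> \<in> Edges" "t \<in> {0..1}" for \<alpha> t using that by fastforce
  then have "ginner u (superpose bloch d) = ginner ?v (superpose bloch d)"
    unfolding ginner_def by (intro infsum_cong integral_cong) simp
  also have "\<dots> = integral {-pi..pi} (\<lambda>P. of_real (2 * pi * cell_density P) * (c P * cnj (d P)))" by (rule packet_inner[OF c d])
  also have "\<dots> = integral {-pi..pi} (\<lambda>P. of_real (2 * pi * cell_density P * (cmod (d P))^2) / (of_real (L P) - z))"
    by (rule integral_cong) (simp add: c_def flip: complex_norm_square)
  finally show ?thesis .
qed

text \<open>Comparing \<open>packet_resolvent\<close> with the integral against \<open>push\<close>
  identifies the spectral measure. All energies in the range of \<open>L\<close> lie in the ball, so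
  the whole positive mass does.\<close>

lemma packet_spectral_measure:
  assumes neg: "\<And>N. negligible N \<Longrightarrow> negligible {P \<in> {a..b}. L P \<in> N}" and near: "\<And>P. \<bar>L P - x\<bar> < e"
  shows "\<exists>f \<mu>. gL2 f \<and> spec_meas q m k f \<mu> \<and> absolutely_continuous lborel \<mu> \<and> emeasure \<mu> (ball x e) > 0"
proof -
  \<comment> \<open>A continuous bump positive exactly inside the interval; continuity up to its
    ends makes it an admissible amplitude, positivity gives the measure positive mass.\<close>
  define d where "d P = complex_of_real (max 0 ((P - a) * (b - P)))" for P
  have d0: "d P = 0" if "P \<notin> {a..b}" for P
  proof -
    have "(P - a) * (b - P) \<le> 0" using that ab by (auto simp: mult_le_0_iff)
    then show ?thesis by (simp add: d_def)
  qed
  have cd: "continuous_on UNIV d" unfolding d_def by (intro continuous_intros)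
  have d: "packet d" using d0 cd by (simp add: packet_def)
  define g where "g P = 2 * pi * cell_density P * (cmod (d P))^2" for P
  have dens: "0 \<le> cell_density P" for P
    unfolding cell_density_def using cell_norm_nonneg by (simp add: add_nonneg_nonneg)
  have g: "continuous_on UNIV g" "\<And>P. 0 \<le> g P" "\<And>P. P \<notin> {a..b} \<Longrightarrow> g P = 0"
    unfolding g_def using dens d0 by (auto intro!: continuous_intros cd cell_density_continuous)
  have gp: "0 < g P" if "P \<in> {a<..<b}" for P
  proof -
    have "0 < (P - a) * (b - P)" using that by simp
    then have "d P \<noteq> 0" unfolding d_def using that by (auto simp: max_def)
    then show ?thesis unfolding g_def using cell_density_pos[of P] that by simp
  qed
  let ?\<mu> = "push g L"
  have sub: "{a..b} \<subseteq> {-pi..pi}" using a_pos b_pi by auto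
  have "spec_meas q m k (superpose bloch d) ?\<mu>"
    unfolding spec_meas_def
  proof (intro conjI allI impI; (elim conjE)?)
    show "sets ?\<mu> = sets borel" by (simp add: push_def)
    show "finite_measure ?\<mu>" by (rule finite_measure_push[OF g L_cont])
    fix z u u' u'' assume z: "Im z \<noteq> 0" and u: "Hdom m k u u' u''" "ae_eq (Hminus q u u'' z) (superpose bloch d)"
    have "continuous_on UNIV (\<lambda>t. 1 / (complex_of_real t - z))"
      by (intro continuous_intros) (use z in \<open>auto simp: complex_eq_iff\<close>)
    from integral_push[OF g L_cont this]
    have "integral\<^sup>L ?\<mu> (\<lambda>t. 1 / (of_real t - z)) = integral {a..b} (\<lambda>P. g P *\<^sub>R (1 / (of_real (L P) - z)))" .
    also have "\<dots> = integral {-pi..pi} (\<lambda>P. g P *\<^sub>R (1 / (of_real (L P) - z)))"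
      by (rule integral_spike_set; rule negligible_subset[OF negligible_empty]) (use sub g(3) in auto)
    also have "\<dots> = ginner u (superpose bloch d)"
      unfolding packet_resolvent[OF d z u] by (rule integral_cong) (simp add: g_def scaleR_conv_of_real)
    finally show "ginner u (superpose bloch d) = integral\<^sup>L ?\<mu> (\<lambda>t. 1 / (of_real t - z))" by simp
  qed
  moreover have "0 < emeasure ?\<mu> (ball x e)"
    by (rule emeasure_push_pos[OF g L_cont ab gp]) (use near in \<open>auto simp: dist_real_def abs_minus_commute\<close>)
  ultimately show ?thesis
    using superpose_gL2[OF quasiperiodic_bloch(1) d] absolutely_continuous_push[OF g L_cont neg] by blast
qed

end

context nanotube
begin

lemma Hac_eq: "Hac q m k = {complex_of_real x |x. \<bar>Re (F (of_real x))\<bar> \<le> 1}"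
proof (rule antisym[OF Hac_subset], rule subsetI)
  fix w assume "w \<in> {complex_of_real x |x. \<bar>Re (F (of_real x))\<bar> \<le> 1}"
  then obtain x where x: "w = of_real x" "\<bar>Re (F (of_real x))\<bar> \<le> 1" by blast
  have "\<exists>f \<mu>. gL2 f \<and> spec_meas q m k f \<mu> \<and> absolutely_continuous lborel \<mu> \<and> emeasure \<mu> (ball x \<epsilon>) > 0" if e: "0 < \<epsilon>" for \<epsilon>
  proof (rule band_chart[OF x(2) e])
    fix a b :: real and L :: "real \<Rightarrow> real"
    assume L: "0 < a" "a < b" "b < pi" "continuous_on UNIV L" "\<And>P. \<bar>L P - x\<bar> < \<epsilon>"
      "\<And>P. phi1 q (of_real (L P)) \<noteq> 0" "\<And>P. P \<in> {a..b} \<Longrightarrow> F (of_real (L P)) = of_real (cos P)"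
      "\<And>N. negligible N \<Longrightarrow> negligible {P \<in> {a..b}. L P \<in> N}"
    interpret band_packets q m k a b L by unfold_locales (fact L)+
    show ?thesis by (rule packet_spectral_measure[OF L(8,5)])
  qed
  then show "w \<in> Hac q m k" unfolding Hac_def x(1) by blast
qed

end

theorem theorem1p3:
  fixes m :: nat and q :: "real \<Rightarrow> real"
  assumes q_meas: "q \<in> borel_measurable (lebesgue_on {0..1})"
      and q_L2: "(\<lambda>t. (q t)^2) integrable_on {0..1}"
  shows
    "(\<forall>k\<in>{1..m}. \<forall>z. z \<notin> sigmaD q \<longrightarrow>
        (\<forall>a b c d \<tau>1 \<tau>2 r. monodromy q m k z = (a, b, c, d)
           \<and> \<tau>1 + \<tau>2 = a + d \<and> \<tau>1 * \<tau>2 = a * d - b * c \<and> r^2 = rho q m k z \<longrightarrow>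
           ((\<tau>1 + 1/\<tau>1) / 2 = xi q m k z + r \<and> (\<tau>2 + 1/\<tau>2) / 2 = xi q m k z - r) \<or>
           ((\<tau>1 + 1/\<tau>1) / 2 = xi q m k z - r \<and> (\<tau>2 + 1/\<tau>2) / 2 = xi q m k z + r)))
   \<and> (\<forall>k < 2 * m + 1.
        Hspec q m k = Hpp q m k \<union> Hac q m k \<and>
        Hpp q m k = sigmaD q \<and>
        Hac q m k = {complex_of_real x | x. \<exists>r. r^2 = rho q m k (of_real x) \<and>
             Im (xi q m k (of_real x) + r) = 0 \<and> \<bar>Re (xi q m k (of_real x) + r)\<bar> \<le> 1})
   \<and> (\<forall>k\<le>m. \<forall>x::real. (k = 0 \<or> rho q m k (of_real x) \<noteq> 0) \<longrightarrow>
        (\<forall>S g. open S \<and> complex_of_real x \<in> S \<and> g holomorphic_on S \<and>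
              (\<forall>z\<in>S. (g z - xi q m k z)^2 = rho q m k z) \<and>
              Im (g (of_real x)) = 0 \<and> \<bar>Re (g (of_real x))\<bar> < 1 \<longrightarrow>
              deriv g (of_real x) \<noteq> 0))"
proof (intro conjI ballI allI impI)
  have nt: "nanotube q m k" if "k < 2 * m + 1" for k
    using assms that by unfold_locales
  {
    fix k z a b c d \<tau>1 \<tau>2 r
    assume "k \<in> {1..m}" "z \<notin> sigmaD q"
      and *: "monodromy q m k z = (a, b, c, d) \<and> \<tau>1 + \<tau>2 = a + d \<and> \<tau>1 * \<tau>2 = a * d - b * c \<and> r^2 = rho q m k z"
    then have "nanotube q m k" "phi1 q z \<noteq> 0" using nt[of k] by (auto simp: sigmaD_def)
    then show "((\<tau>1 + 1/\<tau>1) / 2 = xi q m k z + r \<and> (\<tau>2 + 1/\<tau>2) / 2 = xi q m k z - r) \<or>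
        ((\<tau>1 + 1/\<tau>1) / 2 = xi q m k z - r \<and> (\<tau>2 + 1/\<tau>2) / 2 = xi q m k z + r)"
      using * by (intro nanotube.lyapunov_branches) auto
  }
  {
    fix k assume "k < 2 * m + 1"
    then interpret nanotube q m k by (rule nt)
    show "Hspec q m k = Hpp q m k \<union> Hac q m k" by (simp only: Hspec_eq Hpp_eq Hac_eq)
    show "Hpp q m k = sigmaD q" by (rule Hpp_eq)
    show "Hac q m k = {complex_of_real x | x. \<exists>r. r^2 = rho q m k (of_real x) \<and>
        Im (xi q m k (of_real x) + r) = 0 \<and> \<bar>Re (xi q m k (of_real x) + r)\<bar> \<le> 1}"
      by (simp only: Hac_eq band_iff)
  }
  {
    fix k and x :: real and S g
    assume "k \<le> m" and *: "open S \<and> complex_of_real x \<in> S \<and> g holomorphic_on S \<and>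
      (\<forall>z\<in>S. (g z - xi q m k z)^2 = rho q m k z) \<and> Im (g (of_real x)) = 0 \<and> \<bar>Re (g (of_real x))\<bar> < 1"
    then have "nanotube q m k" using nt[of k] by simp
    then show "deriv g (of_real x) \<noteq> 0" using * by (intro nanotube.branch_deriv_nonzero[where S=S]) auto
  }
qed


end
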